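(* For $N=1$, $m\geq 3$, $m$ odd and $\mathrm{char}\,\mathbb{K}=2$, $$\mathrm{HH}^*(\Lambda_1)/\mathcal{N}\cong \mathbb{K}[\chi_{2,0},\chi_{m,1},\chi_{m,-1}]/(\chi_{2,0}^m - \chi_{m,1}\chi_{m,-1})$$ and hence $\mathrm{HH}^*(\Lambda_1)/\mathcal{N}$ is a commutative finitely generated algebra of Krull dimension $2$.
   Context: Let $\mathbb{K}$ be a field. Let $\mathcal{Q}$ be the quiver with vertices $0,1,\ldots,m-1$ and, for each $i$ (indices modulo $m$), arrows $a_i:i\to i+1$ and $\bar a_i:i+1\to i$. Paths are written from left to right; $e_i$ is the trivial path at $i$. $\Lambda_N=\mathbb{K}\mathcal{Q}/I_N$ where $I_N$ is generated by $a_ia_{i+1}$, $\bar a_{i-1}\bar a_{i-2}$, $(a_i\bar a_i)^N-(\bar a_{i-1}a_{i-1})^N$ for all $i$. $\mathrm{HH}^*(\Lambda_N)=\mathrm{Ext}^*_{\Lambda_N^e}(\Lambda_N,\Lambda_N)$ with the Yoneda product; $\mathcal{N}$ is the ideal generated by all homogeneous nilpotent elements. Write $\otimes=\otimes_{\mathbb{K}}$. A minimal projective bimodule resolution of $\Lambda_N$ is $(P^*,\partial^* )$ with $P^n=\bigoplus_{i=0}^{m-1}\bigoplus_{r=0}^n\Lambda_Ne_i\otimes e_{i+n-2r}\Lambda_N$. Write $e_i\otimes_r e_{i+n-2r}$ for the generator of the $(i,r)$-summand of $P^n$ (first index modulo $m$; generators in $P^{n-1}$ with tensor subscript $-1$ or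 $n$ are $0$). Unsubscripted $a,\bar a$ denote the arrows of that type making the expression composable. $\partial^0$ is multiplication, and for $n\geq1$, $\partial^n(e_i\otimes_r e_{i+n-2r})$ is: if $n-2r>0$: $e_i\otimes_r e_{i+n-1-2r}a+(-1)^{n+r}a e_{i+1}\otimes_r e_{i+n-2r}+(-1)^{n+r}\bar a(a\bar a)^{N-1}e_{i-1}\otimes_{r-1}e_{i+n-2r}+(-1)^n e_i\otimes_{r-1}e_{i+n+1-2r}\bar a(a\bar a)^{N-1}$; if $n-2r<0$: $e_i\otimes_r e_{i+n-1-2r}a(\bar aa)^{N-1}+(-1)^{n+r}a(\bar aa)^{N-1} e_{i+1}\otimes_r e_{i+n-2r}+(-1)^{n+r}\bar a e_{i-1}\otimes_{r-1}e_{i+n-2r}+(-1)^n e_i\otimes_{r-1}e_{i+n+1-2r}\bar a$; if $n=2r$: $\sum_{k=0}^{N-1}\big((\bar aa)^k[e_i\otimes_{r}e_{i-1}a+(-1)^{r}\bar a e_{i-1}\otimes_{r-1}e_i](\bar aa)^{N-k-1}+(a\bar a)^k[(-1)^{r}ae_{i+1}\otimes_{r}e_i+e_i\otimes_{r-1}e_{i+1}\bar a](a\bar a)^{N-k-1}\big)$. Classes in $\mathrm{HH}^n(\Lambda_N)$ are represented by cocycles in $\mathrm{Hom}_{\Lambda_N^e}(P^n,\Lambda_N)$; for a cocycle only the non-zero images of generators are listed. For $0\leq i\leq m-1$ and $k\in\mathbb{Z}$, $e_i\otimes e_{i+k}\in P^n$ means $e_i\otimes_r e_{i+n-2r}$ with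 $r=(n-k)/2$ ($k$ is not reduced modulo $m$). Here, for all $i=0,\ldots,m-1$: $\chi_{2,0}\in\mathrm{HH}^2$: $e_i\otimes e_i\mapsto e_i$; $\chi_{m,1}\in\mathrm{HH}^m$: $e_i\otimes e_{i+m}\mapsto e_i$; $\chi_{m,-1}\in\mathrm{HH}^m$: $e_i\otimes e_{i-m}\mapsto e_i$. In the quotient, these symbols denote the images of the classes. *)

theory Defs
  imports
    "HOL-Algebra.Algebra"
    "HOL-Library.Extended_Nat"
begin

section \<open>Algebras over a field, given by a type\<close>

text \<open>
  A \<open>\<bbbK>\<close>-algebra is a HOL-Algebra ring (not necessarily commutative) with a scalar
  multiplication, i.e. an element of the record type \<open>('k, 'a) module\<close>, the field being the
  type \<open>'k\<close>.
\<close>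

definition alg_quot :: "('k, 'a, 'm) module_scheme \<Rightarrow> 'a set \<Rightarrow> ('k, 'a set) module" where
  "alg_quot A I =
     \<lparr>carrier = a_rcosets\<^bsub>A\<^esub> I, monoid.mult = rcoset_mult A I, one = I +>\<^bsub>A\<^esub> \<one>\<^bsub>A\<^esub>,
      ring.zero = I, ring.add = set_add A, smult = (\<lambda>c S. \<Union>x\<in>S. I +>\<^bsub>A\<^esub> (c \<odot>\<^bsub>A\<^esub> x))\<rparr>"

definition alg_iso :: "('k, 'a, 'm) module_scheme \<Rightarrow> ('k, 'b, 'n) module_scheme \<Rightarrow> ('a \<Rightarrow> 'b) set" where
  "alg_iso A B =
     {h \<in> ring_iso A B. \<forall>c. \<forall>x\<in>carrier A. h (c \<odot>\<^bsub>A\<^esub> x) = c \<odot>\<^bsub>B\<^esub> h x}"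

definition finitely_generated_algebra :: "('k, 'a, 'm) module_scheme \<Rightarrow> bool" where
  "finitely_generated_algebra A \<longleftrightarrow>
     (\<exists>S. finite S \<and> S \<subseteq> carrier A \<and>
        (\<forall>B. subring B A \<and> (\<forall>c. \<forall>x\<in>B. c \<odot>\<^bsub>A\<^esub> x \<in> B) \<and> S \<subseteq> B \<longrightarrow> B = carrier A))"

definition krull_dim :: "('a, 'm) ring_scheme \<Rightarrow> enat" where
  "krull_dim R =
     (SUP n \<in> {n. \<exists>p. (\<forall>i\<le>n. primeideal (p i) R) \<and> (\<forall>i<n. p i \<subset> p (Suc i))}. enat n)"

text \<open>The polynomial algebra over \<open>'k\<close> in the variables \<open>'v\<close>: the monoid algebra of the
  monoid of exponent vectors.\<close>

definition poly_alg :: "('k::comm_ring_1, ('v \<Rightarrow>\<^sub>0 nat) \<Rightarrow>\<^sub>0 'k) module" where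
  "poly_alg =
     \<lparr>carrier = UNIV, monoid.mult = (*), one = 1, ring.zero = 0, ring.add = (+),
      smult = (\<lambda>c p. Poly_Mapping.single 0 c * p)\<rparr>"

definition pvar :: "'v \<Rightarrow> ('v \<Rightarrow>\<^sub>0 nat) \<Rightarrow>\<^sub>0 'k::comm_ring_1" where
  "pvar v = Poly_Mapping.single (Poly_Mapping.single v 1) 1"


section \<open>The quiver, its path algebra and the quotient\<close>

text \<open>The vertices are the integers in \<open>{0..<m}\<close>; \<open>Arr i\<close> is the arrow from \<open>i\<close> to \<open>i + 1\<close> and
  \<open>Bar i\<close> the arrow from \<open>i + 1\<close> to \<open>i\<close>, modulo \<open>m\<close>. A path is a start vertex with a word of
  arrows, read from left to right.\<close>

datatype arrow = Arr int | Bar int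

type_synonym path = "int \<times> arrow list"

fun arrow_index :: "arrow \<Rightarrow> int" where
  "arrow_index (Arr i) = i"
| "arrow_index (Bar i) = i"

fun arrow_src :: "nat \<Rightarrow> arrow \<Rightarrow> int" where
  "arrow_src m (Arr i) = i"
| "arrow_src m (Bar i) = (i + 1) mod int m"

fun arrow_tgt :: "nat \<Rightarrow> arrow \<Rightarrow> int" where
  "arrow_tgt m (Arr i) = (i + 1) mod int m"
| "arrow_tgt m (Bar i) = i"

fun is_path_from :: "nat \<Rightarrow> int \<Rightarrow> arrow list \<Rightarrow> bool" where
  "is_path_from m v [] \<longleftrightarrow> v \<in> {0..<int m}"
| "is_path_from m v (x # w) \<longleftrightarrow>
     arrow_index x \<in> {0..<int m} \<and> arrow_src m x = v \<and> is_path_from m (arrow_tgt m x) w"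

fun path_end :: "nat \<Rightarrow> int \<Rightarrow> arrow list \<Rightarrow> int" where
  "path_end m v [] = v"
| "path_end m v (x # w) = path_end m (arrow_tgt m x) w"

text \<open>The coefficient of a path in a product sums over all ways to cut the path in two.\<close>

definition path_alg :: "nat \<Rightarrow> ('k::field, path \<Rightarrow> 'k) module" where
  "path_alg m =
     \<lparr>carrier = {f. finite {p. f p \<noteq> 0} \<and> (\<forall>v w. f (v, w) \<noteq> 0 \<longrightarrow> is_path_from m v w)},
      monoid.mult = (\<lambda>f g (v, w). \<Sum>k\<le>length w.
                f (v, take k w) * g (path_end m v (take k w), drop k w)),
      one = (\<lambda>(v, w). if w = [] \<and> v \<in> {0..<int m} then 1 else 0),
      ring.zero = (\<lambda>_. 0),
      ring.add = (\<lambda>f g p. f p + g p),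
      smult = (\<lambda>c f p. c * f p)\<rparr>"

definition path_elem :: "path \<Rightarrow> path \<Rightarrow> 'k::field" where
  "path_elem p = (\<lambda>q. if q = p then 1 else 0)"

definition q_e :: "nat \<Rightarrow> int \<Rightarrow> path \<Rightarrow> 'k::field" where
  "q_e m i = path_elem (i mod int m, [])"

definition q_a :: "nat \<Rightarrow> int \<Rightarrow> path \<Rightarrow> 'k::field" where
  "q_a m i = path_elem (i mod int m, [Arr (i mod int m)])"

definition q_b :: "nat \<Rightarrow> int \<Rightarrow> path \<Rightarrow> 'k::field" where
  "q_b m i = path_elem ((i + 1) mod int m, [Bar (i mod int m)])"

definition rel_ideal :: "nat \<Rightarrow> nat \<Rightarrow> (path \<Rightarrow> 'k::field) set" where
  "rel_ideal m N = (let Q = path_alg m in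
     genideal Q (\<Union>i\<in>{0..<int m}.
       {q_a m i \<otimes>\<^bsub>Q\<^esub> q_a m (i + 1),
        q_b m (i - 1) \<otimes>\<^bsub>Q\<^esub> q_b m (i - 2),
        ((q_a m i \<otimes>\<^bsub>Q\<^esub> q_b m i) [^]\<^bsub>Q\<^esub> N)
          \<ominus>\<^bsub>Q\<^esub> ((q_b m (i - 1) \<otimes>\<^bsub>Q\<^esub> q_a m (i - 1)) [^]\<^bsub>Q\<^esub> N)}))"

type_synonym 'k lam = "(path \<Rightarrow> 'k) set"

definition Lam :: "nat \<Rightarrow> nat \<Rightarrow> ('k::field, 'k lam) module" where
  "Lam m N = alg_quot (path_alg m) (rel_ideal m N)"

definition l_e :: "nat \<Rightarrow> nat \<Rightarrow> int \<Rightarrow> 'k::field lam" where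
  "l_e m N i = rel_ideal m N +>\<^bsub>path_alg m\<^esub> q_e m i"

text \<open>The unsubscripted \<open>a\<close> and barred \<open>a\<close> of the differential are rendered as the sums of all
  arrows of the given type: in a product with an idempotent or a composable path,
  only the composable summand survives.\<close>

definition l_a :: "nat \<Rightarrow> nat \<Rightarrow> 'k::field lam" where
  "l_a m N = rel_ideal m N +>\<^bsub>path_alg m\<^esub> finsum (path_alg m) (q_a m) {0..<int m}"

definition l_b :: "nat \<Rightarrow> nat \<Rightarrow> 'k::field lam" where
  "l_b m N = rel_ideal m N +>\<^bsub>path_alg m\<^esub> finsum (path_alg m) (q_b m) {0..<int m}"


section \<open>Bimodules\<close>

text \<open>As for the modules of HOL-Algebra, the ring fields \<open>mult\<close> and \<open>one\<close> are not used. Bimodules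
  over a \<open>\<bbbK>\<close>-algebra \<open>A\<close> with \<open>\<bbbK>\<close> acting centrally are the modules over the enveloping
  algebra of \<open>A\<close>.\<close>

record ('l, 'x) bimodule = "'x ring" +
  lact :: "'l \<Rightarrow> 'x \<Rightarrow> 'x"
  ract :: "'x \<Rightarrow> 'l \<Rightarrow> 'x"

definition is_bimodule :: "('k, 'l) module \<Rightarrow> ('l, 'x) bimodule \<Rightarrow> bool" where
  "is_bimodule A M \<longleftrightarrow> abelian_group M \<and>
     (\<forall>a\<in>carrier A. \<forall>x\<in>carrier M. lact M a x \<in> carrier M \<and> ract M x a \<in> carrier M) \<and>
     (\<forall>x\<in>carrier M. lact M \<one>\<^bsub>A\<^esub> x = x \<and> ract M x \<one>\<^bsub>A\<^esub> = x) \<and>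
     (\<forall>a\<in>carrier A. \<forall>b\<in>carrier A. \<forall>x\<in>carrier M.
        lact M (a \<otimes>\<^bsub>A\<^esub> b) x = lact M a (lact M b x) \<and>
        ract M x (a \<otimes>\<^bsub>A\<^esub> b) = ract M (ract M x a) b \<and>
        ract M (lact M a x) b = lact M a (ract M x b) \<and>
        lact M (a \<oplus>\<^bsub>A\<^esub> b) x = lact M a x \<oplus>\<^bsub>M\<^esub> lact M b x \<and>
        ract M x (a \<oplus>\<^bsub>A\<^esub> b) = ract M x a \<oplus>\<^bsub>M\<^esub> ract M x b) \<and>
     (\<forall>a\<in>carrier A. \<forall>x\<in>carrier M. \<forall>y\<in>carrier M.
        lact M a (x \<oplus>\<^bsub>M\<^esub> y) = lact M a x \<oplus>\<^bsub>M\<^esub> lact M a y \<and>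
        ract M (x \<oplus>\<^bsub>M\<^esub> y) a = ract M x a \<oplus>\<^bsub>M\<^esub> ract M y a) \<and>
     (\<forall>c. \<forall>x\<in>carrier M. lact M (c \<odot>\<^bsub>A\<^esub> \<one>\<^bsub>A\<^esub>) x = ract M x (c \<odot>\<^bsub>A\<^esub> \<one>\<^bsub>A\<^esub>))"

definition bimod_hom ::
  "('k, 'l) module \<Rightarrow> ('l, 'x) bimodule \<Rightarrow> ('l, 'y) bimodule \<Rightarrow> ('x \<Rightarrow> 'y) set" where
  "bimod_hom A M M' = {f \<in> carrier M \<rightarrow>\<^sub>E carrier M'.
     (\<forall>x\<in>carrier M. \<forall>y\<in>carrier M. f (x \<oplus>\<^bsub>M\<^esub> y) = f x \<oplus>\<^bsub>M'\<^esub> f y) \<and>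
     (\<forall>a\<in>carrier A. \<forall>x\<in>carrier M.
        f (lact M a x) = lact M' a (f x) \<and> f (ract M x a) = ract M' (f x) a)}"

definition regular_bimod :: "('k, 'l) module \<Rightarrow> ('l, 'l) bimodule" where
  "regular_bimod A =
     \<lparr>carrier = carrier A, monoid.mult = undefined, one = undefined,
      ring.zero = \<zero>\<^bsub>A\<^esub>, ring.add = (\<oplus>\<^bsub>A\<^esub>),
      lact = (\<otimes>\<^bsub>A\<^esub>), ract = (\<otimes>\<^bsub>A\<^esub>)\<rparr>"

definition bimod_sum :: "'j set \<Rightarrow> ('j \<Rightarrow> ('l, 'x) bimodule) \<Rightarrow> ('l, 'j \<Rightarrow> 'x) bimodule" where
  \<comment> \<open>only used for finite index sets, where it is the direct sum\<close>
  "bimod_sum J M =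
     \<lparr>carrier = (\<Pi>\<^sub>E j\<in>J. carrier (M j)), monoid.mult = undefined, one = undefined,
      ring.zero = (\<lambda>j\<in>J. \<zero>\<^bsub>M j\<^esub>), ring.add = (\<lambda>x y. \<lambda>j\<in>J. x j \<oplus>\<^bsub>M j\<^esub> y j),
      lact = (\<lambda>a x. \<lambda>j\<in>J. lact (M j) a (x j)), ract = (\<lambda>x a. \<lambda>j\<in>J. ract (M j) (x j) a)\<rparr>"

text \<open>For \<open>\<bbbK>\<close>-subspaces \<open>U\<close>, \<open>V\<close> of \<open>A\<close>, the tensor product over \<open>\<bbbK>\<close> is the free abelian group on
  \<open>U \<times> V\<close> modulo the biadditive and \<open>\<bbbK>\<close>-balanced relations. It is a bimodule if \<open>U\<close> is a left
  and \<open>V\<close> a right ideal.\<close>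

definition tensor_null :: "('k, 'l) module \<Rightarrow> 'l set \<Rightarrow> 'l set \<Rightarrow> ('l \<times> 'l \<Rightarrow>\<^sub>0 int) set" where
  "tensor_null A U V = generate (free_Abelian_group (U \<times> V))
     ({frag_of (u \<oplus>\<^bsub>A\<^esub> u', v) - frag_of (u, v) - frag_of (u', v) | u u' v.
          u \<in> U \<and> u' \<in> U \<and> v \<in> V} \<union>
      {frag_of (u, v \<oplus>\<^bsub>A\<^esub> v') - frag_of (u, v) - frag_of (u, v') | u v v'.
          u \<in> U \<and> v \<in> V \<and> v' \<in> V} \<union>
      {frag_of (c \<odot>\<^bsub>A\<^esub> u, v) - frag_of (u, c \<odot>\<^bsub>A\<^esub> v) | c u v. u \<in> U \<and> v \<in> V})"

definition tensor_class ::
  "('k, 'l) module \<Rightarrow> 'l set \<Rightarrow> 'l set \<Rightarrow> ('l \<times> 'l \<Rightarrow>\<^sub>0 int) \<Rightarrow> ('l \<times> 'l \<Rightarrow>\<^sub>0 int) set" where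
  "tensor_class A U V t = tensor_null A U V #>\<^bsub>free_Abelian_group (U \<times> V)\<^esub> t"

definition tensor_bimod ::
  "('k, 'l) module \<Rightarrow> 'l set \<Rightarrow> 'l set \<Rightarrow> ('l, ('l \<times> 'l \<Rightarrow>\<^sub>0 int) set) bimodule" where
  "tensor_bimod A U V = (let F = free_Abelian_group (U \<times> V) Mod tensor_null A U V in
     \<lparr>carrier = carrier F, monoid.mult = undefined, one = undefined,
      ring.zero = \<one>\<^bsub>F\<^esub>, ring.add = (\<otimes>\<^bsub>F\<^esub>),
      lact = (\<lambda>a T. \<Union>t\<in>T. tensor_class A U V
                (frag_extend (\<lambda>(u, v). frag_of (a \<otimes>\<^bsub>A\<^esub> u, v)) t)),
      ract = (\<lambda>T a. \<Union>t\<in>T. tensor_class A U V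
                (frag_extend (\<lambda>(u, v). frag_of (u, v \<otimes>\<^bsub>A\<^esub> a)) t))\<rparr>)"

definition fg_projective_bimod :: "('k, 'l) module \<Rightarrow> ('l, 'x) bimodule \<Rightarrow> bool" where
  \<comment> \<open>a direct summand of a free bimodule of finite rank\<close>
  "fg_projective_bimod A M \<longleftrightarrow> (\<exists>k::nat.
     let F = bimod_sum {..<k} (\<lambda>_. tensor_bimod A (carrier A) (carrier A)) in
     \<exists>s\<in>bimod_hom A M F. \<exists>p\<in>bimod_hom A F M. \<forall>x\<in>carrier M. p (s x) = x)"


section \<open>Hochschild cohomology from a bimodule resolution\<close>

text \<open>\<open>diff C n\<close> is the map from degree \<open>n + 1\<close> to degree \<open>n\<close>, and \<open>aug C\<close> the augmentation from
  degree \<open>0\<close> to the algebra.\<close>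

record ('l, 'x) bimod_complex =
  trm :: "nat \<Rightarrow> ('l, 'x) bimodule"
  diff :: "nat \<Rightarrow> 'x \<Rightarrow> 'x"
  aug :: "'x \<Rightarrow> 'l"

definition projective_bimod_resolution :: "('k, 'l) module \<Rightarrow> ('l, 'x) bimod_complex \<Rightarrow> bool" where
  "projective_bimod_resolution A C \<longleftrightarrow>
     (\<forall>n. is_bimodule A (trm C n) \<and> fg_projective_bimod A (trm C n)) \<and>
     (\<forall>n. diff C n \<in> bimod_hom A (trm C (Suc n)) (trm C n)) \<and>
     aug C \<in> bimod_hom A (trm C 0) (regular_bimod A) \<and>
     aug C ` carrier (trm C 0) = carrier A \<and>
     {x \<in> carrier (trm C 0). aug C x = \<zero>\<^bsub>A\<^esub>} = diff C 0 ` carrier (trm C 1) \<and>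
     (\<forall>n. {x \<in> carrier (trm C (Suc n)). diff C n x = \<zero>\<^bsub>trm C n\<^esub>} =
          diff C (Suc n) ` carrier (trm C (Suc (Suc n))))"

definition cochains :: "('k, 'l) module \<Rightarrow> ('l, 'x) bimod_complex \<Rightarrow> nat \<Rightarrow> ('x \<Rightarrow> 'l) set" where
  "cochains A C n = bimod_hom A (trm C n) (regular_bimod A)"

definition cocycles ::
  "('k, 'l) module \<Rightarrow> ('l, 'x) bimod_complex \<Rightarrow> nat \<Rightarrow> ('k, 'x \<Rightarrow> 'l) module" where
  \<comment> \<open>a \<open>\<bbbK>\<close>-space; \<open>mult\<close> and \<open>one\<close> are not used\<close>
  "cocycles A C n =
     \<lparr>carrier = {f \<in> cochains A C n. \<forall>x\<in>carrier (trm C (Suc n)). f (diff C n x) = \<zero>\<^bsub>A\<^esub>},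
      monoid.mult = undefined, one = undefined,
      ring.zero = (\<lambda>x\<in>carrier (trm C n). \<zero>\<^bsub>A\<^esub>),
      ring.add = (\<lambda>f g. \<lambda>x\<in>carrier (trm C n). f x \<oplus>\<^bsub>A\<^esub> g x),
      smult = (\<lambda>c f. \<lambda>x\<in>carrier (trm C n). c \<odot>\<^bsub>A\<^esub> f x)\<rparr>"

fun coboundaries :: "('k, 'l) module \<Rightarrow> ('l, 'x) bimod_complex \<Rightarrow> nat \<Rightarrow> ('x \<Rightarrow> 'l) set" where
  "coboundaries A C 0 = {\<zero>\<^bsub>cocycles A C 0\<^esub>}"
| "coboundaries A C (Suc n) =
     (\<lambda>g. compose (carrier (trm C (Suc n))) g (diff C n)) ` cochains A C n"

definition HH_deg ::
  "('k, 'l) module \<Rightarrow> ('l, 'x) bimod_complex \<Rightarrow> nat \<Rightarrow> ('k, ('x \<Rightarrow> 'l) set) module" where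
  "HH_deg A C n = alg_quot (cocycles A C n) (coboundaries A C n)"

text \<open>\<open>L j\<close>, from degree \<open>q + j\<close> to degree \<open>j\<close>, form a chain map lifting the cocycle \<open>f\<close> of
  degree \<open>q\<close>.\<close>

definition is_lifting ::
  "('k, 'l) module \<Rightarrow> ('l, 'x) bimod_complex \<Rightarrow> nat \<Rightarrow> ('x \<Rightarrow> 'l) \<Rightarrow> (nat \<Rightarrow> 'x \<Rightarrow> 'x) \<Rightarrow> bool" where
  "is_lifting A C q f L \<longleftrightarrow>
     (\<forall>j. L j \<in> bimod_hom A (trm C (q + j)) (trm C j)) \<and>
     (\<forall>x\<in>carrier (trm C q). aug C (L 0 x) = f x) \<and>
     (\<forall>j. \<forall>x\<in>carrier (trm C (q + Suc j)). diff C j (L (Suc j) x) = L j (diff C (q + j) x))"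

text \<open>The Yoneda product of the classes of \<open>f\<close> (degree \<open>p\<close>) and \<open>g\<close> (degree \<open>q\<close>) is the class of
  \<open>f \<circ> L p\<close>, where \<open>L\<close> lifts \<open>g\<close>. As in \<^const>\<open>rcoset_mult\<close>, the class is written as the union over
  all choices of representatives (and of liftings), so that no choice is made; over a projective
  resolution all these choices give the same class.\<close>

definition yoneda ::
  "('k, 'l) module \<Rightarrow> ('l, 'x) bimod_complex \<Rightarrow> nat \<Rightarrow> nat \<Rightarrow>
     ('x \<Rightarrow> 'l) set \<Rightarrow> ('x \<Rightarrow> 'l) set \<Rightarrow> ('x \<Rightarrow> 'l) set" where
  "yoneda A C p q S T = (\<Union>f\<in>S. \<Union>g\<in>T. \<Union>L\<in>{L. is_lifting A C q g L}.
     coboundaries A C (p + q) +>\<^bsub>cocycles A C (p + q)\<^esub>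
       compose (carrier (trm C (p + q))) f (L p))"

definition HH_class ::
  "('k, 'l) module \<Rightarrow> ('l, 'x) bimod_complex \<Rightarrow> nat \<Rightarrow> ('x \<Rightarrow> 'l) \<Rightarrow> nat \<Rightarrow> ('x \<Rightarrow> 'l) set" where
  "HH_class A C n f = (\<lambda>k. if k = n then coboundaries A C n +>\<^bsub>cocycles A C n\<^esub> f
                             else \<zero>\<^bsub>HH_deg A C k\<^esub>)"

definition HH_alg ::
  "('k, 'l) module \<Rightarrow> ('l, 'x) bimod_complex \<Rightarrow> ('k, nat \<Rightarrow> ('x \<Rightarrow> 'l) set) module" where
  "HH_alg A C =
     \<lparr>carrier = {x. (\<forall>n. x n \<in> carrier (HH_deg A C n)) \<and> finite {n. x n \<noteq> \<zero>\<^bsub>HH_deg A C n\<^esub>}},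
      monoid.mult = (\<lambda>x y n. finsum (HH_deg A C n) (\<lambda>p. yoneda A C p (n - p) (x p) (y (n - p))) {..n}),
      one = HH_class A C 0 (aug C),
      ring.zero = (\<lambda>n. \<zero>\<^bsub>HH_deg A C n\<^esub>),
      ring.add = (\<lambda>x y n. x n \<oplus>\<^bsub>HH_deg A C n\<^esub> y n),
      smult = (\<lambda>c x n. c \<odot>\<^bsub>HH_deg A C n\<^esub> x n)\<rparr>"

definition HH_nil_ideal ::
  "('k, 'l) module \<Rightarrow> ('l, 'x) bimod_complex \<Rightarrow> (nat \<Rightarrow> ('x \<Rightarrow> 'l) set) set" where
  "HH_nil_ideal A C = genideal (HH_alg A C)
     {x \<in> carrier (HH_alg A C).
        (\<exists>n. \<forall>k. k \<noteq> n \<longrightarrow> x k = \<zero>\<^bsub>HH_deg A C k\<^esub>) \<and>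
        (\<exists>j::nat. j > 0 \<and> x [^]\<^bsub>HH_alg A C\<^esub> j = \<zero>\<^bsub>HH_alg A C\<^esub>)}"


section \<open>The explicit minimal resolution\<close>

type_synonym 'k res = "int \<times> int \<Rightarrow> ('k lam \<times> 'k lam \<Rightarrow>\<^sub>0 int) set"

definition left_proj :: "nat \<Rightarrow> nat \<Rightarrow> int \<Rightarrow> 'k::field lam set" where
  "left_proj m N i = (\<lambda>x. x \<otimes>\<^bsub>Lam m N\<^esub> l_e m N i) ` carrier (Lam m N)"

definition right_proj :: "nat \<Rightarrow> nat \<Rightarrow> int \<Rightarrow> 'k::field lam set" where
  "right_proj m N i = (\<lambda>x. l_e m N i \<otimes>\<^bsub>Lam m N\<^esub> x) ` carrier (Lam m N)"

definition res_index :: "nat \<Rightarrow> nat \<Rightarrow> (int \<times> int) set" where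
  "res_index m n = {0..<int m} \<times> {0..int n}"

definition res_summand ::
  "nat \<Rightarrow> nat \<Rightarrow> nat \<Rightarrow> int \<times> int \<Rightarrow> ('k::field lam, ('k lam \<times> 'k lam \<Rightarrow>\<^sub>0 int) set) bimodule" where
  "res_summand m N n = (\<lambda>(i, r).
     tensor_bimod (Lam m N) (left_proj m N i) (right_proj m N (i + int n - 2 * r)))"

definition res_term :: "nat \<Rightarrow> nat \<Rightarrow> nat \<Rightarrow> ('k::field lam, 'k res) bimodule" where
  "res_term m N n = bimod_sum (res_index m n) (res_summand m N n)"

text \<open>The generator \<open>e\<^sub>i \<otimes>\<^sub>r e\<^bsub>i+n-2r\<^esub>\<close> of the \<open>n\<close>-th term, with \<open>i\<close> read modulo \<open>m\<close>, and \<open>0\<close> for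
  \<open>r\<close> outside \<open>{0..n}\<close>.\<close>

definition res_gen :: "nat \<Rightarrow> nat \<Rightarrow> nat \<Rightarrow> int \<Rightarrow> int \<Rightarrow> 'k::field res" where
  "res_gen m N n i r = (\<lambda>j\<in>res_index m n.
     if j = (i mod int m, r)
     then tensor_class (Lam m N) (left_proj m N i) (right_proj m N (i + int n - 2 * r))
            (frag_of (l_e m N i, l_e m N (i + int n - 2 * r)))
     else \<zero>\<^bsub>res_summand m N n j\<^esub>)"

definition signed :: "('a, 'm) ring_scheme \<Rightarrow> int \<Rightarrow> 'a \<Rightarrow> 'a" where
  "signed M k x = (if even k then x else \<ominus>\<^bsub>M\<^esub> x)"

text \<open>The value of the differential on the generator \<open>e\<^sub>i \<otimes>\<^sub>r e\<^bsub>i+n-2r\<^esub>\<close> of degree \<open>n \<ge> 1\<close>.\<close>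

definition res_diff_gen :: "nat \<Rightarrow> nat \<Rightarrow> nat \<Rightarrow> int \<Rightarrow> int \<Rightarrow> 'k::field res" where
  "res_diff_gen m N n i r = (let
      A = Lam m N; M = res_term m N (n - 1); g = res_gen m N (n - 1); a = l_a m N; b = l_b m N;
      ab = (\<lambda>k::nat. (a \<otimes>\<^bsub>A\<^esub> b) [^]\<^bsub>A\<^esub> k);
      ba = (\<lambda>k::nat. (b \<otimes>\<^bsub>A\<^esub> a) [^]\<^bsub>A\<^esub> k);
      n' = int n
    in
      if n' - 2 * r > 0 then
        ract M (g i r) a
        \<oplus>\<^bsub>M\<^esub> signed M (n' + r) (lact M a (g (i + 1) r))
        \<oplus>\<^bsub>M\<^esub> signed M (n' + r) (lact M (b \<otimes>\<^bsub>A\<^esub> ab (N - 1)) (g (i - 1) (r - 1)))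
        \<oplus>\<^bsub>M\<^esub> signed M n' (ract M (g i (r - 1)) (b \<otimes>\<^bsub>A\<^esub> ab (N - 1)))
      else if n' - 2 * r < 0 then
        ract M (g i r) (a \<otimes>\<^bsub>A\<^esub> ba (N - 1))
        \<oplus>\<^bsub>M\<^esub> signed M (n' + r) (lact M (a \<otimes>\<^bsub>A\<^esub> ba (N - 1)) (g (i + 1) r))
        \<oplus>\<^bsub>M\<^esub> signed M (n' + r) (lact M b (g (i - 1) (r - 1)))
        \<oplus>\<^bsub>M\<^esub> signed M n' (ract M (g i (r - 1)) b)
      else
        finsum M (\<lambda>k.
          lact M (ba k)
            (ract M (ract M (g i r) a \<oplus>\<^bsub>M\<^esub> signed M r (lact M b (g (i - 1) (r - 1))))
              (ba (N - k - 1)))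
          \<oplus>\<^bsub>M\<^esub>
          lact M (ab k)
            (ract M (signed M r (lact M a (g (i + 1) r)) \<oplus>\<^bsub>M\<^esub> ract M (g i (r - 1)) b)
              (ab (N - k - 1))))
          {..<N})"

definition min_res :: "nat \<Rightarrow> nat \<Rightarrow> ('k::field lam, 'k res) bimod_complex" where
  "min_res m N =
     \<lparr>trm = res_term m N,
      diff = (\<lambda>n. THE f. f \<in> bimod_hom (Lam m N) (res_term m N (Suc n)) (res_term m N n) \<and>
                (\<forall>(i, r)\<in>res_index m (Suc n).
                   f (res_gen m N (Suc n) i r) = res_diff_gen m N (Suc n) i r)),
      aug = (THE f. f \<in> bimod_hom (Lam m N) (res_term m N 0) (regular_bimod (Lam m N)) \<and>
               (\<forall>i\<in>{0..<int m}. f (res_gen m N 0 i 0) = l_e m N i))\<rparr>"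

type_synonym 'k hh = "nat \<Rightarrow> ('k res \<Rightarrow> 'k lam) set"

definition HH :: "nat \<Rightarrow> nat \<Rightarrow> ('k::field, 'k hh) module" where
  "HH m N = HH_alg (Lam m N) (min_res m N)"

definition HH_nil :: "nat \<Rightarrow> nat \<Rightarrow> 'k::field hh set" where
  "HH_nil m N = HH_nil_ideal (Lam m N) (min_res m N)"

text \<open>The class in degree \<open>n\<close> of the cocycle with \<open>e\<^sub>i \<otimes> e\<^bsub>i+d\<^esub> \<mapsto> e\<^sub>i\<close> for all \<open>i\<close> and all other
  generators mapped to \<open>0\<close>. For \<open>d = 0\<close>, \<open>n = 2\<close> this is \<open>\<chi>\<^bsub>2,0\<^esub>\<close>, and for
  \<open>d = m\<close>, \<open>d = - m\<close> with \<open>n = m\<close> it is \<open>\<chi>\<^bsub>m,1\<^esub>\<close>, \<open>\<chi>\<^bsub>m,-1\<^esub>\<close>.\<close>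

definition chi :: "nat \<Rightarrow> nat \<Rightarrow> nat \<Rightarrow> int \<Rightarrow> 'k::field hh" where
  "chi m N n d = HH_class (Lam m N) (min_res m N) n
     (THE f. f \<in> bimod_hom (Lam m N) (res_term m N n) (regular_bimod (Lam m N)) \<and>
        (\<forall>(i, r)\<in>res_index m n. f (res_gen m N n i r) =
           (if int n - 2 * r = d then l_e m N i else \<zero>\<^bsub>Lam m N\<^esub>)))"

datatype chi_var = X20 | Xm1 | Xm_neg1

definition chi_rel :: "nat \<Rightarrow> ((chi_var \<Rightarrow>\<^sub>0 nat) \<Rightarrow>\<^sub>0 'k::field) set" where
  "chi_rel m = genideal poly_alg {pvar X20 ^ m - pvar Xm1 * pvar Xm_neg1}"

end

theory Submission
  imports Defs "HOL-Computational_Algebra.Polynomial"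
begin

text \<open>For N = 1, with a and b the sums of all arrows of the two types, the relations of
  \<Lambda> read aa = bb = 0 and ab = ba, and the radical has cube zero. In characteristic 2 the
  signs disappear and the three cases of the differential become one formula, d g(i,r) = g(i,r) a +
  a g(i+1,r) + b g(i-1,r-1) + g(i,r-1) b, where g(i,r) is the generator of the (i,r)-summand
  (\<open>dg\<close>). A contracting homotopy that is linear for the right action
  (\<open>homotopy_Suc\<close>, \<open>homotopy_0\<close>) shows that the complex is a projective
  resolution (\<open>resolution\<close>). That the Yoneda product of any projective bimodule
  resolution is well defined, associative and unital is the content of \<open>yo_cl\<close>,
  \<open>yo_assoc\<close> and \<open>ring_HH\<close>.

  Modulo nilpotents only the idempotent part of a cocycle survives. For a cocycle f of degree n, let
  \<gamma> n f be the polynomial in w whose coefficient at w^r is the coefficient of e_0 in f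
  (g(0,r)). The cocycle condition makes the coefficient of e_i in f (g(i,r)) independent of i
  (\<open>val_const\<close>), and comparison of end points allows it to be non-zero only if m
  divides n - 2r. Coboundaries have \<gamma> = 0 because every term of the differential contains an
  arrow (\<open>\<gamma>_B\<close>). Since \<open>dg\<close> has the same shape for all n and r, the
  cocycle \<open>\<kappa> q s\<close>, sending g(i,s) to e_i and all other generators to 0, is
  lifted by a shift of indices; hence it acts as multiplication by w^s
  (\<open>mlt_\<kappa>\<close>). A cocycle with \<gamma> = 0 takes values in the radical
  (\<open>\<gamma>_zero_rad\<close>), and right linearity of the homotopy provides a lifting of it
  with values in P rad (\<open>rad_lifting\<close>), so that products with it again have \<gamma> =
  0. Every cocycle is a combination of these two kinds, whence \<gamma> is multiplicative
  (\<open>mlt_all\<close>, \<open>\<Gamma>_yo\<close>).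

  Placing degree n at t^n gives a ring homomorphism \<Psi> from the cohomology ring to the
  polynomial ring in t and w, whose image \<open>chi_supp m\<close> is spanned by the t^n w^r with r
  \<le> n and m dividing n - 2r (\<open>\<Psi>_image\<close>). Its kernel is the ideal generated by
  the homogeneous nilpotent elements (\<open>nil_ideal\<close>): the target is a domain, and a
  homogeneous class in the kernel has cube zero because rad^3 = 0 (\<open>class_cube\<close>).

  What remains is commutative algebra. The three classes go to t^2 w, t^m and t^m w^m. These
  generate \<open>chi_supp m\<close> (\<open>chi_eval_surj\<close>). Modulo the given relation every
  polynomial reduces to monomials not divisible by both of the last two variables, and such
  monomials have distinct bidegrees (\<open>normal_inj\<close>), so there is no further relation
  (\<open>chi_eval_kernel\<close>). Three elements of a polynomial ring in two variables are
  algebraically dependent, which excludes a chain of four primes (\<open>no_long_chain\<close>),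
  while an explicit chain of three primes exists (\<open>krull_dim_bip\<close>).\<close>

section \<open>Algebras over a field and their quotients\<close>

locale k_algebra = ring A for A :: "('k::field, 'a, 'm) module_scheme" (structure) +
  assumes smult_closed [simp]: "x \<in> carrier A \<Longrightarrow> c \<odot> x \<in> carrier A"
    and smult_r_distr: "\<lbrakk>x \<in> carrier A; y \<in> carrier A\<rbrakk> \<Longrightarrow> c \<odot> (x \<oplus> y) = c \<odot> x \<oplus> c \<odot> y"
    and smult_l_distr: "x \<in> carrier A \<Longrightarrow> (c + d) \<odot> x = c \<odot> x \<oplus> d \<odot> x"
    and smult_assoc1: "x \<in> carrier A \<Longrightarrow> (c * d) \<odot> x = c \<odot> (d \<odot> x)"
    and smult_one [simp]: "x \<in> carrier A \<Longrightarrow> 1 \<odot> x = x"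
    and smult_mult_l: "\<lbrakk>x \<in> carrier A; y \<in> carrier A\<rbrakk> \<Longrightarrow> (c \<odot> x) \<otimes> y = c \<odot> (x \<otimes> y)"
    and smult_mult_r: "\<lbrakk>x \<in> carrier A; y \<in> carrier A\<rbrakk> \<Longrightarrow> x \<otimes> (c \<odot> y) = c \<odot> (x \<otimes> y)"
begin

lemma smult_l_null [simp]: "x \<in> carrier A \<Longrightarrow> 0 \<odot> x = \<zero>"
  by (metis add.l_cancel_one' smult_closed smult_l_distr add_0)

lemma smult_r_null [simp]: "c \<odot> \<zero> = \<zero>"
  by (metis add.l_cancel_one' smult_closed smult_r_distr zero_closed l_zero)

lemma smult_eq_mult: "x \<in> carrier A \<Longrightarrow> c \<odot> x = (c \<odot> \<one>) \<otimes> x"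
  by (simp add: smult_mult_l)

lemma smult_eq_mult': "x \<in> carrier A \<Longrightarrow> c \<odot> x = x \<otimes> (c \<odot> \<one>)"
  by (simp add: smult_mult_r)

lemma smult_minus: "x \<in> carrier A \<Longrightarrow> c \<odot> (\<ominus> x) = \<ominus> (c \<odot> x)"
  by (metis add.inv_closed add.inv_equality l_neg smult_closed smult_r_distr smult_r_null)

end

text \<open>\<open>A Quot I\<close> and \<open>alg_quot A I\<close> share all ring fields and differ
  only in the scalar multiplication, which the predicate \<open>ring\<close> does not see.\<close>

lemma ring_FactRing_alg_quot: "ring (A Quot I) \<longleftrightarrow> ring (alg_quot A I)"
  by (simp add: ring_def abelian_group_def abelian_monoid_def abelian_group_axioms_def
    comm_monoid_def comm_monoid_axioms_def comm_group_def group_def group_axioms_def Units_def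
    monoid_def ring_axioms_def alg_quot_def FactRing_def)

locale alg_ideal = ideal I A for I and A :: "('k, 'a, 'm) module_scheme" (structure)
begin

lemma ring_alg_quot: "ring (alg_quot A I)"
  using quotient_is_ring ring_FactRing_alg_quot by blast

lemma coset_eq_iff: "\<lbrakk>x \<in> carrier A; y \<in> carrier A\<rbrakk> \<Longrightarrow> I +> x = I +> y \<longleftrightarrow> x \<ominus> y \<in> I"
  by (meson ideal_axioms quotient_eq_iff_same_a_r_cos)

lemma alg_quot_carrier: "carrier (alg_quot A I) = (\<lambda>x. I +> x) ` carrier A"
  by (auto simp: alg_quot_def A_RCOSETS_def')

lemma alg_quot_add: "\<lbrakk>x \<in> carrier A; y \<in> carrier A\<rbrakk> \<Longrightarrow> (I +> x) \<oplus>\<^bsub>alg_quot A I\<^esub> (I +> y) = I +> (x \<oplus> y)"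
  by (simp add: alg_quot_def a_rcos_sum)

lemma alg_quot_mult: "\<lbrakk>x \<in> carrier A; y \<in> carrier A\<rbrakk> \<Longrightarrow> (I +> x) \<otimes>\<^bsub>alg_quot A I\<^esub> (I +> y) = I +> (x \<otimes> y)"
  by (simp add: alg_quot_def rcoset_mult_add)

lemma alg_quot_zero: "\<zero>\<^bsub>alg_quot A I\<^esub> = I +> \<zero>"
  by (simp add: alg_quot_def a_subset)

lemma alg_quot_one: "\<one>\<^bsub>alg_quot A I\<^esub> = I +> \<one>"
  by (simp add: alg_quot_def)

end

text \<open>Replacing x by h + x with h in I changes c x by c h, which lies in I again, so all
  cosets in the defining union coincide. Only a subgroup stable under scalars is assumed, so that
  the lemma serves cohomology groups as well as quotient algebras.\<close>

lemma alg_quot_smult: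
  fixes A :: "('k, 'a, 'm) module_scheme" (structure)
  assumes "abelian_subgroup I A" "\<And>x. x \<in> I \<Longrightarrow> c \<odot> x \<in> I"
    and "\<And>x. x \<in> carrier A \<Longrightarrow> c \<odot> x \<in> carrier A"
    and "\<And>x y. \<lbrakk>x \<in> carrier A; y \<in> carrier A\<rbrakk> \<Longrightarrow> c \<odot> (x \<oplus> y) = c \<odot> x \<oplus> c \<odot> y"
    and x: "x \<in> carrier A"
  shows "c \<odot>\<^bsub>alg_quot A I\<^esub> (I +> x) = I +> (c \<odot> x)"
proof -
  interpret abelian_subgroup I A by fact
  have *: "I +> (c \<odot> y) = I +> (c \<odot> x)" if y: "y \<in> I +> x" for y
  proof -
    obtain h where h: "h \<in> I" "y = h \<oplus> x" using y by (auto simp: a_r_coset_def')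
    have hc: "h \<in> carrier A" using h a_subset by auto
    have "c \<odot> y = c \<odot> h \<oplus> c \<odot> x" using h hc x assms by simp
    then have "c \<odot> y \<in> I +> (c \<odot> x)" using h assms(2)[of h] by (auto simp: a_r_coset_def')
    then show ?thesis
      using a_repr_independence[OF _ _ a_subgroup] x assms(3) by metis
  qed
  have "I +> x \<noteq> {}" using a_rcos_self[OF x] by blast
  then have "(\<Union>y\<in>I +> x. I +> (c \<odot> y)) = I +> (c \<odot> x)"
    using * by (rule SUP_eq_const)
  then show ?thesis by (simp add: alg_quot_def)
qed

lemma (in k_algebra) k_algebra_alg_quot:
  assumes "ideal I A"
  shows "k_algebra (alg_quot A I)"
    and "x \<in> carrier A \<Longrightarrow> c \<odot>\<^bsub>alg_quot A I\<^esub> (I +> x) = I +> (c \<odot> x)"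
proof -
  interpret I: alg_ideal I A by (simp add: alg_ideal_def assms)
  interpret Q: ring "alg_quot A I" by (rule I.ring_alg_quot)
  have cI: "c \<odot> x \<in> I" if "x \<in> I" for c x
    using that I.a_subset smult_eq_mult I.I_l_closed by (metis I.Icarr one_closed smult_closed)
  have *: "c \<odot>\<^bsub>alg_quot A I\<^esub> (I +> x) = I +> (c \<odot> x)" if "x \<in> carrier A" for x c
    by (rule alg_quot_smult) (use that cI in \<open>auto simp: smult_r_distr intro: I.is_abelian_subgroup\<close>)
  show "x \<in> carrier A \<Longrightarrow> c \<odot>\<^bsub>alg_quot A I\<^esub> (I +> x) = I +> (c \<odot> x)" by (rule *)
  note s = I.alg_quot_add I.alg_quot_mult *
  show "k_algebra (alg_quot A I)"
    by unfold_locales (auto simp: I.alg_quot_carrier s smult_r_distr smult_l_distr smult_assoc1 smult_mult_l smult_mult_r)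
qed

section \<open>Ring structure and spanning paths of the path algebra\<close>

section \<open>The path algebra\<close>

lemma is_path_from_start: "is_path_from m v w \<Longrightarrow> v \<in> {0..<int m}"
  by (cases w; cases "hd w") auto

lemma is_path_from_append:
  "is_path_from m v (u @ w) \<longleftrightarrow> is_path_from m v u \<and> is_path_from m (path_end m v u) w"
  by (induction u arbitrary: v) (auto dest: is_path_from_start)

lemma path_end_append: "path_end m v (u @ w) = path_end m (path_end m v u) w"
  by (induction u arbitrary: v) auto

lemma is_path_from_end: "is_path_from m v w \<Longrightarrow> path_end m v w \<in> {0..<int m}"
  by (induction w arbitrary: v) auto

lemma path_alg_simps:
  "carrier (path_alg m) = {f :: path \<Rightarrow> 'k::field. finite {p. f p \<noteq> 0} \<and> (\<forall>v w. f (v, w) \<noteq> 0 \<longrightarrow> is_path_from m v w)}"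
  "(f \<oplus>\<^bsub>path_alg m\<^esub> g) p = f p + (g p :: 'k)"
  "(f \<otimes>\<^bsub>path_alg m\<^esub> g) (v, w) = (\<Sum>k\<le>length w. f (v, take k w) * (g (path_end m v (take k w), drop k w) :: 'k))"
  "\<zero>\<^bsub>path_alg m\<^esub> p = (0::'k)"
  "\<one>\<^bsub>path_alg m\<^esub> (v, w) = (if w = [] \<and> v \<in> {0..<int m} then 1 else (0::'k))"
  "(c \<odot>\<^bsub>path_alg m\<^esub> f) p = c * (f p :: 'k)"
  by (simp_all add: path_alg_def)

text \<open>A non-zero coefficient of the product requires a cut whose two pieces lie in the
  supports of the factors. The support therefore consists of concatenations of pairs from two finite
  sets, and the pieces fit together to a path.\<close>

lemma path_alg_mult_closed:
  fixes f g :: "path \<Rightarrow> 'k::field"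
  assumes "f \<in> carrier (path_alg m)" "g \<in> carrier (path_alg m)"
  shows "f \<otimes>\<^bsub>path_alg m\<^esub> g \<in> carrier (path_alg m)"
proof -
  let ?h = "f \<otimes>\<^bsub>path_alg m\<^esub> g"
  have *: "\<exists>k\<le>length w. f (v, take k w) \<noteq> 0 \<and> g (path_end m v (take k w), drop k w) \<noteq> 0"
    if h: "?h (v, w) \<noteq> 0" for v w
  proof (rule ccontr)
    assume "\<not> ?thesis"
    then have "?h (v, w) = (0::'k)"
      unfolding path_alg_simps by (intro sum.neutral) auto
    with h show False by simp
  qed
  have "{p. ?h p \<noteq> 0} \<subseteq> (\<lambda>(p, q). (fst p, snd p @ snd q)) ` ({p. f p \<noteq> 0} \<times> {p. g p \<noteq> 0})"
  proof
    fix p assume "p \<in> {p. ?h p \<noteq> 0}"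
    then obtain v w where p: "p = (v, w)" and "?h (v, w) \<noteq> 0" by (cases p) auto
    then obtain k where "f (v, take k w) \<noteq> 0" "g (path_end m v (take k w), drop k w) \<noteq> 0"
      using * by blast
    then show "p \<in> (\<lambda>(p, q). (fst p, snd p @ snd q)) ` ({p. f p \<noteq> 0} \<times> {p. g p \<noteq> 0})"
      by (intro image_eqI[of _ _ "((v, take k w), (path_end m v (take k w), drop k w))"]) (auto simp: p)
  qed
  moreover have "finite ({p. f p \<noteq> 0} \<times> {p. g p \<noteq> 0})"
    using assms by (auto simp: path_alg_simps)
  ultimately have "finite {p. ?h p \<noteq> 0}" using finite_surj by blast
  moreover have "is_path_from m v w" if h: "?h (v, w) \<noteq> 0" for v w
  proof -
    obtain k where "f (v, take k w) \<noteq> 0" "g (path_end m v (take k w), drop k w) \<noteq> 0"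
      using *[OF h] by blast
    then have "is_path_from m v (take k w)" "is_path_from m (path_end m v (take k w)) (drop k w)"
      using assms by (auto simp: path_alg_simps)
    then show ?thesis by (metis is_path_from_append append_take_drop_id)
  qed
  ultimately show ?thesis by (simp add: path_alg_simps(1))
qed

text \<open>Both sides sum over the ways to cut the word into three pieces; in \<open>F i l\<close>
  the first piece has length i and the second has length l.\<close>

lemma path_alg_mult_assoc:
  fixes f g h :: "path \<Rightarrow> 'k::field"
  shows "(f \<otimes>\<^bsub>path_alg m\<^esub> g) \<otimes>\<^bsub>path_alg m\<^esub> h = f \<otimes>\<^bsub>path_alg m\<^esub> (g \<otimes>\<^bsub>path_alg m\<^esub> h)"
proof (rule ext)
  fix p :: path
  obtain v w where p: "p = (v, w)" by (cases p)
  define F where "F i l = f (v, take i w) * g (path_end m v (take i w), take l (drop i w))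
      * h (path_end m v (take (i + l) w), drop (i + l) w)" for i l
  have "((f \<otimes>\<^bsub>path_alg m\<^esub> g) \<otimes>\<^bsub>path_alg m\<^esub> h) p = (\<Sum>k\<le>length w. \<Sum>i\<le>k. F i (k - i))"
    unfolding p path_alg_simps F_def
    by (intro sum.cong refl) (auto simp: sum_distrib_right drop_take intro!: sum.cong)
  also have "\<dots> = (\<Sum>(i, j)\<in>{(i, j). i + j \<le> length w}. F i j)"
    by (rule sum.triangle_reindex_eq[symmetric])
  also have "{(i, j). i + j \<le> length w} = (SIGMA i:{..length w}. {..length w - i})"
    by auto
  also have "(\<Sum>(i, j)\<in>\<dots>. F i j) = (\<Sum>i\<le>length w. \<Sum>j\<le>length w - i. F i j)"
    by (rule sum.Sigma[symmetric]) auto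
  also have "\<dots> = (f \<otimes>\<^bsub>path_alg m\<^esub> (g \<otimes>\<^bsub>path_alg m\<^esub> h)) p"
    unfolding p path_alg_simps F_def
    by (intro sum.cong refl)
      (auto simp: sum_distrib_left take_add path_end_append mult.assoc add.commute intro!: sum.cong)
  finally show "((f \<otimes>\<^bsub>path_alg m\<^esub> g) \<otimes>\<^bsub>path_alg m\<^esub> h) p = (f \<otimes>\<^bsub>path_alg m\<^esub> (g \<otimes>\<^bsub>path_alg m\<^esub> h)) p" .
qed

lemma path_alg_ring: "ring (path_alg m :: ('k::field, path \<Rightarrow> 'k) module)"
proof -
  let ?A = "path_alg m :: ('k, path \<Rightarrow> 'k) module"
  have add: "f \<oplus>\<^bsub>?A\<^esub> g \<in> carrier ?A" if "f \<in> carrier ?A" "g \<in> carrier ?A" for f g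
  proof -
    have "{p. (f \<oplus>\<^bsub>?A\<^esub> g) p \<noteq> 0} \<subseteq> {p. f p \<noteq> 0} \<union> {p. g p \<noteq> 0}" by (auto simp: path_alg_simps)
    moreover have "finite ({p. f p \<noteq> 0} \<union> {p. g p \<noteq> 0})" using that by (auto simp: path_alg_simps)
    ultimately have "finite {p. (f \<oplus>\<^bsub>?A\<^esub> g) p \<noteq> 0}" by (rule finite_subset)
    moreover have "is_path_from m v w" if "(f \<oplus>\<^bsub>?A\<^esub> g) (v, w) \<noteq> 0" for v w
      using that \<open>f \<in> _\<close> \<open>g \<in> _\<close> by (cases "f (v, w) = 0") (auto simp: path_alg_simps)
    ultimately show ?thesis unfolding path_alg_simps(1) by blast
  qed
  have neg: "(\<lambda>p. - f p) \<in> carrier ?A" if "f \<in> carrier ?A" for f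
    using that by (auto simp: path_alg_simps)
  have one: "\<one>\<^bsub>?A\<^esub> \<in> carrier ?A"
  proof -
    have "{p. \<one>\<^bsub>?A\<^esub> p \<noteq> 0} \<subseteq> (\<lambda>v. (v, [])) ` {0..<int m}"
      by (auto simp: path_alg_def split: if_splits)
    then have "finite {p. \<one>\<^bsub>?A\<^esub> p \<noteq> 0}" by (rule finite_subset) auto
    then show ?thesis unfolding path_alg_simps(1) by (auto simp: path_alg_simps(5) split: if_splits)
  qed
  have zero: "\<zero>\<^bsub>?A\<^esub> \<in> carrier ?A" by (auto simp: path_alg_simps)
  have grp: "abelian_group ?A"
  proof (rule abelian_groupI)
    fix f assume f: "f \<in> carrier ?A"
    show "\<exists>y\<in>carrier ?A. y \<oplus>\<^bsub>?A\<^esub> f = \<zero>\<^bsub>?A\<^esub>"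
      by (rule bexI[OF _ neg[OF f]]) (simp add: path_alg_def)
  qed (auto simp: add zero, auto simp: path_alg_def)
  have lone: "\<one>\<^bsub>?A\<^esub> \<otimes>\<^bsub>?A\<^esub> f = f" if f: "f \<in> carrier ?A" for f
  proof (rule ext, clarify)
    fix v w
    have "(\<one>\<^bsub>?A\<^esub> \<otimes>\<^bsub>?A\<^esub> f) (v, w) = (\<Sum>k\<le>length w. if k = 0 then f (v, w) else 0)"
      unfolding path_alg_simps
      using f is_path_from_start[of m v w] by (intro sum.cong) (auto simp: path_alg_simps(1))
    then show "(\<one>\<^bsub>?A\<^esub> \<otimes>\<^bsub>?A\<^esub> f) (v, w) = f (v, w)" by simp
  qed
  have rone: "f \<otimes>\<^bsub>?A\<^esub> \<one>\<^bsub>?A\<^esub> = f" if f: "f \<in> carrier ?A" for f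
  proof (rule ext, clarify)
    fix v w
    have "(f \<otimes>\<^bsub>?A\<^esub> \<one>\<^bsub>?A\<^esub>) (v, w) = (\<Sum>k\<le>length w. if k = length w then f (v, w) else 0)"
      unfolding path_alg_simps
      using f is_path_from_end[of m v w] by (intro sum.cong) (auto simp: path_alg_simps(1))
    then show "(f \<otimes>\<^bsub>?A\<^esub> \<one>\<^bsub>?A\<^esub>) (v, w) = f (v, w)" by simp
  qed
  show ?thesis
  proof (rule ringI[OF grp])
    show "Group.monoid ?A"
      by (rule monoidI) (auto simp: path_alg_mult_closed one lone rone path_alg_mult_assoc)
  qed (rule ext, clarify, simp add: path_alg_simps(2-) sum.distrib distrib_left distrib_right)+
qed

lemma path_alg_k_algebra: "k_algebra (path_alg m :: ('k::field, path \<Rightarrow> 'k) module)"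
proof -
  let ?A = "path_alg m :: ('k, path \<Rightarrow> 'k) module"
  interpret ring ?A by (rule path_alg_ring)
  have cl: "c \<odot>\<^bsub>?A\<^esub> f \<in> carrier ?A" if "f \<in> carrier ?A" for f c
  proof -
    have "{p. (c \<odot>\<^bsub>?A\<^esub> f) p \<noteq> 0} \<subseteq> {p. f p \<noteq> 0}" by (auto simp: path_alg_simps)
    moreover have "finite {p. f p \<noteq> 0}" using that by (simp add: path_alg_simps)
    ultimately have "finite {p. (c \<odot>\<^bsub>?A\<^esub> f) p \<noteq> 0}" by (rule finite_subset)
    then show ?thesis using that unfolding path_alg_simps(1) by (auto simp: path_alg_simps(6))
  qed
  show ?thesis
    by unfold_locales
      (simp_all add: cl, (rule ext, clarify, simp add: path_alg_simps(2-) sum_distrib_left algebra_simps)+)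
qed

lemma path_elem_closed: "is_path_from m v w \<Longrightarrow> path_elem (v, w) \<in> carrier (path_alg m)"
  by (auto simp: path_alg_simps(1) path_elem_def)

text \<open>Only the cut at \<open>length u\<close> can contribute to a coefficient of this
  product.\<close>

lemma path_elem_mult:
  "path_elem (v, u) \<otimes>\<^bsub>path_alg m\<^esub> path_elem (v', w)
    = (if path_end m v u = v' then path_elem (v, u @ w) else (\<lambda>_. 0 :: 'k::field))" (is "?l = ?r")
proof (rule ext, clarify)
  fix x y
  have *: "take k y = u \<and> drop k y = w \<longleftrightarrow> k = length u \<and> y = u @ w" if "k \<le> length y" for k
    using that by auto
  have **: "path_elem (v, u) (x, take k y) * path_elem (v', w) (path_end m x (take k y), drop k y)
      = (if k = length u then ?r (x, y) else 0)" if k: "k \<le> length y" for k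
  proof (cases "take k y = u \<and> drop k y = w")
    case True
    then show ?thesis using *[OF k] by (auto simp: path_elem_def)
  next
    case False
    then have "k = length u \<Longrightarrow> y \<noteq> u @ w" using *[OF k] by metis
    with False show ?thesis by (auto simp: path_elem_def)
  qed
  have "?l (x, y) = (\<Sum>k\<le>length y. if k = length u then ?r (x, y) else 0)"
    unfolding path_alg_simps by (intro sum.cong refl **) simp
  also have "\<dots> = ?r (x, y)" by (auto simp: path_elem_def)
  finally show "?l (x, y) = ?r (x, y)" .
qed

text \<open>The paths span: a finitely supported f is exhausted by splitting off one path of its
  support at a time.\<close>

lemma path_alg_induct [consumes 1, case_names zero single add]:
  fixes f :: "path \<Rightarrow> 'k::field"
  assumes "f \<in> carrier (path_alg m)"
    and zero: "P \<zero>\<^bsub>path_alg m\<^esub>"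
    and single: "\<And>c v w. is_path_from m v w \<Longrightarrow> P (c \<odot>\<^bsub>path_alg m\<^esub> path_elem (v, w))"
    and add: "\<And>f g. \<lbrakk>f \<in> carrier (path_alg m); g \<in> carrier (path_alg m); P f; P g\<rbrakk> \<Longrightarrow> P (f \<oplus>\<^bsub>path_alg m\<^esub> g)"
  shows "P f"
proof -
  interpret k_algebra "path_alg m :: ('k, path \<Rightarrow> 'k) module" by (rule path_alg_k_algebra)
  have "P f" if "finite S" "{p. f p \<noteq> 0} \<subseteq> S" "f \<in> carrier (path_alg m)" for S f
    using that
  proof (induction S arbitrary: f rule: finite_induct)
    case empty
    then have "f = \<zero>\<^bsub>path_alg m\<^esub>" by (auto simp: fun_eq_iff path_alg_def)
    then show ?case using assms(2) by simp
  next
    case (insert p S)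
    obtain v w where p: "p = (v, w)" by (cases p)
    define g where "g = (\<lambda>q. if q = p then 0 else f q)"
    show ?case
    proof (cases "f p = 0")
      case True
      then show ?thesis using insert by (intro insert.IH) auto
    next
      case False
      then have pth: "is_path_from m v w" using insert.prems p by (auto simp: path_alg_simps(1))
      have "{q. g q \<noteq> 0} \<subseteq> {q. f q \<noteq> 0}" by (auto simp: g_def)
      moreover have "finite {q. f q \<noteq> 0}" using insert.prems by (simp add: path_alg_simps(1))
      ultimately have "finite {q. g q \<noteq> 0}" by (rule finite_subset)
      then have g: "g \<in> carrier (path_alg m)"
        using insert.prems by (auto simp: path_alg_simps(1) g_def)
      have "P g" using insert g by (intro insert.IH) (auto simp: g_def)
      moreover have "f = g \<oplus>\<^bsub>path_alg m\<^esub> (f p \<odot>\<^bsub>path_alg m\<^esub> path_elem (v, w))"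
        by (rule ext) (simp add: path_alg_def g_def p path_elem_def)
      moreover have "P (g \<oplus>\<^bsub>path_alg m\<^esub> (f p \<odot>\<^bsub>path_alg m\<^esub> path_elem (v, w)))"
        using \<open>P g\<close> by (intro assms(4) g single pth smult_closed path_elem_closed)
      ultimately show ?thesis by (metis (lifting))
    qed
  qed
  from this[OF _ subset_refl assms(1)] show ?thesis using assms(1) by (simp add: path_alg_simps(1))
qed

lemma finsum_path_alg:
  assumes "finite S" "\<And>s. s \<in> S \<Longrightarrow> F s \<in> carrier (path_alg m)"
  shows "finsum (path_alg m) F S p = (\<Sum>s\<in>S. (F s p :: 'k::field))"
proof -
  interpret k_algebra "path_alg m :: ('k, path \<Rightarrow> 'k) module" by (rule path_alg_k_algebra)
  show ?thesis using assms
  proof (induction S rule: finite_induct)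
    case (insert x S)
    then have "finsum (path_alg m) F (insert x S) = F x \<oplus>\<^bsub>path_alg m\<^esub> finsum (path_alg m) F S"
      by (intro finsum_insert) auto
    then show ?case using insert by (simp add: path_alg_simps(2))
  qed (simp add: path_alg_simps(4))
qed

section \<open>Linear coordinates that vanish on the relations\<close>

section \<open>Coordinates\<close>

text \<open>The coordinates with respect to the four elements ending at the vertex \<open>i\<close>: the vertex itself,
  the two arrows ending there, and the common class of the two cycles.\<close>

definition cE :: "nat \<Rightarrow> int \<Rightarrow> (path \<Rightarrow> 'k) \<Rightarrow> 'k::field" where
  "cE m i f = f (i mod int m, [])"
definition cA :: "nat \<Rightarrow> int \<Rightarrow> (path \<Rightarrow> 'k) \<Rightarrow> 'k::field" where
  "cA m i f = f ((i - 1) mod int m, [Arr ((i - 1) mod int m)])"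
definition cB :: "nat \<Rightarrow> int \<Rightarrow> (path \<Rightarrow> 'k) \<Rightarrow> 'k::field" where
  "cB m i f = f ((i + 1) mod int m, [Bar (i mod int m)])"
definition cS :: "nat \<Rightarrow> int \<Rightarrow> (path \<Rightarrow> 'k) \<Rightarrow> 'k::field" where
  "cS m i f = f (i mod int m, [Arr (i mod int m), Bar (i mod int m)])
    + f (i mod int m, [Bar ((i - 1) mod int m), Arr ((i - 1) mod int m)])"

lemmas c_defs = cE_def cA_def cB_def cS_def

lemma path_alg_mult_short:
  fixes f g :: "path \<Rightarrow> 'k::field"
  shows "(f \<otimes>\<^bsub>path_alg m\<^esub> g) (v, []) = f (v, []) * g (v, [])"
    "(f \<otimes>\<^bsub>path_alg m\<^esub> g) (v, [x]) = f (v, []) * g (v, [x]) + f (v, [x]) * g (arrow_tgt m x, [])"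
    "(f \<otimes>\<^bsub>path_alg m\<^esub> g) (v, [x, y]) = f (v, []) * g (v, [x, y]) + f (v, [x]) * g (arrow_tgt m x, [y])
      + f (v, [x, y]) * g (arrow_tgt m y, [])"
  by (simp_all add: path_alg_simps(3))

text \<open>A word of length at most 2 has at most three cuts, and after summing over the two cycles
  at a vertex the coordinates of a product depend only on the coordinates of the factors. This is
  what makes their common kernel a two-sided ideal.\<close>

lemma c_mult:
  fixes f g :: "path \<Rightarrow> 'k::field" and m :: nat
  defines "h \<equiv> f \<otimes>\<^bsub>path_alg m\<^esub> g"
  shows "cE m i h = cE m i f * cE m i g"
    "cA m i h = cE m (i - 1) f * cA m i g + cA m i f * cE m i g"
    "cB m i h = cE m (i + 1) f * cB m i g + cB m i f * cE m i g"
    "cS m i h = cE m i f * cS m i g + cS m i f * cE m i g + cA m (i + 1) f * cB m i g + cB m (i - 1) f * cA m i g"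
  unfolding h_def c_defs path_alg_mult_short by (simp_all add: mod_simps algebra_simps)

lemma c_linear:
  fixes f g :: "path \<Rightarrow> 'k::field"
  shows "cE m i (f \<oplus>\<^bsub>path_alg m\<^esub> g) = cE m i f + cE m i g" "cA m i (f \<oplus>\<^bsub>path_alg m\<^esub> g) = cA m i f + cA m i g"
    "cB m i (f \<oplus>\<^bsub>path_alg m\<^esub> g) = cB m i f + cB m i g" "cS m i (f \<oplus>\<^bsub>path_alg m\<^esub> g) = cS m i f + cS m i g"
    "cE m i (c \<odot>\<^bsub>path_alg m\<^esub> g) = c * cE m i g" "cA m i (c \<odot>\<^bsub>path_alg m\<^esub> g) = c * cA m i g"
    "cB m i (c \<odot>\<^bsub>path_alg m\<^esub> g) = c * cB m i g" "cS m i (c \<odot>\<^bsub>path_alg m\<^esub> g) = c * cS m i g"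
    "cE m i \<zero>\<^bsub>path_alg m\<^esub> = (0::'k)" "cA m i \<zero>\<^bsub>path_alg m\<^esub> = (0::'k)"
    "cB m i \<zero>\<^bsub>path_alg m\<^esub> = (0::'k)" "cS m i \<zero>\<^bsub>path_alg m\<^esub> = (0::'k)"
  by (simp_all add: c_defs path_alg_simps algebra_simps)

text \<open>The elements of the path algebra whose classes are \<open>l_a\<close> and
  \<open>l_b\<close>.\<close>

definition p_a :: "nat \<Rightarrow> path \<Rightarrow> 'k::field" where
  "p_a m = finsum (path_alg m) (q_a m) {0..<int m}"
definition p_b :: "nat \<Rightarrow> path \<Rightarrow> 'k::field" where
  "p_b m = finsum (path_alg m) (q_b m) {0..<int m}"

locale path_setup =
  fixes m :: nat and Q :: "('k::field, path \<Rightarrow> 'k) module" (structure)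
  assumes m: "m \<ge> 3" and Q: "Q = path_alg m"
begin

sublocale k_algebra Q unfolding Q by (rule path_alg_k_algebra)

abbreviation pe :: "int \<Rightarrow> path \<Rightarrow> 'k" where "pe \<equiv> q_e m"
abbreviation pa :: "path \<Rightarrow> 'k" where "pa \<equiv> p_a m"
abbreviation pb :: "path \<Rightarrow> 'k" where "pb \<equiv> p_b m"

lemma m_pos: "int m > 0" using m by simp

lemma q_closed: "q_e m i \<in> carrier Q" "q_a m i \<in> carrier Q" "q_b m i \<in> carrier Q"
  unfolding Q q_e_def q_a_def q_b_def using m_pos by (auto intro!: path_elem_closed simp: mod_simps)

lemma p_closed: "pa \<in> carrier Q" "pb \<in> carrier Q"
  unfolding p_a_def p_b_def Q[symmetric] by (auto intro!: finsum_closed q_closed)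

lemma p_apply:
  "pa (v, w) = (if v \<in> {0..<int m} \<and> w = [Arr v] then 1 else 0)"
  "pb (v, w) = (if v \<in> {0..<int m} \<and> w = [Bar ((v - 1) mod int m)] then 1 else 0)"
proof -
  have "pa (v, w) = (\<Sum>s\<in>{0..<int m}. q_a m s (v, w))"
    unfolding p_a_def using q_closed unfolding Q by (intro finsum_path_alg) auto
  also have "\<dots> = (\<Sum>s\<in>{0..<int m}. if s = v then if w = [Arr v] then 1 else 0 else 0)"
    by (intro sum.cong) (auto simp: q_a_def path_elem_def)
  finally show "pa (v, w) = (if v \<in> {0..<int m} \<and> w = [Arr v] then 1 else 0)" by simp
  have *: "v = (s + 1) mod int m \<longleftrightarrow> v \<in> {0..<int m} \<and> s = (v - 1) mod int m" if "s \<in> {0..<int m}" for s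
    using that m_pos by (auto simp: mod_simps) 
  have "pb (v, w) = (\<Sum>s\<in>{0..<int m}. q_b m s (v, w))"
    unfolding p_b_def using q_closed unfolding Q by (intro finsum_path_alg) auto
  also have "\<dots> = (\<Sum>s\<in>{0..<int m}. if s = (v - 1) mod int m then if v \<in> {0..<int m} \<and> w = [Bar ((v - 1) mod int m)] then 1 else 0 else 0)"
    by (intro sum.cong) (use * in \<open>auto simp: q_b_def path_elem_def\<close>)
  finally show "pb (v, w) = (if v \<in> {0..<int m} \<and> w = [Bar ((v - 1) mod int m)] then 1 else 0)" using m_pos by simp
qed

lemma e_mult_apply:
  "(pe i \<otimes> f) (v, w) = (if v = i mod int m then f (v, w) else 0)"
  "(f \<otimes> pe i) (v, w) = (if path_end m v w = i mod int m then f (v, w) else 0)"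
proof -
  have "(pe i \<otimes> f) (v, w) = (\<Sum>k\<le>length w. if k = 0 then if v = i mod int m then f (v, w) else 0 else 0)"
    unfolding Q path_alg_simps by (intro sum.cong) (auto simp: q_e_def path_elem_def)
  then show "(pe i \<otimes> f) (v, w) = (if v = i mod int m then f (v, w) else 0)" by simp
  have "(f \<otimes> pe i) (v, w) = (\<Sum>k\<le>length w. if k = length w then if path_end m v w = i mod int m then f (v, w) else 0 else 0)"
    unfolding Q path_alg_simps by (intro sum.cong) (auto simp: q_e_def path_elem_def)
  then show "(f \<otimes> pe i) (v, w) = (if path_end m v w = i mod int m then f (v, w) else 0)" by simp
qed

lemma mod_succ_eq_iff: "(i + 1) mod int m = (j + 1) mod int m \<longleftrightarrow> i mod int m = j mod int m"
  "(i - 1) mod int m = (j - 1) mod int m \<longleftrightarrow> i mod int m = j mod int m"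
  by (simp_all add: mod_eq_dvd_iff)

lemma p_rel:
  "pe i \<otimes> pa = q_a m i" "pa \<otimes> pe (i + 1) = q_a m i" "pe i \<otimes> pb = q_b m (i - 1)" "pb \<otimes> pe (i - 1) = q_b m (i - 1)"
  "pe i \<otimes> pe j = (if i mod int m = j mod int m then pe i else \<zero>)"
proof -
  have *: "(v + 1) mod int m = (i + 1) mod int m \<longleftrightarrow> v = i mod int m" if "v \<in> {0..<int m}" for v
    using that mod_succ_eq_iff(1)[of v i] by simp
  have **: "(v - 1) mod int m = (i - 1) mod int m \<longleftrightarrow> v = i mod int m" if "v \<in> {0..<int m}" for v
    using that mod_succ_eq_iff(2)[of v i] by simp
  show "pe i \<otimes> pa = q_a m i"
    using m_pos by (intro ext, clarify) (auto simp: e_mult_apply p_apply q_a_def path_elem_def)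
  show "pa \<otimes> pe (i + 1) = q_a m i"
    using m_pos by (intro ext, clarify) (auto simp: e_mult_apply p_apply q_a_def path_elem_def *)
  show "pe i \<otimes> pb = q_b m (i - 1)"
    using m_pos by (intro ext, clarify) (auto simp: e_mult_apply p_apply q_b_def path_elem_def mod_simps)
  show "pb \<otimes> pe (i - 1) = q_b m (i - 1)"
    using m_pos by (intro ext, clarify) (auto simp: e_mult_apply p_apply q_b_def path_elem_def mod_simps **)
  show "pe i \<otimes> pe j = (if i mod int m = j mod int m then pe i else \<zero>)"
    by (rule ext, clarify, simp add: e_mult_apply(1), simp add: q_e_def path_elem_def Q path_alg_simps(4))
qed

lemma sum_pe: "finsum Q pe {0..<int m} = \<one>"
proof (rule ext, clarify)
  fix v w
  have "finsum Q pe {0..<int m} (v, w) = (\<Sum>s\<in>{0..<int m}. pe s (v, w))"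
    using q_closed(1) unfolding Q by (intro finsum_path_alg) auto
  also have "\<dots> = (\<Sum>s\<in>{0..<int m}. if s = v then if w = [] then 1 else 0 else 0)"
    by (intro sum.cong) (auto simp: q_e_def path_elem_def)
  finally show "finsum Q pe {0..<int m} (v, w) = \<one> (v, w)" by (simp add: Q path_alg_simps)
qed

lemma c_values:
  "cE m i (pe j) = (if i mod int m = j mod int m then 1 else 0)" "cA m i (pe j) = 0" "cB m i (pe j) = 0" "cS m i (pe j) = 0"
  "cE m i pa = 0" "cA m i pa = 1" "cB m i pa = 0" "cS m i pa = 0"
  "cE m i pb = 0" "cA m i pb = 0" "cB m i pb = 1" "cS m i pb = 0"
  using m_pos by (auto simp: c_defs q_e_def path_elem_def p_apply mod_simps)

text \<open>An upper bound for the ideal of relations at N = 1: since the relations lie in this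
  kernel, the coordinates descend to the quotient algebra.\<close>

definition K :: "(path \<Rightarrow> 'k) set" where
  "K = {f \<in> carrier Q. \<forall>i. cE m i f = 0 \<and> cA m i f = 0 \<and> cB m i f = 0 \<and> cS m i f = 0}"

lemma c_mult': "cE m i (f \<otimes> g) = cE m i f * cE m i g"
    "cA m i (f \<otimes> g) = cE m (i - 1) f * cA m i g + cA m i f * cE m i g"
    "cB m i (f \<otimes> g) = cE m (i + 1) f * cB m i g + cB m i f * cE m i g"
    "cS m i (f \<otimes> g) = cE m i f * cS m i g + cS m i f * cE m i g + cA m (i + 1) f * cB m i g + cB m (i - 1) f * cA m i g"
  unfolding Q by (rule c_mult)+

lemma c_linear':
  shows "cE m i (f \<oplus> g) = cE m i f + cE m i g" "cA m i (f \<oplus> g) = cA m i f + cA m i g"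
    "cB m i (f \<oplus> g) = cB m i f + cB m i g" "cS m i (f \<oplus> g) = cS m i f + cS m i g"
    "cE m i (c \<odot> g) = c * cE m i g" "cA m i (c \<odot> g) = c * cA m i g"
    "cB m i (c \<odot> g) = c * cB m i g" "cS m i (c \<odot> g) = c * cS m i g"
    "cE m i \<zero> = (0::'k)" "cA m i \<zero> = (0::'k)"
    "cB m i \<zero> = (0::'k)" "cS m i \<zero> = (0::'k)"
  unfolding Q by (rule c_linear)+

lemma ideal_K: "ideal K Q"
proof (rule idealI[OF ring_axioms])
  have min: "\<ominus> f = (- 1) \<odot> f" if "f \<in> carrier Q" for f
    using minus_equality[of "(- 1) \<odot> f" f] smult_l_distr[of f "- 1" 1] that by simp
  show "subgroup K (add_monoid Q)"
  proof (rule subgroup.intro)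
    show "inv\<^bsub>add_monoid Q\<^esub> x \<in> K" if "x \<in> K" for x
      using that min[of x] unfolding a_inv_def[symmetric] by (auto simp: K_def c_linear')
  qed (auto simp: K_def c_linear')
qed (auto simp: K_def c_mult')

lemma K_I:
  assumes "f \<in> carrier Q" "\<And>j. cE m j f = 0" "\<And>j. cA m j f = 0" "\<And>j. cB m j f = 0" "\<And>j. cS m j f = 0"
  shows "f \<in> K"
  using assms by (simp add: K_def)

text \<open>The products of two arrows of the same type have no coordinate at all, and
  \<open>cS\<close> takes the same value on the two cycles at a vertex, hence vanishes on their
  difference.\<close>

lemma rel_gens_in_K:
  "(\<Union>i\<in>{0..<int m}. {q_a m i \<otimes> q_a m (i + 1), q_b m (i - 1) \<otimes> q_b m (i - 2),
        ((q_a m i \<otimes> q_b m i) [^] (1::nat)) \<ominus> ((q_b m (i - 1) \<otimes> q_a m (i - 1)) [^] (1::nat))}) \<subseteq> K"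
proof -
  have qa: "q_a m i = pe i \<otimes> pa" and qb: "q_b m i = pe (i + 1) \<otimes> pb" for i
    using p_rel(1)[of i] p_rel(3)[of "i + 1"] by simp_all
  note cl = q_closed p_closed m_closed
  have 1: "q_a m i \<otimes> q_a m (i + 1) \<in> K" for i
    by (rule K_I) (simp_all only: cl, simp_all add: qa c_mult' c_values)
  have 2: "q_b m (i - 1) \<otimes> q_b m (i - 2) \<in> K" for i
    by (rule K_I) (simp_all only: cl, simp_all add: qb c_mult' c_values)
  have min: "\<ominus> f = (- 1) \<odot> f" if "f \<in> carrier Q" for f
    using minus_equality[of "(- 1) \<odot> f" f] smult_l_distr[of f "- 1" 1] that by simp
  have 3: "(q_a m i \<otimes> q_b m i) \<ominus> (q_b m (i - 1) \<otimes> q_a m (i - 1)) \<in> K" for i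
    unfolding a_minus_def min[OF m_closed[OF q_closed(3,2)]]
    by (rule K_I) (simp_all only: cl a_closed smult_closed, simp_all add: c_linear' qa qb c_mult' c_values mod_succ_eq_iff)
  have pow: "x [^] (1::nat) = x" if "x \<in> carrier Q" for x
    using that by simp
  show ?thesis
    using 1 2 3 unfolding pow[OF m_closed[OF q_closed(2,3)]] pow[OF m_closed[OF q_closed(3,2)]] by blast
qed

lemma rel_ideal: "ideal (rel_ideal m 1) Q" "rel_ideal m 1 \<subseteq> K"
proof -
  interpret K: ideal K Q by (rule ideal_K)
  show "ideal (rel_ideal m 1) Q"
    unfolding rel_ideal_def Let_def Q[symmetric]
    using rel_gens_in_K K.a_subset by (intro genideal_ideal) blast
  show "rel_ideal m 1 \<subseteq> K"
    unfolding rel_ideal_def Let_def Q[symmetric]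
    by (intro genideal_minimal ideal_K rel_gens_in_K)
qed

text \<open>The generating set is indexed by 0 \<le> i < m only; all its elements depend on i modulo
  m, so the relations hold for every integer i and indices can be shifted freely afterwards.\<close>

lemma rel_in_ideal:
  "q_a m i \<otimes> q_a m (i + 1) \<in> rel_ideal m 1" "q_b m (i - 1) \<otimes> q_b m (i - 2) \<in> rel_ideal m 1"
  "(q_a m i \<otimes> q_b m i) \<ominus> (q_b m (i - 1) \<otimes> q_a m (i - 1)) \<in> rel_ideal m 1"
proof -
  interpret K: ideal K Q by (rule ideal_K)
  note sub = subset_trans[OF rel_gens_in_K K.a_subset]
  define j where "j = i mod int m"
  have j: "j \<in> {0..<int m}" using m_pos by (simp add: j_def)
  have q: "q_a m i = q_a m j" "q_a m (i + 1) = q_a m (j + 1)" "q_a m (i - 1) = q_a m (j - 1)"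
     "q_b m i = q_b m j" "q_b m (i - 1) = q_b m (j - 1)" "q_b m (i - 2) = q_b m (j - 2)"
    by (simp_all add: q_a_def q_b_def j_def mod_simps)
  have "{q_a m j \<otimes> q_a m (j + 1), q_b m (j - 1) \<otimes> q_b m (j - 2),
        ((q_a m j \<otimes> q_b m j) [^] (1::nat)) \<ominus> ((q_b m (j - 1) \<otimes> q_a m (j - 1)) [^] (1::nat))} \<subseteq> rel_ideal m 1"
    unfolding rel_ideal_def Let_def Q[symmetric]
    using genideal_self[OF sub] j by blast
  then show "q_a m i \<otimes> q_a m (i + 1) \<in> rel_ideal m 1" "q_b m (i - 1) \<otimes> q_b m (i - 2) \<in> rel_ideal m 1"
     "(q_a m i \<otimes> q_b m i) \<ominus> (q_b m (i - 1) \<otimes> q_a m (i - 1)) \<in> rel_ideal m 1"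
    unfolding q using q_closed by auto
qed

end

section \<open>Relations, a basis and coordinates of the algebra \<Lambda> at N = 1\<close>

section \<open>The algebra for N = 1\<close>

text \<open>The coordinates of a coset are read off an arbitrary representative. By
  \<open>k_cls\<close> the choice does not matter, because the ideal lies in the common kernel of
  the coordinates.\<close>

definition kE :: "nat \<Rightarrow> int \<Rightarrow> 'k lam \<Rightarrow> 'k::field" where "kE m i x = cE m i (SOME f. f \<in> x)"
definition kA :: "nat \<Rightarrow> int \<Rightarrow> 'k lam \<Rightarrow> 'k::field" where "kA m i x = cA m i (SOME f. f \<in> x)"
definition kB :: "nat \<Rightarrow> int \<Rightarrow> 'k lam \<Rightarrow> 'k::field" where "kB m i x = cB m i (SOME f. f \<in> x)"
definition kS :: "nat \<Rightarrow> int \<Rightarrow> 'k lam \<Rightarrow> 'k::field" where "kS m i x = cS m i (SOME f. f \<in> x)"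

locale lam1 =
  fixes m :: nat and L :: "('k::field, 'k lam) module" (structure)
  assumes m: "m \<ge> 3" and L: "L = Lam m 1"
begin

abbreviation Q :: "('k, path \<Rightarrow> 'k) module" where "Q \<equiv> path_alg m"
definition e :: "int \<Rightarrow> 'k lam" where "e = l_e m 1"
definition a :: "'k lam" where "a = l_a m 1"
definition b :: "'k lam" where "b = l_b m 1"
definition I :: "(path \<Rightarrow> 'k) set" where "I = rel_ideal m 1"
abbreviation cls :: "(path \<Rightarrow> 'k) \<Rightarrow> 'k lam" where "cls f \<equiv> I +>\<^bsub>Q\<^esub> f"

sublocale P: path_setup m Q
  by unfold_locales (simp_all add: m)

lemma I_props: "ideal I Q" "I \<subseteq> P.K"
  unfolding I_def by (rule P.rel_ideal)+

lemmas rel_in_I = P.rel_in_ideal[folded I_def]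

sublocale R: alg_ideal I Q
  by (simp add: alg_ideal_def I_props)

lemma L_quot: "L = alg_quot Q I"
  unfolding L Lam_def I_def ..

sublocale k_algebra L
  unfolding L_quot by (rule P.k_algebra_alg_quot(1)[OF I_props(1)])

lemma e_def': "e i = cls (P.pe i)" unfolding e_def I_def l_e_def ..
lemma a_def': "a = cls P.pa" unfolding a_def I_def l_a_def p_a_def ..
lemma b_def': "b = cls P.pb" unfolding b_def I_def l_b_def p_b_def ..

lemma carrier_L: "carrier L = cls ` carrier Q"
  unfolding L_quot by (rule R.alg_quot_carrier)

lemma cls_closed: "f \<in> carrier Q \<Longrightarrow> cls f \<in> carrier L"
  by (simp add: carrier_L)

lemma cls_add: "f \<in> carrier Q \<Longrightarrow> g \<in> carrier Q \<Longrightarrow> cls f \<oplus> cls g = cls (f \<oplus>\<^bsub>Q\<^esub> g)"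
  unfolding L_quot by (rule R.alg_quot_add)

lemma cls_mult: "f \<in> carrier Q \<Longrightarrow> g \<in> carrier Q \<Longrightarrow> cls f \<otimes> cls g = cls (f \<otimes>\<^bsub>Q\<^esub> g)"
  unfolding L_quot by (rule R.alg_quot_mult)

lemma cls_smult: "f \<in> carrier Q \<Longrightarrow> c \<odot> cls f = cls (c \<odot>\<^bsub>Q\<^esub> f)"
  unfolding L_quot by (rule P.k_algebra_alg_quot(2)[OF I_props(1)])

lemma zero_L: "\<zero> = cls \<zero>\<^bsub>Q\<^esub>" unfolding L_quot by (rule R.alg_quot_zero)
lemma one_L: "\<one> = cls \<one>\<^bsub>Q\<^esub>" unfolding L_quot by (rule R.alg_quot_one)

lemma cls_eq: "f \<in> carrier Q \<Longrightarrow> g \<in> carrier Q \<Longrightarrow> f \<ominus>\<^bsub>Q\<^esub> g \<in> I \<Longrightarrow> cls f = cls g"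
  using R.coset_eq_iff by blast

lemma cls_eq_zero: "f \<in> carrier Q \<Longrightarrow> f \<in> I \<Longrightarrow> cls f = \<zero>"
  using cls_eq[of f "\<zero>\<^bsub>Q\<^esub>"] by (simp add: zero_L a_minus_def P.zero_closed P.r_zero)

lemma gens_closed [simp]: "e i \<in> carrier L" "a \<in> carrier L" "b \<in> carrier L"
  unfolding e_def' a_def' b_def' by (auto intro!: cls_closed P.q_closed P.p_closed)

lemma e_mod [simp]: "e (i mod int m) = e i" by (simp add: e_def l_e_def q_e_def)

lemma e_cong: "i mod int m = j mod int m \<Longrightarrow> e i = e j" by (metis e_mod)

lemma e_e: "e i \<otimes> e j = (if i mod int m = j mod int m then e i else \<zero>)"
  unfolding e_def' by (simp add: cls_mult P.q_closed P.p_rel zero_L)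

lemma e_idem [simp]: "e i \<otimes> e i = e i" by (simp add: e_e)

lemma e_a: "e i \<otimes> a = cls (q_a m i)" "a \<otimes> e (i + 1) = cls (q_a m i)"
  unfolding e_def' a_def' by (simp_all add: cls_mult P.q_closed P.p_closed P.p_rel)

lemma e_b: "e i \<otimes> b = cls (q_b m (i - 1))" "b \<otimes> e (i - 1) = cls (q_b m (i - 1))"
  unfolding e_def' b_def' by (simp_all add: cls_mult P.q_closed P.p_closed P.p_rel)

lemma a_e: "a \<otimes> e i = e (i - 1) \<otimes> a"
  using e_a(2)[of "i - 1"] e_a(1)[of "i - 1"] by simp

lemma b_e: "b \<otimes> e i = e (i + 1) \<otimes> b"
  using e_b(2)[of "i + 1"] e_b(1)[of "i + 1"] by simp

lemma sum_e: "finsum L e {0..<int m} = \<one>"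
proof -
  have "finsum L e S = cls (finsum Q P.pe S)" if "finite S" for S
    using that
  proof (induction S rule: finite_induct)
    case empty then show ?case by (simp add: zero_L)
  next
    case (insert x S)
    have "finsum L e (insert x S) = e x \<oplus> finsum L e S"
      using insert by (intro finsum_insert) auto
    also have "\<dots> = cls (P.pe x \<oplus>\<^bsub>Q\<^esub> finsum Q P.pe S)"
      unfolding insert.IH unfolding e_def' using P.q_closed by (intro cls_add) (auto intro: P.finsum_closed)
    also have "P.pe x \<oplus>\<^bsub>Q\<^esub> finsum Q P.pe S = finsum Q P.pe (insert x S)"
      using insert P.q_closed by (intro P.finsum_insert[symmetric]) auto
    finally show ?case .
  qed
  from this[of "{0..<int m}"] show ?thesis by (simp add: P.sum_pe one_L)
qed

text \<open>Since 1 is the sum of the e i, identities between sums of arrows can be checked vertex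
  by vertex.\<close>

lemma eq_by_left_e:
  assumes "x \<in> carrier L" "y \<in> carrier L" "\<And>i. e i \<otimes> x = e i \<otimes> y"
  shows "x = y"
proof -
  have "z = finsum L (\<lambda>i. e i \<otimes> z) {0..<int m}" if "z \<in> carrier L" for z
    using that finsum_ldistr[of "{0..<int m}" z e] by (simp add: sum_e)
  from this[OF assms(1)] this[OF assms(2)] show ?thesis unfolding assms(3) by (rule trans[OF _ sym])
qed

text \<open>Inserting the idempotent e (i + 1) between the factors turns the relation at the vertex
  i into one for the sum of all arrows; the same device proves the next two relations.\<close>

lemma rel_aa: "a \<otimes> a = \<zero>"
proof (rule eq_by_left_e)
  fix i
  have "e i \<otimes> a \<otimes> (e (i + 1) \<otimes> a) = \<zero>"
    unfolding e_a(1) by (simp add: cls_mult P.q_closed cls_eq_zero rel_in_I)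
  moreover have "e i \<otimes> a \<otimes> (e (i + 1) \<otimes> a) = e i \<otimes> (a \<otimes> e (i + 1)) \<otimes> a" by (simp add: m_assoc)
  ultimately show "e i \<otimes> (a \<otimes> a) = e i \<otimes> \<zero>" unfolding a_e by (simp add: m_assoc[symmetric])
qed auto

lemma rel_bb: "b \<otimes> b = \<zero>"
proof (rule eq_by_left_e)
  fix i
  have "e i \<otimes> b \<otimes> (e (i - 1) \<otimes> b) = \<zero>"
    unfolding e_b(1) using rel_in_I(2)[of i] by (simp add: cls_mult P.q_closed cls_eq_zero)
  moreover have "e i \<otimes> b \<otimes> (e (i - 1) \<otimes> b) = e i \<otimes> (b \<otimes> e (i - 1)) \<otimes> b" by (simp add: m_assoc)
  ultimately show "e i \<otimes> (b \<otimes> b) = e i \<otimes> \<zero>" unfolding b_e by (simp add: m_assoc[symmetric])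
qed auto

lemma rel_ab: "b \<otimes> a = a \<otimes> b"
proof (rule eq_by_left_e)
  fix i
  have "e i \<otimes> a \<otimes> (e (i + 1) \<otimes> b) = e i \<otimes> b \<otimes> (e (i - 1) \<otimes> a)"
    unfolding e_a(1) e_b(1) using rel_in_I(3)[of i] by (simp add: cls_mult P.q_closed cls_eq)
  moreover have "e i \<otimes> a \<otimes> (e (i + 1) \<otimes> b) = e i \<otimes> (a \<otimes> e (i + 1)) \<otimes> b" by (simp add: m_assoc)
  moreover have "e i \<otimes> b \<otimes> (e (i - 1) \<otimes> a) = e i \<otimes> (b \<otimes> e (i - 1)) \<otimes> a" by (simp add: m_assoc)
  ultimately show "e i \<otimes> (b \<otimes> a) = e i \<otimes> (a \<otimes> b)"
    unfolding b_e a_e by (simp add: m_assoc[symmetric])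
qed auto

lemma some_cls: assumes f: "f \<in> carrier Q"
  shows "\<exists>k\<in>P.K. (SOME g. g \<in> cls f) = k \<oplus>\<^bsub>Q\<^esub> f"
proof -
  have "(SOME g. g \<in> cls f) \<in> cls f"
    by (rule someI[of "\<lambda>g. g \<in> cls f"], rule R.a_rcos_self[OF f])
  then show ?thesis using I_props(2) by (auto simp: a_r_coset_def')
qed

lemma k_cls: assumes f: "f \<in> carrier Q"
  shows "kE m i (cls f) = cE m i f" "kA m i (cls f) = cA m i f" "kB m i (cls f) = cB m i f" "kS m i (cls f) = cS m i f"
proof -
  obtain k where "k \<in> P.K" "(SOME g. g \<in> cls f) = k \<oplus>\<^bsub>Q\<^esub> f" using some_cls[OF f] by blast
  then show "kE m i (cls f) = cE m i f" "kA m i (cls f) = cA m i f" "kB m i (cls f) = cB m i f" "kS m i (cls f) = cS m i f"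
    by (simp_all add: kE_def kA_def kB_def kS_def c_linear P.K_def)
qed

lemma k_mult:
  assumes "x \<in> carrier L" "y \<in> carrier L"
  shows "kE m i (x \<otimes> y) = kE m i x * kE m i y"
    "kA m i (x \<otimes> y) = kE m (i - 1) x * kA m i y + kA m i x * kE m i y"
    "kB m i (x \<otimes> y) = kE m (i + 1) x * kB m i y + kB m i x * kE m i y"
    "kS m i (x \<otimes> y) = kE m i x * kS m i y + kS m i x * kE m i y + kA m (i + 1) x * kB m i y + kB m (i - 1) x * kA m i y"
  using assms by (auto simp: carrier_L cls_mult k_cls c_mult)

lemma k_linear:
  assumes "x \<in> carrier L" "y \<in> carrier L"
  shows "kE m i (x \<oplus> y) = kE m i x + kE m i y" "kA m i (x \<oplus> y) = kA m i x + kA m i y"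
    "kB m i (x \<oplus> y) = kB m i x + kB m i y" "kS m i (x \<oplus> y) = kS m i x + kS m i y"
    "kE m i (c \<odot> x) = c * kE m i x" "kA m i (c \<odot> x) = c * kA m i x"
    "kB m i (c \<odot> x) = c * kB m i x" "kS m i (c \<odot> x) = c * kS m i x"
    "kE m i \<zero> = 0" "kA m i \<zero> = 0" "kB m i \<zero> = 0" "kS m i \<zero> = 0"
  using assms by (auto simp: carrier_L cls_add cls_smult zero_L k_cls c_linear)

lemma k_values:
  "kE m i (e j) = (if i mod int m = j mod int m then 1 else 0)" "kA m i (e j) = 0" "kB m i (e j) = 0" "kS m i (e j) = 0"
  "kE m i a = 0" "kA m i a = 1" "kB m i a = 0" "kS m i a = 0"
  "kE m i b = 0" "kA m i b = 0" "kB m i b = 1" "kS m i b = 0"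
  unfolding e_def' a_def' b_def' by (simp_all add: k_cls P.q_closed P.p_closed P.c_values)

text \<open>By aa = bb = 0 and ba = ab, the set of words 1, a, b, ab, 0 is closed under left
  multiplication by a and by b, so an induction along the path reduces it to one of these words
  behind its start vertex.\<close>

lemma path_class:
  assumes "is_path_from m v w"
  shows "\<exists>x\<in>{\<one>, a, b, a \<otimes> b, \<zero>}. cls (path_elem (v, w)) = e v \<otimes> x"
  using assms
proof (induction w arbitrary: v)
  case Nil
  then have "path_elem (v, []) = P.pe v" by (simp add: q_e_def)
  then have "cls (path_elem (v, [])) = e v \<otimes> \<one>" by (simp add: e_def'[symmetric])
  then show ?case by blast
next
  case (Cons c w)
  have pt: "is_path_from m (arrow_tgt m c) w" using Cons.prems by simp
  then have pw: "path_elem (arrow_tgt m c, w) \<in> carrier Q" by (rule path_elem_closed)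
  obtain x where x: "x \<in> {\<one>, a, b, a \<otimes> b, \<zero>}" "cls (path_elem (arrow_tgt m c, w)) = e (arrow_tgt m c) \<otimes> x"
    using Cons.IH[OF pt] by blast
  have xc: "x \<in> carrier L" using x(1) by (elim insertE emptyE) simp_all
  have cc: "path_elem (v, c # w) = path_elem (v, [c]) \<otimes>\<^bsub>Q\<^esub> path_elem (arrow_tgt m c, w)"
    by (simp add: path_elem_mult)
  show ?case
  proof (cases c)
    case (Arr i)
    then have v: "v = i" "i mod int m = i" using Cons.prems by auto
    have q: "path_elem (v, [c]) = q_a m v" using Arr v by (simp add: q_a_def)
    have t: "e (arrow_tgt m c) = e (v + 1)" using Arr v by simp
    have "cls (path_elem (v, c # w)) = e v \<otimes> a \<otimes> (e (v + 1) \<otimes> x)"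
      unfolding cc q e_a(1) t[symmetric] x(2)[symmetric] by (simp add: cls_mult P.q_closed pw)
    also have "\<dots> = e v \<otimes> (a \<otimes> e (v + 1)) \<otimes> x" using xc by (simp add: m_assoc)
    also have "\<dots> = e v \<otimes> (a \<otimes> x)" using xc by (simp add: a_e m_assoc[symmetric])
    finally have "cls (path_elem (v, c # w)) = e v \<otimes> (a \<otimes> x)" .
    moreover have "a \<otimes> x \<in> {\<one>, a, b, a \<otimes> b, \<zero>}"
      using x(1) by (elim insertE emptyE) (simp_all add: rel_aa m_assoc[symmetric])
    ultimately show ?thesis by blast
  next
    case (Bar i)
    then have v: "v = (i + 1) mod int m" "i mod int m = i" using Cons.prems by auto
    have q: "path_elem (v, [c]) = q_b m (v - 1)" using Bar v by (simp add: q_b_def mod_simps)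
    have t: "e (arrow_tgt m c) = e (v - 1)" using Bar v by (intro e_cong) (simp add: mod_simps)
    have "cls (path_elem (v, c # w)) = e v \<otimes> b \<otimes> (e (v - 1) \<otimes> x)"
      unfolding cc q e_b(1) t[symmetric] x(2)[symmetric] by (simp add: cls_mult P.q_closed pw)
    also have "\<dots> = e v \<otimes> (b \<otimes> e (v - 1)) \<otimes> x" using xc by (simp add: m_assoc)
    also have "\<dots> = e v \<otimes> (b \<otimes> x)" using xc by (simp add: b_e m_assoc[symmetric])
    finally have "cls (path_elem (v, c # w)) = e v \<otimes> (b \<otimes> x)" .
    moreover have "b \<otimes> (a \<otimes> b) = \<zero>" by (simp add: rel_ab[symmetric] m_assoc[symmetric] rel_bb)
    then have "b \<otimes> x \<in> {\<one>, a, b, a \<otimes> b, \<zero>}"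
      using x(1) by (elim insertE emptyE) (simp_all add: rel_bb rel_ab)
    ultimately show ?thesis by blast
  qed
qed

abbreviation comb :: "int \<Rightarrow> 'k \<Rightarrow> 'k \<Rightarrow> 'k \<Rightarrow> 'k \<Rightarrow> 'k lam" where
  "comb i c1 c2 c3 c4 \<equiv> c1 \<odot> e i \<oplus> c2 \<odot> (a \<otimes> e i) \<oplus> c3 \<odot> (b \<otimes> e i) \<oplus> c4 \<odot> (a \<otimes> b \<otimes> e i)"

lemma comb_add: "comb i c1 c2 c3 c4 \<oplus> comb i d1 d2 d3 d4 = comb i (c1 + d1) (c2 + d2) (c3 + d3) (c4 + d4)"
  by (simp add: smult_l_distr a_ac)

lemma comb_smult: "c \<odot> comb i c1 c2 c3 c4 = comb i (c * c1) (c * c2) (c * c3) (c * c4)"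
  by (simp add: smult_r_distr smult_assoc1)

lemma L_induct [consumes 1, case_names zero single add]:
  assumes "x \<in> carrier L"
    and "P \<zero>"
    and single: "\<And>c v y. y \<in> {\<one>, a, b, a \<otimes> b, \<zero>} \<Longrightarrow> P (c \<odot> (e v \<otimes> y))"
    and add: "\<And>x y. \<lbrakk>x \<in> carrier L; y \<in> carrier L; P x; P y\<rbrakk> \<Longrightarrow> P (x \<oplus> y)"
  shows "P x"
proof -
  have "P (cls f)" if "f \<in> carrier Q" for f
    using that
  proof (induction rule: path_alg_induct)
    case zero
    then show ?case using assms(2) by (simp add: zero_L)
  next
    case (single c v w)
    from path_class[OF single]
    obtain y where y: "y \<in> {\<one>, a, b, a \<otimes> b, \<zero>}" "cls (path_elem (v, w)) = e v \<otimes> y"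
      by (rule bexE)
    have "cls (c \<odot>\<^bsub>Q\<^esub> path_elem (v, w)) = c \<odot> (e v \<otimes> y)"
      unfolding y(2)[symmetric] by (rule cls_smult[symmetric], rule path_elem_closed, rule single)
    then show ?case using assms(3)[OF y(1), of c v] by simp
  next
    case (add f g)
    then show ?case using assms(4)[OF cls_closed cls_closed, of f g] by (simp add: cls_add)
  qed
  then show ?thesis using assms(1) unfolding carrier_L by (elim imageE) simp
qed

lemma right_e_span: "x \<in> carrier L \<Longrightarrow> \<exists>c1 c2 c3 c4. x \<otimes> e i = comb i c1 c2 c3 c4"
proof (induction rule: L_induct)
  case zero
  show ?case by (intro exI[of _ 0]) simp
next
  case (single c v y)
  have y: "y \<in> carrier L" using single by (elim insertE emptyE) simp_all
  \<comment> \<open>Each basis word shifts vertices by a fixed amount, so the idempotent on its left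
    may be moved to its right.\<close>
  have "\<exists>j. e v \<otimes> y = y \<otimes> e j"
    using single
  proof (elim insertE emptyE)
    show "y = \<one> \<Longrightarrow> ?thesis" by (intro exI[of _ v]) simp
    show "y = a \<Longrightarrow> ?thesis" by (intro exI[of _ "v + 1"]) (simp add: a_e)
    show "y = b \<Longrightarrow> ?thesis" by (intro exI[of _ "v - 1"]) (simp add: b_e)
    show "y = a \<otimes> b \<Longrightarrow> ?thesis"
      using b_e[of v] a_e[of "v + 1"] by (intro exI[of _ v]) (simp add: m_assoc, simp add: m_assoc[symmetric])
    show "y = \<zero> \<Longrightarrow> ?thesis" by simp
  qed
  then obtain j where "e v \<otimes> y \<otimes> e i = y \<otimes> (e j \<otimes> e i)" using y by (metis gens_closed(1) m_assoc)
  then consider "e v \<otimes> y \<otimes> e i = y \<otimes> e i" | "e v \<otimes> y \<otimes> e i = \<zero>"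
    using y e_cong[of j i] by (cases "j mod int m = i mod int m") (simp_all add: e_e)
  then show ?case
  proof cases
    case 1
    have "\<exists>c1 c2 c3 c4. c \<odot> (y \<otimes> e i) = comb i c1 c2 c3 c4"
      using single
    proof (elim insertE emptyE)
      show "y = \<one> \<Longrightarrow> ?thesis" by (rule exI[of _ c], (rule exI[of _ 0])+) simp
      show "y = a \<Longrightarrow> ?thesis" by (rule exI[of _ 0], rule exI[of _ c], (rule exI[of _ 0])+) simp
      show "y = b \<Longrightarrow> ?thesis" by (rule exI[of _ 0], rule exI[of _ 0], rule exI[of _ c], (rule exI[of _ 0])+) simp
      show "y = a \<otimes> b \<Longrightarrow> ?thesis" by (rule exI[of _ 0], rule exI[of _ 0], rule exI[of _ 0], rule exI[of _ c]) simp
      show "y = \<zero> \<Longrightarrow> ?thesis" by ((rule exI[of _ 0])+) simp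
    qed
    then show ?thesis using 1 y by (simp add: smult_mult_l)
  next
    case 2
    have "c \<odot> (e v \<otimes> y) \<otimes> e i = comb i 0 0 0 0" using 2 y by (simp add: smult_mult_l)
    then show ?thesis by blast
  qed
next
  case (add x y)
  then obtain c1 c2 c3 c4 d1 d2 d3 d4 where "x \<otimes> e i = comb i c1 c2 c3 c4" "y \<otimes> e i = comb i d1 d2 d3 d4" by blast
  then have "(x \<oplus> y) \<otimes> e i = comb i (c1 + d1) (c2 + d2) (c3 + d3) (c4 + d4)"
    using add comb_add by (simp add: l_distr)
  then show ?case by blast
qed

text \<open>Applying the four coordinates to any expansion provided by \<open>right_e_span\<close>
  forces its coefficients. Thus the four elements e i, a e i, b e i, ab e i form a basis of
  \<Lambda> e i with these coordinates.\<close>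

lemma decomp:
  assumes x: "x \<in> carrier L"
  shows "x \<otimes> e i = comb i (kE m i x) (kA m i x) (kB m i x) (kS m i x)"
proof -
  obtain c1 c2 c3 c4 where *: "x \<otimes> e i = comb i c1 c2 c3 c4" using right_e_span[OF x] by blast
  have "kE m i x = c1"
    using arg_cong[OF *, of "kE m i"] x by (simp add: k_mult k_linear k_values)
  moreover have "kA m i x = c2"
    using arg_cong[OF *, of "kA m i"] x by (simp add: k_mult k_linear k_values)
  moreover have "kB m i x = c3"
    using arg_cong[OF *, of "kB m i"] x by (simp add: k_mult k_linear k_values)
  moreover have "kS m i x = c4"
    using arg_cong[OF *, of "kS m i"] x by (simp add: k_mult k_linear k_values)
  ultimately show ?thesis using * by simp
qed

end

section \<open>Bimodules, their direct sums and the regular bimodule\<close>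

section \<open>Bimodules\<close>

locale bimod =
  fixes A :: "('k::field, 'l) module" and M :: "('l, 'x) bimodule"
  assumes bim: "is_bimodule A M"
begin

sublocale abelian_group M using bim by (simp add: is_bimodule_def)

lemma act_closed [simp]:
  "a \<in> carrier A \<Longrightarrow> x \<in> carrier M \<Longrightarrow> lact M a x \<in> carrier M"
  "a \<in> carrier A \<Longrightarrow> x \<in> carrier M \<Longrightarrow> ract M x a \<in> carrier M"
  using bim by (simp_all add: is_bimodule_def)

lemma act_one [simp]:
  "x \<in> carrier M \<Longrightarrow> lact M \<one>\<^bsub>A\<^esub> x = x" "x \<in> carrier M \<Longrightarrow> ract M x \<one>\<^bsub>A\<^esub> = x"
  using bim by (simp_all add: is_bimodule_def)

lemma act_mult:
  assumes "a \<in> carrier A" "b \<in> carrier A" "x \<in> carrier M"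
  shows "lact M (a \<otimes>\<^bsub>A\<^esub> b) x = lact M a (lact M b x)"
    "ract M x (a \<otimes>\<^bsub>A\<^esub> b) = ract M (ract M x a) b"
    "ract M (lact M a x) b = lact M a (ract M x b)"
    "lact M (a \<oplus>\<^bsub>A\<^esub> b) x = lact M a x \<oplus>\<^bsub>M\<^esub> lact M b x"
    "ract M x (a \<oplus>\<^bsub>A\<^esub> b) = ract M x a \<oplus>\<^bsub>M\<^esub> ract M x b"
  using bim assms unfolding is_bimodule_def by blast+

lemma act_add:
  assumes "a \<in> carrier A" "x \<in> carrier M" "y \<in> carrier M"
  shows "lact M a (x \<oplus>\<^bsub>M\<^esub> y) = lact M a x \<oplus>\<^bsub>M\<^esub> lact M a y"
    "ract M (x \<oplus>\<^bsub>M\<^esub> y) a = ract M x a \<oplus>\<^bsub>M\<^esub> ract M y a"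
  using bim assms unfolding is_bimodule_def by blast+

lemma act_scalar: "x \<in> carrier M \<Longrightarrow> lact M (c \<odot>\<^bsub>A\<^esub> \<one>\<^bsub>A\<^esub>) x = ract M x (c \<odot>\<^bsub>A\<^esub> \<one>\<^bsub>A\<^esub>)"
  using bim unfolding is_bimodule_def by blast

lemma act_zero [simp]:
  assumes "a \<in> carrier A"
  shows "lact M a \<zero>\<^bsub>M\<^esub> = \<zero>\<^bsub>M\<^esub>" "ract M \<zero>\<^bsub>M\<^esub> a = \<zero>\<^bsub>M\<^esub>"
  using act_add[OF assms, of "\<zero>\<^bsub>M\<^esub>" "\<zero>\<^bsub>M\<^esub>"] act_closed[OF assms zero_closed]
  by (simp_all add: add.l_cancel_one')

end

lemma is_bimoduleI:
  assumes "abelian_group M"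
    "\<And>a x. a \<in> carrier A \<Longrightarrow> x \<in> carrier M \<Longrightarrow> lact M a x \<in> carrier M"
    "\<And>a x. a \<in> carrier A \<Longrightarrow> x \<in> carrier M \<Longrightarrow> ract M x a \<in> carrier M"
    "\<And>x. x \<in> carrier M \<Longrightarrow> lact M \<one>\<^bsub>A\<^esub> x = x"
    "\<And>x. x \<in> carrier M \<Longrightarrow> ract M x \<one>\<^bsub>A\<^esub> = x"
    "\<And>a b x. a \<in> carrier A \<Longrightarrow> b \<in> carrier A \<Longrightarrow> x \<in> carrier M \<Longrightarrow> lact M (a \<otimes>\<^bsub>A\<^esub> b) x = lact M a (lact M b x)"
    "\<And>a b x. a \<in> carrier A \<Longrightarrow> b \<in> carrier A \<Longrightarrow> x \<in> carrier M \<Longrightarrow> ract M x (a \<otimes>\<^bsub>A\<^esub> b) = ract M (ract M x a) b"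
    "\<And>a b x. a \<in> carrier A \<Longrightarrow> b \<in> carrier A \<Longrightarrow> x \<in> carrier M \<Longrightarrow> ract M (lact M a x) b = lact M a (ract M x b)"
    "\<And>a b x. a \<in> carrier A \<Longrightarrow> b \<in> carrier A \<Longrightarrow> x \<in> carrier M \<Longrightarrow> lact M (a \<oplus>\<^bsub>A\<^esub> b) x = lact M a x \<oplus>\<^bsub>M\<^esub> lact M b x"
    "\<And>a b x. a \<in> carrier A \<Longrightarrow> b \<in> carrier A \<Longrightarrow> x \<in> carrier M \<Longrightarrow> ract M x (a \<oplus>\<^bsub>A\<^esub> b) = ract M x a \<oplus>\<^bsub>M\<^esub> ract M x b"
    "\<And>a x y. a \<in> carrier A \<Longrightarrow> x \<in> carrier M \<Longrightarrow> y \<in> carrier M \<Longrightarrow> lact M a (x \<oplus>\<^bsub>M\<^esub> y) = lact M a x \<oplus>\<^bsub>M\<^esub> lact M a y"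
    "\<And>a x y. a \<in> carrier A \<Longrightarrow> x \<in> carrier M \<Longrightarrow> y \<in> carrier M \<Longrightarrow> ract M (x \<oplus>\<^bsub>M\<^esub> y) a = ract M x a \<oplus>\<^bsub>M\<^esub> ract M y a"
    "\<And>c x. x \<in> carrier M \<Longrightarrow> lact M (c \<odot>\<^bsub>A\<^esub> \<one>\<^bsub>A\<^esub>) x = ract M x (c \<odot>\<^bsub>A\<^esub> \<one>\<^bsub>A\<^esub>)"
  shows "is_bimodule A M"
  unfolding is_bimodule_def using assms by simp

lemma is_bimodule_sum:
  fixes A :: "('k::field, 'l) module"
  assumes "\<And>j. j \<in> J \<Longrightarrow> is_bimodule A (M j)"
  shows "is_bimodule A (bimod_sum J M)"
proof -
  have B: "bimod A (M j)" if "j \<in> J" for j using assms[OF that] by (simp add: bimod_def)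
  then have G: "abelian_group (M j)" if "j \<in> J" for j using that unfolding bimod_def is_bimodule_def by blast
  note E = bimod.act_closed[OF B] bimod.act_one[OF B] bimod.act_mult[OF B] bimod.act_add[OF B]
    abelian_groupE(1-5)[OF G] PiE_mem[of _ J "\<lambda>j. carrier (M j)"] restrict_PiE_iff
  have rest: "restrict f J = restrict g J" if "\<And>j. j \<in> J \<Longrightarrow> f j = g j" for f g :: "_ \<Rightarrow> 'c"
    using that by (simp add: restrict_def fun_eq_iff)
  have rest': "restrict f J = x" if "x \<in> (\<Pi>\<^sub>E j\<in>J. carrier (M j))" "\<And>j. j \<in> J \<Longrightarrow> f j = x j" for f x
    using that by (intro extensionalityI[of _ J]) (simp_all add: PiE_def)
  have grp: "abelian_group (bimod_sum J M)"
  proof (rule abelian_groupI)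
    fix x assume "x \<in> carrier (bimod_sum J M)"
    then have x: "x \<in> (\<Pi>\<^sub>E j\<in>J. carrier (M j))" by (simp add: bimod_sum_def)
    have "(\<lambda>j\<in>J. (\<lambda>j\<in>J. \<ominus>\<^bsub>M j\<^esub> x j) j \<oplus>\<^bsub>M j\<^esub> x j) = (\<lambda>j\<in>J. \<zero>\<^bsub>M j\<^esub>)"
      using x by (intro rest) (simp add: abelian_group.l_neg[OF G] E)
    then show "\<exists>y\<in>carrier (bimod_sum J M). y \<oplus>\<^bsub>bimod_sum J M\<^esub> x = \<zero>\<^bsub>bimod_sum J M\<^esub>"
      using x by (intro bexI[of _ "\<lambda>j\<in>J. \<ominus>\<^bsub>M j\<^esub> x j"]) (simp_all add: bimod_sum_def abelian_group.a_inv_closed[OF G] E)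
    show "\<zero>\<^bsub>bimod_sum J M\<^esub> \<oplus>\<^bsub>bimod_sum J M\<^esub> x = x"
      using x by (simp add: bimod_sum_def) (rule rest'; simp add: E abelian_monoid.r_zero[OF abelian_group.axioms(1)[OF G]])
  next
    fix x y assume xy: "x \<in> carrier (bimod_sum J M)" "y \<in> carrier (bimod_sum J M)"
    show "x \<oplus>\<^bsub>bimod_sum J M\<^esub> y \<in> carrier (bimod_sum J M)"
      using xy by (simp add: bimod_sum_def E)
    show "x \<oplus>\<^bsub>bimod_sum J M\<^esub> y = y \<oplus>\<^bsub>bimod_sum J M\<^esub> x"
      using xy by (simp add: bimod_sum_def) (rule rest; simp add: E)
    fix z assume z: "z \<in> carrier (bimod_sum J M)"
    show "x \<oplus>\<^bsub>bimod_sum J M\<^esub> y \<oplus>\<^bsub>bimod_sum J M\<^esub> z = x \<oplus>\<^bsub>bimod_sum J M\<^esub> (y \<oplus>\<^bsub>bimod_sum J M\<^esub> z)"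
      using xy z by (simp add: bimod_sum_def) (rule rest; simp add: E abelian_monoid.a_lcomm[OF abelian_group.axioms(1)[OF G]])
  qed (simp add: bimod_sum_def E)
  show ?thesis
  proof (rule is_bimoduleI[OF grp])
    fix x c assume "x \<in> carrier (bimod_sum J M)"
    then have x: "x \<in> (\<Pi>\<^sub>E j\<in>J. carrier (M j))" by (simp add: bimod_sum_def)
    show "lact (bimod_sum J M) \<one>\<^bsub>A\<^esub> x = x" "ract (bimod_sum J M) x \<one>\<^bsub>A\<^esub> = x"
      using x by (simp_all add: bimod_sum_def) (rule rest'; simp add: E)+
    show "lact (bimod_sum J M) (c \<odot>\<^bsub>A\<^esub> \<one>\<^bsub>A\<^esub>) x = ract (bimod_sum J M) x (c \<odot>\<^bsub>A\<^esub> \<one>\<^bsub>A\<^esub>)"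
      using x by (simp add: bimod_sum_def) (rule rest; simp add: E bimod.act_scalar[OF B])
  next
    fix a x assume a: "a \<in> carrier A" and x: "x \<in> carrier (bimod_sum J M)"
    show "lact (bimod_sum J M) a x \<in> carrier (bimod_sum J M)" "ract (bimod_sum J M) x a \<in> carrier (bimod_sum J M)"
      using a x by (simp_all add: bimod_sum_def E)
    fix y assume y: "y \<in> carrier (bimod_sum J M)"
    show "lact (bimod_sum J M) a (x \<oplus>\<^bsub>bimod_sum J M\<^esub> y) = lact (bimod_sum J M) a x \<oplus>\<^bsub>bimod_sum J M\<^esub> lact (bimod_sum J M) a y"
      "ract (bimod_sum J M) (x \<oplus>\<^bsub>bimod_sum J M\<^esub> y) a = ract (bimod_sum J M) x a \<oplus>\<^bsub>bimod_sum J M\<^esub> ract (bimod_sum J M) y a"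
      using a x y by (simp_all add: bimod_sum_def) (rule rest; simp add: E)+
  next
    fix a b x assume ab: "a \<in> carrier A" "b \<in> carrier A" and x: "x \<in> carrier (bimod_sum J M)"
    show "lact (bimod_sum J M) (a \<otimes>\<^bsub>A\<^esub> b) x = lact (bimod_sum J M) a (lact (bimod_sum J M) b x)"
      "ract (bimod_sum J M) x (a \<otimes>\<^bsub>A\<^esub> b) = ract (bimod_sum J M) (ract (bimod_sum J M) x a) b"
      "ract (bimod_sum J M) (lact (bimod_sum J M) a x) b = lact (bimod_sum J M) a (ract (bimod_sum J M) x b)"
      "lact (bimod_sum J M) (a \<oplus>\<^bsub>A\<^esub> b) x = lact (bimod_sum J M) a x \<oplus>\<^bsub>bimod_sum J M\<^esub> lact (bimod_sum J M) b x"
      "ract (bimod_sum J M) x (a \<oplus>\<^bsub>A\<^esub> b) = ract (bimod_sum J M) x a \<oplus>\<^bsub>bimod_sum J M\<^esub> ract (bimod_sum J M) x b"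
      using ab x by (simp_all add: bimod_sum_def) (rule rest; simp add: E)+
  qed
qed

lemma is_bimodule_regular:
  assumes "k_algebra B"
  shows "is_bimodule B (regular_bimod B)"
proof -
  interpret B: k_algebra B by fact
  have "\<exists>y\<in>carrier B. y \<oplus>\<^bsub>B\<^esub> x = \<zero>\<^bsub>B\<^esub>" if "x \<in> carrier B" for x
    using that B.l_neg B.a_inv_closed by blast
  then have "abelian_group (regular_bimod B)"
    by (intro abelian_groupI) (simp_all add: regular_bimod_def B.a_ac)
  then show ?thesis
    by (rule is_bimoduleI) (simp_all add: regular_bimod_def B.m_assoc B.l_distr B.r_distr B.smult_mult_l B.smult_mult_r)
qed

lemma comm_group_cong:
  assumes "comm_group G" "carrier H = carrier G" "monoid.mult H = monoid.mult G" "one H = one G"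
  shows "comm_group H"
proof -
  interpret comm_group G by fact
  have "\<exists>y\<in>carrier G. y \<otimes>\<^bsub>G\<^esub> x = \<one>\<^bsub>G\<^esub>" if "x \<in> carrier G" for x
    using that by (intro bexI[of _ "inv\<^bsub>G\<^esub> x"]) simp_all
  then show ?thesis
    by (intro comm_groupI) (simp_all add: assms(2-) m_ac)
qed

section \<open>The tensor product over the field by generators and relations\<close>

section \<open>Tensor products\<close>

locale tensor = k_algebra A for A :: "('k::field, 'l) module" (structure) +
  fixes U V :: "'l set"
  assumes U: "U \<subseteq> carrier A" "\<zero> \<in> U" "\<And>u u'. \<lbrakk>u \<in> U; u' \<in> U\<rbrakk> \<Longrightarrow> u \<oplus> u' \<in> U" "\<And>x u. \<lbrakk>x \<in> carrier A; u \<in> U\<rbrakk> \<Longrightarrow> x \<otimes> u \<in> U"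
    and V: "V \<subseteq> carrier A" "\<zero> \<in> V" "\<And>v v'. \<lbrakk>v \<in> V; v' \<in> V\<rbrakk> \<Longrightarrow> v \<oplus> v' \<in> V" "\<And>x v. \<lbrakk>x \<in> carrier A; v \<in> V\<rbrakk> \<Longrightarrow> v \<otimes> x \<in> V"
begin

declare carrier_free_Abelian_group_iff [simp del]

abbreviation F where "F \<equiv> free_Abelian_group (U \<times> V)"
abbreviation N where "N \<equiv> tensor_null A U V"
abbreviation T where "T \<equiv> tensor_bimod A U V"
abbreviation tc where "tc \<equiv> tensor_class A U V"
definition ten where "ten u v = tc (frag_of (u, v))"

definition rels where "rels = {frag_of (u \<oplus> u', v) - frag_of (u, v) - frag_of (u', v) | u u' v.
          u \<in> U \<and> u' \<in> U \<and> v \<in> V} \<union>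
      {frag_of (u, v \<oplus> v') - frag_of (u, v) - frag_of (u, v') | u v v'.
          u \<in> U \<and> v \<in> V \<and> v' \<in> V} \<union>
      {frag_of (c \<odot> u, v) - frag_of (u, c \<odot> v) | c u v. u \<in> U \<and> v \<in> V}"

lemma rels_cases [consumes 1, case_names left right scalar]:
  assumes "t \<in> rels"
    and "\<And>u u' v. \<lbrakk>u \<in> U; u' \<in> U; v \<in> V; t = frag_of (u \<oplus> u', v) - frag_of (u, v) - frag_of (u', v)\<rbrakk> \<Longrightarrow> P"
    and "\<And>u v v'. \<lbrakk>u \<in> U; v \<in> V; v' \<in> V; t = frag_of (u, v \<oplus> v') - frag_of (u, v) - frag_of (u, v')\<rbrakk> \<Longrightarrow> P"
    and "\<And>c u v. \<lbrakk>u \<in> U; v \<in> V; t = frag_of (c \<odot> u, v) - frag_of (u, c \<odot> v)\<rbrakk> \<Longrightarrow> P"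
  shows P
  using assms unfolding rels_def by blast

lemma relsI:
  "\<lbrakk>u \<in> U; u' \<in> U; v \<in> V\<rbrakk> \<Longrightarrow> frag_of (u \<oplus> u', v) - frag_of (u, v) - frag_of (u', v) \<in> rels"
  "\<lbrakk>u \<in> U; v \<in> V; v' \<in> V\<rbrakk> \<Longrightarrow> frag_of (u, v \<oplus> v') - frag_of (u, v) - frag_of (u, v') \<in> rels"
  "\<lbrakk>u \<in> U; v \<in> V\<rbrakk> \<Longrightarrow> frag_of (c \<odot> u, v) - frag_of (u, c \<odot> v) \<in> rels"
  unfolding rels_def by blast+

lemma N_def: "N = generate F rels"
  unfolding tensor_null_def rels_def ..

lemma smult_UV: "u \<in> U \<Longrightarrow> c \<odot> u \<in> U" "v \<in> V \<Longrightarrow> c \<odot> v \<in> V"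
  using U V by (metis one_closed smult_closed smult_eq_mult subsetD, metis one_closed smult_closed smult_eq_mult' subsetD)

sublocale F: comm_group F by (rule abelian_free_Abelian_group)

lemma carrier_F: "t \<in> carrier F \<longleftrightarrow> Poly_Mapping.keys t \<subseteq> U \<times> V"
  by (simp add: free_Abelian_group_def)

lemma frag_in_F: "u \<in> U \<Longrightarrow> v \<in> V \<Longrightarrow> frag_of (u, v) \<in> carrier F"
  by (simp add: carrier_F)

lemma F_closed: "s \<in> carrier F \<Longrightarrow> t \<in> carrier F \<Longrightarrow> s - t \<in> carrier F"
  "s \<in> carrier F \<Longrightarrow> t \<in> carrier F \<Longrightarrow> s + t \<in> carrier F" "0 \<in> carrier F"
  unfolding carrier_F by (meson Un_least keys_diff order_trans) (meson Un_least Poly_Mapping.keys_add order_trans, simp)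

lemma rels_in_F: "rels \<subseteq> carrier F"
proof
  fix t assume "t \<in> rels"
  then show "t \<in> carrier F"
    by (cases rule: rels_cases) (auto intro!: F_closed frag_in_F U V smult_UV)
qed

lemma N_subgroup: "subgroup N F"
  unfolding N_def by (rule F.generate_is_subgroup[OF rels_in_F])

lemma N_normal: "N \<lhd> F"
  using F.normal_iff_subgroup N_subgroup by blast

lemma N_sub: "N \<subseteq> carrier F" using N_subgroup subgroup.subset by blast

lemma carrier_T: "carrier T = tc ` carrier F"
  by (auto simp: tensor_bimod_def Let_def FactGroup_def RCOSETS_def tensor_class_def)

lemma tc_add: "s \<in> carrier F \<Longrightarrow> t \<in> carrier F \<Longrightarrow> tc s \<oplus>\<^bsub>T\<^esub> tc t = tc (s + t)"
  using normal.rcos_sum[OF N_normal, of s t] by (simp add: tensor_bimod_def Let_def tensor_class_def)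

lemma T_zero: "\<zero>\<^bsub>T\<^esub> = tc 0"
  using F.coset_mult_one[OF N_sub] by (simp add: tensor_bimod_def Let_def tensor_class_def)

lemma tc_eq: assumes "s \<in> carrier F" "t \<in> carrier F" "s - t \<in> N" shows "tc s = tc t"
proof -
  have "s = (s - t) \<otimes>\<^bsub>F\<^esub> t" by simp
  then have "s \<in> N #>\<^bsub>F\<^esub> t" using F.rcosI[OF assms(3) N_sub assms(2)] by simp
  then show ?thesis unfolding tensor_class_def by (rule F.repr_independence[OF _ assms(2) N_subgroup, symmetric])
qed

lemma tc_eq_zero: "t \<in> N \<Longrightarrow> tc t = \<zero>\<^bsub>T\<^esub>"
  unfolding T_zero using N_sub by (intro tc_eq F_closed) auto

lemma tc_mem: "s \<in> carrier F \<Longrightarrow> t \<in> tc s \<Longrightarrow> t \<in> carrier F \<and> t - s \<in> N"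
proof -
  assume s: "s \<in> carrier F" and "t \<in> tc s"
  then obtain n where "n \<in> N" "t = n + s" by (auto simp: tensor_class_def r_coset_def)
  then show ?thesis using s N_sub F_closed by auto
qed

lemma tc_self: "s \<in> carrier F \<Longrightarrow> s \<in> tc s"
  unfolding tensor_class_def using F.rcos_self N_subgroup by blast

lemma T_group: "abelian_group T"
proof -
  have "comm_group (F Mod N)" by (rule F.abelian_FactGroup[OF N_subgroup])
  then show ?thesis
    by (intro comm_group_abelian_groupI) (erule comm_group_cong; simp add: tensor_bimod_def Let_def)
qed

sublocale T: abelian_group T by (rule T_group)

lemma ten_closed [simp]: "u \<in> U \<Longrightarrow> v \<in> V \<Longrightarrow> ten u v \<in> carrier T"
  by (simp add: ten_def carrier_T frag_in_F)

lemma tc_diff: assumes "s \<in> carrier F" "t \<in> carrier F" shows "tc (s - t) \<oplus>\<^bsub>T\<^esub> tc t = tc s"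
  using assms tc_add[of "s - t" t] by (simp add: F_closed)

lemma tc_eqI3: assumes "r \<in> carrier F" "s \<in> carrier F" "t \<in> carrier F" "r - s - t \<in> rels"
  shows "tc r = tc s \<oplus>\<^bsub>T\<^esub> tc t"
proof -
  have "r - (s + t) \<in> N" using assms(4) unfolding N_def by (simp add: algebra_simps generate.incl)
  then show ?thesis using assms by (simp add: tc_add tc_eq F_closed)
qed

lemma ten_rels:
  "\<lbrakk>u \<in> U; u' \<in> U; v \<in> V\<rbrakk> \<Longrightarrow> ten (u \<oplus> u') v = ten u v \<oplus>\<^bsub>T\<^esub> ten u' v"
  "\<lbrakk>u \<in> U; v \<in> V; v' \<in> V\<rbrakk> \<Longrightarrow> ten u (v \<oplus> v') = ten u v \<oplus>\<^bsub>T\<^esub> ten u v'"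
  "\<lbrakk>u \<in> U; v \<in> V\<rbrakk> \<Longrightarrow> ten (c \<odot> u) v = ten u (c \<odot> v)"
proof -
  show "\<lbrakk>u \<in> U; u' \<in> U; v \<in> V\<rbrakk> \<Longrightarrow> ten (u \<oplus> u') v = ten u v \<oplus>\<^bsub>T\<^esub> ten u' v"
    unfolding ten_def by (rule tc_eqI3) (simp_all add: frag_in_F U relsI)
  show "\<lbrakk>u \<in> U; v \<in> V; v' \<in> V\<rbrakk> \<Longrightarrow> ten u (v \<oplus> v') = ten u v \<oplus>\<^bsub>T\<^esub> ten u v'"
    unfolding ten_def by (rule tc_eqI3) (simp_all add: frag_in_F V relsI)
  show "\<lbrakk>u \<in> U; v \<in> V\<rbrakk> \<Longrightarrow> ten (c \<odot> u) v = ten u (c \<odot> v)"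
    unfolding ten_def by (rule tc_eq) (simp_all add: frag_in_F smult_UV relsI generate.incl N_def)
qed

text \<open>The negative of a pure tensor is the pure tensor of (-u) and v. Hence every class is a
  sum of pure tensors, although the underlying free abelian group has arbitrary integer
  coefficients.\<close>

lemma T_induct [consumes 1, case_names zero ten add]:
  assumes x: "x \<in> carrier T" and zero: "P \<zero>\<^bsub>T\<^esub>" and ten: "\<And>u v. u \<in> U \<Longrightarrow> v \<in> V \<Longrightarrow> P (ten u v)"
    and add: "\<And>x y. \<lbrakk>x \<in> carrier T; y \<in> carrier T; P x; P y\<rbrakk> \<Longrightarrow> P (x \<oplus>\<^bsub>T\<^esub> y)"
  shows "P x"
proof -
  have neg: "tc (- frag_of (u, v)) = ten (\<ominus> u) v" if u: "u \<in> U" and v: "v \<in> V" for u v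
  proof -
    have uc: "u \<in> carrier A" using u U by auto
    then have mu: "\<ominus> u \<in> U" using U(4)[of "\<ominus> \<one>" u] u by (simp add: l_minus)
    have "ten \<zero> v \<oplus>\<^bsub>T\<^esub> ten \<zero> v = ten \<zero> v" using ten_rels(1)[of \<zero> \<zero> v] U(2) v by simp
    then have z: "ten \<zero> v = \<zero>\<^bsub>T\<^esub>" using ten_closed[OF U(2) v] by simp
    have "ten (\<ominus> u) v \<oplus>\<^bsub>T\<^esub> ten u v = \<zero>\<^bsub>T\<^esub>"
      using ten_rels(1)[OF mu u v] z uc by (simp add: l_neg)
    moreover have "tc (- frag_of (u, v)) \<oplus>\<^bsub>T\<^esub> ten u v = \<zero>\<^bsub>T\<^esub>"
      unfolding ten_def T_zero using tc_diff[of 0 "frag_of (u, v)"] frag_in_F[OF u v] F_closed(3) by simp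
    moreover have "tc (- frag_of (u, v)) \<in> carrier T"
      unfolding carrier_T using frag_in_F[OF u v] F_closed(1)[of 0 "frag_of (u, v)"] F_closed(3) by simp
    ultimately show ?thesis using T.minus_equality u v mu ten_closed by metis
  qed
  have *: "t \<in> carrier F \<and> P (tc t) \<and> P (tc (- t))" if "Poly_Mapping.keys t \<subseteq> U \<times> V" for t
    using that
  proof (induction t rule: frag_induction)
    case zero
    then show ?case using assms(2) F_closed(3) by (simp add: T_zero)
  next
    case (one p)
    then obtain u v where p: "p = (u, v)" "u \<in> U" "v \<in> V" by (cases p) auto
    have "\<ominus> u \<in> U" using U(4)[of "\<ominus> \<one>" u] p U(1) by (simp add: l_minus subset_eq)
    then show ?case using p ten[of u v] ten[of "\<ominus> u" v] neg[of u v] frag_in_F by (simp add: ten_def)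
  next
    case (diff s t)
    have mt: "- s \<in> carrier F" "- t \<in> carrier F"
      using F_closed(1)[OF F_closed(3), of t] F_closed(1)[OF F_closed(3), of s] diff by simp_all
    have "tc (s - t) = tc s \<oplus>\<^bsub>T\<^esub> tc (- t)" "tc (- (s - t)) = tc (- s) \<oplus>\<^bsub>T\<^esub> tc t"
      using diff mt by (simp_all add: tc_add)
    then show ?case using diff mt assms(4) F_closed(1) by (simp add: carrier_T)
  qed
  obtain t where "x = tc t" "t \<in> carrier F" using x unfolding carrier_T by (rule imageE)
  then show ?thesis using * carrier_F by simp
qed

text \<open>A balanced biadditive map extends to the free abelian group, kills the three kinds of
  relators and so factors through the quotient. The target is any abelian group, because maps that
  are linear on one side only will be needed as well.\<close>

lemma T_universal:
  assumes G: "abelian_group G"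
    and cl: "\<And>u v. \<lbrakk>u \<in> U; v \<in> V\<rbrakk> \<Longrightarrow> \<beta> u v \<in> carrier G"
    and l: "\<And>u u' v. \<lbrakk>u \<in> U; u' \<in> U; v \<in> V\<rbrakk> \<Longrightarrow> \<beta> (u \<oplus> u') v = \<beta> u v \<oplus>\<^bsub>G\<^esub> \<beta> u' v"
    and r: "\<And>u v v'. \<lbrakk>u \<in> U; v \<in> V; v' \<in> V\<rbrakk> \<Longrightarrow> \<beta> u (v \<oplus> v') = \<beta> u v \<oplus>\<^bsub>G\<^esub> \<beta> u v'"
    and c: "\<And>c u v. \<lbrakk>u \<in> U; v \<in> V\<rbrakk> \<Longrightarrow> \<beta> (c \<odot> u) v = \<beta> u (c \<odot> v)"
  shows "\<exists>\<phi>. \<phi> \<in> carrier T \<rightarrow> carrier G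
      \<and> (\<forall>x\<in>carrier T. \<forall>y\<in>carrier T. \<phi> (x \<oplus>\<^bsub>T\<^esub> y) = \<phi> x \<oplus>\<^bsub>G\<^esub> \<phi> y) \<and> (\<forall>u\<in>U. \<forall>v\<in>V. \<phi> (ten u v) = \<beta> u v)"
proof -
  interpret G: abelian_group G by fact
  have img: "case_prod \<beta> ` (U \<times> V) \<subseteq> carrier (add_monoid G)" using cl by auto
  obtain h where h: "h \<in> hom F (add_monoid G)" "\<And>x. x \<in> U \<times> V \<Longrightarrow> h (frag_of x) = case_prod \<beta> x"
    using comm_group.free_Abelian_group_universal[OF G.a_comm_group img] by blast
  interpret h: group_hom F "add_monoid G" h
    by (simp add: group_hom_def group_hom_axioms_def h F.is_group G.a_group)
  have hd: "h (s - t) \<oplus>\<^bsub>G\<^esub> h t = h s" if "s \<in> carrier F" "t \<in> carrier F" for s t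
    using h.hom_mult[of "s - t" t] that by (simp add: F_closed)
  have hfr: "h (frag_of (u, v)) = \<beta> u v" if "u \<in> U" "v \<in> V" for u v using h(2)[of "(u, v)"] that by simp
  have hcl: "h t \<in> carrier G" if "t \<in> carrier F" for t using h.hom_closed[OF that] by simp
  have hz: "h (s - t) = \<zero>\<^bsub>G\<^esub>" if "s \<in> carrier F" "t \<in> carrier F" "h s = h t" for s t
    using hd[OF that(1,2)] hcl[OF that(2)] hcl[OF F_closed(1)[OF that(1,2)]] that(3) by simp
  have "h t = \<zero>\<^bsub>G\<^esub>" if t: "t \<in> rels" for t
    using t
  proof (cases rule: rels_cases)
    case (left u u' v)
    have "h (frag_of (u \<oplus> u', v) - (frag_of (u, v) + frag_of (u', v))) = \<zero>\<^bsub>G\<^esub>"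
      using left h.hom_mult[of "frag_of (u, v)" "frag_of (u', v)"]
      by (intro hz) (simp_all add: F_closed frag_in_F U hfr l)
    then show ?thesis by (simp add: left(4) diff_diff_eq)
  next
    case (right u v v')
    have "h (frag_of (u, v \<oplus> v') - (frag_of (u, v) + frag_of (u, v'))) = \<zero>\<^bsub>G\<^esub>"
      using right h.hom_mult[of "frag_of (u, v)" "frag_of (u, v')"]
      by (intro hz) (simp_all add: F_closed frag_in_F V hfr r)
    then show ?thesis by (simp add: right(4) diff_diff_eq)
  next
    case (scalar c u v)
    have "h (frag_of (c \<odot> u, v) - frag_of (u, c \<odot> v)) = \<zero>\<^bsub>G\<^esub>"
      using scalar by (intro hz) (simp_all add: frag_in_F smult_UV hfr c)
    then show ?thesis by (simp add: scalar(3))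
  qed
  then have ker: "rels \<subseteq> kernel F (add_monoid G) h"
    using rels_in_F by (simp add: kernel_def subset_eq)
  have "N \<subseteq> kernel F (add_monoid G) h"
    unfolding N_def using ker by (intro F.generate_subgroup_incl h.subgroup_kernel)
  then obtain g where g: "g \<in> hom (F Mod N) (add_monoid G)" "\<And>x. x \<in> carrier F \<Longrightarrow> g (N #>\<^bsub>F\<^esub> x) = h x"
    using h.FactGroup_universal_kernel[OF N_normal] by blast
  have gt: "g (tc t) = h t" if "t \<in> carrier F" for t using g(2)[OF that] by (simp add: tensor_class_def)
  have "g (x \<oplus>\<^bsub>T\<^esub> y) = g x \<oplus>\<^bsub>G\<^esub> g y" if x: "x \<in> carrier T" and y: "y \<in> carrier T" for x y
  proof -
    obtain s where "x = tc s" "s \<in> carrier F" using x unfolding carrier_T by (rule imageE)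
    moreover obtain t where "y = tc t" "t \<in> carrier F" using y unfolding carrier_T by (rule imageE)
    ultimately show ?thesis using h.hom_mult[of s t] by (simp add: tc_add gt F_closed)
  qed
  moreover have "g \<in> carrier T \<rightarrow> carrier G"
    unfolding carrier_T using gt hcl by (intro funcsetI) (elim imageE, simp)
  moreover have "g (ten u v) = \<beta> u v" if "u \<in> U" "v \<in> V" for u v
    using that by (simp add: ten_def gt frag_in_F hfr)
  ultimately show ?thesis by blast
qed

text \<open>The map f \<otimes> g sends relators to relators of the same kind, so it preserves
  \<open>N\<close> and the union over representatives is a single class. Left and right
  multiplication are both special cases.\<close>

lemma T_act:
  assumes f: "\<And>u. u \<in> U \<Longrightarrow> f u \<in> U" "\<And>u u'. \<lbrakk>u \<in> U; u' \<in> U\<rbrakk> \<Longrightarrow> f (u \<oplus> u') = f u \<oplus> f u'" "\<And>c u. u \<in> U \<Longrightarrow> f (c \<odot> u) = c \<odot> f u"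
    and g: "\<And>v. v \<in> V \<Longrightarrow> g v \<in> V" "\<And>v v'. \<lbrakk>v \<in> V; v' \<in> V\<rbrakk> \<Longrightarrow> g (v \<oplus> v') = g v \<oplus> g v'" "\<And>c v. v \<in> V \<Longrightarrow> g (c \<odot> v) = c \<odot> g v"
  defines "act \<equiv> \<lambda>x. \<Union>t\<in>x. tc (frag_extend (\<lambda>(u, v). frag_of (f u, g v)) t)"
  shows "x \<in> carrier T \<Longrightarrow> act x \<in> carrier T"
    and "x \<in> carrier T \<Longrightarrow> y \<in> carrier T \<Longrightarrow> act (x \<oplus>\<^bsub>T\<^esub> y) = act x \<oplus>\<^bsub>T\<^esub> act y"
    and "u \<in> U \<Longrightarrow> v \<in> V \<Longrightarrow> act (ten u v) = ten (f u) (g v)"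
proof -
  define ex where "ex = frag_extend (\<lambda>(u, v). frag_of (f u, g v))"
  have exF: "ex t \<in> carrier F" if "t \<in> carrier F" for t
    unfolding carrier_F ex_def
    by (rule order_trans[OF keys_frag_extend]) (use that f g in \<open>auto simp: carrier_F\<close>)
  have exd: "ex (s - t) = ex s - ex t" "ex (s + t) = ex s + ex t" "ex 0 = 0" "ex (- t) = - ex t" for s t
    by (simp_all add: ex_def frag_extend_diff frag_extend_add frag_extend_minus)
  have exf: "ex (frag_of (u, v)) = frag_of (f u, g v)" for u v by (simp add: ex_def)
  have exr: "ex t \<in> rels" if "t \<in> rels" for t
    using that
    by (cases rule: rels_cases) (simp_all add: exd exf f g relsI)
  have exN: "ex t \<in> N" if "t \<in> N" for t
    using that unfolding N_def
  proof (induction rule: generate.induct)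
    case one then show ?case by (simp add: exd generate.one[of F, simplified])
  next
    case (incl h) then show ?case by (simp add: exr generate.incl)
  next
    case (inv h)
    then have h: "h \<in> carrier F" "ex h \<in> carrier F" using rels_in_F exF by auto
    have "inv\<^bsub>F\<^esub> (ex h) \<in> generate F rels" by (rule generate.inv) (rule exr[OF inv])
    then show ?case using h by (simp add: exd carrier_F)
  next
    case (eng h1 h2)
    then show ?case using generate.eng[OF eng.IH] by (simp add: exd)
  qed
  have act: "act (tc t) = tc (ex t)" if t: "t \<in> carrier F" for t
  proof -
    have "tc (ex s) = tc (ex t)" if "s \<in> tc t" for s
      using tc_mem[OF t that] t exN[of "s - t"] by (intro tc_eq) (simp_all add: exF exd)
    moreover have "tc t \<noteq> {}" using tc_self[OF t] by blast
    ultimately show ?thesis unfolding act_def ex_def[symmetric] by (intro SUP_eq_const)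
  qed
  show "x \<in> carrier T \<Longrightarrow> act x \<in> carrier T"
    unfolding carrier_T using act exF by (elim imageE) simp
  show "x \<in> carrier T \<Longrightarrow> y \<in> carrier T \<Longrightarrow> act (x \<oplus>\<^bsub>T\<^esub> y) = act x \<oplus>\<^bsub>T\<^esub> act y"
    unfolding carrier_T by (elim imageE) (simp add: tc_add act exF F_closed exd)
  show "u \<in> U \<Longrightarrow> v \<in> V \<Longrightarrow> act (ten u v) = ten (f u) (g v)"
    by (simp add: ten_def act frag_in_F exf)
qed

text \<open>The vacuous \<open>\<lambda>v. v\<close> displays the action as a tensor product of two
  maps, one of them the identity, which is the shape treated in \<open>T_act\<close>.\<close>

lemma lact_T: "lact T a x = (\<Union>t\<in>x. tc (frag_extend (\<lambda>(u, v). frag_of (a \<otimes> u, (\<lambda>v. v) v)) t))"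
  by (simp add: tensor_bimod_def Let_def)

lemma ract_T: "ract T x a = (\<Union>t\<in>x. tc (frag_extend (\<lambda>(u, v). frag_of ((\<lambda>v. v) u, v \<otimes> a)) t))"
  by (simp add: tensor_bimod_def Let_def)

lemma UV_carrier [simp]: "u \<in> U \<Longrightarrow> u \<in> carrier A" "v \<in> V \<Longrightarrow> v \<in> carrier A"
  using U V by auto

lemma T_lact:
  assumes "a \<in> carrier A"
  shows "x \<in> carrier T \<Longrightarrow> lact T a x \<in> carrier T"
    and "x \<in> carrier T \<Longrightarrow> y \<in> carrier T \<Longrightarrow> lact T a (x \<oplus>\<^bsub>T\<^esub> y) = lact T a x \<oplus>\<^bsub>T\<^esub> lact T a y"
    and "u \<in> U \<Longrightarrow> v \<in> V \<Longrightarrow> lact T a (ten u v) = ten (a \<otimes> u) v"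
  unfolding lact_T
  by (rule T_act, simp_all add: assms U V r_distr smult_mult_r)+

lemma T_ract:
  assumes "a \<in> carrier A"
  shows "x \<in> carrier T \<Longrightarrow> ract T x a \<in> carrier T"
    and "x \<in> carrier T \<Longrightarrow> y \<in> carrier T \<Longrightarrow> ract T (x \<oplus>\<^bsub>T\<^esub> y) a = ract T x a \<oplus>\<^bsub>T\<^esub> ract T y a"
    and "u \<in> U \<Longrightarrow> v \<in> V \<Longrightarrow> ract T (ten u v) a = ten u (v \<otimes> a)"
  unfolding ract_T
  by (rule T_act, simp_all add: assms U V l_distr smult_mult_l)+

lemma T_act_zero:
  assumes "a \<in> carrier A" shows "lact T a \<zero>\<^bsub>T\<^esub> = \<zero>\<^bsub>T\<^esub>" "ract T \<zero>\<^bsub>T\<^esub> a = \<zero>\<^bsub>T\<^esub>"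
  using T_lact(1)[OF assms T.zero_closed] T_lact(2)[OF assms T.zero_closed T.zero_closed]
    T_ract(1)[OF assms T.zero_closed] T_ract(2)[OF assms T.zero_closed T.zero_closed]
  by simp_all

lemma is_bimodule_T: "is_bimodule A T"
proof (rule is_bimoduleI[OF T_group])
  note S = T_lact T_ract T_act_zero
  note ac = T.a_assoc T.a_comm T.a_lcomm
  fix a b x assume ab: "a \<in> carrier A" "b \<in> carrier A" and x: "x \<in> carrier T"
  show "lact T (a \<otimes> b) x = lact T a (lact T b x)"
    using x by (induction rule: T_induct) (simp_all add: S ab U V m_assoc)
  show "ract T x (a \<otimes> b) = ract T (ract T x a) b"
    using x by (induction rule: T_induct) (simp_all add: S ab U V m_assoc)
  show "ract T (lact T a x) b = lact T a (ract T x b)"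
    using x by (induction rule: T_induct) (simp_all add: S ab U V m_assoc)
  show "lact T (a \<oplus> b) x = lact T a x \<oplus>\<^bsub>T\<^esub> lact T b x"
    using x by (induction rule: T_induct) (simp_all add: S ab U V l_distr ten_rels ac)
  show "ract T x (a \<oplus> b) = ract T x a \<oplus>\<^bsub>T\<^esub> ract T x b"
    using x by (induction rule: T_induct) (simp_all add: S ab U V r_distr ten_rels ac)
next
  note S = T_lact T_ract T_act_zero
  fix x c assume x: "x \<in> carrier T"
  show "lact T \<one> x = x" using x by (induction rule: T_induct) (simp_all add: S U V)
  show "ract T x \<one> = x" using x by (induction rule: T_induct) (simp_all add: S U V)
  show "lact T (c \<odot> \<one>) x = ract T x (c \<odot> \<one>)"
    using x by (induction rule: T_induct) (simp_all add: S U V smult_eq_mult[symmetric] smult_eq_mult'[symmetric] ten_rels)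
qed (simp_all add: T_lact T_ract)

end

section \<open>Bimodule homomorphisms and sub-bimodules\<close>

lemma bimod_homD:
  assumes "f \<in> bimod_hom A M M'"
  shows "x \<in> carrier M \<Longrightarrow> f x \<in> carrier M'"
    "x \<in> carrier M \<Longrightarrow> y \<in> carrier M \<Longrightarrow> f (x \<oplus>\<^bsub>M\<^esub> y) = f x \<oplus>\<^bsub>M'\<^esub> f y"
    "a \<in> carrier A \<Longrightarrow> x \<in> carrier M \<Longrightarrow> f (lact M a x) = lact M' a (f x)"
    "a \<in> carrier A \<Longrightarrow> x \<in> carrier M \<Longrightarrow> f (ract M x a) = ract M' (f x) a"
    "f \<in> extensional (carrier M)"
  using assms unfolding bimod_hom_def by (auto simp: PiE_iff)

lemma bimod_homI:
  assumes "f \<in> extensional (carrier M)" "\<And>x. x \<in> carrier M \<Longrightarrow> f x \<in> carrier M'"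
    "\<And>x y. x \<in> carrier M \<Longrightarrow> y \<in> carrier M \<Longrightarrow> f (x \<oplus>\<^bsub>M\<^esub> y) = f x \<oplus>\<^bsub>M'\<^esub> f y"
    "\<And>a x. a \<in> carrier A \<Longrightarrow> x \<in> carrier M \<Longrightarrow> f (lact M a x) = lact M' a (f x)"
    "\<And>a x. a \<in> carrier A \<Longrightarrow> x \<in> carrier M \<Longrightarrow> f (ract M x a) = ract M' (f x) a"
  shows "f \<in> bimod_hom A M M'"
  using assms by (simp add: bimod_hom_def PiE_iff)

lemma bimod_hom_eqI:
  assumes "f \<in> bimod_hom A M M'" "g \<in> bimod_hom A M M''" "\<And>x. x \<in> carrier M \<Longrightarrow> f x = g x"
  shows "f = g"
  using extensionalityI[OF bimod_homD(5)[OF assms(1)] bimod_homD(5)[OF assms(2)]] assms(3) by blast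

context bimod
begin

lemma hom_zero:
  assumes "f \<in> bimod_hom A M M'" "abelian_group M'"
  shows "f \<zero>\<^bsub>M\<^esub> = \<zero>\<^bsub>M'\<^esub>"
proof -
  interpret N: abelian_group M' by fact
  have "f \<zero>\<^bsub>M\<^esub> \<oplus>\<^bsub>M'\<^esub> f \<zero>\<^bsub>M\<^esub> = f \<zero>\<^bsub>M\<^esub>"
    using bimod_homD(2)[OF assms(1) zero_closed zero_closed] by simp
  then show ?thesis using bimod_homD(1)[OF assms(1) zero_closed] by simp
qed

lemma hom_minus:
  assumes "f \<in> bimod_hom A M M'" "abelian_group M'" "x \<in> carrier M"
  shows "f (\<ominus>\<^bsub>M\<^esub> x) = \<ominus>\<^bsub>M'\<^esub> f x"
proof -
  interpret N: abelian_group M' by fact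
  have "f (\<ominus>\<^bsub>M\<^esub> x) \<oplus>\<^bsub>M'\<^esub> f x = \<zero>\<^bsub>M'\<^esub>"
    using bimod_homD(2)[OF assms(1) a_inv_closed[OF assms(3)] assms(3)] hom_zero[OF assms(1,2)] assms(3)
    by (simp add: l_neg)
  then show ?thesis using bimod_homD(1)[OF assms(1)] assms(3) by (simp add: N.minus_equality)
qed

lemma hom_restrict:
  assumes "\<And>x. x \<in> carrier M \<Longrightarrow> f x \<in> carrier M'"
    "\<And>x y. x \<in> carrier M \<Longrightarrow> y \<in> carrier M \<Longrightarrow> f (x \<oplus>\<^bsub>M\<^esub> y) = f x \<oplus>\<^bsub>M'\<^esub> f y"
    "\<And>a x. a \<in> carrier A \<Longrightarrow> x \<in> carrier M \<Longrightarrow> f (lact M a x) = lact M' a (f x)"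
    "\<And>a x. a \<in> carrier A \<Longrightarrow> x \<in> carrier M \<Longrightarrow> f (ract M x a) = ract M' (f x) a"
  shows "restrict f (carrier M) \<in> bimod_hom A M M'"
  using assms by (intro bimod_homI) simp_all

lemma hom_id: "restrict (\<lambda>x. x) (carrier M) \<in> bimod_hom A M M"
  by (intro hom_restrict) simp_all

lemma hom_compose:
  assumes "f \<in> bimod_hom A M M'" "g \<in> bimod_hom A M' M''"
  shows "compose (carrier M) g f \<in> bimod_hom A M M''"
  unfolding compose_def
  by (intro hom_restrict) (simp_all add: bimod_homD[OF assms(1)] bimod_homD[OF assms(2)])

lemma hom_add:
  assumes "bimod A M'" "f \<in> bimod_hom A M M'" "g \<in> bimod_hom A M M'"
  shows "(\<lambda>x\<in>carrier M. f x \<oplus>\<^bsub>M'\<^esub> g x) \<in> bimod_hom A M M'"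
proof -
  interpret N: bimod A M' by fact
  show ?thesis
    by (intro hom_restrict)
      (simp_all add: bimod_homD[OF assms(2)] bimod_homD[OF assms(3)] N.a_ac N.act_add)
qed

lemma hom_const_zero:
  assumes "bimod A M'"
  shows "(\<lambda>x\<in>carrier M. \<zero>\<^bsub>M'\<^esub>) \<in> bimod_hom A M M'"
proof -
  interpret N: bimod A M' by fact
  show ?thesis by (intro hom_restrict) simp_all
qed

lemma hom_uminus:
  assumes "bimod A M'" "f \<in> bimod_hom A M M'"
  shows "(\<lambda>x\<in>carrier M. \<ominus>\<^bsub>M'\<^esub> f x) \<in> bimod_hom A M M'"
proof -
  interpret N: bimod A M' by fact
  have l: "lact M' a (\<ominus>\<^bsub>M'\<^esub> y) = \<ominus>\<^bsub>M'\<^esub> lact M' a y" "ract M' (\<ominus>\<^bsub>M'\<^esub> y) a = \<ominus>\<^bsub>M'\<^esub> ract M' y a"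
    if a: "a \<in> carrier A" and y: "y \<in> carrier M'" for a y
  proof -
    have "lact M' a (\<ominus>\<^bsub>M'\<^esub> y) \<oplus>\<^bsub>M'\<^esub> lact M' a y = \<zero>\<^bsub>M'\<^esub>" "ract M' (\<ominus>\<^bsub>M'\<^esub> y) a \<oplus>\<^bsub>M'\<^esub> ract M' y a = \<zero>\<^bsub>M'\<^esub>"
      unfolding N.act_add[OF a N.a_inv_closed[OF y] y, symmetric] N.l_neg[OF y] by (rule N.act_zero[OF a])+
    then show "lact M' a (\<ominus>\<^bsub>M'\<^esub> y) = \<ominus>\<^bsub>M'\<^esub> lact M' a y" "ract M' (\<ominus>\<^bsub>M'\<^esub> y) a = \<ominus>\<^bsub>M'\<^esub> ract M' y a"
      using a y by (simp_all add: N.minus_equality)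
  qed
  show ?thesis
    by (intro hom_restrict) (simp_all add: bimod_homD[OF assms(2)] N.minus_add l)
qed

lemma hom_diff:
  assumes "bimod A M'" "f \<in> bimod_hom A M M'" "g \<in> bimod_hom A M M'"
  shows "(\<lambda>x\<in>carrier M. f x \<ominus>\<^bsub>M'\<^esub> g x) \<in> bimod_hom A M M'"
proof -
  have "(\<lambda>x\<in>carrier M. f x \<oplus>\<^bsub>M'\<^esub> (\<lambda>x\<in>carrier M. \<ominus>\<^bsub>M'\<^esub> g x) x) \<in> bimod_hom A M M'"
    by (intro hom_add hom_uminus assms)
  moreover have "(\<lambda>x\<in>carrier M. f x \<oplus>\<^bsub>M'\<^esub> (\<lambda>x\<in>carrier M. \<ominus>\<^bsub>M'\<^esub> g x) x) = (\<lambda>x\<in>carrier M. f x \<ominus>\<^bsub>M'\<^esub> g x)"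
    by (intro restrict_ext) (simp add: a_minus_def)
  ultimately show ?thesis by simp
qed

lemma hom_scale:
  assumes "bimod A M'" "f \<in> bimod_hom A M M'" "k_algebra A"
  shows "(\<lambda>x\<in>carrier M. lact M' (c \<odot>\<^bsub>A\<^esub> \<one>\<^bsub>A\<^esub>) (f x)) \<in> bimod_hom A M M'"
proof -
  interpret N: bimod A M' by fact
  interpret R: k_algebra A by fact
  have central: "lact M' (c \<odot>\<^bsub>A\<^esub> \<one>\<^bsub>A\<^esub>) (lact M' a y) = lact M' a (lact M' (c \<odot>\<^bsub>A\<^esub> \<one>\<^bsub>A\<^esub>) y)"
    if "a \<in> carrier A" "y \<in> carrier M'" for a y
    using that by (simp add: N.act_mult(1)[symmetric] R.smult_mult_l R.smult_mult_r)
  show ?thesis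
    by (intro hom_restrict) (simp_all add: bimod_homD[OF assms(2)] N.act_add N.act_mult(3) central)
qed

definition sub_bimod :: "'x set \<Rightarrow> bool" where
  "sub_bimod S \<longleftrightarrow> S \<subseteq> carrier M \<and> \<zero>\<^bsub>M\<^esub> \<in> S \<and> (\<forall>x\<in>S. \<forall>y\<in>S. x \<oplus>\<^bsub>M\<^esub> y \<in> S) \<and>
    (\<forall>a\<in>carrier A. \<forall>x\<in>S. lact M a x \<in> S \<and> ract M x a \<in> S)"

lemma sub_bimod_carrier: "sub_bimod (carrier M)"
  by (simp add: sub_bimod_def)

end

section \<open>Finite sums of the projective bimodules generated by a pair of idempotents\<close>

section \<open>Direct sums of tensor products\<close>

text \<open>The summand at j is the tensor product of A \<epsilon>(j) and \<eta>(j) A. With vertex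
  idempotents this gives the terms of the resolution, and with both idempotents equal to 1 it gives
  the free bimodules.\<close>

locale tensor_family = k_algebra A for A :: "('k::field, 'l) module" (structure) +
  fixes J :: "'j set" and \<epsilon> \<eta> :: "'j \<Rightarrow> 'l"
  assumes fin: "finite J"
    and idem: "\<And>j. j \<in> J \<Longrightarrow> \<epsilon> j \<in> carrier A" "\<And>j. j \<in> J \<Longrightarrow> \<epsilon> j \<otimes> \<epsilon> j = \<epsilon> j"
      "\<And>j. j \<in> J \<Longrightarrow> \<eta> j \<in> carrier A" "\<And>j. j \<in> J \<Longrightarrow> \<eta> j \<otimes> \<eta> j = \<eta> j"
begin

abbreviation U where "U j \<equiv> (\<lambda>x. x \<otimes> \<epsilon> j) ` carrier A"
abbreviation V where "V j \<equiv> (\<lambda>x. \<eta> j \<otimes> x) ` carrier A"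
abbreviation T where "T j \<equiv> tensor_bimod A (U j) (V j)"
abbreviation FB where "FB \<equiv> bimod_sum J T"

definition emb where "emb j t = (\<lambda>k\<in>J. if k = j then t else \<zero>\<^bsub>T k\<^esub>)"
definition W where "W j u v = emb j (tensor.ten A (U j) (V j) u v)"
abbreviation gen where "gen j \<equiv> W j (\<epsilon> j) (\<eta> j)"

lemma U_iff: "j \<in> J \<Longrightarrow> u \<in> U j \<longleftrightarrow> u \<in> carrier A \<and> u \<otimes> \<epsilon> j = u"
  using idem by (auto simp: m_assoc) (metis image_eqI)

lemma V_iff: "j \<in> J \<Longrightarrow> v \<in> V j \<longleftrightarrow> v \<in> carrier A \<and> \<eta> j \<otimes> v = v"
  using idem by (auto simp: m_assoc[symmetric]) (metis image_eqI)

lemma tensor: "j \<in> J \<Longrightarrow> tensor A (U j) (V j)"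
proof unfold_locales
  assume j: "j \<in> J"
  show "U j \<subseteq> carrier A" "V j \<subseteq> carrier A" using idem j by auto
  show "\<zero> \<in> U j" "\<zero> \<in> V j" using j idem by (simp_all only: U_iff V_iff) simp_all
  show "u \<oplus> u' \<in> U j" if "u \<in> U j" "u' \<in> U j" for u u'
    using that j idem by (simp only: U_iff) (simp add: l_distr)
  show "u \<oplus> u' \<in> V j" if "u \<in> V j" "u' \<in> V j" for u u'
    using that j idem by (simp only: V_iff) (simp add: r_distr)
  show "x \<otimes> u \<in> U j" if "x \<in> carrier A" "u \<in> U j" for x u
    using that j idem by (simp only: U_iff) (simp add: m_assoc)
  show "u \<otimes> x \<in> V j" if "x \<in> carrier A" "u \<in> V j" for x u
    using that j idem by (simp only: V_iff) (simp add: m_assoc[symmetric])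
qed

lemma bimod_T: "j \<in> J \<Longrightarrow> bimod A (T j)"
  by (simp add: bimod_def tensor.is_bimodule_T[OF tensor])

sublocale FB: bimod A FB
  by (simp add: bimod_def is_bimodule_sum tensor.is_bimodule_T[OF tensor])

lemma T_zero: "j \<in> J \<Longrightarrow> \<zero>\<^bsub>T j\<^esub> \<in> carrier (T j)"
  using bimod_T unfolding bimod_def is_bimodule_def by (blast intro: abelian_groupE(2))

lemma FB_simps:
  "x \<in> carrier FB \<longleftrightarrow> x \<in> (\<Pi>\<^sub>E j\<in>J. carrier (T j))" "\<zero>\<^bsub>FB\<^esub> = (\<lambda>j\<in>J. \<zero>\<^bsub>T j\<^esub>)" "x \<oplus>\<^bsub>FB\<^esub> y = (\<lambda>j\<in>J. x j \<oplus>\<^bsub>T j\<^esub> y j)"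
  "lact FB a x = (\<lambda>j\<in>J. lact (T j) a (x j))" "ract FB x a = (\<lambda>j\<in>J. ract (T j) (x j) a)"
  by (simp_all add: bimod_sum_def)

lemma emb_props:
  assumes j: "j \<in> J"
  shows "s \<in> carrier (T j) \<Longrightarrow> emb j s \<in> carrier FB"
    "emb j (s \<oplus>\<^bsub>T j\<^esub> t) = emb j s \<oplus>\<^bsub>FB\<^esub> emb j t"
    "a \<in> carrier A \<Longrightarrow> lact FB a (emb j s) = emb j (lact (T j) a s)"
    "a \<in> carrier A \<Longrightarrow> ract FB (emb j s) a = emb j (ract (T j) s a)"
proof -
  have z1: "\<zero>\<^bsub>T k\<^esub> \<oplus>\<^bsub>T k\<^esub> \<zero>\<^bsub>T k\<^esub> = \<zero>\<^bsub>T k\<^esub>" if "k \<in> J" for k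
  proof -
    interpret Tk: bimod A "T k" by (rule bimod_T[OF that])
    show ?thesis by simp
  qed
  have z2: "lact (T k) a \<zero>\<^bsub>T k\<^esub> = \<zero>\<^bsub>T k\<^esub>" "ract (T k) \<zero>\<^bsub>T k\<^esub> a = \<zero>\<^bsub>T k\<^esub>"
    if "k \<in> J" "a \<in> carrier A" for k a
    using bimod.act_zero[OF bimod_T[OF that(1)] that(2)] by simp_all
  show "s \<in> carrier (T j) \<Longrightarrow> emb j s \<in> carrier FB" using T_zero by (simp add: FB_simps emb_def restrict_PiE_iff)
  show "emb j (s \<oplus>\<^bsub>T j\<^esub> t) = emb j s \<oplus>\<^bsub>FB\<^esub> emb j t"
    unfolding FB_simps emb_def by (intro restrict_ext) (simp add: z1)
  show "a \<in> carrier A \<Longrightarrow> lact FB a (emb j s) = emb j (lact (T j) a s)" 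
    "a \<in> carrier A \<Longrightarrow> ract FB (emb j s) a = emb j (ract (T j) s a)"
    unfolding FB_simps emb_def by (intro restrict_ext, simp add: z2)+
qed

lemma W_closed: "j \<in> J \<Longrightarrow> u \<in> U j \<Longrightarrow> v \<in> V j \<Longrightarrow> W j u v \<in> carrier FB"
  unfolding W_def by (intro emb_props(1) tensor.ten_closed[OF tensor])

lemma gen_UV: "j \<in> J \<Longrightarrow> \<epsilon> j \<in> U j" "j \<in> J \<Longrightarrow> \<eta> j \<in> V j"
  using idem by (simp_all only: U_iff V_iff simp_thms)

lemma gen_closed [simp]: "j \<in> J \<Longrightarrow> gen j \<in> carrier FB"
  by (intro W_closed gen_UV)

lemma W_act:
  assumes "j \<in> J" "u \<in> U j" "v \<in> V j" "a \<in> carrier A"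
  shows "lact FB a (W j u v) = W j (a \<otimes> u) v" "ract FB (W j u v) a = W j u (v \<otimes> a)"
  unfolding W_def emb_props(3,4)[OF assms(1,4)] tensor.T_lact(3)[OF tensor[OF assms(1)] assms(4,2,3)]
    tensor.T_ract(3)[OF tensor[OF assms(1)] assms(4,2,3)] by simp_all

text \<open>Since u = u \<epsilon>(j) and v = \<eta>(j) v, every pure tensor is obtained by acting
  on the one generator of its summand.\<close>

lemma W_eq:
  assumes j: "j \<in> J" and u: "u \<in> U j" and v: "v \<in> V j"
  shows "W j u v = ract FB (lact FB u (gen j)) v"
proof -
  have uc: "u \<in> carrier A" "u \<otimes> \<epsilon> j = u" and vc: "v \<in> carrier A" "\<eta> j \<otimes> v = v"
    using u v U_iff[OF j] V_iff[OF j] by blast+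
  show ?thesis
    using W_act(1)[OF j gen_UV[OF j] uc(1)] W_act(2)[OF j u gen_UV(2)[OF j] vc(1)] uc vc by simp
qed

lemma gen_idem: "j \<in> J \<Longrightarrow> lact FB (\<epsilon> j) (gen j) = gen j" "j \<in> J \<Longrightarrow> ract FB (gen j) (\<eta> j) = gen j"
  using W_act[OF _ gen_UV] idem by simp_all

lemma FB_induct_emb:
  assumes x: "x \<in> carrier FB" and zero: "P \<zero>\<^bsub>FB\<^esub>" and emb: "\<And>j t. j \<in> J \<Longrightarrow> t \<in> carrier (T j) \<Longrightarrow> P (emb j t)"
    and add: "\<And>x y. \<lbrakk>x \<in> carrier FB; y \<in> carrier FB; P x; P y\<rbrakk> \<Longrightarrow> P (x \<oplus>\<^bsub>FB\<^esub> y)"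
  shows "P x"
proof -
  \<comment> \<open>The truncation of x to the components in S; x is rebuilt by enlarging S one
    index at a time.\<close>
  define part where "part S = (\<lambda>k\<in>J. if k \<in> S then x k else \<zero>\<^bsub>T k\<^esub>)" for S
  have xk: "k \<in> J \<Longrightarrow> x k \<in> carrier (T k)" for k using x unfolding FB_simps by (rule PiE_mem)
  have pc: "part S \<in> carrier FB" for S
    using xk T_zero by (simp add: part_def FB_simps restrict_PiE_iff)
  have "P (part S)" if "finite S" "S \<subseteq> J" for S
    using that
  proof (induction S rule: finite_induct)
    case empty
    have "part {} = \<zero>\<^bsub>FB\<^esub>" by (simp add: part_def FB_simps)
    then show ?case using zero by simp
  next
    case (insert j S)
    then have j: "j \<in> J" "j \<notin> S" by auto
    have "part (insert j S) = emb j (x j) \<oplus>\<^bsub>FB\<^esub> part S"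
      unfolding part_def emb_def FB_simps
    proof (intro restrict_ext)
      fix k assume k: "k \<in> J"
      interpret Tk: bimod A "T k" by (rule bimod_T[OF k])
      show "(if k \<in> insert j S then x k else \<zero>\<^bsub>T k\<^esub>) =
         (\<lambda>k\<in>J. if k = j then x j else \<zero>\<^bsub>T k\<^esub>) k \<oplus>\<^bsub>T k\<^esub> (\<lambda>k\<in>J. if k \<in> S then x k else \<zero>\<^bsub>T k\<^esub>) k"
        using k j xk[OF k] Tk.r_zero[OF xk[OF k]] by (cases "k = j") simp_all
    qed
    moreover have "P (emb j (x j) \<oplus>\<^bsub>FB\<^esub> part S)"
      using insert by (intro add emb pc emb_props(1) j xk) auto
    ultimately show ?case by simp
  qed
  moreover have "part J = x"
    using x unfolding FB_simps part_def by (intro extensionalityI[of _ J]) (simp_all add: PiE_def)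
  ultimately show ?thesis using fin by fastforce
qed

lemma FB_induct [consumes 1, case_names zero gen add]:
  assumes x: "x \<in> carrier FB" and zero: "P \<zero>\<^bsub>FB\<^esub>"
    and gen: "\<And>j u v. \<lbrakk>j \<in> J; u \<in> U j; v \<in> V j\<rbrakk> \<Longrightarrow> P (W j u v)"
    and add: "\<And>x y. \<lbrakk>x \<in> carrier FB; y \<in> carrier FB; P x; P y\<rbrakk> \<Longrightarrow> P (x \<oplus>\<^bsub>FB\<^esub> y)"
  shows "P x"
  using x zero
proof (rule FB_induct_emb)
  fix j t assume j: "j \<in> J" and t: "t \<in> carrier (T j)"
  show "P (emb j t)"
  proof (rule tensor.T_induct[OF tensor[OF j] t])
    have "emb j \<zero>\<^bsub>T j\<^esub> = \<zero>\<^bsub>FB\<^esub>" unfolding emb_def FB_simps by (intro restrict_ext) simp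
    then show "P (emb j \<zero>\<^bsub>T j\<^esub>)" using zero by simp
    show "P (emb j (tensor.ten A (U j) (V j) u v))" if "u \<in> U j" "v \<in> V j" for u v
      using gen[OF j that] by (simp add: W_def)
    show "P (emb j (s \<oplus>\<^bsub>T j\<^esub> t))" if s: "s \<in> carrier (T j)" and t: "t \<in> carrier (T j)" and P: "P (emb j s)" "P (emb j t)" for s t
      unfolding emb_props(2)[OF j] by (intro add P emb_props(1) j s t)
  qed
qed (rule add)

text \<open>The maps on the summands are added up, which is legitimate because J is finite. The
  extension is only additive, so that it also yields maps compatible with one action but not with
  the other.\<close>

lemma FB_universal:
  assumes G: "abelian_group G"
    and cl: "\<And>j u v. \<lbrakk>j \<in> J; u \<in> U j; v \<in> V j\<rbrakk> \<Longrightarrow> \<beta> j u v \<in> carrier G"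
    and l: "\<And>j u u' v. \<lbrakk>j \<in> J; u \<in> U j; u' \<in> U j; v \<in> V j\<rbrakk> \<Longrightarrow> \<beta> j (u \<oplus> u') v = \<beta> j u v \<oplus>\<^bsub>G\<^esub> \<beta> j u' v"
    and r: "\<And>j u v v'. \<lbrakk>j \<in> J; u \<in> U j; v \<in> V j; v' \<in> V j\<rbrakk> \<Longrightarrow> \<beta> j u (v \<oplus> v') = \<beta> j u v \<oplus>\<^bsub>G\<^esub> \<beta> j u v'"
    and c: "\<And>j c u v. \<lbrakk>j \<in> J; u \<in> U j; v \<in> V j\<rbrakk> \<Longrightarrow> \<beta> j (c \<odot> u) v = \<beta> j u (c \<odot> v)"
  obtains \<phi> where "\<phi> \<in> carrier FB \<rightarrow> carrier G"
    "\<And>x y. x \<in> carrier FB \<Longrightarrow> y \<in> carrier FB \<Longrightarrow> \<phi> (x \<oplus>\<^bsub>FB\<^esub> y) = \<phi> x \<oplus>\<^bsub>G\<^esub> \<phi> y"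
    "\<And>j u v. \<lbrakk>j \<in> J; u \<in> U j; v \<in> V j\<rbrakk> \<Longrightarrow> \<phi> (W j u v) = \<beta> j u v"
proof -
  interpret G: abelian_group G by fact
  have "\<forall>j\<in>J. \<exists>\<phi>. \<phi> \<in> carrier (T j) \<rightarrow> carrier G
      \<and> (\<forall>x\<in>carrier (T j). \<forall>y\<in>carrier (T j). \<phi> (x \<oplus>\<^bsub>T j\<^esub> y) = \<phi> x \<oplus>\<^bsub>G\<^esub> \<phi> y)
      \<and> (\<forall>u\<in>U j. \<forall>v\<in>V j. \<phi> (tensor.ten A (U j) (V j) u v) = \<beta> j u v)"
    by (intro ballI tensor.T_universal[OF tensor G]) (simp_all only: cl l r c)
  from bchoice[OF this] obtain \<psi> where
    \<psi>1: "\<And>j. j \<in> J \<Longrightarrow> \<psi> j \<in> carrier (T j) \<rightarrow> carrier G" and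
    \<psi>2: "\<And>j x y. j \<in> J \<Longrightarrow> x \<in> carrier (T j) \<Longrightarrow> y \<in> carrier (T j) \<Longrightarrow> \<psi> j (x \<oplus>\<^bsub>T j\<^esub> y) = \<psi> j x \<oplus>\<^bsub>G\<^esub> \<psi> j y" and
    \<psi>3: "\<And>j u v. j \<in> J \<Longrightarrow> u \<in> U j \<Longrightarrow> v \<in> V j \<Longrightarrow> \<psi> j (tensor.ten A (U j) (V j) u v) = \<beta> j u v"
    by blast
  have \<psi>c: "\<psi> j x \<in> carrier G" if "j \<in> J" "x \<in> carrier (T j)" for j x using \<psi>1[OF that(1)] that(2) by (rule funcset_mem)
  have \<psi>0: "\<psi> j \<zero>\<^bsub>T j\<^esub> = \<zero>\<^bsub>G\<^esub>" if j: "j \<in> J" for j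
  proof -
    interpret Tj: bimod A "T j" by (rule bimod_T[OF j])
    show ?thesis using \<psi>2[OF j Tj.zero_closed Tj.zero_closed] \<psi>c[OF j Tj.zero_closed] by simp
  qed
  define \<phi> where "\<phi> x = (\<Oplus>\<^bsub>G\<^esub>j\<in>J. \<psi> j (x j))" for x
  have mem: "x j \<in> carrier (T j)" if "x \<in> carrier FB" "j \<in> J" for x j
    using that unfolding FB_simps by (rule PiE_mem)
  show thesis
  proof (rule that[of \<phi>])
    show "\<phi> \<in> carrier FB \<rightarrow> carrier G"
      unfolding \<phi>_def using mem \<psi>c by (intro funcsetI G.finsum_closed) simp
    show "\<phi> (x \<oplus>\<^bsub>FB\<^esub> y) = \<phi> x \<oplus>\<^bsub>G\<^esub> \<phi> y" if x: "x \<in> carrier FB" and y: "y \<in> carrier FB" for x y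
    proof -
      have "\<phi> (x \<oplus>\<^bsub>FB\<^esub> y) = (\<Oplus>\<^bsub>G\<^esub>j\<in>J. \<psi> j (x j) \<oplus>\<^bsub>G\<^esub> \<psi> j (y j))"
        unfolding \<phi>_def by (intro G.finsum_cong') (simp_all add: FB_simps \<psi>2 \<psi>c mem[OF x] mem[OF y])
      then show ?thesis unfolding \<phi>_def using \<psi>c mem x y by (simp add: G.finsum_addf Pi_iff)
    qed
    show "\<phi> (W j u v) = \<beta> j u v" if j: "j \<in> J" and u: "u \<in> U j" and v: "v \<in> V j" for j u v
    proof -
      have "\<phi> (W j u v) = (\<Oplus>\<^bsub>G\<^esub>k\<in>J. if j = k then \<beta> j u v else \<zero>\<^bsub>G\<^esub>)"
        unfolding \<phi>_def
      proof (intro G.finsum_cong' refl)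
        show "(\<lambda>k. if j = k then \<beta> j u v else \<zero>\<^bsub>G\<^esub>) \<in> J \<rightarrow> carrier G"
          by (simp add: Pi_iff cl[OF j u v])
        fix k assume k: "k \<in> J"
        then show "\<psi> k (W j u v k) = (if j = k then \<beta> j u v else \<zero>\<^bsub>G\<^esub>)"
          using \<psi>3[OF j u v] \<psi>0[OF k] by (cases "k = j") (simp_all add: W_def emb_def)
      qed
      also have "\<dots> = \<beta> j u v" using G.finsum_singleton[OF j fin, of "\<lambda>k. \<beta> j u v"] cl[OF j u v] by simp
      finally show ?thesis .
    qed
  qed
qed

text \<open>A bimodule map out of A \<epsilon> \<otimes> \<eta> A amounts to an element of
  \<epsilon> M \<eta>: the pure tensor of u and v must go to u x v, and this is balanced because
  scalars act centrally on M.\<close>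

lemma FB_hom:
  assumes M: "bimod A M" and x: "\<And>j. j \<in> J \<Longrightarrow> x j \<in> carrier M"
    "\<And>j. j \<in> J \<Longrightarrow> lact M (\<epsilon> j) (x j) = x j" "\<And>j. j \<in> J \<Longrightarrow> ract M (x j) (\<eta> j) = x j"
  obtains \<phi> where "\<phi> \<in> bimod_hom A FB M" "\<And>j. j \<in> J \<Longrightarrow> \<phi> (gen j) = x j"
proof -
  interpret M: bimod A M by fact
  have UVc: "u \<in> carrier A" "v \<in> carrier A" if "j \<in> J" "u \<in> U j" "v \<in> V j" for j u v
    using that U_iff V_iff by blast+
  have sc: "ract M (lact M (c \<odot> u) y) v = ract M (lact M u y) (c \<odot> v)"
    if "u \<in> carrier A" "v \<in> carrier A" "y \<in> carrier M" for c u v y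
  proof -
    have "lact M (c \<odot> u) y = lact M (u \<otimes> (c \<odot> \<one>)) y"
      unfolding smult_eq_mult'[OF that(1), of c, symmetric] ..
    also have "\<dots> = ract M (lact M u y) (c \<odot> \<one>)"
      using that by (simp only: M.act_mult(1) M.act_scalar M.act_mult(3) smult_closed one_closed)
    finally have "ract M (lact M (c \<odot> u) y) v = ract M (lact M u y) ((c \<odot> \<one>) \<otimes> v)"
      using that by (simp add: M.act_mult(2))
    then show ?thesis unfolding smult_eq_mult[OF that(2), of c, symmetric] .
  qed
  obtain \<phi> where \<phi>: "\<phi> \<in> carrier FB \<rightarrow> carrier M"
    "\<And>x y. x \<in> carrier FB \<Longrightarrow> y \<in> carrier FB \<Longrightarrow> \<phi> (x \<oplus>\<^bsub>FB\<^esub> y) = \<phi> x \<oplus>\<^bsub>M\<^esub> \<phi> y"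
    "\<And>j u v. \<lbrakk>j \<in> J; u \<in> U j; v \<in> V j\<rbrakk> \<Longrightarrow> \<phi> (W j u v) = ract M (lact M u (x j)) v"
    by (rule FB_universal[OF M.abelian_group_axioms, of "\<lambda>j u v. ract M (lact M u (x j)) v"])
      (simp_all only: UVc x sc M.act_closed M.act_mult M.act_add)
  have \<phi>c: "\<phi> z \<in> carrier M" if "z \<in> carrier FB" for z using \<phi>(1) that by (rule funcset_mem)
  have \<phi>0: "\<phi> \<zero>\<^bsub>FB\<^esub> = \<zero>\<^bsub>M\<^esub>"
    using \<phi>(2)[OF FB.zero_closed FB.zero_closed] \<phi>c[OF FB.zero_closed] by simp
  have aU: "a \<otimes> u \<in> U j" if "j \<in> J" "a \<in> carrier A" "u \<in> U j" for a u j
    using tensor.U(4)[OF tensor] that by simp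
  have aV: "v \<otimes> a \<in> V j" if "j \<in> J" "a \<in> carrier A" "v \<in> V j" for a v j
    using tensor.V(4)[OF tensor] that by simp
  have hom: "restrict \<phi> (carrier FB) \<in> bimod_hom A FB M"
  proof (rule FB.hom_restrict[OF \<phi>c \<phi>(2)])
    fix a z assume a: "a \<in> carrier A" and z: "z \<in> carrier FB"
    from z show "\<phi> (lact FB a z) = lact M a (\<phi> z)"
    proof (induction rule: FB_induct)
      case zero then show ?case using a \<phi>0 by simp
    next
      case (gen j u v)
      then show ?case using a x UVc[OF gen] by (simp only: W_act \<phi>(3) aU M.act_mult M.act_closed)
    next
      case (add x y)
      then show ?case using a by (simp add: FB.act_add \<phi>(2) \<phi>c M.act_add)
    qed
    from z show "\<phi> (ract FB z a) = ract M (\<phi> z) a"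
    proof (induction rule: FB_induct)
      case zero then show ?case using a \<phi>0 by simp
    next
      case (gen j u v)
      then show ?case using a x UVc[OF gen] by (simp only: W_act \<phi>(3) aV M.act_mult M.act_closed)
    next
      case (add x y)
      then show ?case using a by (simp add: FB.act_add \<phi>(2) \<phi>c M.act_add)
    qed
  qed
  show thesis
  proof (rule that[OF hom])
    fix j assume j: "j \<in> J"
    show "restrict \<phi> (carrier FB) (gen j) = x j"
      using \<phi>(3)[OF j gen_UV[OF j]] x[OF j] j by simp
  qed
qed

lemma FB_hom_eqI:
  assumes f: "f \<in> bimod_hom A FB M" and g: "g \<in> bimod_hom A FB M" and M: "bimod A M"
    and eq: "\<And>j. j \<in> J \<Longrightarrow> f (gen j) = g (gen j)"
  shows "f = g"
proof (rule bimod_hom_eqI[OF f g])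
  interpret M: bimod A M by fact
  fix x assume "x \<in> carrier FB"
  then show "f x = g x"
  proof (induction rule: FB_induct)
    case zero
    then show ?case using FB.hom_zero[OF f] FB.hom_zero[OF g] M.abelian_group_axioms by simp
  next
    case (gen j u v)
    then have "u \<in> carrier A" "v \<in> carrier A" using U_iff V_iff by blast+
    then show ?case using gen eq by (simp only: W_eq bimod_homD[OF f] bimod_homD[OF g] FB.act_closed gen_closed)
  next
    case (add x y)
    then show ?case by (simp add: bimod_homD(2)[OF f] bimod_homD(2)[OF g])
  qed
qed

lemma FB_hom_sub:
  assumes f: "f \<in> bimod_hom A FB M" and M: "bimod A M" and S: "bimod.sub_bimod A M S"
    and gen: "\<And>j. j \<in> J \<Longrightarrow> f (gen j) \<in> S" and x: "x \<in> carrier FB"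
  shows "f x \<in> S"
  using x
proof (induction rule: FB_induct)
  interpret M: bimod A M by fact
  note S' = S[unfolded M.sub_bimod_def]
  case zero
  then show ?case using FB.hom_zero[OF f M.abelian_group_axioms] S' by simp
next
  interpret M: bimod A M by fact
  note S' = S[unfolded M.sub_bimod_def]
  case (gen j u v)
  then have "u \<in> carrier A" "v \<in> carrier A" using U_iff V_iff by blast+
  then show ?case
    using gen(1) assms(4)[OF gen(1)] S' by (simp only: W_eq[OF gen] bimod_homD[OF f] FB.act_closed gen_closed)
next
  interpret M: bimod A M by fact
  case (add x y)
  then show ?case using S[unfolded M.sub_bimod_def] by (simp add: bimod_homD(2)[OF f])
qed

end

lemma free_family:
  assumes "k_algebra A"
  shows "tensor_family A {..<k::nat} (\<lambda>_. \<one>\<^bsub>A\<^esub>) (\<lambda>_. \<one>\<^bsub>A\<^esub>)"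
    and "(\<lambda>x. x \<otimes>\<^bsub>A\<^esub> \<one>\<^bsub>A\<^esub>) ` carrier A = carrier A" "(\<lambda>x. \<one>\<^bsub>A\<^esub> \<otimes>\<^bsub>A\<^esub> x) ` carrier A = carrier A"
proof -
  interpret A: k_algebra A by fact
  show "tensor_family A {..<k} (\<lambda>_. \<one>\<^bsub>A\<^esub>) (\<lambda>_. \<one>\<^bsub>A\<^esub>)" by unfold_locales simp_all
  show "(\<lambda>x. x \<otimes>\<^bsub>A\<^esub> \<one>\<^bsub>A\<^esub>) ` carrier A = carrier A" "(\<lambda>x. \<one>\<^bsub>A\<^esub> \<otimes>\<^bsub>A\<^esub> x) ` carrier A = carrier A"
    by (simp_all add: image_def)
qed

context tensor_family
begin

text \<open>A \<epsilon> \<otimes> \<eta> A is a direct summand of A \<otimes> A. The inclusion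
  sends its generator to \<epsilon> (1 \<otimes> 1) \<eta>, the projection sends 1 \<otimes> 1 to
  the generator, and the composite fixes the generator since \<epsilon> and \<eta> act on it as the
  identity.\<close>

lemma fg_projective_FB: "fg_projective_bimod A FB"
proof -
  obtain h where h: "bij_betw h {..<card J} J"
    using ex_bij_betw_nat_finite[OF fin] by (auto simp: atLeast0LessThan)
  \<comment> \<open>An enumeration of J and its inverse match the summands with those of a free
    bimodule, which is indexed by an initial segment of the natural numbers.\<close>
  define g where "g = inv_into {..<card J} h"
  have hg: "h (g j) = j" "g j \<in> {..<card J}" if "j \<in> J" for j
    using that h f_inv_into_f[of j h "{..<card J}"] inv_into_into[of j h "{..<card J}"]
    unfolding g_def by (simp_all add: bij_betw_def)
  have hJ: "h n \<in> J" if "n < card J" for n using h that by (auto simp: bij_betw_def)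
  interpret G: tensor_family A "{..<card J}" "\<lambda>_. \<one>" "\<lambda>_. \<one>"
    by (rule free_family[OF k_algebra_axioms])
  have Gb: "bimod A G.FB" and Fb: "bimod A FB" by unfold_locales
  have GF: "G.FB = bimod_sum {..<card J} (\<lambda>_. tensor_bimod A (carrier A) (carrier A))"
    by (simp add: free_family(2,3)[OF k_algebra_axioms])
  obtain s where s: "s \<in> bimod_hom A FB G.FB"
    "\<And>j. j \<in> J \<Longrightarrow> s (gen j) = ract G.FB (lact G.FB (\<epsilon> j) (G.gen (g j))) (\<eta> j)"
  proof (rule FB_hom[OF Gb, of "\<lambda>j. ract G.FB (lact G.FB (\<epsilon> j) (G.gen (g j))) (\<eta> j)"])
    fix j assume j: "j \<in> J"
    note c = idem[OF j] hg(2)[OF j] G.gen_closed[OF hg(2)[OF j]]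
    show "ract G.FB (lact G.FB (\<epsilon> j) (G.gen (g j))) (\<eta> j) \<in> carrier G.FB"
      using c by (simp only: G.FB.act_closed)
    show "lact G.FB (\<epsilon> j) (ract G.FB (lact G.FB (\<epsilon> j) (G.gen (g j))) (\<eta> j)) = ract G.FB (lact G.FB (\<epsilon> j) (G.gen (g j))) (\<eta> j)"
      using c by (simp only: G.FB.act_closed G.FB.act_mult(3)[symmetric] G.FB.act_mult(1)[symmetric])
    show "ract G.FB (ract G.FB (lact G.FB (\<epsilon> j) (G.gen (g j))) (\<eta> j)) (\<eta> j) = ract G.FB (lact G.FB (\<epsilon> j) (G.gen (g j))) (\<eta> j)"
      using c by (simp only: G.FB.act_closed G.FB.act_mult(2)[symmetric])
  qed blast
  obtain p where p: "p \<in> bimod_hom A G.FB FB" "\<And>n. n \<in> {..<card J} \<Longrightarrow> p (G.gen n) = gen (h n)"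
    by (rule G.FB_hom[OF Fb, of "\<lambda>n. gen (h n)"]) (use hJ in \<open>simp_all add: FB.act_one\<close>)
  have eq: "compose (carrier FB) p s = restrict (\<lambda>x. x) (carrier FB)"
  proof (rule FB_hom_eqI[OF FB.hom_compose[OF s(1) p(1)] FB.hom_id Fb])
    fix j assume j: "j \<in> J"
    note c = idem[OF j] hg[OF j] G.gen_closed[OF hg(2)[OF j]]
    have "p (s (gen j)) = ract FB (lact FB (\<epsilon> j) (gen j)) (\<eta> j)"
      using c j by (simp only: s(2) bimod_homD[OF p(1)] p(2) G.FB.act_closed)
    then show "compose (carrier FB) p s (gen j) = restrict (\<lambda>x. x) (carrier FB) (gen j)"
      using j by (simp add: compose_def gen_idem)
  qed
  have ps: "p (s x) = x" if "x \<in> carrier FB" for x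
    using fun_cong[OF eq, of x] unfolding compose_def restrict_apply'[OF that] .
  show ?thesis
    unfolding fg_projective_bimod_def Let_def
    by (rule exI[of _ "card J"], rule bexI[OF _ s(1)[unfolded GF]], rule bexI[OF _ p(1)[unfolded GF]]) (simp add: ps)
qed

end

text \<open>The lifting property of projectives, with control over the values of the lift: they can be
  taken in any sub-bimodule that maps onto the values of the given map.\<close>

lemma projective_lift:
  assumes A: "k_algebra A" and proj: "fg_projective_bimod A P" and P: "bimod A P" and M: "bimod A M" and M': "bimod A M'"
    and \<pi>: "\<pi> \<in> bimod_hom A M M'" and S: "bimod.sub_bimod A M S"
    and f: "f \<in> bimod_hom A P M'" and im: "\<And>x. x \<in> carrier P \<Longrightarrow> f x \<in> \<pi> ` S"
  obtains g where "g \<in> bimod_hom A P M" "\<And>x. x \<in> carrier P \<Longrightarrow> g x \<in> S" "\<And>x. x \<in> carrier P \<Longrightarrow> \<pi> (g x) = f x"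
proof -
  obtain k :: nat where "\<exists>s\<in>bimod_hom A P (bimod_sum {..<k} (\<lambda>_. tensor_bimod A (carrier A) (carrier A))).
      \<exists>p\<in>bimod_hom A (bimod_sum {..<k} (\<lambda>_. tensor_bimod A (carrier A) (carrier A))) P. \<forall>x\<in>carrier P. p (s x) = x"
    using proj unfolding fg_projective_bimod_def Let_def by blast
  interpret P: bimod A P by fact
  interpret M: bimod A M by fact
  interpret M': bimod A M' by fact
  interpret G: tensor_family A "{..<k}" "\<lambda>_. \<one>\<^bsub>A\<^esub>" "\<lambda>_. \<one>\<^bsub>A\<^esub>"
    by (rule free_family[OF A])
  have GF: "G.FB = bimod_sum {..<k} (\<lambda>_. tensor_bimod A (carrier A) (carrier A))"
    by (simp add: free_family(2,3)[OF A])
  from \<open>\<exists>s\<in>_. _\<close> obtain s p where s: "s \<in> bimod_hom A P G.FB" and p: "p \<in> bimod_hom A G.FB P"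
    and ps: "\<And>x. x \<in> carrier P \<Longrightarrow> p (s x) = x"
    unfolding GF by blast
  have "\<forall>j\<in>{..<k}. \<exists>y. y \<in> S \<and> \<pi> y = f (p (G.gen j))"
  proof
    fix j assume "j \<in> {..<k}"
    then have "f (p (G.gen j)) \<in> \<pi> ` S" by (intro im bimod_homD(1)[OF p] G.gen_closed)
    then show "\<exists>y. y \<in> S \<and> \<pi> y = f (p (G.gen j))" by force
  qed
  from bchoice[OF this] obtain y where y: "\<And>j. j \<in> {..<k} \<Longrightarrow> y j \<in> S" "\<And>j. j \<in> {..<k} \<Longrightarrow> \<pi> (y j) = f (p (G.gen j))"
    by blast
  have yM: "y j \<in> carrier M" if "j \<in> {..<k}" for j
    using y(1)[OF that] S unfolding M.sub_bimod_def by blast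
  obtain \<phi> where \<phi>: "\<phi> \<in> bimod_hom A G.FB M" "\<And>j. j \<in> {..<k} \<Longrightarrow> \<phi> (G.gen j) = y j"
    by (rule G.FB_hom[OF M, of y]) (simp_all add: yM)
  have \<phi>S: "\<phi> x \<in> S" if "x \<in> carrier G.FB" for x
    by (rule G.FB_hom_sub[OF \<phi>(1) M S _ that]) (simp only: \<phi>(2) y(1))
  have eq: "compose (carrier G.FB) \<pi> \<phi> = compose (carrier G.FB) f p"
    by (rule G.FB_hom_eqI[OF G.FB.hom_compose[OF \<phi>(1) \<pi>] G.FB.hom_compose[OF p f] M'])
      (simp only: compose_def G.gen_closed restrict_apply if_True \<phi>(2) y(2))
  have c: "\<pi> (\<phi> x) = f (p x)" if "x \<in> carrier G.FB" for x
    using fun_cong[OF eq, of x] unfolding compose_def restrict_apply'[OF that] .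
  define g where "g = compose (carrier P) \<phi> s"
  have g: "g x = \<phi> (s x)" if "x \<in> carrier P" for x using that by (simp add: g_def compose_def)
  show thesis
  proof (rule that[of g])
    show "g \<in> bimod_hom A P M" unfolding g_def by (rule P.hom_compose[OF s \<phi>(1)])
    fix x assume x: "x \<in> carrier P"
    show "g x \<in> S" unfolding g[OF x] by (rule \<phi>S[OF bimod_homD(1)[OF s x]])
    show "\<pi> (g x) = f x" unfolding g[OF x] c[OF bimod_homD(1)[OF s x]] ps[OF x] ..
  qed
qed

section \<open>Cocycles, cohomology groups and the comparison theorem for any projective bimodule
  resolution\<close>

section \<open>The Hochschild cohomology ring of a projective resolution\<close>

lemma finsum_hom:
  assumes G: "abelian_group G" and G': "abelian_group G'" and f: "\<And>i. i \<in> S \<Longrightarrow> f i \<in> carrier G"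
    and cl: "\<And>x. x \<in> carrier G \<Longrightarrow> h x \<in> carrier G'"
    and add: "\<And>x y. x \<in> carrier G \<Longrightarrow> y \<in> carrier G \<Longrightarrow> h (x \<oplus>\<^bsub>G\<^esub> y) = h x \<oplus>\<^bsub>G'\<^esub> h y"
    and S: "finite S"
  shows "h (finsum G f S) = finsum G' (\<lambda>i. h (f i)) S"
proof -
  interpret G: abelian_group G by fact
  interpret G': abelian_group G' by fact
  have "h \<zero>\<^bsub>G\<^esub> = \<zero>\<^bsub>G'\<^esub>"
    using add[OF G.zero_closed G.zero_closed] cl[OF G.zero_closed] by simp
  with S f show ?thesis
  proof (induction S rule: finite_induct)
    case (insert x S)
    then show ?case by (simp add: G.finsum_insert G'.finsum_insert Pi_iff cl add)
  qed simp
qed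

text \<open>Both sides run over all pairs with p + j \<le> n. This exchange of summation is what
  associativity of a graded product comes down to.\<close>

lemma (in abelian_group) finsum_triangle:
  assumes "\<And>p j. p + j \<le> n \<Longrightarrow> F p j \<in> carrier G"
  shows "(\<Oplus>k\<in>{..n::nat}. \<Oplus>p\<in>{..k}. F p (k - p)) = (\<Oplus>p\<in>{..n}. \<Oplus>j\<in>{..n - p}. F p j)"
  using assms
proof (induction n)
  case 0
  then show ?case by simp
next
  case (Suc n)
  have IH: "(\<Oplus>k\<in>{..n}. \<Oplus>p\<in>{..k}. F p (k - p)) = (\<Oplus>p\<in>{..n}. \<Oplus>j\<in>{..n - p}. F p j)"
    using Suc by simp
  have F: "F p j \<in> carrier G" if "p + j \<le> Suc n" for p j using Suc.prems that .
  have c1: "(\<Oplus>p\<in>{..n}. F p (Suc n - p)) \<in> carrier G" "(\<Oplus>p\<in>{..n}. \<Oplus>j\<in>{..n - p}. F p j) \<in> carrier G"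
    using F by (auto intro!: finsum_closed)
  have "(\<Oplus>k\<in>{..Suc n}. \<Oplus>p\<in>{..k}. F p (k - p)) = (\<Oplus>p\<in>{..Suc n}. F p (Suc n - p)) \<oplus> (\<Oplus>k\<in>{..n}. \<Oplus>p\<in>{..k}. F p (k - p))"
    using F by (intro finsum_Suc) (auto intro!: finsum_closed)
  also have "(\<Oplus>p\<in>{..Suc n}. F p (Suc n - p)) = F (Suc n) 0 \<oplus> (\<Oplus>p\<in>{..n}. F p (Suc n - p))"
    using F finsum_Suc[of "\<lambda>p. F p (Suc n - p)" n] by (simp add: Pi_iff)
  finally have l: "(\<Oplus>k\<in>{..Suc n}. \<Oplus>p\<in>{..k}. F p (k - p))
     = F (Suc n) 0 \<oplus> (\<Oplus>p\<in>{..n}. F p (Suc n - p)) \<oplus> (\<Oplus>p\<in>{..n}. \<Oplus>j\<in>{..n - p}. F p j)"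
    unfolding IH .
  have "(\<Oplus>p\<in>{..Suc n}. \<Oplus>j\<in>{..Suc n - p}. F p j) = (\<Oplus>j\<in>{..Suc n - Suc n}. F (Suc n) j) \<oplus> (\<Oplus>p\<in>{..n}. \<Oplus>j\<in>{..Suc n - p}. F p j)"
    using F by (intro finsum_Suc) (auto intro!: finsum_closed)
  also have "(\<Oplus>p\<in>{..n}. \<Oplus>j\<in>{..Suc n - p}. F p j) = (\<Oplus>p\<in>{..n}. F p (Suc n - p) \<oplus> (\<Oplus>j\<in>{..n - p}. F p j))"
  proof (rule finsum_cong')
    show "(\<lambda>p. F p (Suc n - p) \<oplus> (\<Oplus>j\<in>{..n - p}. F p j)) \<in> {..n} \<rightarrow> carrier G"
      using F by (auto intro!: finsum_closed)
    fix p assume p: "p \<in> {..n}"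
    then have "Suc n - p = Suc (n - p)" by auto
    then show "(\<Oplus>j\<in>{..Suc n - p}. F p j) = F p (Suc n - p) \<oplus> (\<Oplus>j\<in>{..n - p}. F p j)"
      using F p by (simp only:) (rule finsum_Suc, auto)
  qed simp
  also have "\<dots> = (\<Oplus>p\<in>{..n}. F p (Suc n - p)) \<oplus> (\<Oplus>p\<in>{..n}. \<Oplus>j\<in>{..n - p}. F p j)"
    using F by (intro finsum_addf) (auto intro!: finsum_closed)
  also have "(\<Oplus>j\<in>{..Suc n - Suc n}. F (Suc n) j) = F (Suc n) 0" using F by (simp add: Pi_iff)
  finally show ?case unfolding l using c1 F[of "Suc n" 0] by (simp add: a_assoc)
qed

locale proj_res = k_algebra A for A :: "('k::field, 'l) module" (structure) +
  fixes C :: "('l, 'x) bimod_complex"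
  assumes res: "projective_bimod_resolution A C"
begin

abbreviation P where "P \<equiv> trm C"
abbreviation d where "d \<equiv> diff C"
abbreviation R where "R \<equiv> regular_bimod A"
abbreviation Z where "Z \<equiv> cocycles A C"
abbreviation B where "B \<equiv> coboundaries A C"
abbreviation H where "H \<equiv> HH_deg A C"
definition cl where "cl n f = B n +>\<^bsub>Z n\<^esub> f"

lemma bimod_P: "bimod A (P n)" and proj_P: "fg_projective_bimod A (P n)"
  and d_hom: "d n \<in> bimod_hom A (P (Suc n)) (P n)" and aug_hom: "aug C \<in> bimod_hom A (P 0) R"
  and aug_surj: "aug C ` carrier (P 0) = carrier A"
  and exact0: "{x \<in> carrier (P 0). aug C x = \<zero>} = d 0 ` carrier (P 1)"
  and exact: "{x \<in> carrier (P (Suc n)). d n x = \<zero>\<^bsub>P n\<^esub>} = d (Suc n) ` carrier (P (Suc (Suc n)))"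
  using res unfolding projective_bimod_resolution_def bimod_def by blast+

sublocale P: bimod A "P n" for n by (rule bimod_P)
sublocale R: bimod A R by (simp add: bimod_def is_bimodule_regular k_algebra_axioms)

lemma R_simps [simp]: "carrier R = carrier A" "\<zero>\<^bsub>R\<^esub> = \<zero>" "x \<oplus>\<^bsub>R\<^esub> y = x \<oplus> y" "lact R = (\<otimes>)" "ract R = (\<otimes>)"
  by (simp_all add: regular_bimod_def)

lemma d_closed [simp]: "x \<in> carrier (P (Suc n)) \<Longrightarrow> d n x \<in> carrier (P n)"
  by (rule bimod_homD(1)[OF d_hom])

lemma dd [simp]: "x \<in> carrier (P (Suc (Suc n))) \<Longrightarrow> d n (d (Suc n) x) = \<zero>\<^bsub>P n\<^esub>"
  using exact[of n] by auto

lemma aug_d [simp]: "x \<in> carrier (P (Suc 0)) \<Longrightarrow> aug C (d 0 x) = \<zero>"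
  using exact0 by auto

lemma hom_P0: "f \<in> bimod_hom A (P n) (P k) \<Longrightarrow> f \<zero>\<^bsub>P n\<^esub> = \<zero>\<^bsub>P k\<^esub>"
  by (rule P.hom_zero[OF _ P.abelian_group_axioms])

lemma hom_R0: "f \<in> bimod_hom A (P n) R \<Longrightarrow> f \<zero>\<^bsub>P n\<^esub> = \<zero>"
  using P.hom_zero[OF _ R.abelian_group_axioms] by simp

lemma Z_iff: "f \<in> carrier (Z n) \<longleftrightarrow> f \<in> bimod_hom A (P n) R \<and> (\<forall>x\<in>carrier (P (Suc n)). f (d n x) = \<zero>)"
  by (auto simp: cocycles_def cochains_def)

lemma Z_simps: "f \<oplus>\<^bsub>Z n\<^esub> g = (\<lambda>x\<in>carrier (P n). f x \<oplus> g x)" "\<zero>\<^bsub>Z n\<^esub> = (\<lambda>x\<in>carrier (P n). \<zero>)"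
  "c \<odot>\<^bsub>Z n\<^esub> f = (\<lambda>x\<in>carrier (P n). c \<odot> f x)"
  by (simp_all add: cocycles_def)

lemma Z_hom: "f \<in> carrier (Z n) \<Longrightarrow> f \<in> bimod_hom A (P n) R"
  by (simp add: Z_iff)

lemma Z_val: "f \<in> carrier (Z n) \<Longrightarrow> x \<in> carrier (P n) \<Longrightarrow> f x \<in> carrier A"
  using bimod_homD(1)[OF Z_hom] by fastforce

lemma Z_d: "f \<in> carrier (Z n) \<Longrightarrow> x \<in> carrier (P (Suc n)) \<Longrightarrow> f (d n x) = \<zero>"
  by (simp add: Z_iff)

lemma Z_eqI: "f \<in> carrier (Z n) \<Longrightarrow> g \<in> carrier (Z n) \<Longrightarrow> (\<And>x. x \<in> carrier (P n) \<Longrightarrow> f x = g x) \<Longrightarrow> f = g"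
  using bimod_hom_eqI[OF Z_hom Z_hom] by blast

lemma Z_closed:
  "f \<in> carrier (Z n) \<Longrightarrow> g \<in> carrier (Z n) \<Longrightarrow> f \<oplus>\<^bsub>Z n\<^esub> g \<in> carrier (Z n)"
  "\<zero>\<^bsub>Z n\<^esub> \<in> carrier (Z n)"
  "f \<in> carrier (Z n) \<Longrightarrow> c \<odot>\<^bsub>Z n\<^esub> f \<in> carrier (Z n)"
  "f \<in> carrier (Z n) \<Longrightarrow> (\<lambda>x\<in>carrier (P n). \<ominus> f x) \<in> carrier (Z n)"
proof -
  have m: "\<ominus>\<^bsub>R\<^esub> x = \<ominus> x" for x by (simp add: a_inv_def m_inv_def)
  show "f \<oplus>\<^bsub>Z n\<^esub> g \<in> carrier (Z n)" if "f \<in> carrier (Z n)" "g \<in> carrier (Z n)"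
    unfolding Z_iff Z_simps
    using P.hom_add[OF R.bimod_axioms Z_hom[OF that(1)] Z_hom[OF that(2)]] Z_d[OF that(1)] Z_d[OF that(2)] by simp
  show "\<zero>\<^bsub>Z n\<^esub> \<in> carrier (Z n)"
    unfolding Z_iff Z_simps using P.hom_const_zero[OF R.bimod_axioms] by simp
  show "(\<lambda>x\<in>carrier (P n). \<ominus> f x) \<in> carrier (Z n)" if "f \<in> carrier (Z n)"
    unfolding Z_iff using P.hom_uminus[OF R.bimod_axioms Z_hom[OF that]] Z_d[OF that] by (simp add: m)
  show "c \<odot>\<^bsub>Z n\<^esub> f \<in> carrier (Z n)" if f: "f \<in> carrier (Z n)"
  proof -
    have "(\<lambda>x\<in>carrier (P n). (c \<odot> \<one>) \<otimes> f x) = (\<lambda>x\<in>carrier (P n). c \<odot> f x)"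
      by (intro restrict_ext) (simp add: smult_mult_l Z_val[OF f])
    then show ?thesis
      unfolding Z_iff Z_simps using P.hom_scale[OF R.bimod_axioms Z_hom[OF f] k_algebra_axioms, of c] Z_d[OF f] by simp
  qed
qed

lemma Z_group: "abelian_group (Z n)"
proof (rule abelian_groupI)
  fix f g h assume f: "f \<in> carrier (Z n)" and g: "g \<in> carrier (Z n)"
  show "f \<oplus>\<^bsub>Z n\<^esub> g \<in> carrier (Z n)" using f g by (rule Z_closed)
  show "f \<oplus>\<^bsub>Z n\<^esub> g = g \<oplus>\<^bsub>Z n\<^esub> f"
    unfolding Z_simps using f g by (intro restrict_ext) (simp add: Z_val a_comm)
  assume h: "h \<in> carrier (Z n)"
  show "f \<oplus>\<^bsub>Z n\<^esub> g \<oplus>\<^bsub>Z n\<^esub> h = f \<oplus>\<^bsub>Z n\<^esub> (g \<oplus>\<^bsub>Z n\<^esub> h)"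
    unfolding Z_simps using f g h by (intro restrict_ext) (simp add: Z_val a_assoc)
next
  show "\<zero>\<^bsub>Z n\<^esub> \<in> carrier (Z n)" by (rule Z_closed)
  fix f assume f: "f \<in> carrier (Z n)"
  show "\<zero>\<^bsub>Z n\<^esub> \<oplus>\<^bsub>Z n\<^esub> f = f"
    using Z_closed(1)[OF Z_closed(2) f] f by (rule Z_eqI) (simp add: Z_simps Z_val[OF f])
  show "\<exists>y\<in>carrier (Z n). y \<oplus>\<^bsub>Z n\<^esub> f = \<zero>\<^bsub>Z n\<^esub>"
  proof (rule bexI[OF _ Z_closed(4)[OF f]])
    show "(\<lambda>x\<in>carrier (P n). \<ominus> f x) \<oplus>\<^bsub>Z n\<^esub> f = \<zero>\<^bsub>Z n\<^esub>"
      unfolding Z_simps by (intro restrict_ext) (simp add: Z_val[OF f] l_neg)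
  qed
qed

sublocale Z: abelian_group "Z n" for n by (rule Z_group)

lemma B_I:
  assumes "u \<in> bimod_hom A (P n) R" "f \<in> extensional (carrier (P (Suc n)))" "\<And>x. x \<in> carrier (P (Suc n)) \<Longrightarrow> f x = u (d n x)"
  shows "f \<in> B (Suc n)"
proof -
  have "f = compose (carrier (P (Suc n))) u (d n)"
    using assms(2,3) by (intro extensionalityI[OF assms(2)]) (auto simp: compose_def)
  then show ?thesis using assms(1) by (simp add: cochains_def)
qed

lemma B_E:
  assumes "b \<in> B (Suc n)"
  obtains u where "u \<in> bimod_hom A (P n) R" "\<And>x. x \<in> carrier (P (Suc n)) \<Longrightarrow> b x = u (d n x)"
  using assms by (auto simp: cochains_def compose_def)

lemma B_0: "b \<in> B 0 \<longleftrightarrow> b = \<zero>\<^bsub>Z 0\<^esub>" by simp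

lemma B_sub: "B n \<subseteq> carrier (Z n)"
proof (cases n)
  case 0 then show ?thesis using Z_closed(2) by simp
next
  case (Suc k)
  show ?thesis
  proof
    fix b assume b: "b \<in> B n"
    then have "b \<in> (\<lambda>g. compose (carrier (P (Suc k))) g (d k)) ` bimod_hom A (P k) R" by (simp add: Suc cochains_def)
    then obtain u where u: "u \<in> bimod_hom A (P k) R" "b = compose (carrier (P (Suc k))) u (d k)" by blast
    show "b \<in> carrier (Z n)"
      unfolding Z_iff Suc u(2) using P.hom_compose[OF d_hom u(1)] hom_R0[OF u(1)] by (simp add: compose_def)
  qed
qed

lemma B_subgroup: "abelian_subgroup (B n) (Z n)"
proof (rule abelian_subgroupI3[OF _ Z_group], rule additive_subgroupI, rule subgroup.intro)
  show "B n \<subseteq> carrier (add_monoid (Z n))" using B_sub by simp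
  have inv: "\<ominus>\<^bsub>Z n\<^esub> f = (\<lambda>x\<in>carrier (P n). \<ominus> f x)" if "f \<in> carrier (Z n)" for f
  proof (rule Z.minus_equality)
    show "(\<lambda>x\<in>carrier (P n). \<ominus> f x) \<oplus>\<^bsub>Z n\<^esub> f = \<zero>\<^bsub>Z n\<^esub>"
      unfolding Z_simps by (intro restrict_ext) (simp add: Z_val[OF that] l_neg)
  qed (use that Z_closed in auto)
  show "x \<otimes>\<^bsub>add_monoid (Z n)\<^esub> y \<in> B n" if x: "x \<in> B n" and y: "y \<in> B n" for x y
  proof (cases n)
    case 0 then show ?thesis using x y Z.l_zero[OF Z.zero_closed] by simp
  next
    case (Suc k)
    obtain u where u: "u \<in> bimod_hom A (P k) R" "\<And>z. z \<in> carrier (P (Suc k)) \<Longrightarrow> x z = u (d k z)"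
      using x unfolding Suc by (rule B_E) (rule that)
    obtain v where v: "v \<in> bimod_hom A (P k) R" "\<And>z. z \<in> carrier (P (Suc k)) \<Longrightarrow> y z = v (d k z)"
      using y unfolding Suc by (rule B_E) (rule that)
    show ?thesis unfolding Suc
      by (rule B_I[OF P.hom_add[OF R.bimod_axioms u(1) v(1)]]) (simp_all add: Z_simps u v)
  qed
  show "\<one>\<^bsub>add_monoid (Z n)\<^esub> \<in> B n"
  proof (cases n)
    case (Suc k)
    show ?thesis unfolding Suc
      by (rule B_I[OF P.hom_const_zero[OF R.bimod_axioms]]) (simp_all add: Z_simps)
  qed simp
  show "inv\<^bsub>add_monoid (Z n)\<^esub> x \<in> B n" if x: "x \<in> B n" for x
  proof (cases n)
    case 0 then show ?thesis using x by (simp add: a_inv_def[symmetric])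
  next
    case (Suc k)
    obtain u where u: "u \<in> bimod_hom A (P k) R" "\<And>z. z \<in> carrier (P (Suc k)) \<Longrightarrow> x z = u (d k z)"
      using x unfolding Suc by (rule B_E) (rule that)
    have m: "\<ominus>\<^bsub>R\<^esub> x = \<ominus> x" for x by (simp add: a_inv_def m_inv_def)
    have "(\<lambda>x\<in>carrier (P k). \<ominus> u x) \<in> bimod_hom A (P k) R"
      using P.hom_uminus[OF R.bimod_axioms u(1)] by (simp add: m)
    then have "(\<lambda>z\<in>carrier (P n). \<ominus> x z) \<in> B n" unfolding Suc by (rule B_I) (simp_all add: u)
    moreover have "x \<in> carrier (Z n)" using x B_sub by blast
    ultimately show ?thesis unfolding a_inv_def[symmetric] using inv[of x] by simp
  qed
qed

sublocale B: abelian_subgroup "B n" "Z n" for n by (rule B_subgroup)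

lemma H_carrier: "carrier (H n) = cl n ` carrier (Z n)"
  by (auto simp: HH_deg_def alg_quot_def A_RCOSETS_def' cl_def)

lemma cl_closed: "f \<in> carrier (Z n) \<Longrightarrow> cl n f \<in> carrier (H n)"
  by (simp add: H_carrier)

lemma H_cases: assumes "x \<in> carrier (H n)" obtains f where "f \<in> carrier (Z n)" "x = cl n f"
  using assms unfolding H_carrier by (elim imageE)

lemma cl_add: "f \<in> carrier (Z n) \<Longrightarrow> g \<in> carrier (Z n) \<Longrightarrow> cl n f \<oplus>\<^bsub>H n\<^esub> cl n g = cl n (f \<oplus>\<^bsub>Z n\<^esub> g)"
  by (simp add: HH_deg_def alg_quot_def cl_def B.a_rcos_sum)

lemma H_zero: "\<zero>\<^bsub>H n\<^esub> = cl n \<zero>\<^bsub>Z n\<^esub>"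
  by (simp add: HH_deg_def alg_quot_def cl_def B.a_subset)

lemma cl_eqI: "f \<in> carrier (Z n) \<Longrightarrow> b \<in> B n \<Longrightarrow> cl n (b \<oplus>\<^bsub>Z n\<^esub> f) = cl n f"
proof -
  assume f: "f \<in> carrier (Z n)" and b: "b \<in> B n"
  have "b \<oplus>\<^bsub>Z n\<^esub> f \<in> B n +>\<^bsub>Z n\<^esub> f" using Z.a_rcosI[OF b B.a_subset f] .
  then show ?thesis unfolding cl_def using Z.a_repr_independence[OF _ f B.a_subgroup] by simp
qed

lemma cl_zero: "b \<in> B n \<Longrightarrow> cl n b = \<zero>\<^bsub>H n\<^esub>"
  using cl_eqI[OF Z.zero_closed, of b n] B_sub by (auto simp: H_zero)

lemma cl_mem: assumes "f' \<in> cl n f" obtains b where "b \<in> B n" "f' = b \<oplus>\<^bsub>Z n\<^esub> f"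
  using assms by (auto simp: cl_def a_r_coset_def')

lemma cl_self: "f \<in> carrier (Z n) \<Longrightarrow> f \<in> cl n f"
  unfolding cl_def by (rule B.a_rcos_self)

lemma H_group: "abelian_group (H n)"
proof -
  have "comm_group (Z n A_Mod B n)" by (rule B.a_factorgroup_is_comm_group)
  then show ?thesis
    by (intro comm_group_abelian_groupI) (erule comm_group_cong; simp add: HH_deg_def alg_quot_def A_FactGroup_def')
qed

sublocale H: abelian_group "H n" for n by (rule H_group)

lemma cl_smult: assumes f: "f \<in> carrier (Z n)" shows "c \<odot>\<^bsub>H n\<^esub> cl n f = cl n (c \<odot>\<^bsub>Z n\<^esub> f)"
  unfolding HH_deg_def cl_def
proof (rule alg_quot_smult[OF B_subgroup])
  show "c \<odot>\<^bsub>Z n\<^esub> b \<in> B n" if b: "b \<in> B n" for b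
  proof (cases n)
    case 0 then show ?thesis using b by (auto simp: Z_simps intro!: restrict_ext)
  next
    case (Suc k)
    obtain u where u: "u \<in> bimod_hom A (P k) R" "\<And>z. z \<in> carrier (P (Suc k)) \<Longrightarrow> b z = u (d k z)"
      using b unfolding Suc by (rule B_E) (rule that)
    have uA: "u y \<in> carrier A" if "y \<in> carrier (P k)" for y using bimod_homD(1)[OF u(1) that] by simp
    show ?thesis unfolding Suc
      by (rule B_I[OF P.hom_scale[OF R.bimod_axioms u(1) k_algebra_axioms, of c]]) (simp_all add: Z_simps u smult_mult_l uA)
  qed
  show "x \<in> carrier (Z n) \<Longrightarrow> c \<odot>\<^bsub>Z n\<^esub> x \<in> carrier (Z n)" for x by (rule Z_closed)
  show "c \<odot>\<^bsub>Z n\<^esub> (x \<oplus>\<^bsub>Z n\<^esub> y) = c \<odot>\<^bsub>Z n\<^esub> x \<oplus>\<^bsub>Z n\<^esub> c \<odot>\<^bsub>Z n\<^esub> y" if "x \<in> carrier (Z n)" "y \<in> carrier (Z n)" for x y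
    unfolding Z_simps by (intro restrict_ext) (simp add: Z_val[OF that(1)] Z_val[OF that(2)] smult_r_distr)
qed (rule f)

text \<open>Liftings and homotopies\<close>

definition cyc where "cyc j y \<longleftrightarrow> (case j of 0 \<Rightarrow> aug C y = \<zero> | Suc i \<Rightarrow> d i y = \<zero>\<^bsub>P i\<^esub>)"

lemma cyc_exact: "y \<in> carrier (P j) \<Longrightarrow> cyc j y \<Longrightarrow> y \<in> d j ` carrier (P (Suc j))"
  using exact0 exact[of "j - 1"] by (cases j) (auto simp: cyc_def)

text \<open>The comparison theorem with control over the values: projectivity gives each L j, and
  the lifts stay in the sub-bimodules \<open>S j\<close> as soon as every cycle in
  \<open>S j\<close> is the boundary of an element of \<open>S (Suc j)\<close>. Besides the whole
  resolution, it is applied to the sub-bimodules P rad.\<close>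

lemma lifting_exists_in:
  assumes g: "g \<in> carrier (Z q)" and S: "\<And>j. bimod.sub_bimod A (P j) (S j)"
    and base: "\<And>x. x \<in> carrier (P q) \<Longrightarrow> g x \<in> aug C ` S 0"
    and ex: "\<And>j y. y \<in> S j \<Longrightarrow> cyc j y \<Longrightarrow> y \<in> d j ` S (Suc j)"
  obtains L where "is_lifting A C q g L" "\<And>j x. x \<in> carrier (P (q + j)) \<Longrightarrow> L j x \<in> S j"
proof -
  \<comment> \<open>The invariant records that f composed with the differential takes values in
    cycles; this is exactly what allows the next lift to be chosen.\<close>
  define Pr where "Pr j f \<longleftrightarrow> f \<in> bimod_hom A (P (q + j)) (P j) \<and> (\<forall>x\<in>carrier (P (q + j)). f x \<in> S j)
     \<and> (\<forall>x\<in>carrier (P (Suc (q + j))). cyc j (f (d (q + j) x))) \<and> (j = 0 \<longrightarrow> (\<forall>x\<in>carrier (P q). aug C (f x) = g x))" for j f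
  have "\<exists>L. \<forall>j. Pr j (L j) \<and> (\<forall>x\<in>carrier (P (q + Suc j)). d j (L (Suc j) x) = L j (d (q + j) x))"
  proof (rule dependent_nat_choice)
    obtain f where f: "f \<in> bimod_hom A (P q) (P 0)" "\<And>x. x \<in> carrier (P q) \<Longrightarrow> f x \<in> S 0" "\<And>x. x \<in> carrier (P q) \<Longrightarrow> aug C (f x) = g x"
      using projective_lift[OF k_algebra_axioms proj_P bimod_P bimod_P R.bimod_axioms aug_hom S Z_hom[OF g] base] by blast
    then show "\<exists>f. Pr 0 f" using Z_d[OF g] by (intro exI[of _ f]) (simp add: Pr_def cyc_def)
  next
    fix f j assume f: "Pr j f"
    then have fh: "f \<in> bimod_hom A (P (q + j)) (P j)" by (simp add: Pr_def)
    have comp: "compose (carrier (P (Suc (q + j)))) f (d (q + j)) \<in> bimod_hom A (P (Suc (q + j))) (P j)"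
      by (rule P.hom_compose[OF d_hom fh])
    have im: "compose (carrier (P (Suc (q + j)))) f (d (q + j)) x \<in> d j ` S (Suc j)" if "x \<in> carrier (P (Suc (q + j)))" for x
      using f that by (simp add: compose_def Pr_def ex)
    obtain f' where f': "f' \<in> bimod_hom A (P (Suc (q + j))) (P (Suc j))" "\<And>x. x \<in> carrier (P (Suc (q + j))) \<Longrightarrow> f' x \<in> S (Suc j)"
      "\<And>x. x \<in> carrier (P (Suc (q + j))) \<Longrightarrow> d j (f' x) = compose (carrier (P (Suc (q + j)))) f (d (q + j)) x"
      using projective_lift[OF k_algebra_axioms proj_P bimod_P bimod_P bimod_P d_hom S comp im] by blast
    then have f'': "d j (f' x) = f (d (q + j) x)" if "x \<in> carrier (P (Suc (q + j)))" for x
      using that by (simp add: compose_def)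
    then show "\<exists>f'. Pr (Suc j) f' \<and> (\<forall>x\<in>carrier (P (q + Suc j)). d j (f' x) = f (d (q + j) x))"
      using f' hom_P0[OF fh] by (intro exI[of _ f']) (simp add: Pr_def cyc_def)
  qed
  then obtain L where L: "\<And>j. Pr j (L j)" "\<And>j x. x \<in> carrier (P (q + Suc j)) \<Longrightarrow> d j (L (Suc j) x) = L j (d (q + j) x)"
    by blast
  show thesis
  proof (rule that[of L])
    show "is_lifting A C q g L" using L L(1)[of 0] unfolding is_lifting_def Pr_def by simp
    show "L j x \<in> S j" if "x \<in> carrier (P (q + j))" for j x using L(1)[of j] that by (simp add: Pr_def)
  qed
qed

lemma lifting_exists:
  assumes g: "g \<in> carrier (Z q)" obtains L where "is_lifting A C q g L"
proof (rule lifting_exists_in[OF g P.sub_bimod_carrier])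
  show "g x \<in> aug C ` carrier (P 0)" if "x \<in> carrier (P q)" for x
    using Z_val[OF g that] by (simp add: aug_surj)
qed (rule cyc_exact, assumption+)

lemma liftD:
  assumes "is_lifting A C q g L"
  shows "L j \<in> bimod_hom A (P (q + j)) (P j)" "x \<in> carrier (P q) \<Longrightarrow> aug C (L 0 x) = g x"
    "x \<in> carrier (P (Suc (q + j))) \<Longrightarrow> d j (L (Suc j) x) = L j (d (q + j) x)"
    "x \<in> carrier (P (q + j)) \<Longrightarrow> L j x \<in> carrier (P j)"
  using assms bimod_homD(1)[of "L j" A "P (q + j)" "P j" x] unfolding is_lifting_def by simp_all

lemma liftI:
  assumes "\<And>j. L j \<in> bimod_hom A (P (q + j)) (P j)" "\<And>x. x \<in> carrier (P q) \<Longrightarrow> aug C (L 0 x) = g x"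
    "\<And>j x. x \<in> carrier (P (Suc (q + j))) \<Longrightarrow> d j (L (Suc j) x) = L j (d (q + j) x)"
  shows "is_lifting A C q g L"
  using assms unfolding is_lifting_def by simp

abbreviation cmp where "cmp p q f L \<equiv> compose (carrier (P (p + q))) f (L p)"

lemma cmp_val: "x \<in> carrier (P (p + q)) \<Longrightarrow> cmp p q f L x = f (L p x)" by (simp add: compose_def)

lemma cmp_Z: assumes "f \<in> carrier (Z p)" "is_lifting A C q g L" shows "cmp p q f L \<in> carrier (Z (p + q))"
proof -
  have "f (L p (d (p + q) x)) = \<zero>" if "x \<in> carrier (P (Suc (p + q)))" for x
    using liftD(3)[OF assms(2), of x p, symmetric] liftD(4)[OF assms(2), of x "Suc p"] Z_d[OF assms(1)] that
    by (simp add: add.commute)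
  then show ?thesis
    using P.hom_compose[OF liftD(1)[OF assms(2), of p] Z_hom[OF assms(1)]]
    by (simp add: Z_iff compose_def add.commute)
qed

lemma lift_add:
  assumes "is_lifting A C q g L" "is_lifting A C q g' L'"
  shows "is_lifting A C q (g \<oplus>\<^bsub>Z q\<^esub> g') (\<lambda>j. \<lambda>x\<in>carrier (P (q + j)). L j x \<oplus>\<^bsub>P j\<^esub> L' j x)"
  using liftD[OF assms(1)] liftD[OF assms(2)]
  by (intro liftI P.hom_add[OF bimod_P])
    (simp_all add: bimod_homD(2)[OF aug_hom] bimod_homD(2)[OF d_hom] Z_simps)

lemma lift_diff:
  assumes "is_lifting A C q g L" "is_lifting A C q g' L'" "g' \<in> carrier (Z q)" "g'' \<in> carrier (Z q)" "g = g'' \<oplus>\<^bsub>Z q\<^esub> g'"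
  shows "is_lifting A C q g'' (\<lambda>j. \<lambda>x\<in>carrier (P (q + j)). L j x \<ominus>\<^bsub>P j\<^esub> L' j x)"
proof -
  have m: "\<ominus>\<^bsub>R\<^esub> x = \<ominus> x" for x by (simp add: a_inv_def m_inv_def)
  have g: "g x = g'' x \<oplus> g' x" if "x \<in> carrier (P q)" for x using that by (simp add: assms(5) Z_simps)
  have au: "aug C (\<ominus>\<^bsub>P 0\<^esub> x) = \<ominus> aug C x" if "x \<in> carrier (P 0)" for x
    using P.hom_minus[OF aug_hom R.abelian_group_axioms that] by (simp add: m)
  have du: "d j (\<ominus>\<^bsub>P (Suc j)\<^esub> x) = \<ominus>\<^bsub>P j\<^esub> d j x" if "x \<in> carrier (P (Suc j))" for j x
    using P.hom_minus[OF d_hom P.abelian_group_axioms that] .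
  show ?thesis
    using liftD[OF assms(1)] liftD[OF assms(2)]
    by (intro liftI P.hom_diff[OF bimod_P])
      (simp_all add: a_minus_def bimod_homD(2)[OF aug_hom] bimod_homD(2)[OF d_hom] au du g
        Z_val[OF assms(3)] Z_val[OF assms(4)] a_assoc r_neg)
qed

lemma lift_smult:
  assumes "is_lifting A C q g L" "g \<in> carrier (Z q)"
  shows "is_lifting A C q (c \<odot>\<^bsub>Z q\<^esub> g) (\<lambda>j. \<lambda>x\<in>carrier (P (q + j)). lact (P j) (c \<odot> \<one>) (L j x))"
  using liftD[OF assms(1)]
  by (intro liftI P.hom_scale[OF bimod_P _ k_algebra_axioms])
    (simp_all add: bimod_homD(3)[OF aug_hom] bimod_homD(3)[OF d_hom] Z_simps smult_mult_l Z_val[OF assms(2)])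

text \<open>If b = u d then b L = u d L = (u L) d, since L commutes with the differentials.\<close>

lemma cmp_B:
  assumes b: "b \<in> B p" and L: "is_lifting A C q g L"
  shows "cmp p q b L \<in> B (p + q)"
proof (cases p)
  case 0
  have "cmp 0 q b L = \<zero>\<^bsub>Z q\<^esub>"
    using b liftD(4)[OF L, of _ 0] by (auto simp: 0 Z_simps compose_def intro!: restrict_ext)
  then show ?thesis using B.zero_closed by (simp add: 0)
next
  case (Suc k)
  obtain u where u: "u \<in> bimod_hom A (P k) R" "\<And>z. z \<in> carrier (P (Suc k)) \<Longrightarrow> b z = u (d k z)"
    using b unfolding Suc by (rule B_E) (rule that)
  have "cmp p q b L \<in> B (Suc (k + q))"
  proof (rule B_I)
    show "compose (carrier (P (k + q))) u (L k) \<in> bimod_hom A (P (k + q)) R"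
      using P.hom_compose[OF liftD(1)[OF L, of k] u(1)] by (simp add: add.commute)
    show "cmp p q b L \<in> extensional (carrier (P (Suc (k + q))))" by (simp add: Suc)
    show "cmp p q b L x = compose (carrier (P (k + q))) u (L k) (d (k + q) x)" if "x \<in> carrier (P (Suc (k + q)))" for x
      using that u(2) liftD(3)[OF L, of x k] liftD(4)[OF L, of x "Suc k"] by (simp add: Suc compose_def add.commute)
  qed
  then show ?thesis by (simp add: Suc)
qed

end

section \<open>The Yoneda product on classes\<close>

context proj_res
begin

lemma lift_P:
  assumes "bimod A M'" "\<pi> \<in> bimod_hom A (P k) M'" "f \<in> bimod_hom A (P n) M'"
    and "\<And>x. x \<in> carrier (P n) \<Longrightarrow> f x \<in> \<pi> ` carrier (P k)"
  shows "\<exists>g. g \<in> bimod_hom A (P n) (P k) \<and> (\<forall>x\<in>carrier (P n). \<pi> (g x) = f x)"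
  by (rule projective_lift[OF k_algebra_axioms proj_P bimod_P bimod_P assms(1,2) P.sub_bimod_carrier assms(3,4)]) blast+

text \<open>A lifting of a coboundary is null-homotopic. With a homotopy s, the composite f L equals
  f s d in positive degree p, because f kills boundaries, and so it is a coboundary. In degree p = 0
  the correction D below takes the place of s d.\<close>

lemma cmp_null:
  assumes f: "f \<in> carrier (Z p)" and g: "g \<in> B q" and L: "is_lifting A C q g L"
  shows "cmp p q f L \<in> B (p + q)"
proof -
  note Lh = liftD(1)[OF L] and La = liftD(2)[OF L] and Ld = liftD(3)[OF L] and Lc = liftD(4)[OF L]
  have m: "\<ominus>\<^bsub>R\<^esub> x = \<ominus> x" for x by (simp add: a_inv_def m_inv_def)
  have neg: "h (\<ominus>\<^bsub>P j\<^esub> x) = \<ominus>\<^bsub>P k\<^esub> h x" if "h \<in> bimod_hom A (P j) (P k)" "x \<in> carrier (P j)" for h j k x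
    using P.hom_minus[OF that(1) P.abelian_group_axioms that(2)] .
  have augneg: "aug C (\<ominus>\<^bsub>P 0\<^esub> x) = \<ominus> aug C x" if "x \<in> carrier (P 0)" for x
    using P.hom_minus[OF aug_hom R.abelian_group_axioms that] by (simp add: m)
  \<comment> \<open>D is the bottom term of the homotopy composed with d: if g = u d and s lifts u
    through the augmentation, then D = s d has the same augmentation as L 0, and f D = (f s) d is a
    coboundary. For q = 0 the only coboundary is zero and D = 0.\<close>
  obtain D where D: "D \<in> bimod_hom A (P q) (P 0)" "\<And>x. x \<in> carrier (P q) \<Longrightarrow> aug C (D x) = g x"
    "\<And>x. x \<in> carrier (P (Suc q)) \<Longrightarrow> D (d q x) = \<zero>\<^bsub>P 0\<^esub>"
    "p = 0 \<longrightarrow> compose (carrier (P q)) f D \<in> B q"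
  proof (cases q)
    case 0
    have z: "g = \<zero>\<^bsub>Z 0\<^esub>" using g 0 by simp
    show thesis
    proof (rule that[of "\<lambda>x\<in>carrier (P q). \<zero>\<^bsub>P 0\<^esub>"])
      show "(\<lambda>x\<in>carrier (P q). \<zero>\<^bsub>P 0\<^esub>) \<in> bimod_hom A (P q) (P 0)" by (rule P.hom_const_zero[OF bimod_P])
      have "compose (carrier (P q)) f (\<lambda>x\<in>carrier (P q). \<zero>\<^bsub>P 0\<^esub>) = \<zero>\<^bsub>Z 0\<^esub>" if "p = 0"
        using hom_R0[OF Z_hom[OF f]] that by (auto simp: 0 Z_simps compose_def intro!: restrict_ext)
      then show "p = 0 \<longrightarrow> compose (carrier (P q)) f (\<lambda>x\<in>carrier (P q). \<zero>\<^bsub>P 0\<^esub>) \<in> B q" by (simp add: 0)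
    qed (simp_all add: z 0 Z_simps hom_R0[OF aug_hom])
  next
    case (Suc q')
    obtain u where u: "u \<in> bimod_hom A (P q') R" "\<And>z. z \<in> carrier (P (Suc q')) \<Longrightarrow> g z = u (d q' z)"
      using g unfolding Suc by (rule B_E) (rule that)
    have uc: "u x \<in> aug C ` carrier (P 0)" if "x \<in> carrier (P q')" for x
      using bimod_homD(1)[OF u(1) that] by (simp add: aug_surj)
    obtain s where s: "s \<in> bimod_hom A (P q') (P 0)" "\<And>x. x \<in> carrier (P q') \<Longrightarrow> aug C (s x) = u x"
      using lift_P[OF R.bimod_axioms aug_hom u(1) uc] by blast
    show thesis
    proof (rule that[of "compose (carrier (P q)) s (d q')"])
      show "compose (carrier (P q)) s (d q') \<in> bimod_hom A (P q) (P 0)"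
        unfolding Suc by (rule P.hom_compose[OF d_hom s(1)])
      show "aug C (compose (carrier (P q)) s (d q') x) = g x" if "x \<in> carrier (P q)" for x
        using that by (simp add: Suc compose_def s u)
      show "compose (carrier (P q)) s (d q') (d q x) = \<zero>\<^bsub>P 0\<^esub>" if "x \<in> carrier (P (Suc q))" for x
        using that by (simp add: Suc compose_def hom_P0[OF s(1)])
      show "p = 0 \<longrightarrow> compose (carrier (P q)) f (compose (carrier (P q)) s (d q')) \<in> B q"
      proof
        assume "p = 0"
        then have "compose (carrier (P q')) f s \<in> bimod_hom A (P q') R"
          using P.hom_compose[OF s(1), of f R] Z_hom[OF f] by simp
        then show "compose (carrier (P q)) f (compose (carrier (P q)) s (d q')) \<in> B q"
          unfolding Suc by (rule B_I) (simp_all add: compose_def)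
      qed
    qed
  qed
  \<comment> \<open>The condition d s d = L d makes L (Suc j) - s d a cycle, so that the next term
    of the homotopy exists.\<close>
  define Pr where "Pr j s \<longleftrightarrow> s \<in> bimod_hom A (P (q + j)) (P (Suc j))
     \<and> (\<forall>x\<in>carrier (P (Suc (q + j))). d j (s (d (q + j) x)) = L j (d (q + j) x))
     \<and> (j = 0 \<longrightarrow> (\<forall>x\<in>carrier (P q). d 0 (s x) = L 0 x \<ominus>\<^bsub>P 0\<^esub> D x))" for j s
  have "\<exists>s. \<forall>j. Pr j (s j) \<and> (\<forall>x\<in>carrier (P (Suc (q + j))). d (Suc j) (s (Suc j) x) = L (Suc j) x \<ominus>\<^bsub>P (Suc j)\<^esub> s j (d (q + j) x))"
  proof (rule dependent_nat_choice)
    have t: "(\<lambda>x\<in>carrier (P q). L 0 x \<ominus>\<^bsub>P 0\<^esub> D x) \<in> bimod_hom A (P q) (P 0)"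
      using P.hom_diff[OF bimod_P _ D(1), of "L 0"] Lh[of 0] by simp
    have im: "(\<lambda>x\<in>carrier (P q). L 0 x \<ominus>\<^bsub>P 0\<^esub> D x) x \<in> d 0 ` carrier (P (Suc 0))" if x: "x \<in> carrier (P q)" for x
    proof (rule cyc_exact)
      have c: "L 0 x \<in> carrier (P 0)" "D x \<in> carrier (P 0)" "g x \<in> carrier A"
        using Lc[of x 0] bimod_homD(1)[OF D(1)] x Z_val[OF subsetD[OF B_sub g]] by auto
      then show "(\<lambda>x\<in>carrier (P q). L 0 x \<ominus>\<^bsub>P 0\<^esub> D x) x \<in> carrier (P 0)" using x by simp
      show "cyc 0 ((\<lambda>x\<in>carrier (P q). L 0 x \<ominus>\<^bsub>P 0\<^esub> D x) x)"
        using x c La[OF x] D(2)[OF x] by (simp add: cyc_def a_minus_def bimod_homD(2)[OF aug_hom] augneg r_neg)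
    qed
    obtain s where s: "s \<in> bimod_hom A (P q) (P (Suc 0))" "\<And>x. x \<in> carrier (P q) \<Longrightarrow> d 0 (s x) = (\<lambda>x\<in>carrier (P q). L 0 x \<ominus>\<^bsub>P 0\<^esub> D x) x"
      using lift_P[OF bimod_P d_hom t im] by blast
    have "d 0 (s (d q x)) = L 0 (d q x)" if "x \<in> carrier (P (Suc q))" for x
      using that s(2)[of "d q x"] D(3)[OF that] Lc[of "d q x" 0] by (simp add: a_minus_def)
    then show "\<exists>s. Pr 0 s" using s by (intro exI[of _ s]) (simp add: Pr_def)
  next
    fix s j assume s: "Pr j s"
    then have sh: "s \<in> bimod_hom A (P (q + j)) (P (Suc j))" by (simp add: Pr_def)
    define t where "t = (\<lambda>x\<in>carrier (P (Suc (q + j))). L (Suc j) x \<ominus>\<^bsub>P (Suc j)\<^esub> compose (carrier (P (Suc (q + j)))) s (d (q + j)) x)"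
    have tv: "t x = L (Suc j) x \<ominus>\<^bsub>P (Suc j)\<^esub> s (d (q + j) x)" if "x \<in> carrier (P (Suc (q + j)))" for x
      using that by (simp add: t_def compose_def)
    have sc: "s (d (q + j) x) \<in> carrier (P (Suc j))" if "x \<in> carrier (P (Suc (q + j)))" for x
      using bimod_homD(1)[OF sh] that by simp
    have Lc': "L (Suc j) x \<in> carrier (P (Suc j))" if "x \<in> carrier (P (Suc (q + j)))" for x using Lc[of x "Suc j"] that by simp
    have t: "t \<in> bimod_hom A (P (Suc (q + j))) (P (Suc j))"
      unfolding t_def using Lh[of "Suc j"] by (intro P.hom_diff[OF bimod_P] P.hom_compose[OF d_hom sh]) simp
    have im: "t x \<in> d (Suc j) ` carrier (P (Suc (Suc j)))" if x: "x \<in> carrier (P (Suc (q + j)))" for x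
    proof (rule cyc_exact)
      show "t x \<in> carrier (P (Suc j))" by (rule bimod_homD(1)[OF t x])
      have "d j (s (d (q + j) x)) = L j (d (q + j) x)" using s x by (simp add: Pr_def)
      then show "cyc (Suc j) (t x)"
        using x Ld[OF x] Lc[of "d (q + j) x" j] sc[OF x] Lc'[OF x]
        by (simp add: cyc_def tv a_minus_def bimod_homD(2)[OF d_hom] neg[OF d_hom] P.r_neg)
    qed
    obtain s' where s': "s' \<in> bimod_hom A (P (Suc (q + j))) (P (Suc (Suc j)))" "\<And>x. x \<in> carrier (P (Suc (q + j))) \<Longrightarrow> d (Suc j) (s' x) = t x"
      using lift_P[OF bimod_P d_hom t im] by blast
    have "d (Suc j) (s' (d (Suc (q + j)) x)) = L (Suc j) (d (Suc (q + j)) x)" if "x \<in> carrier (P (Suc (Suc (q + j))))" for x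
      using that by (simp add: s'(2) tv hom_P0[OF sh] a_minus_def Lc')
    then show "\<exists>s'. Pr (Suc j) s' \<and> (\<forall>x\<in>carrier (P (Suc (q + j))). d (Suc j) (s' x) = L (Suc j) x \<ominus>\<^bsub>P (Suc j)\<^esub> s (d (q + j) x))"
      using s' by (intro exI[of _ s']) (simp add: Pr_def tv)
  qed
  then obtain s where s: "\<And>j. Pr j (s j)"
    "\<And>j x. x \<in> carrier (P (Suc (q + j))) \<Longrightarrow> d (Suc j) (s (Suc j) x) = L (Suc j) x \<ominus>\<^bsub>P (Suc j)\<^esub> s j (d (q + j) x)"
    by blast
  have sh: "s j \<in> bimod_hom A (P (q + j)) (P (Suc j))" for j using s(1)[of j] by (simp add: Pr_def)
  \<comment> \<open>A cocycle does not distinguish elements that differ by a boundary.\<close>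
  have split: "f y = f z" if "y \<in> carrier (P p)" "z \<in> carrier (P p)" "w \<in> carrier (P (Suc p))" "d p w = y \<ominus>\<^bsub>P p\<^esub> z" for y z w
  proof -
    have "y = d p w \<oplus>\<^bsub>P p\<^esub> z" using that by (simp add: a_minus_def P.a_assoc P.l_neg)
    then have "f y = f (d p w) \<oplus> f z" using that bimod_homD(2)[OF Z_hom[OF f], of "d p w" z] by simp
    then show ?thesis using Z_d[OF f that(3)] Z_val[OF f that(2)] by simp
  qed
  show ?thesis
  proof (cases p)
    case 0
    have "f (L 0 x) = f (D x)" if x: "x \<in> carrier (P q)" for x
      using split[of "L 0 x" "D x" "s 0 x"] s(1)[of 0] x Lc[of x 0] bimod_homD(1)[OF D(1) x] bimod_homD(1)[OF sh[of 0], of x]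
      by (simp add: 0 Pr_def)
    then have "cmp p q f L = compose (carrier (P q)) f D" by (auto simp: 0 compose_def intro!: restrict_ext)
    then show ?thesis using D(4) 0 by simp
  next
    case (Suc p')
    have e: "f (L p x) = f (s p' (d (q + p') x))" if x: "x \<in> carrier (P (Suc (q + p')))" for x
      using split[of "L p x" "s p' (d (q + p') x)" "s p x"] s(2)[OF x] x Lc[of x p] bimod_homD(1)[OF sh[of p'], of "d (q + p') x"]
        bimod_homD(1)[OF sh[of p], of x]
      by (simp add: Suc)
    have u: "compose (carrier (P (q + p'))) f (s p') \<in> bimod_hom A (P (q + p')) R"
      using P.hom_compose[OF sh[of p'], of f R] Z_hom[OF f] by (simp add: Suc)
    have "cmp p q f L \<in> B (Suc (q + p'))"
      by (rule B_I[OF u]) (simp_all add: Suc compose_def add.commute[of p'] e[unfolded Suc])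
    then show ?thesis by (simp add: Suc add.commute)
  qed
qed

abbreviation yo where "yo \<equiv> yoneda A C"

text \<open>Changing f by a coboundary b, g by a coboundary b' and the lifting to L' changes f L by
  b L' + f D, where D = L' - L lifts b'. The two terms are coboundaries by \<open>cmp_B\<close> and
  \<open>cmp_null\<close>, so all members of the defining union are the same class.\<close>

lemma yo_cl:
  assumes f: "f \<in> carrier (Z p)" and g: "g \<in> carrier (Z q)" and L: "is_lifting A C q g L"
  shows "yo p q (cl p f) (cl q g) = cl (p + q) (cmp p q f L)"
proof -
  have *: "cl (p + q) (cmp p q f' L') = cl (p + q) (cmp p q f L)"
    if f': "f' \<in> cl p f" and g': "g' \<in> cl q g" and L': "is_lifting A C q g' L'" for f' g' L'
  proof -
    obtain b where b: "b \<in> B p" "f' = b \<oplus>\<^bsub>Z p\<^esub> f" using f' by (rule cl_mem)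
    obtain b' where b': "b' \<in> B q" "g' = b' \<oplus>\<^bsub>Z q\<^esub> g" using g' by (rule cl_mem)
    have bZ: "b \<in> carrier (Z p)" "b' \<in> carrier (Z q)" using b b' B_sub by auto
    define D where "D = (\<lambda>j. \<lambda>x\<in>carrier (P (q + j)). L' j x \<ominus>\<^bsub>P j\<^esub> L j x)"
    have D: "is_lifting A C q b' D" unfolding D_def by (rule lift_diff[OF L' L g bZ(2) b'(2)])
    have "cmp p q f' L' = (cmp p q b L' \<oplus>\<^bsub>Z (p + q)\<^esub> cmp p q f D) \<oplus>\<^bsub>Z (p + q)\<^esub> cmp p q f L"
    proof (rule Z_eqI)
      have f'Z: "f' \<in> carrier (Z p)" unfolding b(2) by (rule Z_closed(1)[OF bZ(1) f])
      show "cmp p q f' L' \<in> carrier (Z (p + q))" by (rule cmp_Z[OF f'Z L'])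
      show "(cmp p q b L' \<oplus>\<^bsub>Z (p + q)\<^esub> cmp p q f D) \<oplus>\<^bsub>Z (p + q)\<^esub> cmp p q f L \<in> carrier (Z (p + q))"
        by (intro Z_closed(1) cmp_Z[OF bZ(1) L'] cmp_Z[OF f D] cmp_Z[OF f L])
      fix x assume x: "x \<in> carrier (P (p + q))"
      then have x': "x \<in> carrier (P (q + p))" by (simp add: add.commute)
      have c: "L p x \<in> carrier (P p)" "L' p x \<in> carrier (P p)" "D p x \<in> carrier (P p)"
        using liftD(4)[OF L x'] liftD(4)[OF L' x'] liftD(4)[OF D x'] .
      have "L' p x = D p x \<oplus>\<^bsub>P p\<^esub> L p x" using x' c by (simp add: D_def a_minus_def P.a_assoc P.l_neg)
      then have "f (L' p x) = f (D p x) \<oplus> f (L p x)" using bimod_homD(2)[OF Z_hom[OF f] c(3,1)] by simp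
      then show "cmp p q f' L' x = ((cmp p q b L' \<oplus>\<^bsub>Z (p + q)\<^esub> cmp p q f D) \<oplus>\<^bsub>Z (p + q)\<^esub> cmp p q f L) x"
        using x c by (simp add: Z_simps cmp_val b(2) a_assoc Z_val[OF f] Z_val[OF bZ(1)])
    qed
    moreover have "cmp p q b L' \<oplus>\<^bsub>Z (p + q)\<^esub> cmp p q f D \<in> B (p + q)"
      by (intro B.a_closed cmp_B[OF b(1) L'] cmp_null[OF f b'(1) D])
    ultimately show ?thesis using cl_eqI[OF cmp_Z[OF f L]] by simp
  qed
  show ?thesis
    unfolding yoneda_def
    unfolding cl_def[symmetric]
  proof (rule equalityI)
    show "(\<Union>f\<in>cl p f. \<Union>g\<in>cl q g. \<Union>L\<in>{L. is_lifting A C q g L}. cl (p + q) (cmp p q f L)) \<subseteq> cl (p + q) (cmp p q f L)"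
      by (intro UN_least) (simp add: *)
    show "cl (p + q) (cmp p q f L) \<subseteq> (\<Union>f\<in>cl p f. \<Union>g\<in>cl q g. \<Union>L\<in>{L. is_lifting A C q g L}. cl (p + q) (cmp p q f L))"
      by (rule order_trans[OF _ UN_upper[OF cl_self[OF f]]], rule order_trans[OF _ UN_upper[OF cl_self[OF g]]], rule UN_upper) (simp add: L)
  qed
qed

lemma yo_closed: "a \<in> carrier (H p) \<Longrightarrow> b \<in> carrier (H q) \<Longrightarrow> yo p q a b \<in> carrier (H (p + q))"
proof -
  assume "a \<in> carrier (H p)" "b \<in> carrier (H q)"
  then obtain f g where f: "f \<in> carrier (Z p)" "a = cl p f" and g: "g \<in> carrier (Z q)" "b = cl q g" by (metis H_cases)
  obtain L where L: "is_lifting A C q g L" using lifting_exists[OF g(1)] .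
  show ?thesis unfolding f(2) g(2) yo_cl[OF f(1) g(1) L] by (rule cl_closed[OF cmp_Z[OF f(1) L]])
qed

lemma yo_add_l:
  assumes "a \<in> carrier (H p)" "a' \<in> carrier (H p)" "b \<in> carrier (H q)"
  shows "yo p q (a \<oplus>\<^bsub>H p\<^esub> a') b = yo p q a b \<oplus>\<^bsub>H (p + q)\<^esub> yo p q a' b"
proof -
  obtain f where f: "f \<in> carrier (Z p)" "a = cl p f" using assms(1) by (rule H_cases)
  obtain f' where f': "f' \<in> carrier (Z p)" "a' = cl p f'" using assms(2) by (rule H_cases)
  obtain g where g: "g \<in> carrier (Z q)" "b = cl q g" using assms(3) by (rule H_cases)
  obtain L where L: "is_lifting A C q g L" using lifting_exists[OF g(1)] .
  have "cmp p q (f \<oplus>\<^bsub>Z p\<^esub> f') L = cmp p q f L \<oplus>\<^bsub>Z (p + q)\<^esub> cmp p q f' L"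
    unfolding Z_simps compose_def by (intro restrict_ext) (simp add: liftD(4)[OF L] add.commute)
  then show ?thesis
    unfolding f(2) g(2) f'(2) cl_add[OF f(1) f'(1)] yo_cl[OF f(1) g(1) L] yo_cl[OF f'(1) g(1) L]
      yo_cl[OF Z_closed(1)[OF f(1) f'(1)] g(1) L] cl_add[OF cmp_Z[OF f(1) L] cmp_Z[OF f'(1) L]] by simp
qed

lemma yo_add_r:
  assumes "a \<in> carrier (H p)" "b \<in> carrier (H q)" "b' \<in> carrier (H q)"
  shows "yo p q a (b \<oplus>\<^bsub>H q\<^esub> b') = yo p q a b \<oplus>\<^bsub>H (p + q)\<^esub> yo p q a b'"
proof -
  obtain f where f: "f \<in> carrier (Z p)" "a = cl p f" using assms(1) by (rule H_cases)
  obtain g where g: "g \<in> carrier (Z q)" "b = cl q g" using assms(2) by (rule H_cases)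
  obtain g' where g': "g' \<in> carrier (Z q)" "b' = cl q g'" using assms(3) by (rule H_cases)
  obtain L where L: "is_lifting A C q g L" using lifting_exists[OF g(1)] .
  obtain L' where L': "is_lifting A C q g' L'" using lifting_exists[OF g'(1)] .
  have "cmp p q f (\<lambda>j. \<lambda>x\<in>carrier (P (q + j)). L j x \<oplus>\<^bsub>P j\<^esub> L' j x) = cmp p q f L \<oplus>\<^bsub>Z (p + q)\<^esub> cmp p q f L'"
    unfolding Z_simps compose_def using liftD(4)[OF L, of _ p] liftD(4)[OF L', of _ p]
    by (intro restrict_ext) (simp add: bimod_homD(2)[OF Z_hom[OF f(1)]] add.commute)
  then show ?thesis
    unfolding f(2) g(2) g'(2) cl_add[OF g(1) g'(1)] yo_cl[OF f(1) g(1) L] yo_cl[OF f(1) g'(1) L']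
      yo_cl[OF f(1) Z_closed(1)[OF g(1) g'(1)] lift_add[OF L L']] cl_add[OF cmp_Z[OF f(1) L] cmp_Z[OF f(1) L']] by simp
qed

lemma yo_zero:
  "b \<in> carrier (H q) \<Longrightarrow> yo p q \<zero>\<^bsub>H p\<^esub> b = \<zero>\<^bsub>H (p + q)\<^esub>" "a \<in> carrier (H p) \<Longrightarrow> yo p q a \<zero>\<^bsub>H q\<^esub> = \<zero>\<^bsub>H (p + q)\<^esub>"
  using yo_add_l[OF H.zero_closed H.zero_closed, of b q p] yo_add_r[OF _ H.zero_closed H.zero_closed, of a p q]
    yo_closed[OF H.zero_closed, of b q p] yo_closed[OF _ H.zero_closed, of a p q] by simp_all

lemma yo_assoc:
  assumes "a \<in> carrier (H p)" "b \<in> carrier (H q)" "c \<in> carrier (H r)"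
  shows "yo (p + q) r (yo p q a b) c = yo p (q + r) a (yo q r b c)"
proof -
  obtain f where f: "f \<in> carrier (Z p)" "a = cl p f" using assms(1) by (rule H_cases)
  obtain g where g: "g \<in> carrier (Z q)" "b = cl q g" using assms(2) by (rule H_cases)
  obtain h where h: "h \<in> carrier (Z r)" "c = cl r h" using assms(3) by (rule H_cases)
  obtain L where L: "is_lifting A C q g L" using lifting_exists[OF g(1)] .
  obtain K where K: "is_lifting A C r h K" using lifting_exists[OF h(1)] .
  \<comment> \<open>The composite of the two liftings, with K shifted by q, lifts the cocycle g K;
    both bracketings are then represented by f composed with L and K.\<close>
  define M where "M j = compose (carrier (P (q + r + j))) (L j) (K (q + j))" for j
  have Kc: "K (q + j) x \<in> carrier (P (q + j))" if "x \<in> carrier (P (q + r + j))" for x j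
    using liftD(4)[OF K, of x "q + j"] that by (simp add: ac_simps)
  have M: "is_lifting A C (q + r) (cmp q r g K) M"
  proof (rule liftI)
    show "M j \<in> bimod_hom A (P (q + r + j)) (P j)" for j
      unfolding M_def using P.hom_compose[OF liftD(1)[OF K, of "q + j"] liftD(1)[OF L, of j]] by (simp add: ac_simps)
    show "aug C (M 0 x) = cmp q r g K x" if "x \<in> carrier (P (q + r))" for x
      using that liftD(2)[OF L] Kc[of x 0] by (simp add: M_def compose_def)
    show "d j (M (Suc j) x) = M j (d (q + r + j) x)" if x: "x \<in> carrier (P (Suc (q + r + j)))" for j x
      using x liftD(3)[OF L, of "K (q + Suc j) x" j] liftD(3)[OF K, of x "q + j"] Kc[of x "Suc j"]
      by (simp add: M_def compose_def ac_simps)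
  qed
  have "cmp (p + q) r (cmp p q f L) K = cmp p (q + r) f M"
    unfolding compose_def M_def using Kc[of _ p] by (intro extensionalityI[of _ "carrier (P (p + (q + r)))"]) (simp_all add: ac_simps)
  then show ?thesis
    unfolding f(2) g(2) h(2) yo_cl[OF f(1) g(1) L] yo_cl[OF cmp_Z[OF f(1) L] h(1) K]
      yo_cl[OF g(1) h(1) K] yo_cl[OF f(1) cmp_Z[OF g(1) K] M] by (simp add: add.assoc)
qed

lemma aug_Z: "aug C \<in> carrier (Z 0)"
  using aug_hom by (simp add: Z_iff)

lemma yo_one_l: assumes "b \<in> carrier (H q)" shows "yo 0 q (cl 0 (aug C)) b = b"
proof -
  obtain g where g: "g \<in> carrier (Z q)" "b = cl q g" using assms(1) by (rule H_cases)
  obtain L where L: "is_lifting A C q g L" using lifting_exists[OF g(1)] .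
  have "cmp 0 q (aug C) L = g"
    using cmp_Z[OF aug_Z L] g(1) liftD(2)[OF L] by (intro Z_eqI[of _ q]) (simp_all add: compose_def)
  then show ?thesis unfolding g(2) yo_cl[OF aug_Z g(1) L] by simp
qed

text \<open>The identity chain map lifts the augmentation.\<close>

lemma yo_one_r: assumes "a \<in> carrier (H p)" shows "yo p 0 a (cl 0 (aug C)) = a"
proof -
  obtain f where f: "f \<in> carrier (Z p)" "a = cl p f" using assms(1) by (rule H_cases)
  have L: "is_lifting A C 0 (aug C) (\<lambda>j. restrict (\<lambda>x. x) (carrier (P j)))"
    by (rule liftI) (simp_all add: P.hom_id)
  have "cmp p 0 f (\<lambda>j. restrict (\<lambda>x. x) (carrier (P j))) = f"
    using cmp_Z[OF f(1) L] f(1) by (intro Z_eqI[of _ p]) (simp_all add: compose_def)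
  then show ?thesis unfolding f(2) yo_cl[OF f(1) aug_Z L] by simp
qed

end

section \<open>The graded cohomology ring\<close>

context proj_res
begin

abbreviation HH where "HH \<equiv> HH_alg A C"

lemma HH_carrier: "x \<in> carrier HH \<longleftrightarrow> (\<forall>n. x n \<in> carrier (H n)) \<and> finite {n. x n \<noteq> \<zero>\<^bsub>H n\<^esub>}"
  by (simp add: HH_alg_def)

lemma HH_add: "(x \<oplus>\<^bsub>HH\<^esub> y) n = x n \<oplus>\<^bsub>H n\<^esub> y n" by (simp add: HH_alg_def)
lemma HH_zero: "\<zero>\<^bsub>HH\<^esub> n = \<zero>\<^bsub>H n\<^esub>" by (simp add: HH_alg_def)
lemma HH_smult: "(c \<odot>\<^bsub>HH\<^esub> x) n = c \<odot>\<^bsub>H n\<^esub> x n" by (simp add: HH_alg_def)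
lemma HH_one: "\<one>\<^bsub>HH\<^esub> = HH_class A C 0 (aug C)" by (simp add: HH_alg_def)
lemma HH_mult: "(x \<otimes>\<^bsub>HH\<^esub> y) n = (\<Oplus>\<^bsub>H n\<^esub>p\<in>{..n}. yo p (n - p) (x p) (y (n - p)))"
  by (simp add: HH_alg_def)

lemma HH_class_eq: "HH_class A C n f = (\<lambda>k. if k = n then cl n f else \<zero>\<^bsub>H k\<^esub>)"
  by (rule ext) (simp add: HH_class_def cl_def)

lemma HH_class_closed: "f \<in> carrier (Z n) \<Longrightarrow> HH_class A C n f \<in> carrier HH"
  unfolding HH_carrier HH_class_eq
  by (auto simp: cl_closed intro!: finite_subset[of "{k. (if k = n then cl n f else \<zero>\<^bsub>H k\<^esub>) \<noteq> \<zero>\<^bsub>H k\<^esub>}" "{n}"] split: if_splits)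

lemma yo_closed': "p \<le> n \<Longrightarrow> a \<in> carrier (H p) \<Longrightarrow> b \<in> carrier (H (n - p)) \<Longrightarrow> yo p (n - p) a b \<in> carrier (H n)"
  using yo_closed[of a p b "n - p"] by simp

lemma HH_comp: "x \<in> carrier HH \<Longrightarrow> x n \<in> carrier (H n)" by (simp add: HH_carrier)

lemma HH_mult_comp: "x \<in> carrier HH \<Longrightarrow> y \<in> carrier HH \<Longrightarrow> p \<le> n \<Longrightarrow> yo p (n - p) (x p) (y (n - p)) \<in> carrier (H n)"
  by (intro yo_closed' HH_comp)

lemma HH_add_closed: assumes x: "x \<in> carrier HH" and y: "y \<in> carrier HH" shows "x \<oplus>\<^bsub>HH\<^esub> y \<in> carrier HH"
proof -
  have "{n. (x \<oplus>\<^bsub>HH\<^esub> y) n \<noteq> \<zero>\<^bsub>H n\<^esub>} \<subseteq> {n. x n \<noteq> \<zero>\<^bsub>H n\<^esub>} \<union> {n. y n \<noteq> \<zero>\<^bsub>H n\<^esub>}"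
  proof
    fix n assume "n \<in> {n. (x \<oplus>\<^bsub>HH\<^esub> y) n \<noteq> \<zero>\<^bsub>H n\<^esub>}"
    then show "n \<in> {n. x n \<noteq> \<zero>\<^bsub>H n\<^esub>} \<union> {n. y n \<noteq> \<zero>\<^bsub>H n\<^esub>}"
      by (cases "x n = \<zero>\<^bsub>H n\<^esub>"; cases "y n = \<zero>\<^bsub>H n\<^esub>") (simp_all add: HH_add)
  qed
  moreover have "finite ({n. x n \<noteq> \<zero>\<^bsub>H n\<^esub>} \<union> {n. y n \<noteq> \<zero>\<^bsub>H n\<^esub>})" using x y by (simp add: HH_carrier)
  ultimately have "finite {n. (x \<oplus>\<^bsub>HH\<^esub> y) n \<noteq> \<zero>\<^bsub>H n\<^esub>}" by (rule finite_subset)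
  then show ?thesis using x y by (simp add: HH_carrier HH_add)
qed

lemma HH_smult_closed: assumes x: "x \<in> carrier HH" shows "c \<odot>\<^bsub>HH\<^esub> x \<in> carrier HH"
proof -
  have z: "c \<odot>\<^bsub>H n\<^esub> \<zero>\<^bsub>H n\<^esub> = \<zero>\<^bsub>H n\<^esub>" for n
  proof -
    have "c \<odot>\<^bsub>Z n\<^esub> \<zero>\<^bsub>Z n\<^esub> = \<zero>\<^bsub>Z n\<^esub>" unfolding Z_simps by (intro restrict_ext) simp
    then show ?thesis unfolding H_zero cl_smult[OF Z.zero_closed] by simp
  qed
  have "c \<odot>\<^bsub>H n\<^esub> x n \<in> carrier (H n)" for n
    using HH_comp[OF x, of n] by (rule H_cases) (simp add: cl_smult Z_closed cl_closed)
  moreover have "finite {n. c \<odot>\<^bsub>H n\<^esub> x n \<noteq> \<zero>\<^bsub>H n\<^esub>}"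
    by (rule finite_subset[of _ "{n. x n \<noteq> \<zero>\<^bsub>H n\<^esub>}"]) (use x z in \<open>auto simp: HH_carrier\<close>)
  ultimately show ?thesis by (simp add: HH_carrier HH_smult)
qed

lemma HH_smult_add:
  assumes x: "x \<in> carrier HH" and y: "y \<in> carrier HH"
  shows "c \<odot>\<^bsub>HH\<^esub> (x \<oplus>\<^bsub>HH\<^esub> y) = c \<odot>\<^bsub>HH\<^esub> x \<oplus>\<^bsub>HH\<^esub> c \<odot>\<^bsub>HH\<^esub> y"
proof (rule ext)
  fix n
  obtain f where f: "f \<in> carrier (Z n)" "x n = cl n f" using HH_comp[OF x] by (rule H_cases)
  obtain g where g: "g \<in> carrier (Z n)" "y n = cl n g" using HH_comp[OF y] by (rule H_cases)
  have "c \<odot>\<^bsub>Z n\<^esub> (f \<oplus>\<^bsub>Z n\<^esub> g) = c \<odot>\<^bsub>Z n\<^esub> f \<oplus>\<^bsub>Z n\<^esub> c \<odot>\<^bsub>Z n\<^esub> g"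
    unfolding Z_simps by (intro restrict_ext) (simp add: Z_val[OF f(1)] Z_val[OF g(1)] smult_r_distr)
  then show "(c \<odot>\<^bsub>HH\<^esub> (x \<oplus>\<^bsub>HH\<^esub> y)) n = (c \<odot>\<^bsub>HH\<^esub> x \<oplus>\<^bsub>HH\<^esub> c \<odot>\<^bsub>HH\<^esub> y) n"
    by (simp add: HH_smult HH_add f g cl_add cl_smult Z_closed)
qed

lemma HH_group: "abelian_group HH"
proof (rule abelian_groupI)
  fix x y assume x: "x \<in> carrier HH" and y: "y \<in> carrier HH"
  show "x \<oplus>\<^bsub>HH\<^esub> y \<in> carrier HH" using x y by (rule HH_add_closed)
  show "x \<oplus>\<^bsub>HH\<^esub> y = y \<oplus>\<^bsub>HH\<^esub> x" by (rule ext) (simp add: HH_add H.a_comm HH_comp[OF x] HH_comp[OF y])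
  fix z assume z: "z \<in> carrier HH"
  show "x \<oplus>\<^bsub>HH\<^esub> y \<oplus>\<^bsub>HH\<^esub> z = x \<oplus>\<^bsub>HH\<^esub> (y \<oplus>\<^bsub>HH\<^esub> z)"
    by (rule ext) (simp add: HH_add H.a_assoc HH_comp[OF x] HH_comp[OF y] HH_comp[OF z])
next
  show "\<zero>\<^bsub>HH\<^esub> \<in> carrier HH" by (simp add: HH_carrier HH_zero)
  fix x assume x: "x \<in> carrier HH"
  show "\<zero>\<^bsub>HH\<^esub> \<oplus>\<^bsub>HH\<^esub> x = x" by (rule ext) (simp add: HH_add HH_zero HH_comp[OF x])
  have "(\<lambda>n. \<ominus>\<^bsub>H n\<^esub> x n) \<in> carrier HH"
  proof -
    have "finite {n. \<ominus>\<^bsub>H n\<^esub> x n \<noteq> \<zero>\<^bsub>H n\<^esub>}"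
      by (rule finite_subset[of _ "{n. x n \<noteq> \<zero>\<^bsub>H n\<^esub>}"]) (use x in \<open>auto simp: HH_carrier\<close>)
    then show ?thesis by (simp add: HH_carrier HH_comp[OF x])
  qed
  then show "\<exists>y\<in>carrier HH. y \<oplus>\<^bsub>HH\<^esub> x = \<zero>\<^bsub>HH\<^esub>"
    by (rule bexI[rotated], intro ext) (simp add: HH_add HH_zero HH_comp[OF x] H.l_neg)
qed

lemma HH_mult_closed: assumes x: "x \<in> carrier HH" and y: "y \<in> carrier HH" shows "x \<otimes>\<^bsub>HH\<^esub> y \<in> carrier HH"
proof -
  have "(x \<otimes>\<^bsub>HH\<^esub> y) n \<in> carrier (H n)" for n
    unfolding HH_mult by (intro H.finsum_closed) (simp add: HH_mult_comp[OF x y])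
  moreover have "finite {n. (x \<otimes>\<^bsub>HH\<^esub> y) n \<noteq> \<zero>\<^bsub>H n\<^esub>}"
  proof (rule finite_subset)
    show "{n. (x \<otimes>\<^bsub>HH\<^esub> y) n \<noteq> \<zero>\<^bsub>H n\<^esub>} \<subseteq> (\<lambda>(p, q). p + q) ` ({n. x n \<noteq> \<zero>\<^bsub>H n\<^esub>} \<times> {n. y n \<noteq> \<zero>\<^bsub>H n\<^esub>})"
    proof (rule subsetI, rule ccontr)
      fix n assume n: "n \<in> {n. (x \<otimes>\<^bsub>HH\<^esub> y) n \<noteq> \<zero>\<^bsub>H n\<^esub>}"
        and nn: "n \<notin> (\<lambda>(p, q). p + q) ` ({n. x n \<noteq> \<zero>\<^bsub>H n\<^esub>} \<times> {n. y n \<noteq> \<zero>\<^bsub>H n\<^esub>})"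
      have "yo p (n - p) (x p) (y (n - p)) = \<zero>\<^bsub>H n\<^esub>" if p: "p \<le> n" for p
      proof -
        have "x p = \<zero>\<^bsub>H p\<^esub> \<or> y (n - p) = \<zero>\<^bsub>H (n - p)\<^esub>"
        proof (rule ccontr)
          assume "\<not> ?thesis"
          then have "(p, n - p) \<in> {n. x n \<noteq> \<zero>\<^bsub>H n\<^esub>} \<times> {n. y n \<noteq> \<zero>\<^bsub>H n\<^esub>}" by simp
          then show False using nn p by (metis (mono_tags, lifting) image_eqI le_add_diff_inverse old.prod.case)
        qed
        then show ?thesis
          using yo_zero(1)[OF HH_comp[OF y], of p "n - p"] yo_zero(2)[OF HH_comp[OF x], of p "n - p"] p by fastforce
      qed
      then have "(x \<otimes>\<^bsub>HH\<^esub> y) n = \<zero>\<^bsub>H n\<^esub>" unfolding HH_mult by (intro H.add.finprod_one_eqI) simp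
      then show False using n by simp
    qed
    show "finite ((\<lambda>(p, q). p + q) ` ({n. x n \<noteq> \<zero>\<^bsub>H n\<^esub>} \<times> {n. y n \<noteq> \<zero>\<^bsub>H n\<^esub>}))"
      using x y by (simp add: HH_carrier)
  qed
  ultimately show ?thesis by (simp add: HH_carrier)
qed

lemma HH_mult_assoc:
  assumes x: "x \<in> carrier HH" and y: "y \<in> carrier HH" and z: "z \<in> carrier HH"
  shows "x \<otimes>\<^bsub>HH\<^esub> y \<otimes>\<^bsub>HH\<^esub> z = x \<otimes>\<^bsub>HH\<^esub> (y \<otimes>\<^bsub>HH\<^esub> z)"
proof (rule ext)
  fix n
  \<comment> \<open>Both bracketings expand into the products of the components of degrees p, j and
    n - p - j, over all p + j \<le> n.\<close>
  define F where "F p j = yo p (n - p) (x p) (yo j (n - p - j) (y j) (z (n - p - j)))" for p j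
  have yz: "yo j (n - p - j) (y j) (z (n - p - j)) \<in> carrier (H (n - p))" if "p + j \<le> n" for p j
    using HH_mult_comp[OF y z, of j "n - p"] that by simp
  have F: "F p j \<in> carrier (H n)" if "p + j \<le> n" for p j
    unfolding F_def by (intro yo_closed' HH_comp[OF x] yz) (use that in auto)
  have "(x \<otimes>\<^bsub>HH\<^esub> y \<otimes>\<^bsub>HH\<^esub> z) n = (\<Oplus>\<^bsub>H n\<^esub>k\<in>{..n}. \<Oplus>\<^bsub>H n\<^esub>p\<in>{..k}. F p (k - p))"
    unfolding HH_mult[of "x \<otimes>\<^bsub>HH\<^esub> y"]
  proof (rule H.finsum_cong')
    show "(\<lambda>k. \<Oplus>\<^bsub>H n\<^esub>p\<in>{..k}. F p (k - p)) \<in> {..n} \<rightarrow> carrier (H n)"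
      by (auto intro!: H.finsum_closed F)
    fix k assume k: "k \<in> {..n}"
    have c: "yo p (k - p) (x p) (y (k - p)) \<in> carrier (H k)" if "p \<le> k" for p
      using HH_mult_comp[OF x y that] .
    have "yo k (n - k) ((x \<otimes>\<^bsub>HH\<^esub> y) k) (z (n - k)) = (\<Oplus>\<^bsub>H n\<^esub>p\<in>{..k}. yo k (n - k) (yo p (k - p) (x p) (y (k - p))) (z (n - k)))"
      unfolding HH_mult[of x y]
    proof (rule finsum_hom[OF H_group H_group])
      show "yo k (n - k) a (z (n - k)) \<in> carrier (H n)" if "a \<in> carrier (H k)" for a
        using k by (intro yo_closed' HH_comp[OF z] that) simp
      show "yo k (n - k) (a \<oplus>\<^bsub>H k\<^esub> a') (z (n - k)) = yo k (n - k) a (z (n - k)) \<oplus>\<^bsub>H n\<^esub> yo k (n - k) a' (z (n - k))"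
        if "a \<in> carrier (H k)" "a' \<in> carrier (H k)" for a a'
        using yo_add_l[OF that HH_comp[OF z, of "n - k"]] k by simp
    qed (simp_all add: c)
    also have "\<dots> = (\<Oplus>\<^bsub>H n\<^esub>p\<in>{..k}. F p (k - p))"
    proof (rule H.finsum_cong')
      show "(\<lambda>p. F p (k - p)) \<in> {..k} \<rightarrow> carrier (H n)" using k by (auto intro!: F)
      fix p assume p: "p \<in> {..k}"
      have e: "p + (k - p) = k" "k - p + (n - k) = n - p" "n - p - (k - p) = n - k" using p k by auto
      show "yo k (n - k) (yo p (k - p) (x p) (y (k - p))) (z (n - k)) = F p (k - p)"
        using yo_assoc[OF HH_comp[OF x, of p] HH_comp[OF y, of "k - p"] HH_comp[OF z, of "n - k"]]
        unfolding e F_def .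
    qed simp
    finally show "yo k (n - k) ((x \<otimes>\<^bsub>HH\<^esub> y) k) (z (n - k)) = (\<Oplus>\<^bsub>H n\<^esub>p\<in>{..k}. F p (k - p))" .
  qed simp
  also have "\<dots> = (\<Oplus>\<^bsub>H n\<^esub>p\<in>{..n}. \<Oplus>\<^bsub>H n\<^esub>j\<in>{..n - p}. F p j)"
    by (rule H.finsum_triangle[OF F])
  also have "\<dots> = (x \<otimes>\<^bsub>HH\<^esub> (y \<otimes>\<^bsub>HH\<^esub> z)) n"
    unfolding HH_mult[of x]
  proof (rule H.finsum_cong')
    show "(\<lambda>p. yo p (n - p) (x p) ((y \<otimes>\<^bsub>HH\<^esub> z) (n - p))) \<in> {..n} \<rightarrow> carrier (H n)"
      using HH_mult_comp[OF x HH_mult_closed[OF y z]] by auto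
    fix p assume p: "p \<in> {..n}"
    have "yo p (n - p) (x p) ((y \<otimes>\<^bsub>HH\<^esub> z) (n - p)) = (\<Oplus>\<^bsub>H n\<^esub>j\<in>{..n - p}. yo p (n - p) (x p) (yo j (n - p - j) (y j) (z (n - p - j))))"
      unfolding HH_mult[of y z]
    proof (rule finsum_hom[OF H_group H_group])
      show "yo p (n - p) (x p) a \<in> carrier (H n)" if "a \<in> carrier (H (n - p))" for a
        using p by (intro yo_closed' HH_comp[OF x] that) simp
      show "yo p (n - p) (x p) (a \<oplus>\<^bsub>H (n - p)\<^esub> a') = yo p (n - p) (x p) a \<oplus>\<^bsub>H n\<^esub> yo p (n - p) (x p) a'"
        if "a \<in> carrier (H (n - p))" "a' \<in> carrier (H (n - p))" for a a'
        using yo_add_r[OF HH_comp[OF x, of p] that] p by simp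
      show "yo j (n - p - j) (y j) (z (n - p - j)) \<in> carrier (H (n - p))" if "j \<in> {..n - p}" for j
        using that p by (intro yz) auto
    qed simp
    then show "(\<Oplus>\<^bsub>H n\<^esub>j\<in>{..n - p}. F p j) = yo p (n - p) (x p) ((y \<otimes>\<^bsub>HH\<^esub> z) (n - p))"
      unfolding F_def by simp
  qed simp
  finally show "(x \<otimes>\<^bsub>HH\<^esub> y \<otimes>\<^bsub>HH\<^esub> z) n = (x \<otimes>\<^bsub>HH\<^esub> (y \<otimes>\<^bsub>HH\<^esub> z)) n" .
qed

lemma HH_one_mult:
  assumes x: "x \<in> carrier HH"
  shows "\<one>\<^bsub>HH\<^esub> \<otimes>\<^bsub>HH\<^esub> x = x" "x \<otimes>\<^bsub>HH\<^esub> \<one>\<^bsub>HH\<^esub> = x"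
proof -
  show "\<one>\<^bsub>HH\<^esub> \<otimes>\<^bsub>HH\<^esub> x = x"
  proof (rule ext)
    fix n
    have "(\<one>\<^bsub>HH\<^esub> \<otimes>\<^bsub>HH\<^esub> x) n = (\<Oplus>\<^bsub>H n\<^esub>p\<in>{..n}. if 0 = p then x n else \<zero>\<^bsub>H n\<^esub>)"
      unfolding HH_mult
    proof (rule H.finsum_cong')
      fix p assume p: "p \<in> {..n}"
      show "yo p (n - p) (\<one>\<^bsub>HH\<^esub> p) (x (n - p)) = (if 0 = p then x n else \<zero>\<^bsub>H n\<^esub>)"
        using yo_one_l[OF HH_comp[OF x, of n]] yo_zero(1)[OF HH_comp[OF x, of "n - p"], of p] p
        by (cases "p = 0") (simp_all add: HH_one HH_class_eq)
    qed (auto simp: HH_comp[OF x])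
    also have "\<dots> = x n" using H.finsum_singleton[of 0 "{..n}" "\<lambda>_. x n" n] HH_comp[OF x] by simp
    finally show "(\<one>\<^bsub>HH\<^esub> \<otimes>\<^bsub>HH\<^esub> x) n = x n" .
  qed
  show "x \<otimes>\<^bsub>HH\<^esub> \<one>\<^bsub>HH\<^esub> = x"
  proof (rule ext)
    fix n
    have "(x \<otimes>\<^bsub>HH\<^esub> \<one>\<^bsub>HH\<^esub>) n = (\<Oplus>\<^bsub>H n\<^esub>p\<in>{..n}. if n = p then x n else \<zero>\<^bsub>H n\<^esub>)"
      unfolding HH_mult
    proof (rule H.finsum_cong')
      fix p assume p: "p \<in> {..n}"
      show "yo p (n - p) (x p) (\<one>\<^bsub>HH\<^esub> (n - p)) = (if n = p then x n else \<zero>\<^bsub>H n\<^esub>)"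
        using yo_one_r[OF HH_comp[OF x, of n]] yo_zero(2)[OF HH_comp[OF x, of p], of "n - p"] p
        by (cases "p = n") (simp_all add: HH_one HH_class_eq)
    qed (auto simp: HH_comp[OF x])
    also have "\<dots> = x n" using H.finsum_singleton[of n "{..n}" "\<lambda>_. x n" n] HH_comp[OF x] by simp
    finally show "(x \<otimes>\<^bsub>HH\<^esub> \<one>\<^bsub>HH\<^esub>) n = x n" .
  qed
qed

theorem ring_HH: "ring HH"
proof (rule ringI[OF HH_group])
  show "Group.monoid HH"
    by (rule monoidI) (simp_all add: HH_mult_closed HH_mult_assoc HH_one_mult, simp add: HH_one HH_class_closed aug_Z)
  fix x y z assume x: "x \<in> carrier HH" and y: "y \<in> carrier HH" and z: "z \<in> carrier HH"
  show "(x \<oplus>\<^bsub>HH\<^esub> y) \<otimes>\<^bsub>HH\<^esub> z = x \<otimes>\<^bsub>HH\<^esub> z \<oplus>\<^bsub>HH\<^esub> y \<otimes>\<^bsub>HH\<^esub> z"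
  proof (rule ext)
    fix n
    have "((x \<oplus>\<^bsub>HH\<^esub> y) \<otimes>\<^bsub>HH\<^esub> z) n = (\<Oplus>\<^bsub>H n\<^esub>p\<in>{..n}. yo p (n - p) (x p) (z (n - p)) \<oplus>\<^bsub>H n\<^esub> yo p (n - p) (y p) (z (n - p)))"
      unfolding HH_mult HH_add
    proof (rule H.finsum_cong')
      fix p assume "p \<in> {..n}"
      then show "yo p (n - p) (x p \<oplus>\<^bsub>H p\<^esub> y p) (z (n - p)) = yo p (n - p) (x p) (z (n - p)) \<oplus>\<^bsub>H n\<^esub> yo p (n - p) (y p) (z (n - p))"
        using yo_add_l[OF HH_comp[OF x, of p] HH_comp[OF y, of p] HH_comp[OF z, of "n - p"]] by simp
    qed (auto simp: HH_mult_comp[OF x z] HH_mult_comp[OF y z])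
    also have "\<dots> = (x \<otimes>\<^bsub>HH\<^esub> z \<oplus>\<^bsub>HH\<^esub> y \<otimes>\<^bsub>HH\<^esub> z) n"
      unfolding HH_mult HH_add by (rule H.finsum_addf) (auto simp: HH_mult_comp[OF x z] HH_mult_comp[OF y z])
    finally show "((x \<oplus>\<^bsub>HH\<^esub> y) \<otimes>\<^bsub>HH\<^esub> z) n = (x \<otimes>\<^bsub>HH\<^esub> z \<oplus>\<^bsub>HH\<^esub> y \<otimes>\<^bsub>HH\<^esub> z) n" .
  qed
  show "z \<otimes>\<^bsub>HH\<^esub> (x \<oplus>\<^bsub>HH\<^esub> y) = z \<otimes>\<^bsub>HH\<^esub> x \<oplus>\<^bsub>HH\<^esub> z \<otimes>\<^bsub>HH\<^esub> y"
  proof (rule ext)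
    fix n
    have "(z \<otimes>\<^bsub>HH\<^esub> (x \<oplus>\<^bsub>HH\<^esub> y)) n = (\<Oplus>\<^bsub>H n\<^esub>p\<in>{..n}. yo p (n - p) (z p) (x (n - p)) \<oplus>\<^bsub>H n\<^esub> yo p (n - p) (z p) (y (n - p)))"
      unfolding HH_mult HH_add
    proof (rule H.finsum_cong')
      fix p assume "p \<in> {..n}"
      then show "yo p (n - p) (z p) (x (n - p) \<oplus>\<^bsub>H (n - p)\<^esub> y (n - p)) = yo p (n - p) (z p) (x (n - p)) \<oplus>\<^bsub>H n\<^esub> yo p (n - p) (z p) (y (n - p))"
        using yo_add_r[OF HH_comp[OF z, of p] HH_comp[OF x, of "n - p"] HH_comp[OF y, of "n - p"]] by simp
    qed (auto simp: HH_mult_comp[OF z x] HH_mult_comp[OF z y])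
    also have "\<dots> = (z \<otimes>\<^bsub>HH\<^esub> x \<oplus>\<^bsub>HH\<^esub> z \<otimes>\<^bsub>HH\<^esub> y) n"
      unfolding HH_mult HH_add by (rule H.finsum_addf) (auto simp: HH_mult_comp[OF z x] HH_mult_comp[OF z y])
    finally show "(z \<otimes>\<^bsub>HH\<^esub> (x \<oplus>\<^bsub>HH\<^esub> y)) n = (z \<otimes>\<^bsub>HH\<^esub> x \<oplus>\<^bsub>HH\<^esub> z \<otimes>\<^bsub>HH\<^esub> y) n" .
  qed
qed

end

section \<open>The explicit complex at N = 1 in characteristic 2\<close>

section \<open>The explicit resolution\<close>

lemma (in bimod) lact_zero:
  assumes "k_algebra A" "x \<in> carrier M" shows "lact M \<zero>\<^bsub>A\<^esub> x = \<zero>\<^bsub>M\<^esub>" "ract M x \<zero>\<^bsub>A\<^esub> = \<zero>\<^bsub>M\<^esub>"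
proof -
  interpret R: k_algebra A by fact
  show "lact M \<zero>\<^bsub>A\<^esub> x = \<zero>\<^bsub>M\<^esub>" "ract M x \<zero>\<^bsub>A\<^esub> = \<zero>\<^bsub>M\<^esub>"
    using act_mult(4)[OF R.zero_closed R.zero_closed assms(2)] act_mult(5)[OF R.zero_closed R.zero_closed assms(2)]
      act_closed[OF R.zero_closed assms(2)] by simp_all
qed

locale lam2 = lam1 m L for m :: nat and L :: "('k::field, 'k lam) module" (structure) +
  assumes char2: "CHAR('k) = 2"
begin

lemma two_zero: "(1 :: 'k) + 1 = 0"
proof -
  have "of_nat (CHAR('k)) = (0 :: 'k)" by (rule of_nat_CHAR)
  then show ?thesis unfolding char2 by simp
qed

lemma bimod_char2:
  assumes "bimod L M" and x: "x \<in> carrier M"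
  shows "x \<oplus>\<^bsub>M\<^esub> x = \<zero>\<^bsub>M\<^esub>" "y \<in> carrier M \<Longrightarrow> x \<oplus>\<^bsub>M\<^esub> (x \<oplus>\<^bsub>M\<^esub> y) = y" "\<ominus>\<^bsub>M\<^esub> x = x"
proof -
  interpret M: bimod L M by fact
  have "\<one> \<oplus> \<one> = \<zero>" using smult_l_distr[OF one_closed, of 1 1] unfolding two_zero by simp
  then show 1: "x \<oplus>\<^bsub>M\<^esub> x = \<zero>\<^bsub>M\<^esub>"
    using M.act_mult(4)[OF one_closed one_closed x] M.lact_zero(1)[OF k_algebra_axioms x] x by simp
  then show "y \<in> carrier M \<Longrightarrow> x \<oplus>\<^bsub>M\<^esub> (x \<oplus>\<^bsub>M\<^esub> y) = y" using x by (simp add: M.a_assoc[symmetric])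
  show "\<ominus>\<^bsub>M\<^esub> x = x" using 1 x by (simp add: M.minus_equality)
qed

definition P :: "nat \<Rightarrow> ('k lam, 'k res) bimodule" where "P n = res_term m 1 n"
definition g :: "nat \<Rightarrow> int \<Rightarrow> int \<Rightarrow> 'k res" where "g n i r = res_gen m 1 n i r"

lemma res_index_fin: "finite (res_index m n)" by (simp add: res_index_def)

sublocale F: tensor_family L "res_index m n" "\<lambda>(i, r). e i" "\<lambda>(i, r). e (i + int n - 2 * r)" for n
  by unfold_locales (simp_all add: res_index_fin split: prod.splits)

lemma P_FB: "P n = F.FB n"
proof -
  have "res_summand m 1 n = F.T n"
    unfolding res_summand_def left_proj_def right_proj_def L[symmetric] e_def[symmetric]
    by (rule ext) (simp split: prod.split)
  then show ?thesis by (simp only: P_def res_term_def)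
qed

sublocale Pn: bimod L "P n" for n
  unfolding P_FB by (rule F.FB.bimod_axioms)

lemma e_shift: "e (i mod int m + int n - 2 * r) = e (i + int n - 2 * r)"
  using mod_add_left_eq[of i "int m" "int n - 2 * r"] by (intro e_cong) (simp add: algebra_simps)

lemma g_gen:
  assumes "(i mod int m, r) \<in> res_index m n"
  shows "g n i r = F.gen n (i mod int m, r)"
proof -
  have s: "res_summand m 1 n = F.T n"
    unfolding res_summand_def left_proj_def right_proj_def L[symmetric] e_def[symmetric]
    by (rule ext) (simp split: prod.split)
  note e' = e_shift[of i n r]
  show ?thesis
    unfolding g_def res_gen_def F.W_def F.emb_def s tensor.ten_def[OF F.tensor[OF assms]]
    unfolding left_proj_def right_proj_def L[symmetric] e_def[symmetric]
    by (intro restrict_ext) (simp add: e')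
qed

lemma g_mod: "g n (i mod int m) r = g n i r"
proof -
  note e' = e_shift[of i n r]
  have e'': "e (i mod int m) = e i" by simp
  show ?thesis
    unfolding g_def res_gen_def left_proj_def right_proj_def L[symmetric] e_def[symmetric] e' e'' by simp
qed

lemma mod_range: "i mod int m \<in> {0..<int m}" using m by simp

lemma g_out: "\<not> (0 \<le> r \<and> r \<le> int n) \<Longrightarrow> g n i r = \<zero>\<^bsub>P n\<^esub>"
  unfolding g_def res_gen_def P_def res_term_def bimod_sum_def by (auto simp: res_index_def intro!: restrict_ext)

lemma index_iff: "(i mod int m, r) \<in> res_index m n \<longleftrightarrow> 0 \<le> r \<and> r \<le> int n"
  using mod_range by (simp add: res_index_def)

lemma g_props:
  "g n i r \<in> carrier (P n)" "lact (P n) (e i) (g n i r) = g n i r" "ract (P n) (g n i r) (e (i + int n - 2 * r)) = g n i r"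
proof -
  note e' = e_shift[of i n r]
  have "g n i r \<in> carrier (P n) \<and> lact (P n) (e i) (g n i r) = g n i r \<and> ract (P n) (g n i r) (e (i + int n - 2 * r)) = g n i r"
  proof (cases "0 \<le> r \<and> r \<le> int n")
    case True
    then have ix: "(i mod int m, r) \<in> res_index m n" by (simp only: index_iff)
    show ?thesis
      unfolding g_gen[OF ix] P_FB using F.gen_closed[OF ix] F.gen_idem[OF ix] by (simp add: e')
  next
    case False
    then show ?thesis by (simp add: g_out)
  qed
  then show "g n i r \<in> carrier (P n)" "lact (P n) (e i) (g n i r) = g n i r" "ract (P n) (g n i r) (e (i + int n - 2 * r)) = g n i r"
    by simp_all
qed

lemmas g_closed [simp] = g_props(1)

lemma g_cong: "i mod int m = j mod int m \<Longrightarrow> g n i r = g n j r" by (metis g_mod)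

lemma P_induct [consumes 1, case_names zero gen add]:
  assumes x: "x \<in> carrier (P n)" and zero: "Pr \<zero>\<^bsub>P n\<^esub>"
    and gen: "\<And>i r u v. \<lbrakk>0 \<le> r; r \<le> int n; u \<in> carrier L; v \<in> carrier L; u \<otimes> e i = u\<rbrakk> \<Longrightarrow> Pr (ract (P n) (lact (P n) u (g n i r)) v)"
    and add: "\<And>x y. \<lbrakk>x \<in> carrier (P n); y \<in> carrier (P n); Pr x; Pr y\<rbrakk> \<Longrightarrow> Pr (x \<oplus>\<^bsub>P n\<^esub> y)"
  shows "Pr x"
  using x zero unfolding P_FB
proof (rule F.FB_induct)
  fix j u v assume j: "j \<in> res_index m n" and u: "u \<in> F.U j" and v: "v \<in> F.V n j"
  obtain i r where ir: "j = (i, r)" by (cases j)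
  have i: "i mod int m = i" "0 \<le> r" "r \<le> int n" using j ir by (auto simp: res_index_def)
  have "Pr (ract (P n) (lact (P n) u (g n i r)) v)"
    using i gen F.U_iff[OF j, of u] F.V_iff[OF j, of v] u v unfolding ir by simp
  then show "Pr (F.W n j u v)"
    unfolding F.W_eq[OF j u v] P_FB using g_gen[of i r n] j i ir by simp
qed (use add in \<open>simp only: P_FB\<close>)

text \<open>A bimodule map on P n amounts to a choice of elements of e i M e (i + n - 2r). The
  values are indexed by all integers, periodic in i and zero for r out of range, so that formulas
  involving i + 1, i - 1 and r - 1 need no case distinctions at the borders.\<close>

lemma P_hom:
  assumes M: "bimod L M" and x: "\<And>i r. x i r \<in> carrier M"
    "\<And>i r. lact M (e i) (x i r) = x i r" "\<And>i r. ract M (x i r) (e (i + int n - 2 * r)) = x i r"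
    and per: "\<And>i r. x (i mod int m) r = x i r" and out: "\<And>i r. \<not> (0 \<le> r \<and> r \<le> int n) \<Longrightarrow> x i r = \<zero>\<^bsub>M\<^esub>"
  shows "\<exists>\<phi>. \<phi> \<in> bimod_hom L (P n) M \<and> (\<forall>i r. \<phi> (g n i r) = x i r)"
proof -
  interpret M: bimod L M by fact
  obtain \<phi> where \<phi>: "\<phi> \<in> bimod_hom L (F.FB n) M" "\<And>j. j \<in> res_index m n \<Longrightarrow> \<phi> (F.gen n j) = (case j of (i, r) \<Rightarrow> x i r)"
    by (rule F.FB_hom[OF M, of n "\<lambda>(i, r). x i r"]) (simp_all add: x split: prod.splits)
  have "\<phi> (g n i r) = x i r" for i r
  proof (cases "0 \<le> r \<and> r \<le> int n")
    case True
    then have ix: "(i mod int m, r) \<in> res_index m n" by (simp only: index_iff)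
    show ?thesis unfolding g_gen[OF ix] \<phi>(2)[OF ix] by (simp add: per)
  next
    case False
    then show ?thesis using F.FB.hom_zero[OF \<phi>(1) M.abelian_group_axioms] by (simp add: g_out out P_FB)
  qed
  then show ?thesis using \<phi>(1) unfolding P_FB by blast
qed

lemma P_hom_eqI:
  assumes f: "f \<in> bimod_hom L (P n) M" and f': "f' \<in> bimod_hom L (P n) M" and M: "bimod L M"
    and eq: "\<And>i r. \<lbrakk>i \<in> {0..<int m}; 0 \<le> r; r \<le> int n\<rbrakk> \<Longrightarrow> f (g n i r) = f' (g n i r)"
  shows "f = f'"
proof (rule F.FB_hom_eqI[OF f[unfolded P_FB] f'[unfolded P_FB] M])
  fix j assume j: "j \<in> res_index m n"
  obtain i r where ir: "j = (i, r)" by (cases j)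
  have i: "i mod int m = i" "i \<in> {0..<int m}" "0 \<le> r" "r \<le> int n" using j ir by (auto simp: res_index_def)
  have "g n i r = F.gen n j" using g_gen[of i r n] j i ir by simp
  then show "f (F.gen n j) = f' (F.gen n j)" using eq[OF i(2-4)] by simp
qed

abbreviation la where "la n \<equiv> lact (P n)"
abbreviation ra where "ra n \<equiv> ract (P n)"

text \<open>The common form of the three cases of the differential: for N = 1 the powers of ab and
  ba have exponent 0, and in characteristic 2 all signs are trivial. As n and r enter only as
  indices of generators, shifts of indices will commute with the differential.\<close>

definition dg :: "nat \<Rightarrow> int \<Rightarrow> int \<Rightarrow> 'k res" where
  "dg n i r = ra n (g n i r) a \<oplus>\<^bsub>P n\<^esub> la n a (g n (i + 1) r) \<oplus>\<^bsub>P n\<^esub> la n b (g n (i - 1) (r - 1)) \<oplus>\<^bsub>P n\<^esub> ra n (g n i (r - 1)) b"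

lemma signed_id: "x \<in> carrier (P n) \<Longrightarrow> signed (P n) k x = x"
  by (simp add: signed_def bimod_char2(3)[OF Pn.bimod_axioms])

lemma res_diff_gen: "res_diff_gen m 1 (Suc n) i r = dg n i r"
proof -
  \<comment> \<open>For N = 1 the sum in the case n = 2r has the single term k = 0.\<close>
  have s: "finsum (P n) f {..<1::nat} = f 0" if "f 0 \<in> carrier (P n)" for f
    using that by (simp add: lessThan_Suc)
  have pow: "x [^] (0::nat) = \<one>" for x by simp
  note cl = Pn.act_closed Pn.a_closed g_closed gens_closed one_closed zero_closed
  show ?thesis
    unfolding res_diff_gen_def Let_def L[symmetric] a_def[symmetric] b_def[symmetric] diff_Suc_1
      P_def[symmetric] g_def[symmetric] diff_self_eq_0 pow r_one[OF gens_closed(2)] r_one[OF gens_closed(3)]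
      signed_id[OF Pn.act_closed(1)[OF gens_closed(2) g_closed]] signed_id[OF Pn.act_closed(1)[OF gens_closed(3) g_closed]]
      signed_id[OF Pn.act_closed(2)[OF gens_closed(2) g_closed]] signed_id[OF Pn.act_closed(2)[OF gens_closed(3) g_closed]]
    by (subst s) (simp_all add: dg_def Pn.a_ac)
qed

lemma e_ends:
  "lact (P n) (e i) (dg n i r) = dg n i r" "ract (P n) (dg n i r) (e (i + int (Suc n) - 2 * r)) = dg n i r" "dg n (i mod int m) r = dg n i r"
  "dg n i r \<in> carrier (P n)" "\<not> (0 \<le> r \<and> r \<le> int (Suc n)) \<Longrightarrow> dg n i r = \<zero>\<^bsub>P n\<^esub>"
proof -
  note cl = Pn.act_closed Pn.a_closed g_closed gens_closed m_closed
  have l1: "la n (e i) (ra n (g n i r) x) = ra n (g n i r) x" if "x \<in> carrier L" for x r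
    using that by (simp only: Pn.act_mult(3)[symmetric] cl g_props(2))
  have l2: "la n (e i) (la n a (g n (i + 1) r)) = la n a (g n (i + 1) r)"
    using a_e[of "i + 1"] g_props(2)[of n "i + 1" r] Pn.act_mult(1)[of a "e (i + 1)" "g n (i + 1) r" n] Pn.act_mult(1)[of "e i" a "g n (i + 1) r" n]
    by simp
  have l3: "la n (e i) (la n b (g n (i - 1) r)) = la n b (g n (i - 1) r)" for r
    using b_e[of "i - 1"] g_props(2)[of n "i - 1" r] Pn.act_mult(1)[of b "e (i - 1)" "g n (i - 1) r" n] Pn.act_mult(1)[of "e i" b "g n (i - 1) r" n]
    by simp
  show "lact (P n) (e i) (dg n i r) = dg n i r"
    unfolding dg_def by (simp only: Pn.act_add cl l1 l2 l3)
  define j where "j = i + int (Suc n) - 2 * r"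
  have r1: "ra n (la n x (g n k s)) (e j) = la n x (g n k s)" if "x \<in> carrier L" "k + int n - 2 * s = j" for x k s
    using that g_props(3)[of n k s] by (simp only: Pn.act_mult(3) cl)
  have j': "i + int n - 2 * r = j - 1" "i + int n - 2 * (r - 1) = j + 1" by (simp_all add: j_def)
  have r2: "ra n (ra n (g n i r) a) (e j) = ra n (g n i r) a"
    using a_e[of j] g_props(3)[of n i r] Pn.act_mult(2)[of a "e j" "g n i r" n] Pn.act_mult(2)[of "e (j - 1)" a "g n i r" n]
    unfolding j' by simp
  have r3: "ra n (ra n (g n i (r - 1)) b) (e j) = ra n (g n i (r - 1)) b"
    using b_e[of j] g_props(3)[of n i "r - 1"] Pn.act_mult(2)[of b "e j" "g n i (r - 1)" n] Pn.act_mult(2)[of "e (j + 1)" b "g n i (r - 1)" n]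
    unfolding j' by simp
  have "ra n (la n a (g n (i + 1) r)) (e j) = la n a (g n (i + 1) r)" "ra n (la n b (g n (i - 1) (r - 1))) (e j) = la n b (g n (i - 1) (r - 1))"
    by (intro r1; simp add: j_def)+
  then show "ract (P n) (dg n i r) (e (i + int (Suc n) - 2 * r)) = dg n i r"
    unfolding dg_def j_def[symmetric] by (simp only: Pn.act_add cl r2 r3)
  have "g n (i mod int m + 1) r = g n (i + 1) r" "g n (i mod int m - 1) (r - 1) = g n (i - 1) (r - 1)"
    by (rule g_cong, simp add: mod_simps)+
  then show "dg n (i mod int m) r = dg n i r" by (simp only: dg_def g_mod)
  show "dg n i r \<in> carrier (P n)" unfolding dg_def by (simp only: cl)
  assume "\<not> (0 \<le> r \<and> r \<le> int (Suc n))"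
  then have "\<not> (0 \<le> r \<and> r \<le> int n)" "\<not> (0 \<le> r - 1 \<and> r - 1 \<le> int n)" by auto
  then show "dg n i r = \<zero>\<^bsub>P n\<^esub>" unfolding dg_def by (simp add: g_out)
qed

definition C :: "('k lam, 'k res) bimod_complex" where "C = min_res m 1"

lemma trm_C: "trm C n = P n" by (simp add: C_def min_res_def P_def)

abbreviation d where "d \<equiv> diff C"

lemma bimod_R: "bimod L (regular_bimod L)"
  by (simp add: bimod_def is_bimodule_regular k_algebra_axioms)

text \<open>The definite description in \<open>min_res\<close> denotes: a homomorphism with the
  prescribed values exists by \<open>P_hom\<close>, since these values have the right end points
  (\<open>e_ends\<close>), and it is unique because the generators generate.\<close>

lemma d_props: "d n \<in> bimod_hom L (P (Suc n)) (P n)" "d n (g (Suc n) i r) = dg n i r"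
proof -
  obtain \<phi> where \<phi>: "\<phi> \<in> bimod_hom L (P (Suc n)) (P n)" "\<And>i r. \<phi> (g (Suc n) i r) = dg n i r"
  proof -
    have "\<exists>\<phi>. \<phi> \<in> bimod_hom L (P (Suc n)) (P n) \<and> (\<forall>i r. \<phi> (g (Suc n) i r) = dg n i r)"
      by (rule P_hom[OF Pn.bimod_axioms]) (rule e_ends, assumption?)+
    then show thesis using that by blast
  qed
  have "d n = (THE f. f \<in> bimod_hom L (P (Suc n)) (P n) \<and> (\<forall>(i, r)\<in>res_index m (Suc n). f (g (Suc n) i r) = dg n i r))"
    unfolding C_def min_res_def P_def g_def L[symmetric] res_diff_gen by simp
  also have "\<dots> = \<phi>"
  proof (rule the_equality)
    show "\<phi> \<in> bimod_hom L (P (Suc n)) (P n) \<and> (\<forall>(i, r)\<in>res_index m (Suc n). \<phi> (g (Suc n) i r) = dg n i r)"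
      using \<phi> by simp
    fix f assume f: "f \<in> bimod_hom L (P (Suc n)) (P n) \<and> (\<forall>(i, r)\<in>res_index m (Suc n). f (g (Suc n) i r) = dg n i r)"
    show "f = \<phi>"
    proof (rule P_hom_eqI[OF _ \<phi>(1) Pn.bimod_axioms])
      fix i r assume "i \<in> {0..<int m}" "0 \<le> r" "r \<le> int (Suc n)"
      then have "(i, r) \<in> res_index m (Suc n)" by (simp add: res_index_def)
      then have "case (i, r) of (i, r) \<Rightarrow> f (g (Suc n) i r) = dg n i r" by (rule bspec[OF conjunct2[OF f]])
      then show "f (g (Suc n) i r) = \<phi> (g (Suc n) i r)" using \<phi>(2)[of i r] by simp
    qed (use f in simp)
  qed
  finally show "d n \<in> bimod_hom L (P (Suc n)) (P n)" "d n (g (Suc n) i r) = dg n i r" using \<phi> by simp_all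
qed

lemma aug_props: "aug C \<in> bimod_hom L (P 0) (regular_bimod L)" "aug C (g 0 i r) = (if r = 0 then e i else \<zero>)"
proof -
  have Rs: "carrier (regular_bimod L) = carrier L" "\<zero>\<^bsub>regular_bimod L\<^esub> = \<zero>" "lact (regular_bimod L) = (\<otimes>)" "ract (regular_bimod L) = (\<otimes>)"
    by (simp_all add: regular_bimod_def)
  obtain \<phi> where \<phi>: "\<phi> \<in> bimod_hom L (P 0) (regular_bimod L)" "\<And>i r. \<phi> (g 0 i r) = (if r = 0 then e i else \<zero>)"
  proof -
    have "\<exists>\<phi>. \<phi> \<in> bimod_hom L (P 0) (regular_bimod L) \<and> (\<forall>i r. \<phi> (g 0 i r) = (if r = 0 then e i else \<zero>))"
      by (rule P_hom[OF bimod_R]) (simp_all add: Rs, clarify, simp)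
    then show thesis using that by blast
  qed
  have "aug C = (THE f. f \<in> bimod_hom L (P 0) (regular_bimod L) \<and> (\<forall>i\<in>{0..<int m}. f (g 0 i 0) = e i))"
    unfolding C_def min_res_def P_def g_def L[symmetric] e_def by simp
  also have "\<dots> = \<phi>"
  proof (rule the_equality)
    show "\<phi> \<in> bimod_hom L (P 0) (regular_bimod L) \<and> (\<forall>i\<in>{0..<int m}. \<phi> (g 0 i 0) = e i)" using \<phi> by simp
    fix f assume f: "f \<in> bimod_hom L (P 0) (regular_bimod L) \<and> (\<forall>i\<in>{0..<int m}. f (g 0 i 0) = e i)"
    show "f = \<phi>"
    proof (rule P_hom_eqI[OF _ \<phi>(1) bimod_R])
      fix i r assume "i \<in> {0..<int m}" "0 \<le> r" "r \<le> int 0"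
      then show "f (g 0 i r) = \<phi> (g 0 i r)" using f \<phi>(2)[of i r] by simp
    qed (use f in simp)
  qed
  finally show "aug C \<in> bimod_hom L (P 0) (regular_bimod L)" "aug C (g 0 i r) = (if r = 0 then e i else \<zero>)" using \<phi> by simp_all
qed

lemmas dD = bimod_homD[OF d_props(1)]

text \<open>By right linearity, identities between right linear maps need only be checked on the
  elements \<open>u\<cdot>g\<close> with \<open>u\<close> a basis element.\<close>

lemma P_induct_right [consumes 1, case_names zero add ract gen]:
  assumes x: "x \<in> carrier (P n)" and zero: "Pr \<zero>\<^bsub>P n\<^esub>"
    and add: "\<And>x y. \<lbrakk>x \<in> carrier (P n); y \<in> carrier (P n); Pr x; Pr y\<rbrakk> \<Longrightarrow> Pr (x \<oplus>\<^bsub>P n\<^esub> y)"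
    and ract: "\<And>x v. \<lbrakk>x \<in> carrier (P n); v \<in> carrier L; Pr x\<rbrakk> \<Longrightarrow> Pr (ra n x v)"
    and gen: "\<And>i r. \<lbrakk>0 \<le> r; r \<le> int n\<rbrakk> \<Longrightarrow> Pr (g n i r) \<and> Pr (la n a (g n i r)) \<and> Pr (la n b (g n i r)) \<and> Pr (la n (a \<otimes> b) (g n i r))"
  shows "Pr x"
  using x
proof (induction rule: P_induct)
  case (gen i r u v)
  note cl = Pn.act_closed Pn.a_closed g_closed gens_closed m_closed smult_closed one_closed a_closed
  have sc: "Pr (la n (c \<odot> (y \<otimes> e i)) (g n i r))" if "y \<in> carrier L" "Pr (la n y (g n i r))" for c y
  proof -
    have "la n (c \<odot> (y \<otimes> e i)) (g n i r) = la n (y \<otimes> e i) (ra n (g n i r) (c \<odot> \<one>))"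
      using that(1) smult_eq_mult'[of "y \<otimes> e i" c] by (simp only: cl Pn.act_mult(1) Pn.act_scalar)
    also have "\<dots> = ra n (la n y (g n i r)) (c \<odot> \<one>)"
      using that(1) by (simp only: cl Pn.act_mult(3)[symmetric] Pn.act_mult(1) g_props(2))
    finally show ?thesis using that ract[of "la n y (g n i r)" "c \<odot> \<one>"] by (simp only: cl)
  qed
  have "Pr (la n (\<one> \<otimes> e i \<otimes> e i) (g n i r))" for c using assms(5)[OF gen(1,2), of i] by (simp add: g_props(2))
  have "Pr (la n (comb i c1 c2 c3 c4) (g n i r))" for c1 c2 c3 c4
  proof -
    have "Pr (la n (c1 \<odot> (\<one> \<otimes> e i)) (g n i r))" "Pr (la n (c2 \<odot> (a \<otimes> e i)) (g n i r))" "Pr (la n (c3 \<odot> (b \<otimes> e i)) (g n i r))"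
       "Pr (la n (c4 \<odot> (a \<otimes> b \<otimes> e i)) (g n i r))"
      using assms(5)[OF gen(1,2), of i] by (intro sc; simp)+
    then show ?thesis by (simp only: Pn.act_mult(4) cl l_one add)
  qed
  from this[of "kE m i u" "kA m i u" "kB m i u" "kS m i u"] have "Pr (la n u (g n i r))"
    unfolding decomp[OF gen(3), of i, symmetric] gen(5) .
  then show ?case using gen by (intro ract) (simp_all only: cl)
qed (use zero add in auto)

end

section \<open>Exactness of the explicit complex\<close>

context lam2
begin

subsection \<open>A right linear contracting homotopy\<close>

abbreviation inr where "inr n r \<equiv> 0 \<le> r \<and> r \<le> int n"

text \<open>Values of the homotopy on a g, b g and ab g, with value 0 on g itself. A generator of
  degree n + 1 with r \<le> n is recovered from the term a g(i+1,r) of its boundary; the last one, r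
  = n + 1, has no such term and is recovered from b g(i-1,n). Hence b g is sent to a generator only
  if r = n. On ab g one takes b times the value on a g, and for r = n the extra term cancels the
  boundary term b g(i-1,n) a.\<close>

definition hA :: "nat \<Rightarrow> int \<Rightarrow> int \<Rightarrow> 'k res" where "hA n i r = g (Suc n) (i - 1) r"
definition hB :: "nat \<Rightarrow> int \<Rightarrow> int \<Rightarrow> 'k res" where
  "hB n i r = (if r = int n then g (Suc n) (i + 1) (r + 1) else \<zero>\<^bsub>P (Suc n)\<^esub>)"
definition hS :: "nat \<Rightarrow> int \<Rightarrow> int \<Rightarrow> 'k res" where
  "hS n i r = la (Suc n) b (g (Suc n) (i - 1) r) \<oplus>\<^bsub>P (Suc n)\<^esub>
     (if r = int n then ra (Suc n) (g (Suc n) i (r + 1)) a else \<zero>\<^bsub>P (Suc n)\<^esub>)"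

text \<open>The value on u g, expanded in the basis of \<Lambda> e i. The coefficients are put on
  the right side, which makes the prescription balanced and compatible with right linearity.\<close>

definition Hu :: "nat \<Rightarrow> int \<Rightarrow> int \<Rightarrow> 'k lam \<Rightarrow> 'k res" where
  "Hu n i r u = ra (Suc n) (hA n i r) (kA m i u \<odot> \<one>) \<oplus>\<^bsub>P (Suc n)\<^esub> ra (Suc n) (hB n i r) (kB m i u \<odot> \<one>)
     \<oplus>\<^bsub>P (Suc n)\<^esub> ra (Suc n) (hS n i r) (kS m i u \<odot> \<one>)"

lemma h_closed [simp]: "hA n i r \<in> carrier (P (Suc n))" "hB n i r \<in> carrier (P (Suc n))" "hS n i r \<in> carrier (P (Suc n))"
  by (simp_all add: hA_def hB_def hS_def)

lemma Hu_closed [simp]: "Hu n i r u \<in> carrier (P (Suc n))"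
  by (simp add: Hu_def)

lemma h_period: "hA n (i mod int m) r = hA n i r" "hB n (i mod int m) r = hB n i r" "hS n (i mod int m) r = hS n i r"
proof -
  have *: "g k (i mod int m - 1) r = g k (i - 1) r" "g k (i mod int m + 1) r = g k (i + 1) r" for k r
    by (rule g_cong, simp add: mod_simps)+
  show "hA n (i mod int m) r = hA n i r" "hB n (i mod int m) r = hB n i r" "hS n (i mod int m) r = hS n i r"
    unfolding hA_def hB_def hS_def * g_mod by simp_all
qed

lemma k_period: "kA m (i mod int m) u = kA m i u" "kB m (i mod int m) u = kB m i u" "kS m (i mod int m) u = kS m i u"
  by (simp_all add: kA_def kB_def kS_def cA_def cB_def cS_def mod_simps)

lemma h_end:
  assumes "j = i + int n - 2 * r"
  shows "ra (Suc n) (hA n i r) (e j) = hA n i r" "ra (Suc n) (hB n i r) (e j) = hB n i r" "ra (Suc n) (hS n i r) (e j) = hS n i r"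
proof -
  have 1: "ra (Suc n) (g (Suc n) (i - 1) r) (e j) = g (Suc n) (i - 1) r"
    using g_props(3)[of "Suc n" "i - 1" r] by (simp add: assms)
  have 2: "ra (Suc n) (g (Suc n) (i + 1) (r + 1)) (e j) = g (Suc n) (i + 1) (r + 1)"
    using g_props(3)[of "Suc n" "i + 1" "r + 1"] by (simp add: assms algebra_simps)
  have 3: "ra (Suc n) (g (Suc n) i (r + 1)) (e (j - 1)) = g (Suc n) i (r + 1)"
    using g_props(3)[of "Suc n" i "r + 1"] by (simp add: assms algebra_simps)
  have 4: "ra (Suc n) (ra (Suc n) (g (Suc n) i (r + 1)) a) (e j) = ra (Suc n) (g (Suc n) i (r + 1)) a"
    using a_e[of j] 3 Pn.act_mult(2)[of a "e j" "g (Suc n) i (r + 1)" "Suc n"] Pn.act_mult(2)[of "e (j - 1)" a "g (Suc n) i (r + 1)" "Suc n"] by simp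
  show "ra (Suc n) (hA n i r) (e j) = hA n i r" using 1 by (simp add: hA_def)
  show "ra (Suc n) (hB n i r) (e j) = hB n i r" using 2 by (cases "r = int n") (simp_all add: hB_def)
  show "ra (Suc n) (hS n i r) (e j) = hS n i r" using 1 4 by (cases "r = int n") (simp_all add: hS_def Pn.act_add Pn.act_mult(3))
qed

lemma Hu_end: "ra (Suc n) (Hu n i r u) (e (i + int n - 2 * r)) = Hu n i r u"
proof -
  have c: "ra (Suc n) (ra (Suc n) x (c \<odot> \<one>)) (e j) = ra (Suc n) (ra (Suc n) x (e j)) (c \<odot> \<one>)" if "x \<in> carrier (P (Suc n))" for x c j
    using that by (simp add: Pn.act_mult(2)[symmetric] smult_mult_l smult_mult_r)
  show ?thesis unfolding Hu_def by (simp add: Pn.act_add c h_end[OF refl])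
qed

lemma Hu_linear:
  assumes "u \<in> carrier L" "u' \<in> carrier L"
  shows "Hu n i r (u \<oplus> u') = Hu n i r u \<oplus>\<^bsub>P (Suc n)\<^esub> Hu n i r u'" "Hu n i r (c \<odot> u) = ra (Suc n) (Hu n i r u) (c \<odot> \<one>)"
    "Hu n i r (u \<otimes> e i) = Hu n i r u"
proof -
  have s: "(c * c') \<odot> \<one> = (c' \<odot> \<one>) \<otimes> (c \<odot> \<one>)" for c c'
    by (simp add: smult_mult_l smult_mult_r smult_assoc1[symmetric] mult.commute)
  show "Hu n i r (u \<oplus> u') = Hu n i r u \<oplus>\<^bsub>P (Suc n)\<^esub> Hu n i r u'"
    using assms by (simp add: Hu_def k_linear smult_l_distr Pn.act_mult(5) Pn.a_ac)
  show "Hu n i r (c \<odot> u) = ra (Suc n) (Hu n i r u) (c \<odot> \<one>)"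
    using assms by (simp add: Hu_def k_linear s Pn.act_mult(2) Pn.act_add)
  show "Hu n i r (u \<otimes> e i) = Hu n i r u"
    using assms by (simp add: Hu_def k_mult k_values)
qed

text \<open>The homotopy is linear for the right action only, so it is built from
  \<open>FB_universal\<close> by sending the pure tensor of u and v to \<open>Hu\<close> of u times
  v; right linearity is then verified on pure tensors.\<close>

lemma homotopy_exists:
  "\<exists>\<phi>. \<phi> \<in> carrier (P n) \<rightarrow> carrier (P (Suc n)) \<and>
     (\<forall>x\<in>carrier (P n). \<forall>y\<in>carrier (P n). \<phi> (x \<oplus>\<^bsub>P n\<^esub> y) = \<phi> x \<oplus>\<^bsub>P (Suc n)\<^esub> \<phi> y) \<and>
     (\<forall>x\<in>carrier (P n). \<forall>v\<in>carrier L. \<phi> (ra n x v) = ra (Suc n) (\<phi> x) v) \<and>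
     (\<forall>i r. \<forall>u\<in>carrier L. inr n r \<longrightarrow> \<phi> (la n u (g n i r)) = Hu n i r u)"
proof -
  define \<beta> where "\<beta> j u v = ra (Suc n) (Hu n (fst j) (snd j) u) v" for j u v
  have UV: "u \<in> carrier L" "v \<in> carrier L" if "j \<in> res_index m n" "u \<in> F.U j" "v \<in> F.V n j" for j u v
    using F.U_iff[OF that(1)] F.V_iff[OF that(1)] that by blast+
  have sc: "\<beta> j (c \<odot> u) v = \<beta> j u (c \<odot> v)" if "u \<in> carrier L" "v \<in> carrier L" for j c u v
  proof -
    have "\<beta> j (c \<odot> u) v = ra (Suc n) (Hu n (fst j) (snd j) u) ((c \<odot> \<one>) \<otimes> v)"
      using that by (simp add: \<beta>_def Hu_linear(2)[OF that(1,1)] Pn.act_mult(2))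
    then show ?thesis unfolding smult_eq_mult[OF that(2), of c, symmetric] \<beta>_def .
  qed
  obtain \<phi> where \<phi>: "\<phi> \<in> carrier (F.FB n) \<rightarrow> carrier (P (Suc n))"
    "\<And>x y. x \<in> carrier (F.FB n) \<Longrightarrow> y \<in> carrier (F.FB n) \<Longrightarrow> \<phi> (x \<oplus>\<^bsub>F.FB n\<^esub> y) = \<phi> x \<oplus>\<^bsub>P (Suc n)\<^esub> \<phi> y"
    "\<And>j u v. \<lbrakk>j \<in> res_index m n; u \<in> F.U j; v \<in> F.V n j\<rbrakk> \<Longrightarrow> \<phi> (F.W n j u v) = \<beta> j u v"
  proof (rule F.FB_universal[OF Pn.abelian_group_axioms, of n \<beta>])
    fix j u u' v assume j: "j \<in> res_index m n" "u \<in> F.U j" "u' \<in> F.U j" "v \<in> F.V n j"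
    show "\<beta> j (u \<oplus> u') v = \<beta> j u v \<oplus>\<^bsub>P (Suc n)\<^esub> \<beta> j u' v"
      using UV[OF j(1,2,4)] UV[OF j(1,3,4)] by (simp add: \<beta>_def Hu_linear(1) Pn.act_add)
  next
    fix j u v v' assume j: "j \<in> res_index m n" "u \<in> F.U j" "v \<in> F.V n j" "v' \<in> F.V n j"
    show "\<beta> j u (v \<oplus> v') = \<beta> j u v \<oplus>\<^bsub>P (Suc n)\<^esub> \<beta> j u v'"
      using UV[OF j(1,2,3)] UV[OF j(1,2,4)] by (simp add: \<beta>_def Pn.act_mult(5))
  next
    fix j u v assume j: "j \<in> res_index m n" "u \<in> F.U j" "v \<in> F.V n j"
    show "\<beta> j u v \<in> carrier (P (Suc n))" using UV[OF j] by (simp add: \<beta>_def)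
    show "\<beta> j (c \<odot> u) v = \<beta> j u (c \<odot> v)" for c using UV[OF j] by (rule sc)
  qed blast
  have \<phi>c: "\<phi> x \<in> carrier (P (Suc n))" if "x \<in> carrier (F.FB n)" for x using \<phi>(1) that by (rule funcset_mem)
  have \<phi>0: "\<phi> \<zero>\<^bsub>F.FB n\<^esub> = \<zero>\<^bsub>P (Suc n)\<^esub>"
    using \<phi>(2)[OF F.FB.zero_closed F.FB.zero_closed] \<phi>c[OF F.FB.zero_closed] by simp
  have r: "\<phi> (ract (F.FB n) x w) = ra (Suc n) (\<phi> x) w" if x: "x \<in> carrier (F.FB n)" and w: "w \<in> carrier L" for x w
    using x
  proof (induction rule: F.FB_induct)
    case zero then show ?case using w \<phi>0 by simp
  next
    case (gen j u v)
    have vw: "v \<otimes> w \<in> F.V n j" using tensor.V(4)[OF F.tensor[OF gen(1)] w gen(3)] .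
    have "\<phi> (ract (F.FB n) (F.W n j u v) w) = \<beta> j u (v \<otimes> w)"
      unfolding F.W_act(2)[OF gen w] by (rule \<phi>(3)[OF gen(1,2) vw])
    also have "\<dots> = ra (Suc n) (\<phi> (F.W n j u v)) w"
      unfolding \<phi>(3)[OF gen] \<beta>_def using UV[OF gen] w by (simp add: Pn.act_mult(2))
    finally show ?case .
  next
    case (add x y)
    then show ?case using w by (simp add: F.FB.act_add \<phi>(2) \<phi>c Pn.act_add)
  qed
  have v: "\<phi> (la n u (g n i r)) = Hu n i r u" if u: "u \<in> carrier L" and ir: "inr n r" for i r u
  proof -
    define j where "j = (i mod int m, r)"
    have j: "j \<in> res_index m n" unfolding j_def using ir by (simp only: index_iff)
    have gg: "g n i r = F.gen n j" unfolding j_def by (rule g_gen) (rule j[unfolded j_def])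
    have ue: "u \<otimes> e i \<in> F.U j" unfolding F.U_iff[OF j] using u by (simp add: j_def m_assoc)
    have ev: "e (i + int n - 2 * r) \<in> F.V n j" unfolding F.V_iff[OF j] by (simp add: j_def e_shift)
    have "F.gen n j = F.W n j (e i) (e (i + int n - 2 * r))" by (simp add: j_def e_shift)
    then have "la n u (g n i r) = F.W n j (u \<otimes> e i) (e (i + int n - 2 * r))"
      unfolding gg using F.W_act(1)[OF j F.gen_UV[OF j] u] unfolding P_FB by (simp add: j_def e_shift)
    then have "\<phi> (la n u (g n i r)) = \<beta> j (u \<otimes> e i) (e (i + int n - 2 * r))" using \<phi>(3)[OF j ue ev] by simp
    also have "Hu n (i mod int m) r (u \<otimes> e i) = Hu n i r (u \<otimes> e i)" by (simp only: Hu_def h_period k_period)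
    then have "\<beta> j (u \<otimes> e i) (e (i + int n - 2 * r)) = Hu n i r u"
      by (simp add: \<beta>_def j_def Hu_linear(3)[OF u u] Hu_end)
    finally show ?thesis .
  qed
  show ?thesis
    unfolding P_FB[of n] using \<phi>(1,2) r v[unfolded P_FB[of n]] by blast
qed

definition h :: "nat \<Rightarrow> 'k res \<Rightarrow> 'k res" where
  "h n = (SOME \<phi>. \<phi> \<in> carrier (P n) \<rightarrow> carrier (P (Suc n)) \<and>
     (\<forall>x\<in>carrier (P n). \<forall>y\<in>carrier (P n). \<phi> (x \<oplus>\<^bsub>P n\<^esub> y) = \<phi> x \<oplus>\<^bsub>P (Suc n)\<^esub> \<phi> y) \<and>
     (\<forall>x\<in>carrier (P n). \<forall>v\<in>carrier L. \<phi> (ra n x v) = ra (Suc n) (\<phi> x) v) \<and>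
     (\<forall>i r. \<forall>u\<in>carrier L. inr n r \<longrightarrow> \<phi> (la n u (g n i r)) = Hu n i r u))"

lemma h_props:
  "x \<in> carrier (P n) \<Longrightarrow> h n x \<in> carrier (P (Suc n))"
  "x \<in> carrier (P n) \<Longrightarrow> y \<in> carrier (P n) \<Longrightarrow> h n (x \<oplus>\<^bsub>P n\<^esub> y) = h n x \<oplus>\<^bsub>P (Suc n)\<^esub> h n y"
  "x \<in> carrier (P n) \<Longrightarrow> v \<in> carrier L \<Longrightarrow> h n (ra n x v) = ra (Suc n) (h n x) v"
  "u \<in> carrier L \<Longrightarrow> inr n r \<Longrightarrow> h n (la n u (g n i r)) = Hu n i r u"
proof -
  have "h n \<in> carrier (P n) \<rightarrow> carrier (P (Suc n)) \<and>
     (\<forall>x\<in>carrier (P n). \<forall>y\<in>carrier (P n). h n (x \<oplus>\<^bsub>P n\<^esub> y) = h n x \<oplus>\<^bsub>P (Suc n)\<^esub> h n y) \<and>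
     (\<forall>x\<in>carrier (P n). \<forall>v\<in>carrier L. h n (ra n x v) = ra (Suc n) (h n x) v) \<and>
     (\<forall>i r. \<forall>u\<in>carrier L. inr n r \<longrightarrow> h n (la n u (g n i r)) = Hu n i r u)"
    unfolding h_def by (rule someI_ex[OF homotopy_exists])
  then show "x \<in> carrier (P n) \<Longrightarrow> h n x \<in> carrier (P (Suc n))"
    "x \<in> carrier (P n) \<Longrightarrow> y \<in> carrier (P n) \<Longrightarrow> h n (x \<oplus>\<^bsub>P n\<^esub> y) = h n x \<oplus>\<^bsub>P (Suc n)\<^esub> h n y"
    "x \<in> carrier (P n) \<Longrightarrow> v \<in> carrier L \<Longrightarrow> h n (ra n x v) = ra (Suc n) (h n x) v"
    "u \<in> carrier L \<Longrightarrow> inr n r \<Longrightarrow> h n (la n u (g n i r)) = Hu n i r u"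
    by (simp_all add: Pi_iff)
qed

lemma h_zero: "h n \<zero>\<^bsub>P n\<^esub> = \<zero>\<^bsub>P (Suc n)\<^esub>"
  using h_props(2)[OF Pn.zero_closed Pn.zero_closed] h_props(1)[OF Pn.zero_closed] by simp

lemma h_vals:
  "h n (g n i r) = \<zero>\<^bsub>P (Suc n)\<^esub>"
  "h n (la n a (g n i r)) = (if inr n r then hA n i r else \<zero>\<^bsub>P (Suc n)\<^esub>)"
  "h n (la n b (g n i r)) = (if inr n r then hB n i r else \<zero>\<^bsub>P (Suc n)\<^esub>)"
  "h n (la n (a \<otimes> b) (g n i r)) = (if inr n r then hS n i r else \<zero>\<^bsub>P (Suc n)\<^esub>)"
proof -
  have r0: "ra (Suc n) x \<zero> = \<zero>\<^bsub>P (Suc n)\<^esub>" if "x \<in> carrier (P (Suc n))" for x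
    using Pn.lact_zero(2)[OF k_algebra_axioms that] .
  have "h n (la n (e i) (g n i r)) = \<zero>\<^bsub>P (Suc n)\<^esub>"
  proof (cases "inr n r")
    case True
    show ?thesis unfolding h_props(4)[OF gens_closed(1) True] by (simp add: Hu_def k_values r0)
  qed (simp add: g_out h_zero)
  then show "h n (g n i r) = \<zero>\<^bsub>P (Suc n)\<^esub>" by (simp add: g_props(2))
  show "h n (la n a (g n i r)) = (if inr n r then hA n i r else \<zero>\<^bsub>P (Suc n)\<^esub>)"
  proof (cases "inr n r")
    case True
    show ?thesis unfolding h_props(4)[OF gens_closed(2) True] using True by (simp add: Hu_def k_values r0)
  next
    case False
    then show ?thesis unfolding g_out[OF False] if_not_P[OF False] by (simp add: h_zero)
  qed
  show "h n (la n b (g n i r)) = (if inr n r then hB n i r else \<zero>\<^bsub>P (Suc n)\<^esub>)"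
  proof (cases "inr n r")
    case True
    show ?thesis unfolding h_props(4)[OF gens_closed(3) True] using True by (simp add: Hu_def k_values r0)
  next
    case False
    then show ?thesis unfolding g_out[OF False] if_not_P[OF False] by (simp add: h_zero)
  qed
  show "h n (la n (a \<otimes> b) (g n i r)) = (if inr n r then hS n i r else \<zero>\<^bsub>P (Suc n)\<^esub>)"
  proof (cases "inr n r")
    case True
    show ?thesis unfolding h_props(4)[OF m_closed[OF gens_closed(2,3)] True] using True by (simp add: Hu_def k_values k_mult r0)
  next
    case False
    then show ?thesis unfolding g_out[OF False] if_not_P[OF False] by (simp add: h_zero)
  qed
qed

lemma act_nf:
  assumes "x \<in> carrier (P n)"
  shows "la n a (la n b x) = la n (a \<otimes> b) x" "la n b (la n a x) = la n (a \<otimes> b) x" "la n a (la n a x) = \<zero>\<^bsub>P n\<^esub>" "la n b (la n b x) = \<zero>\<^bsub>P n\<^esub>"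
    "la n a (la n (a \<otimes> b) x) = \<zero>\<^bsub>P n\<^esub>" "la n b (la n (a \<otimes> b) x) = \<zero>\<^bsub>P n\<^esub>"
    "la n (a \<otimes> b) (la n a x) = \<zero>\<^bsub>P n\<^esub>" "la n (a \<otimes> b) (la n b x) = \<zero>\<^bsub>P n\<^esub>"
    "ra n (ra n x a) b = ra n x (a \<otimes> b)" "ra n (ra n x b) a = ra n x (a \<otimes> b)" "ra n (ra n x a) a = \<zero>\<^bsub>P n\<^esub>" "ra n (ra n x b) b = \<zero>\<^bsub>P n\<^esub>"
proof -
  note z = Pn.lact_zero[OF k_algebra_axioms]
  have t: "a \<otimes> (a \<otimes> b) = \<zero>" "b \<otimes> (a \<otimes> b) = \<zero>" "a \<otimes> b \<otimes> a = \<zero>" "a \<otimes> b \<otimes> b = \<zero>"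
  proof -
    show "a \<otimes> (a \<otimes> b) = \<zero>" by (simp add: m_assoc[symmetric] rel_aa)
    show "b \<otimes> (a \<otimes> b) = \<zero>" unfolding rel_ab[symmetric] by (simp add: m_assoc[symmetric] rel_bb)
    show "a \<otimes> b \<otimes> a = \<zero>" by (simp add: m_assoc rel_ab) (simp add: m_assoc[symmetric] rel_aa)
    show "a \<otimes> b \<otimes> b = \<zero>" by (simp add: m_assoc rel_bb)
  qed
  show "la n a (la n b x) = la n (a \<otimes> b) x" "la n b (la n a x) = la n (a \<otimes> b) x" "la n a (la n a x) = \<zero>\<^bsub>P n\<^esub>" "la n b (la n b x) = \<zero>\<^bsub>P n\<^esub>"
    "la n a (la n (a \<otimes> b) x) = \<zero>\<^bsub>P n\<^esub>" "la n b (la n (a \<otimes> b) x) = \<zero>\<^bsub>P n\<^esub>"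
    "la n (a \<otimes> b) (la n a x) = \<zero>\<^bsub>P n\<^esub>" "la n (a \<otimes> b) (la n b x) = \<zero>\<^bsub>P n\<^esub>"
    "ra n (ra n x a) b = ra n x (a \<otimes> b)" "ra n (ra n x b) a = ra n x (a \<otimes> b)" "ra n (ra n x a) a = \<zero>\<^bsub>P n\<^esub>" "ra n (ra n x b) b = \<zero>\<^bsub>P n\<^esub>"
    using assms by (simp_all only: Pn.act_mult(1,2)[symmetric] gens_closed m_closed rel_ab rel_aa rel_bb t z)
qed

lemma h_la_ra:
  "x \<in> carrier (P n) \<Longrightarrow> u \<in> carrier L \<Longrightarrow> v \<in> carrier L \<Longrightarrow> h n (la n u (ra n x v)) = ra (Suc n) (h n (la n u x)) v"
  by (simp add: Pn.act_mult(3)[symmetric] h_props(3))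

text \<open>Normalisation of words around a generator: left actions are pulled outside right
  actions, products are reduced by aa = bb = 0 and ba = ab, and equal terms cancel in pairs.\<close>

lemmas nf = act_nf Pn.act_add Pn.act_mult(3) h_la_ra h_props(1,2,3) h_vals dD(1-4) d_props(2) Pn.a_ac
  bimod_char2(1,2)[OF Pn.bimod_axioms]

text \<open>Each term of the twofold differential of a generator either contains aa or bb or occurs
  twice.\<close>

lemma d_d: assumes "x \<in> carrier (P (Suc (Suc n)))" shows "d n (d (Suc n) x) = \<zero>\<^bsub>P n\<^esub>"
proof -
  have "compose (carrier (P (Suc (Suc n)))) (d n) (d (Suc n)) = (\<lambda>x\<in>carrier (P (Suc (Suc n))). \<zero>\<^bsub>P n\<^esub>)"
  proof (rule P_hom_eqI[OF Pn.hom_compose[OF d_props(1) d_props(1)] Pn.hom_const_zero[OF Pn.bimod_axioms] Pn.bimod_axioms])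
    fix i r
    have "d n (d (Suc n) (g (Suc (Suc n)) i r)) = \<zero>\<^bsub>P n\<^esub>"
      by (simp add: d_props(2) dg_def[of "Suc n"] nf) (simp add: dg_def nf)
    then show "compose (carrier (P (Suc (Suc n)))) (d n) (d (Suc n)) (g (Suc (Suc n)) i r) = (\<lambda>x\<in>carrier (P (Suc (Suc n))). \<zero>\<^bsub>P n\<^esub>) (g (Suc (Suc n)) i r)"
      by (simp add: compose_def)
  qed
  from fun_cong[OF this, of x] show ?thesis using assms by (simp add: compose_def)
qed

end

context lam2
begin

lemma d_zero: "d n \<zero>\<^bsub>P (Suc n)\<^esub> = \<zero>\<^bsub>P n\<^esub>"
  by (rule Pn.hom_zero[OF d_props(1) Pn.abelian_group_axioms])

text \<open>Both sides are additive and right linear, so it suffices to compare them on u g with u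
  among 1, a, b and ab. There the identity follows from the choice of leading terms made in
  \<open>hA\<close>, \<open>hB\<close> and \<open>hS\<close>.\<close>

lemma homotopy_Suc:
  assumes "x \<in> carrier (P (Suc n))"
  shows "d (Suc n) (h (Suc n) x) \<oplus>\<^bsub>P (Suc n)\<^esub> h n (d n x) = x"
  using assms
proof (induction rule: P_induct_right)
  case zero
  show ?case by (simp add: h_zero d_zero)
next
  case (add x y)
  have "d (Suc n) (h (Suc n) (x \<oplus>\<^bsub>P (Suc n)\<^esub> y)) \<oplus>\<^bsub>P (Suc n)\<^esub> h n (d n (x \<oplus>\<^bsub>P (Suc n)\<^esub> y))
     = (d (Suc n) (h (Suc n) x) \<oplus>\<^bsub>P (Suc n)\<^esub> h n (d n x)) \<oplus>\<^bsub>P (Suc n)\<^esub> (d (Suc n) (h (Suc n) y) \<oplus>\<^bsub>P (Suc n)\<^esub> h n (d n y))"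
    using add(1,2) by (simp add: h_props(1,2) dD(1,2) Pn.a_ac)
  then show ?case using add by simp
next
  case (ract x v)
  have "d (Suc n) (h (Suc n) (ra (Suc n) x v)) \<oplus>\<^bsub>P (Suc n)\<^esub> h n (d n (ra (Suc n) x v))
     = ra (Suc n) (d (Suc n) (h (Suc n) x) \<oplus>\<^bsub>P (Suc n)\<^esub> h n (d n x)) v"
    using ract(1,2) by (simp add: h_props(1,3) dD(1,4) Pn.act_add)
  then show ?case using ract by simp
next
  case (gen i r)
  \<comment> \<open>The values of the homotopy change at the last generator, which is r = n + 1 in
    degree n + 1 and r = n in degree n.\<close>
  consider "r = int n + 1" | "r = int n" | "r < int n" using gen by force
  then show ?case
  proof cases
    case 1
    then show ?thesis
      by (simp add: nf dg_def hA_def hB_def hS_def g_out h_zero d_zero) (simp add: add.commute[of 1 "int n"] nf)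
  next
    case 2
    then show ?thesis
      by (cases "n = 0") (simp_all add: nf dg_def hA_def hB_def hS_def g_out h_zero d_zero)
  next
    case 3
    then show ?thesis using gen
      by (cases "r = 0") (simp_all add: nf dg_def hA_def hB_def hS_def g_out h_zero d_zero)
  qed
qed

text \<open>A right linear section of the augmentation, sending v to the sum of the tensors of e i
  and e i v. Composed with the augmentation it is the correction term of the homotopy in degree
  0.\<close>

definition s0 :: "'k lam \<Rightarrow> 'k res" where
  "s0 v = (\<Oplus>\<^bsub>P 0\<^esub>i\<in>{0..<int m}. ra 0 (g 0 i 0) v)"

lemma s0_props:
  "v \<in> carrier L \<Longrightarrow> s0 v \<in> carrier (P 0)"
  "v \<in> carrier L \<Longrightarrow> w \<in> carrier L \<Longrightarrow> s0 (v \<oplus> w) = s0 v \<oplus>\<^bsub>P 0\<^esub> s0 w"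
  "v \<in> carrier L \<Longrightarrow> w \<in> carrier L \<Longrightarrow> s0 (v \<otimes> w) = ra 0 (s0 v) w"
  "v \<in> carrier L \<Longrightarrow> s0 (e i \<otimes> v) = ra 0 (g 0 i 0) v"
proof -
  show c: "v \<in> carrier L \<Longrightarrow> s0 v \<in> carrier (P 0)" for v
    unfolding s0_def by (intro Pn.finsum_closed) auto
  show "v \<in> carrier L \<Longrightarrow> w \<in> carrier L \<Longrightarrow> s0 (v \<oplus> w) = s0 v \<oplus>\<^bsub>P 0\<^esub> s0 w"
    unfolding s0_def by (subst Pn.finsum_addf[symmetric]) (auto simp: Pn.act_mult(5) intro!: Pn.finsum_cong')
  show "s0 (v \<otimes> w) = ra 0 (s0 v) w" if v: "v \<in> carrier L" and w: "w \<in> carrier L" for v w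
  proof -
    have "ra 0 (s0 v) w = (\<Oplus>\<^bsub>P 0\<^esub>i\<in>{0..<int m}. ra 0 (ra 0 (g 0 i 0) v) w)"
      unfolding s0_def
      by (rule finsum_hom[OF Pn.abelian_group_axioms Pn.abelian_group_axioms]) (simp_all add: v w Pn.act_add)
    also have "\<dots> = s0 (v \<otimes> w)"
      unfolding s0_def by (intro Pn.finsum_cong') (simp_all add: v w Pn.act_mult(2))
    finally show ?thesis ..
  qed
  show "s0 (e i \<otimes> v) = ra 0 (g 0 i 0) v" if v: "v \<in> carrier L" for v
  proof -
    have z: "ra 0 (g 0 j 0) (e i \<otimes> v) = (if i mod int m = j then ra 0 (g 0 i 0) v else \<zero>\<^bsub>P 0\<^esub>)"
      if j: "j \<in> {0..<int m}" for j
    proof -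
      have gj: "ra 0 (g 0 j 0) (e j) = g 0 j 0" using g_props(3)[of 0 j 0] by simp
      have jm: "j mod int m = j" using j by simp
      have "ra 0 (g 0 j 0) (e i \<otimes> v) = ra 0 (ra 0 (g 0 j 0) (e j \<otimes> e i)) v"
        using v by (simp add: Pn.act_mult(2) gj)
      moreover have "g 0 j 0 = g 0 i 0" if "i mod int m = j" using that jm by (intro g_cong) simp
      ultimately show ?thesis
        using gj v Pn.lact_zero(2)[OF k_algebra_axioms, of "g 0 j 0" 0] jm by (auto simp: e_e)
    qed
    have "s0 (e i \<otimes> v) = (\<Oplus>\<^bsub>P 0\<^esub>j\<in>{0..<int m}. if i mod int m = j then ra 0 (g 0 i 0) v else \<zero>\<^bsub>P 0\<^esub>)"
      unfolding s0_def by (intro Pn.finsum_cong' refl z) (simp_all add: v)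
    also have "\<dots> = ra 0 (g 0 i 0) v"
      using mod_range v by (intro Pn.finsum_singleton) auto
    finally show ?thesis .
  qed
qed

lemma augD:
  "x \<in> carrier (P 0) \<Longrightarrow> aug C x \<in> carrier L"
  "x \<in> carrier (P 0) \<Longrightarrow> y \<in> carrier (P 0) \<Longrightarrow> aug C (x \<oplus>\<^bsub>P 0\<^esub> y) = aug C x \<oplus> aug C y"
  "u \<in> carrier L \<Longrightarrow> x \<in> carrier (P 0) \<Longrightarrow> aug C (la 0 u x) = u \<otimes> aug C x"
  "u \<in> carrier L \<Longrightarrow> x \<in> carrier (P 0) \<Longrightarrow> aug C (ra 0 x u) = aug C x \<otimes> u"
  using bimod_homD[OF aug_props(1)] by (simp_all add: regular_bimod_def)

lemma aug_zero: "aug C \<zero>\<^bsub>P 0\<^esub> = \<zero>"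
  using augD(2)[OF Pn.zero_closed Pn.zero_closed] augD(1)[OF Pn.zero_closed] by simp

lemma s0_zero: "s0 \<zero> = \<zero>\<^bsub>P 0\<^esub>"
  using s0_props(2)[OF zero_closed zero_closed] s0_props(1)[OF zero_closed] by simp

lemma homotopy_0:
  assumes "x \<in> carrier (P 0)"
  shows "d 0 (h 0 x) \<oplus>\<^bsub>P 0\<^esub> s0 (aug C x) = x"
  using assms
proof (induction rule: P_induct_right)
  case zero
  show ?case by (simp add: h_zero aug_zero s0_zero d_zero)
next
  case (add x y)
  have "d 0 (h 0 (x \<oplus>\<^bsub>P 0\<^esub> y)) \<oplus>\<^bsub>P 0\<^esub> s0 (aug C (x \<oplus>\<^bsub>P 0\<^esub> y))
     = (d 0 (h 0 x) \<oplus>\<^bsub>P 0\<^esub> s0 (aug C x)) \<oplus>\<^bsub>P 0\<^esub> (d 0 (h 0 y) \<oplus>\<^bsub>P 0\<^esub> s0 (aug C y))"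
    using add(1,2) by (simp add: h_props(1,2) dD(1,2) augD s0_props(1,2) Pn.a_ac)
  then show ?case using add by simp
next
  case (ract x v)
  have "d 0 (h 0 (ra 0 x v)) \<oplus>\<^bsub>P 0\<^esub> s0 (aug C (ra 0 x v)) = ra 0 (d 0 (h 0 x) \<oplus>\<^bsub>P 0\<^esub> s0 (aug C x)) v"
    using ract(1,2) by (simp add: h_props(1,3) dD(1,4) augD s0_props(1,3) Pn.act_add)
  then show ?case using ract by simp
next
  case (gen i r)
  then have r: "r = 0" by simp
  have s: "s0 (e i) = g 0 i 0" "s0 (a \<otimes> e i) = ra 0 (g 0 (i - 1) 0) a" "s0 (b \<otimes> e i) = ra 0 (g 0 (i + 1) 0) b"
    "s0 (a \<otimes> b \<otimes> e i) = ra 0 (g 0 i 0) (a \<otimes> b)"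
  proof -
    show "s0 (e i) = g 0 i 0" using s0_props(4)[OF one_closed, of i] by simp
    show "s0 (a \<otimes> e i) = ra 0 (g 0 (i - 1) 0) a" "s0 (b \<otimes> e i) = ra 0 (g 0 (i + 1) 0) b"
      unfolding a_e b_e by (rule s0_props(4); simp)+
    have "a \<otimes> b \<otimes> e i = e i \<otimes> (a \<otimes> b)"
      using a_e[of "i + 1"] by (simp add: m_assoc b_e) (simp add: m_assoc[symmetric])
    then show "s0 (a \<otimes> b \<otimes> e i) = ra 0 (g 0 i 0) (a \<otimes> b)" using s0_props(4)[of "a \<otimes> b" i] by simp
  qed
  show ?case
    unfolding r by (simp add: nf dg_def hA_def hB_def hS_def g_out h_zero d_zero augD aug_props(2) s)
qed

lemma aug_d: assumes "x \<in> carrier (P (Suc 0))" shows "aug C (d 0 x) = \<zero>"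
proof -
  have Rz: "\<zero>\<^bsub>regular_bimod L\<^esub> = \<zero>" by (simp add: regular_bimod_def)
  have c2: "x \<oplus> x = \<zero>" if "x \<in> carrier L" for x
    using bimod_char2(1)[OF bimod_R, of x] that by (simp add: regular_bimod_def)
  have "compose (carrier (P (Suc 0))) (aug C) (d 0) = (\<lambda>x\<in>carrier (P (Suc 0)). \<zero>\<^bsub>regular_bimod L\<^esub>)"
  proof (rule P_hom_eqI[OF Pn.hom_compose[OF d_props(1) aug_props(1)] Pn.hom_const_zero[OF bimod_R] bimod_R])
    fix i r
    have "aug C (d 0 (g (Suc 0) i r)) = \<zero>"
      using a_e[of "i + 1"] b_e[of "i - 1"]
      by (simp add: d_props(2) dg_def augD aug_props(2) c2 a_assoc)
    then show "compose (carrier (P (Suc 0))) (aug C) (d 0) (g (Suc 0) i r) = (\<lambda>x\<in>carrier (P (Suc 0)). \<zero>\<^bsub>regular_bimod L\<^esub>) (g (Suc 0) i r)"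
      by (simp add: compose_def Rz)
  qed
  from fun_cong[OF this, of x] show ?thesis using assms by (simp add: compose_def Rz)
qed

lemma aug_s0: "v \<in> carrier L \<Longrightarrow> aug C (s0 v) = v"
proof -
  assume v: "v \<in> carrier L"
  have "aug C (s0 v) = finsum L (\<lambda>i. aug C (ra 0 (g 0 i 0) v)) {0..<int m}"
    unfolding s0_def by (rule finsum_hom[OF Pn.abelian_group_axioms abelian_group_axioms]) (simp_all add: v augD)
  also have "\<dots> = finsum L (\<lambda>i. e i \<otimes> v) {0..<int m}"
    by (intro finsum_cong') (simp_all add: v augD aug_props(2))
  also have "\<dots> = v" using v finsum_ldistr[of "{0..<int m}" v e] sum_e by simp
  finally show ?thesis .
qed

theorem resolution: "projective_bimod_resolution L C"
  unfolding projective_bimod_resolution_def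
proof (intro conjI allI)
  fix n
  show "is_bimodule L (trm C n)" unfolding trm_C using Pn.bim .
  show "fg_projective_bimod L (trm C n)" unfolding trm_C P_FB by (rule F.fg_projective_FB)
  show "d n \<in> bimod_hom L (trm C (Suc n)) (trm C n)" unfolding trm_C by (rule d_props)
  show "{x \<in> carrier (trm C (Suc n)). d n x = \<zero>\<^bsub>trm C n\<^esub>} = d (Suc n) ` carrier (trm C (Suc (Suc n)))"
    unfolding trm_C
  proof (intro equalityI subsetI)
    fix x assume "x \<in> {x \<in> carrier (P (Suc n)). d n x = \<zero>\<^bsub>P n\<^esub>}"
    then have x: "x \<in> carrier (P (Suc n))" "d n x = \<zero>\<^bsub>P n\<^esub>" by simp_all
    \<comment> \<open>The homotopy formula exhibits a cycle as the boundary of its image under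
      h.\<close>
    have "x = d (Suc n) (h (Suc n) x)" using homotopy_Suc[OF x(1)] x h_zero[of n] by (simp add: dD(1) h_props(1))
    then show "x \<in> d (Suc n) ` carrier (P (Suc (Suc n)))" using h_props(1)[OF x(1)] by (rule image_eqI)
  next
    fix x assume "x \<in> d (Suc n) ` carrier (P (Suc (Suc n)))"
    then show "x \<in> {x \<in> carrier (P (Suc n)). d n x = \<zero>\<^bsub>P n\<^esub>}"
      by (elim imageE) (simp add: d_d dD(1))
  qed
next
  show "aug C \<in> bimod_hom L (trm C 0) (regular_bimod L)" unfolding trm_C by (rule aug_props)
  show "aug C ` carrier (trm C 0) = carrier L"
    unfolding trm_C
  proof (intro equalityI subsetI)
    show "x \<in> carrier L" if "x \<in> aug C ` carrier (P 0)" for x using that by (elim imageE) (simp add: augD)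
    show "x \<in> aug C ` carrier (P 0)" if "x \<in> carrier L" for x
      using that s0_props(1)[OF that] aug_s0[OF that] by (metis image_eqI)
  qed
  show "{x \<in> carrier (trm C 0). aug C x = \<zero>} = d 0 ` carrier (trm C 1)"
    unfolding trm_C One_nat_def
  proof (intro equalityI subsetI)
    fix x assume "x \<in> {x \<in> carrier (P 0). aug C x = \<zero>}"
    then have x: "x \<in> carrier (P 0)" "aug C x = \<zero>" by simp_all
    have "x = d 0 (h 0 x)" using homotopy_0[OF x(1)] x s0_zero by (simp add: dD(1) h_props(1))
    then show "x \<in> d 0 ` carrier (P (Suc 0))" using h_props(1)[OF x(1)] by (rule image_eqI)
  next
    fix x assume "x \<in> d 0 ` carrier (P (Suc 0))"
    then show "x \<in> {x \<in> carrier (P 0). aug C x = \<zero>}"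
      by (elim imageE) (simp add: aug_d dD(1))
  qed
qed

end

section \<open>The radical filtration of \<Lambda> and of the resolution\<close>

section \<open>Radical-valued cocycles\<close>

context lam2
begin

sublocale H: proj_res L C rewrites "trm C = P"
proof -
  show "proj_res L C" using resolution by (intro proj_res.intro k_algebra_axioms) (simp add: proj_res_axioms_def)
  show "trm C = P" by (rule ext) (rule trm_C)
qed

text \<open>The span of the paths of positive length and the span of the cycles, described by
  vanishing coordinates; they are the radical and its square.\<close>

definition rad :: "'k lam set" where "rad = {x \<in> carrier L. \<forall>i. kE m i x = 0}"
definition rad2 :: "'k lam set" where "rad2 = {x \<in> rad. \<forall>i. kA m i x = 0 \<and> kB m i x = 0}"

lemma radD: "x \<in> rad \<Longrightarrow> x \<in> carrier L" "x \<in> rad \<Longrightarrow> kE m i x = 0" by (simp_all add: rad_def)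
lemma rad2D: "x \<in> rad2 \<Longrightarrow> x \<in> rad" "x \<in> rad2 \<Longrightarrow> kA m i x = 0" "x \<in> rad2 \<Longrightarrow> kB m i x = 0"
  by (simp_all add: rad2_def)

lemma k_zero: "kE m i \<zero> = 0" "kA m i \<zero> = 0" "kB m i \<zero> = 0" "kS m i \<zero> = 0"
  using k_linear(9-12)[OF zero_closed zero_closed] by simp_all

lemma k_smult: "x \<in> carrier L \<Longrightarrow> kE m i (c \<odot> x) = c * kE m i x"
  using k_linear(5) by blast

lemma rad_closed:
  "\<zero> \<in> rad" "x \<in> rad \<Longrightarrow> y \<in> rad \<Longrightarrow> x \<oplus> y \<in> rad" "x \<in> rad \<Longrightarrow> u \<in> carrier L \<Longrightarrow> u \<otimes> x \<in> rad"
  "x \<in> rad \<Longrightarrow> u \<in> carrier L \<Longrightarrow> x \<otimes> u \<in> rad"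
  by (simp_all add: rad_def k_linear k_mult k_zero)

lemma rad2_closed:
  "\<zero> \<in> rad2" "x \<in> rad2 \<Longrightarrow> y \<in> rad2 \<Longrightarrow> x \<oplus> y \<in> rad2" "x \<in> rad \<Longrightarrow> y \<in> rad \<Longrightarrow> x \<otimes> y \<in> rad2"
  by (simp_all add: rad_def rad2_def k_linear k_mult k_zero)

lemma coords_zero:
  assumes "x \<in> carrier L" "\<And>i. kE m i x = 0" "\<And>i. kA m i x = 0" "\<And>i. kB m i x = 0" "\<And>i. kS m i x = 0"
  shows "x = \<zero>"
proof -
  have "x \<otimes> e i = \<zero> \<otimes> e i" for i using decomp[OF assms(1), of i] decomp[OF zero_closed, of i] by (simp only: assms k_linear[OF assms(1,1)])
  then have "x \<otimes> e i = \<zero>" for i by simp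
  then have "finsum L (\<lambda>i. x \<otimes> e i) {0..<int m} = \<zero>" by (simp cong: finsum_cong)
  moreover have "finsum L (\<lambda>i. x \<otimes> e i) {0..<int m} = x"
    using finsum_rdistr[of "{0..<int m}" x e] assms(1) sum_e by simp
  ultimately show ?thesis by simp
qed

text \<open>A factor in the radical squared has only the cycle coordinate, and the product formula
  pairs that coordinate only with idempotent coordinates, which vanish in the radical.\<close>

lemma rad_cube: "x \<in> rad2 \<Longrightarrow> y \<in> rad \<Longrightarrow> x \<otimes> y = \<zero>"
  by (rule coords_zero) (simp_all add: rad2_def rad_def k_mult)

text \<open>The sub-bimodule P rad, the sums of the elements x v with v in the radical.\<close>

inductive_set PR :: "nat \<Rightarrow> 'k res set" for n where
  zero: "\<zero>\<^bsub>P n\<^esub> \<in> PR n"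
| ract: "x \<in> carrier (P n) \<Longrightarrow> v \<in> rad \<Longrightarrow> ra n x v \<in> PR n"
| add: "x \<in> PR n \<Longrightarrow> y \<in> PR n \<Longrightarrow> x \<oplus>\<^bsub>P n\<^esub> y \<in> PR n"

lemma PR_carrier: "x \<in> PR n \<Longrightarrow> x \<in> carrier (P n)"
  by (induction rule: PR.induct) (simp_all add: radD)

lemma PR_sub: "Pn.sub_bimod n (PR n)"
  unfolding Pn.sub_bimod_def
proof (intro conjI ballI)
  show "PR n \<subseteq> carrier (P n)" using PR_carrier by (rule subsetI)
  show "\<zero>\<^bsub>P n\<^esub> \<in> PR n" by (rule PR.zero)
  show "x \<oplus>\<^bsub>P n\<^esub> y \<in> PR n" if "x \<in> PR n" "y \<in> PR n" for x y using that by (rule PR.add)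
  fix u x assume u: "u \<in> carrier L" and x: "x \<in> PR n"
  show "la n u x \<in> PR n"
    using x
  proof (induction rule: PR.induct)
    case zero
    show ?case using u PR.zero by simp
  next
    case (ract x v)
    then show ?case using u PR.ract[of "la n u x" n v] by (simp add: Pn.act_mult(3) radD)
  next
    case (add x y)
    then show ?case using u PR.add[of "la n u x" n "la n u y"] by (simp add: Pn.act_add PR_carrier)
  qed
  show "ra n x u \<in> PR n"
    using x
  proof (induction rule: PR.induct)
    case zero
    show ?case using u PR.zero by simp
  next
    case (ract x v)
    then show ?case using u PR.ract[of x n "v \<otimes> u"] by (simp add: Pn.act_mult(2) radD rad_closed)
  next
    case (add x y)
    then show ?case using u PR.add[of "ra n x u" n "ra n y u"] by (simp add: Pn.act_add PR_carrier)
  qed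
qed

text \<open>From h (x v) = h (x) v; this is the use made of right linearity beyond
  exactness.\<close>

lemma h_PR: "x \<in> PR n \<Longrightarrow> h n x \<in> PR (Suc n)"
proof (induction rule: PR.induct)
  case zero
  then show ?case by (simp add: h_zero PR.zero)
next
  case (ract x v)
  then show ?case by (simp add: h_props(1,3) radD PR.ract)
next
  case (add x y)
  then show ?case by (simp add: h_props(2) PR_carrier PR.add)
qed

text \<open>The sections \<open>s0\<close> and \<open>h\<close> are right linear and therefore
  preserve right multiples of the radical. Hence the augmented resolution stays exact on P rad, and
  the comparison theorem can be carried out inside it.\<close>

lemma rad_lifting:
  assumes f: "f \<in> carrier (H.Z q)" and r: "\<And>x. x \<in> carrier (P q) \<Longrightarrow> f x \<in> rad"
  obtains K where "is_lifting L C q f K" "\<And>j x. x \<in> carrier (P (q + j)) \<Longrightarrow> K j x \<in> PR j"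
proof (rule H.lifting_exists_in[OF f PR_sub])
  fix x assume "x \<in> carrier (P q)"
  then have v: "f x \<in> rad" by (rule r)
  then have c: "f x \<in> carrier L" by (rule radD)
  have "s0 (f x) = ra 0 (s0 \<one>) (f x)" using s0_props(3)[OF one_closed c] c by simp
  then have "s0 (f x) \<in> PR 0" using PR.ract[OF s0_props(1)[OF one_closed] v] by simp
  moreover have "f x = aug C (s0 (f x))" using aug_s0[OF c] by simp
  ultimately show "f x \<in> aug C ` PR 0" by (intro image_eqI)
next
  fix j y assume y: "y \<in> PR j" and cy: "H.cyc j y"
  note yc = PR_carrier[OF y]
  have "y = d j (h j y)"
  proof (cases j)
    case 0
    have c: "y \<in> carrier (P 0)" "aug C y = \<zero>" using yc cy by (simp_all add: 0 H.cyc_def)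
    show ?thesis using homotopy_0[OF c(1)] c by (simp add: 0 s0_zero dD(1) h_props(1))
  next
    case (Suc n)
    have c: "y \<in> carrier (P (Suc n))" "d n y = \<zero>\<^bsub>P n\<^esub>" using yc cy by (simp_all add: Suc H.cyc_def)
    show ?thesis using homotopy_Suc[OF c(1)] c by (simp add: Suc h_zero dD(1) h_props(1))
  qed
  then show "y \<in> d j ` PR (Suc j)" using h_PR[OF y] by (rule image_eqI)
qed (use that in blast)

lemma Zf:
  assumes "f \<in> carrier (H.Z n)"
  shows "x \<in> carrier (P n) \<Longrightarrow> f x \<in> carrier L"
    "x \<in> carrier (P n) \<Longrightarrow> y \<in> carrier (P n) \<Longrightarrow> f (x \<oplus>\<^bsub>P n\<^esub> y) = f x \<oplus> f y"
    "u \<in> carrier L \<Longrightarrow> x \<in> carrier (P n) \<Longrightarrow> f (la n u x) = u \<otimes> f x"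
    "u \<in> carrier L \<Longrightarrow> x \<in> carrier (P n) \<Longrightarrow> f (ra n x u) = f x \<otimes> u" "f \<zero>\<^bsub>P n\<^esub> = \<zero>"
  using bimod_homD[OF H.Z_hom[OF assms]] H.hom_R0[OF H.Z_hom[OF assms]] by (simp_all add: regular_bimod_def)

text \<open>On x v with v in the radical a cocycle has the value f (x) v, one layer deeper than f
  (x). The next two lemmas repeat this for the deeper layers, ending at zero.\<close>

lemma Z_PR: assumes "f \<in> carrier (H.Z n)" "x \<in> PR n" shows "f x \<in> rad"
  using assms(2) by (induction rule: PR.induct) (simp_all add: Zf[OF assms(1)] rad_closed radD PR_carrier)

lemma Z_PR2:
  assumes "f \<in> carrier (H.Z n)" "\<And>y. y \<in> carrier (P n) \<Longrightarrow> f y \<in> rad" "x \<in> PR n" shows "f x \<in> rad2"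
  using assms(3) by (induction rule: PR.induct) (simp_all add: Zf[OF assms(1)] rad2_closed radD PR_carrier assms(2))

lemma Z_PR3:
  assumes "f \<in> carrier (H.Z n)" "\<And>y. y \<in> carrier (P n) \<Longrightarrow> f y \<in> rad2" "x \<in> PR n" shows "f x = \<zero>"
  using assms(3) by (induction rule: PR.induct) (simp_all add: Zf[OF assms(1)] radD PR_carrier assms(2) rad_cube)

section \<open>Idempotent coefficients of cocycles\<close>

section \<open>The reduced classes of cocycles\<close>

text \<open>The coefficients of e 0 at the generators with i = 0, arranged as a polynomial in w. By
  \<open>val_const\<close> the other vertices carry no further information, and the Yoneda product
  will become the product of polynomials.\<close>

definition \<gamma> :: "nat \<Rightarrow> ('k res \<Rightarrow> 'k lam) \<Rightarrow> 'k poly" where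
  "\<gamma> n f = (\<Sum>r\<le>n. Polynomial.monom (kE m 0 (f (g n 0 (int r)))) r)"

lemma g_zero: "int n < r \<Longrightarrow> g n i r = \<zero>\<^bsub>P n\<^esub>" "r < 0 \<Longrightarrow> g n i r = \<zero>\<^bsub>P n\<^esub>" by (simp_all add: g_out)

lemma coeff_\<gamma>: assumes "f \<in> carrier (H.Z n)" shows "Polynomial.coeff (\<gamma> n f) r = kE m 0 (f (g n 0 (int r)))"
proof (cases "r \<le> n")
  case True
  then show ?thesis unfolding \<gamma>_def by (simp add: Polynomial.coeff_sum)
next
  case False
  then have "g n 0 (int r) = \<zero>\<^bsub>P n\<^esub>" by (simp add: g_zero)
  then show ?thesis using False unfolding \<gamma>_def by (simp add: Polynomial.coeff_sum Zf(5)[OF assms] k_zero)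
qed

text \<open>The value of a bimodule map on a generator lies in e i \<Lambda> e (i + n - 2r), where
  idempotents occur only if both ends agree modulo m.\<close>

lemma val_ends:
  assumes f: "f \<in> carrier (H.Z n)"
  shows "kE m j (f (g n i r)) \<noteq> 0 \<Longrightarrow> j mod int m = i mod int m"
    "kE m j (f (g n i r)) \<noteq> 0 \<Longrightarrow> j mod int m = (i + int n - 2 * r) mod int m"
proof -
  have c: "f (g n i r) \<in> carrier L" using Zf(1)[OF f g_closed] .
  have "e i \<otimes> f (g n i r) = f (g n i r)" "f (g n i r) \<otimes> e (i + int n - 2 * r) = f (g n i r)"
    using Zf(3)[OF f _ g_closed, of "e i" i r] Zf(4)[OF f _ g_closed, of "e (i + int n - 2 * r)" i r] by (simp_all add: g_props)
  from this[THEN arg_cong, of "kE m j"]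
  show "kE m j (f (g n i r)) \<noteq> 0 \<Longrightarrow> j mod int m = i mod int m"
    "kE m j (f (g n i r)) \<noteq> 0 \<Longrightarrow> j mod int m = (i + int n - 2 * r) mod int m"
    using c by (simp_all add: k_mult k_values split: if_splits)
qed

lemma char2_eq: "x + y = 0 \<Longrightarrow> x = (y :: 'k)"
proof -
  assume "x + y = 0"
  moreover have "y + y = 0" using arg_cong[OF two_zero, of "\<lambda>c. c * y"] by (simp add: distrib_right)
  ultimately have "x + y = y + y" by simp
  then show ?thesis by simp
qed

text \<open>The cocycle condition on \<open>g (n + 1) i r\<close>, read off at the arrow \<open>a\<close>.\<close>

lemma val_shift:
  assumes f: "f \<in> carrier (H.Z n)"
  shows "kE m (i + 1) (f (g n (i + 1) r)) = kE m i (f (g n i r))"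
proof -
  have "f (dg n i r) = \<zero>" using H.Z_d[OF f, of "g (Suc n) i r"] by (simp add: d_props(2))
  from arg_cong[OF this, of "kA m (i + 1)"]
  have "kE m i (f (g n i r)) + kE m (i + 1) (f (g n (i + 1) r)) = 0"
    by (simp add: dg_def Zf[OF f] k_mult k_linear k_values k_zero)
  then show ?thesis by (rule char2_eq[symmetric])
qed

lemma val_const:
  assumes f: "f \<in> carrier (H.Z n)"
  shows "kE m i (f (g n i r)) = kE m 0 (f (g n 0 r))"
proof (induction i rule: int_induct[where k = 0])
  case (step1 i) then show ?case using val_shift[OF f, of i r] by simp
next
  case (step2 i) then show ?case using val_shift[OF f, of "i - 1" r] by simp
qed simp

text \<open>The exponents that end points permit in degree n; conversely each of them is realised by
  the cocycle \<open>\<kappa> n r\<close>.\<close>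

definition good :: "nat \<Rightarrow> nat \<Rightarrow> bool" where "good n r \<longleftrightarrow> r \<le> n \<and> int m dvd int n - 2 * int r"

lemma \<gamma>_good: assumes f: "f \<in> carrier (H.Z n)" and "Polynomial.coeff (\<gamma> n f) r \<noteq> 0" shows "good n r"
proof -
  have nz: "kE m 0 (f (g n 0 (int r))) \<noteq> 0" using assms by (simp add: coeff_\<gamma>)
  then have "r \<le> n" using g_zero(1)[of n "int r" 0] Zf(5)[OF f] by (cases "r \<le> n") (simp_all add: k_zero)
  moreover have "(int n - 2 * int r) mod int m = 0" using val_ends(2)[OF f nz] by simp
  ultimately show ?thesis by (simp add: good_def dvd_eq_mod_eq_0)
qed

text \<open>By \<open>val_ends\<close> only e i can occur in the value on a generator with index i,
  and by \<open>val_const\<close> its coefficient is one of the coefficients of \<gamma>. The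
  radical is an ideal, so vanishing on generators suffices.\<close>

lemma \<gamma>_zero_rad:
  assumes f: "f \<in> carrier (H.Z n)" and 0: "\<gamma> n f = 0" and x: "x \<in> carrier (P n)"
  shows "f x \<in> rad"
proof -
  have gr: "f (g n i r) \<in> rad" for i r
  proof -
    have "kE m j (f (g n i r)) = 0" for j
    proof (rule ccontr)
      assume nz: "kE m j (f (g n i r)) \<noteq> 0"
      then have "j mod int m = i mod int m" by (rule val_ends[OF f])
      then have "kE m i (f (g n i r)) \<noteq> 0" using nz val_const[OF f, of j r] val_const[OF f, of i r] g_cong[of j i n r] by simp
      then have z: "kE m 0 (f (g n 0 r)) \<noteq> 0" by (simp add: val_const[OF f, of i])
      then have "\<not> r < 0" using g_zero(2)[of r n 0] Zf(5)[OF f] by (auto simp: k_zero)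
      then have "Polynomial.coeff (\<gamma> n f) (nat r) \<noteq> 0" using z by (simp add: coeff_\<gamma>[OF f])
      then show False by (simp add: 0)
    qed
    then show ?thesis using Zf(1)[OF f g_closed] by (simp add: rad_def)
  qed
  show ?thesis using x by (induction rule: P_induct) (simp_all add: Zf[OF f] rad_closed gr)
qed

lemma \<gamma>_rad_zero:
  assumes f: "f \<in> carrier (H.Z n)" and "\<And>x. x \<in> carrier (P n) \<Longrightarrow> f x \<in> rad"
  shows "\<gamma> n f = 0"
  by (rule poly_eqI) (simp add: coeff_\<gamma>[OF f] radD(2)[OF assms(2)])

lemma \<gamma>_add: assumes "f \<in> carrier (H.Z n)" "f' \<in> carrier (H.Z n)" shows "\<gamma> n (f \<oplus>\<^bsub>H.Z n\<^esub> f') = \<gamma> n f + \<gamma> n f'"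
  by (rule poly_eqI) (simp add: coeff_\<gamma> assms H.Z_closed(1)[OF assms], simp add: H.Z_simps k_linear(1) Zf(1)[OF assms(1)] Zf(1)[OF assms(2)])

lemma \<gamma>_smult: assumes "f \<in> carrier (H.Z n)" shows "\<gamma> n (c \<odot>\<^bsub>H.Z n\<^esub> f) = smult c (\<gamma> n f)"
  by (rule poly_eqI) (simp add: coeff_\<gamma> assms H.Z_closed(3)[OF assms], simp add: H.Z_simps k_smult Zf(1)[OF assms])

lemma \<gamma>_zero: "\<gamma> n \<zero>\<^bsub>H.Z n\<^esub> = 0"
  by (rule \<gamma>_rad_zero[OF H.Z_closed(2)]) (simp add: H.Z_simps rad_closed)

text \<open>Minimality of the resolution: every term of the differential of a generator carries an
  arrow, so boundary maps have no idempotent part.\<close>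

lemma \<gamma>_B: assumes w: "w \<in> H.B n" shows "\<gamma> n w = 0"
proof (cases n)
  case 0
  then show ?thesis using w \<gamma>_zero by simp
next
  case (Suc k)
  obtain u where u: "u \<in> bimod_hom L (P k) (regular_bimod L)" "\<And>x. x \<in> carrier (P (Suc k)) \<Longrightarrow> w x = u (d k x)"
    using w unfolding Suc by (rule H.B_E) blast
  have ud: "x \<in> carrier (P k) \<Longrightarrow> u x \<in> carrier L"
    "x \<in> carrier (P k) \<Longrightarrow> y \<in> carrier (P k) \<Longrightarrow> u (x \<oplus>\<^bsub>P k\<^esub> y) = u x \<oplus> u y"
    "v \<in> carrier L \<Longrightarrow> x \<in> carrier (P k) \<Longrightarrow> u (la k v x) = v \<otimes> u x"
    "v \<in> carrier L \<Longrightarrow> x \<in> carrier (P k) \<Longrightarrow> u (ra k x v) = u x \<otimes> v" for x y v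
    using bimod_homD[OF u(1)] by (simp_all add: regular_bimod_def)
  have "w \<in> carrier (H.Z n)" using w H.B_sub by blast
  then show ?thesis
    by (intro poly_eqI) (simp add: coeff_\<gamma> Suc u(2) d_props(2) dg_def ud k_linear k_mult k_values)
qed

end

section \<open>Multiplicativity of the idempotent coefficients\<close>

section \<open>Shift maps and multiplicativity\<close>

context lam2
begin

text \<open>A chain map of degree q that lowers r by s; it is the lifting of the basic cocycle
  \<open>\<kappa> q s\<close>.\<close>

definition sh :: "nat \<Rightarrow> nat \<Rightarrow> nat \<Rightarrow> 'k res \<Rightarrow> 'k res" where
  "sh q s j = (SOME \<phi>. \<phi> \<in> bimod_hom L (P (q + j)) (P j) \<and> (\<forall>i r. \<phi> (g (q + j) i r) = g j i (r - int s)))"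

lemma sh_props:
  assumes "good q s"
  shows "sh q s j \<in> bimod_hom L (P (q + j)) (P j)" "sh q s j (g (q + j) i r) = g j i (r - int s)"
proof -
  have s: "s \<le> q" "int m dvd int q - 2 * int s" using assms by (simp_all add: good_def)
  \<comment> \<open>Divisibility of q - 2s by m makes the right end points of a generator and of its
    image agree modulo m.\<close>
  have ee: "e (i + int (q + j) - 2 * r) = e (i + int j - 2 * (r - int s))" for i r
  proof (rule e_cong)
    have "int m dvd (i + int (q + j) - 2 * r) - (i + int j - 2 * (r - int s))" using s(2) by (simp add: algebra_simps)
    then show "(i + int (q + j) - 2 * r) mod int m = (i + int j - 2 * (r - int s)) mod int m"
      by (simp only: mod_eq_dvd_iff)
  qed
  have "\<exists>\<phi>. \<phi> \<in> bimod_hom L (P (q + j)) (P j) \<and> (\<forall>i r. \<phi> (g (q + j) i r) = g j i (r - int s))"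
  proof (rule P_hom[OF Pn.bimod_axioms])
    fix i r
    show "g j i (r - int s) \<in> carrier (P j)" by simp
    show "la j (e i) (g j i (r - int s)) = g j i (r - int s)" by (rule g_props)
    show "ra j (g j i (r - int s)) (e (i + int (q + j) - 2 * r)) = g j i (r - int s)"
      unfolding ee by (rule g_props)
    show "g j (i mod int m) (r - int s) = g j i (r - int s)" by (rule g_mod)
    show "\<not> (0 \<le> r \<and> r \<le> int (q + j)) \<Longrightarrow> g j i (r - int s) = \<zero>\<^bsub>P j\<^esub>"
      using s(1) by (intro g_out) auto
  qed
  from someI_ex[OF this, folded sh_def]
  show "sh q s j \<in> bimod_hom L (P (q + j)) (P j)" "sh q s j (g (q + j) i r) = g j i (r - int s)" by simp_all
qed

text \<open>The formula \<open>dg\<close> is the same in all degrees and for all r, so both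
  composites give it with r replaced by r - s.\<close>

lemma sh_d:
  assumes s: "good q s" and x: "x \<in> carrier (P (Suc (q + j)))"
  shows "d j (sh q s (Suc j) x) = sh q s j (d (q + j) x)"
proof -
  have h1: "sh q s (Suc j) \<in> bimod_hom L (P (Suc (q + j))) (P (Suc j))" using sh_props(1)[OF s, of "Suc j"] by simp
  note h0 = bimod_homD[OF sh_props(1)[OF s, of j]]
  have "compose (carrier (P (Suc (q + j)))) (d j) (sh q s (Suc j)) = compose (carrier (P (Suc (q + j)))) (sh q s j) (d (q + j))"
  proof (rule P_hom_eqI[OF Pn.hom_compose[OF h1 d_props(1)] Pn.hom_compose[OF d_props(1) sh_props(1)[OF s]] Pn.bimod_axioms])
    fix i r
    have "sh q s (Suc j) (g (Suc (q + j)) i r) = g (Suc j) i (r - int s)" using sh_props(2)[OF s, of "Suc j"] by simp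
    moreover have "r - int s - 1 = r - 1 - int s" by simp
    ultimately have "d j (sh q s (Suc j) (g (Suc (q + j)) i r)) = sh q s j (d (q + j) (g (Suc (q + j)) i r))"
      by (simp only: d_props(2) dg_def h0 sh_props(2)[OF s] g_closed gens_closed Pn.act_closed Pn.a_closed)
    then show "compose (carrier (P (Suc (q + j)))) (d j) (sh q s (Suc j)) (g (Suc (q + j)) i r) =
       compose (carrier (P (Suc (q + j)))) (sh q s j) (d (q + j)) (g (Suc (q + j)) i r)"
      by (simp add: compose_def)
  qed
  from fun_cong[OF this, of x] show ?thesis using x by (simp add: compose_def)
qed

definition \<kappa> :: "nat \<Rightarrow> nat \<Rightarrow> 'k res \<Rightarrow> 'k lam" where
  "\<kappa> q s = compose (carrier (P q)) (aug C) (sh q s 0)"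

lemma \<kappa>_hom: assumes s: "good q s" shows "\<kappa> q s \<in> bimod_hom L (P q) (regular_bimod L)"
  unfolding \<kappa>_def using sh_props(1)[OF s, of 0] by (intro Pn.hom_compose[OF _ aug_props(1)]) simp

lemma \<kappa>_g: assumes s: "good q s" shows "\<kappa> q s (g q i r) = (if r = int s then e i else \<zero>)"
  using sh_props(2)[OF s, of 0 i r] by (simp add: \<kappa>_def compose_def aug_props(2))

lemma \<kappa>_lift: assumes s: "good q s" shows "is_lifting L C q (\<kappa> q s) (sh q s)"
  by (rule H.liftI) (simp_all add: sh_props(1)[OF s] sh_d[OF s] \<kappa>_def compose_def)

lemma \<kappa>_Z: assumes s: "good q s" shows "\<kappa> q s \<in> carrier (H.Z q)"
  unfolding H.Z_iff
proof (intro conjI ballI)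
  show "\<kappa> q s \<in> bimod_hom L (P q) (regular_bimod L)" by (rule \<kappa>_hom[OF s])
  fix x assume x: "x \<in> carrier (P (Suc q))"
  have "sh q s (Suc 0) x \<in> carrier (P (Suc 0))" using bimod_homD(1)[OF sh_props(1)[OF s, of "Suc 0"]] x by simp
  from aug_d[OF this] have "aug C (sh q s 0 (d q x)) = \<zero>" using sh_d[OF s, of x 0] x by simp
  then show "\<kappa> q s (d q x) = \<zero>" using x by (simp add: \<kappa>_def compose_def dD(1))
qed

lemma \<gamma>_\<kappa>: assumes s: "good q s" shows "\<gamma> q (\<kappa> q s) = Polynomial.monom 1 s"
  by (rule poly_eqI) (simp add: coeff_\<gamma>[OF \<kappa>_Z[OF s]] \<kappa>_g[OF s] k_values k_zero)

lemma chi_\<kappa>: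
  assumes s: "good n s" and d: "D = int n - 2 * int s"
  shows "chi m 1 n D = HH_class L C n (\<kappa> n s)"
proof -
  have "(THE f. f \<in> bimod_hom L (P n) (regular_bimod L) \<and>
        (\<forall>(i, r)\<in>res_index m n. f (g n i r) = (if int n - 2 * r = D then e i else \<zero>))) = \<kappa> n s"
  proof (rule the_equality)
    show "\<kappa> n s \<in> bimod_hom L (P n) (regular_bimod L) \<and>
        (\<forall>(i, r)\<in>res_index m n. \<kappa> n s (g n i r) = (if int n - 2 * r = D then e i else \<zero>))"
      using \<kappa>_hom[OF s] d by (simp add: \<kappa>_g[OF s])
    fix f assume f: "f \<in> bimod_hom L (P n) (regular_bimod L) \<and>
        (\<forall>(i, r)\<in>res_index m n. f (g n i r) = (if int n - 2 * r = D then e i else \<zero>))"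
    show "f = \<kappa> n s"
    proof (rule P_hom_eqI[OF _ \<kappa>_hom[OF s] bimod_R])
      fix i r assume "i \<in> {0..<int m}" "0 \<le> r" "r \<le> int n"
      then have "(i, r) \<in> res_index m n" by (simp add: res_index_def)
      then have "case (i, r) of (i, r) \<Rightarrow> f (g n i r) = (if int n - 2 * r = D then e i else \<zero>)" by (rule bspec[OF conjunct2[OF f]])
      then show "f (g n i r) = \<kappa> n s (g n i r)" using d by (simp add: \<kappa>_g[OF s])
    qed (use f in simp)
  qed
  then show ?thesis
    unfolding chi_def C_def[symmetric] L[symmetric] P_def[symmetric] g_def[symmetric] e_def[symmetric] by simp
qed

abbreviation cm where "cm p q f K \<equiv> compose (carrier (P (p + q))) f (K p)"

text \<open>Multiplicativity of \<open>\<gamma>\<close> only has to be checked for one lifting of each right factor.\<close>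

definition mlt :: "nat \<Rightarrow> ('k res \<Rightarrow> 'k lam) \<Rightarrow> bool" where
  "mlt q f \<longleftrightarrow> f \<in> carrier (H.Z q) \<and> (\<exists>K. is_lifting L C q f K \<and>
     (\<forall>p. \<forall>f'\<in>carrier (H.Z p). \<gamma> (p + q) (cm p q f' K) = \<gamma> p f' * \<gamma> q f))"

lemma mltI:
  assumes "f \<in> carrier (H.Z q)" "is_lifting L C q f K"
    "\<And>p f'. f' \<in> carrier (H.Z p) \<Longrightarrow> \<gamma> (p + q) (cm p q f' K) = \<gamma> p f' * \<gamma> q f"
  shows "mlt q f"
  using assms unfolding mlt_def by blast

lemma mltE:
  assumes "mlt q f"
  obtains K where "f \<in> carrier (H.Z q)" "is_lifting L C q f K"
    "\<And>p f'. f' \<in> carrier (H.Z p) \<Longrightarrow> \<gamma> (p + q) (cm p q f' K) = \<gamma> p f' * \<gamma> q f"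
  using assms unfolding mlt_def by blast

text \<open>Composing with the shift reads f' at r - s in place of r, which is multiplication of
  \<gamma> by w^s; for r < s the generator is zero, as is the coefficient of the product.\<close>

lemma mlt_\<kappa>: assumes s: "good q s" shows "mlt q (\<kappa> q s)"
proof (rule mltI[OF \<kappa>_Z[OF s] \<kappa>_lift[OF s]])
  fix p f' assume f: "f' \<in> carrier (H.Z p)"
  show "\<gamma> (p + q) (cm p q f' (sh q s)) = \<gamma> p f' * \<gamma> q (\<kappa> q s)"
  proof (rule poly_eqI)
    fix r
    have "sh q s p (g (p + q) 0 (int r)) = g p 0 (int r - int s)" using sh_props(2)[OF s, of p] by (simp add: add.commute)
    then have "Polynomial.coeff (\<gamma> (p + q) (cm p q f' (sh q s))) r = kE m 0 (f' (g p 0 (int r - int s)))"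
      unfolding coeff_\<gamma>[OF H.cmp_Z[OF f \<kappa>_lift[OF s]]] by (simp add: compose_def)
    also have "\<dots> = Polynomial.coeff (\<gamma> p f' * \<gamma> q (\<kappa> q s)) r"
    proof (cases "r < s")
      case True
      then show ?thesis by (simp add: \<gamma>_\<kappa>[OF s] mult.commute[of "\<gamma> p f'"] coeff_monom_mult g_zero Zf(5)[OF f] k_zero)
    next
      case False
      then show ?thesis by (simp add: \<gamma>_\<kappa>[OF s] mult.commute[of "\<gamma> p f'"] coeff_monom_mult coeff_\<gamma>[OF f] of_nat_diff)
    qed
    finally show "Polynomial.coeff (\<gamma> (p + q) (cm p q f' (sh q s))) r = Polynomial.coeff (\<gamma> p f' * \<gamma> q (\<kappa> q s)) r" .
  qed
qed

text \<open>With a lifting in P rad the composite with any cocycle has values in the radical, so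
  both sides of the product formula vanish.\<close>

lemma mlt_rad:
  assumes f: "f \<in> carrier (H.Z q)" and r: "\<And>x. x \<in> carrier (P q) \<Longrightarrow> f x \<in> rad"
  shows "mlt q f"
proof -
  obtain K where K: "is_lifting L C q f K" "\<And>j x. x \<in> carrier (P (q + j)) \<Longrightarrow> K j x \<in> PR j"
    by (rule rad_lifting[OF f r]) blast+
  show ?thesis
  proof (rule mltI[OF f K(1)])
    fix p f' assume f': "f' \<in> carrier (H.Z p)"
    have "\<gamma> (p + q) (cm p q f' K) = 0"
    proof (rule \<gamma>_rad_zero[OF H.cmp_Z[OF f' K(1)]])
      fix x assume "x \<in> carrier (P (p + q))"
      then show "cm p q f' K x \<in> rad" using Z_PR[OF f' K(2)[of x p]] by (simp add: compose_def add.commute)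
    qed
    then show "\<gamma> (p + q) (cm p q f' K) = \<gamma> p f' * \<gamma> q f" using \<gamma>_rad_zero[OF f r] by simp
  qed
qed

lemma mlt_add: assumes "mlt q f" "mlt q f'" shows "mlt q (f \<oplus>\<^bsub>H.Z q\<^esub> f')"
proof -
  obtain K where K: "f \<in> carrier (H.Z q)" "is_lifting L C q f K"
    "\<And>p h. h \<in> carrier (H.Z p) \<Longrightarrow> \<gamma> (p + q) (cm p q h K) = \<gamma> p h * \<gamma> q f"
    using assms(1) by (rule mltE) blast
  obtain K' where K': "f' \<in> carrier (H.Z q)" "is_lifting L C q f' K'"
    "\<And>p h. h \<in> carrier (H.Z p) \<Longrightarrow> \<gamma> (p + q) (cm p q h K') = \<gamma> p h * \<gamma> q f'"
    using assms(2) by (rule mltE) blast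
  note l = H.lift_add[OF K(2) K'(2)]
  show ?thesis
  proof (rule mltI[OF H.Z_closed(1)[OF K(1) K'(1)] l])
    fix p h assume h: "h \<in> carrier (H.Z p)"
    let ?K = "\<lambda>j. \<lambda>x\<in>carrier (P (q + j)). K j x \<oplus>\<^bsub>P j\<^esub> K' j x"
    have "cm p q h ?K = cm p q h K \<oplus>\<^bsub>H.Z (p + q)\<^esub> cm p q h K'"
    proof (rule H.Z_eqI[OF H.cmp_Z[OF h l] H.Z_closed(1)[OF H.cmp_Z[OF h K(2)] H.cmp_Z[OF h K'(2)]]])
      fix x assume x: "x \<in> carrier (P (p + q))"
      then have x': "x \<in> carrier (P (q + p))" by (simp add: add.commute)
      show "cm p q h ?K x = (cm p q h K \<oplus>\<^bsub>H.Z (p + q)\<^esub> cm p q h K') x"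
        using x x' Zf(2)[OF h H.liftD(4)[OF K(2) x'] H.liftD(4)[OF K'(2) x']] by (simp add: H.Z_simps compose_def)
    qed
    then show "\<gamma> (p + q) (cm p q h ?K) = \<gamma> p h * \<gamma> q (f \<oplus>\<^bsub>H.Z q\<^esub> f')"
      by (simp add: \<gamma>_add[OF H.cmp_Z[OF h K(2)] H.cmp_Z[OF h K'(2)]] \<gamma>_add[OF K(1) K'(1)] K(3)[OF h] K'(3)[OF h] distrib_left)
  qed
qed

lemma mlt_smult: assumes "mlt q f" shows "mlt q (c \<odot>\<^bsub>H.Z q\<^esub> f)"
proof -
  obtain K where K: "f \<in> carrier (H.Z q)" "is_lifting L C q f K"
    "\<And>p h. h \<in> carrier (H.Z p) \<Longrightarrow> \<gamma> (p + q) (cm p q h K) = \<gamma> p h * \<gamma> q f"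
    using assms(1) by (rule mltE) blast
  note l = H.lift_smult[OF K(2,1), of c]
  show ?thesis
  proof (rule mltI[OF H.Z_closed(3)[OF K(1)] l])
    fix p h assume h: "h \<in> carrier (H.Z p)"
    let ?K = "\<lambda>j. \<lambda>x\<in>carrier (P (q + j)). la j (c \<odot> \<one>) (K j x)"
    have "cm p q h ?K = c \<odot>\<^bsub>H.Z (p + q)\<^esub> cm p q h K"
    proof (rule H.Z_eqI[OF H.cmp_Z[OF h l] H.Z_closed(3)[OF H.cmp_Z[OF h K(2)]]])
      fix x assume x: "x \<in> carrier (P (p + q))"
      then have x': "x \<in> carrier (P (q + p))" by (simp add: add.commute)
      note kc = H.liftD(4)[OF K(2) x']
      show "cm p q h ?K x = (c \<odot>\<^bsub>H.Z (p + q)\<^esub> cm p q h K) x"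
        using x x' Zf(3)[OF h smult_closed[OF one_closed, of c] kc] smult_eq_mult[OF Zf(1)[OF h kc], of c] by (simp add: H.Z_simps compose_def)
    qed
    then show "\<gamma> (p + q) (cm p q h ?K) = \<gamma> p h * \<gamma> q (c \<odot>\<^bsub>H.Z q\<^esub> f)"
      by (simp add: \<gamma>_smult[OF H.cmp_Z[OF h K(2)]] \<gamma>_smult[OF K(1)] K(3)[OF h])
  qed
qed

lemma \<gamma>_surj:
  assumes "finite T" "\<And>r. r \<in> T \<Longrightarrow> good q r"
  shows "\<exists>f. mlt q f \<and> \<gamma> q f = (\<Sum>r\<in>T. Polynomial.monom (c r) r)"
  using assms
proof (induction T rule: finite_induct)
  case empty
  have "mlt q \<zero>\<^bsub>H.Z q\<^esub>" by (rule mlt_rad[OF H.Z_closed(2)]) (simp add: H.Z_simps rad_closed)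
  then show ?case using \<gamma>_zero by force
next
  case (insert s T)
  then obtain f where f: "mlt q f" "\<gamma> q f = (\<Sum>r\<in>T. Polynomial.monom (c r) r)" by auto
  have s: "good q s" using insert by simp
  have fZ: "f \<in> carrier (H.Z q)" using f(1) by (simp add: mlt_def)
  have "\<gamma> q (c s \<odot>\<^bsub>H.Z q\<^esub> \<kappa> q s \<oplus>\<^bsub>H.Z q\<^esub> f) = (\<Sum>r\<in>insert s T. Polynomial.monom (c r) r)"
    using insert(1,2) by (simp add: \<gamma>_add[OF H.Z_closed(3)[OF \<kappa>_Z[OF s]] fZ] \<gamma>_smult[OF \<kappa>_Z[OF s]] \<gamma>_\<kappa>[OF s] f(2) smult_monom)
  then show ?case using mlt_add[OF mlt_smult[OF mlt_\<kappa>[OF s]] f(1)] by blast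
qed

lemma \<gamma>_image:
  assumes "\<And>r. Polynomial.coeff F r \<noteq> 0 \<Longrightarrow> good q r"
  shows "\<exists>f. mlt q f \<and> \<gamma> q f = F"
proof -
  have fin: "finite {r. Polynomial.coeff F r \<noteq> 0}" by (rule finite_subset[OF _ finite_atMost[of q]]) (use assms good_def in auto)
  obtain f where f: "mlt q f" "\<gamma> q f = (\<Sum>r\<in>{r. Polynomial.coeff F r \<noteq> 0}. Polynomial.monom (Polynomial.coeff F r) r)"
    using \<gamma>_surj[OF fin, of q "Polynomial.coeff F"] assms by blast
  have "(\<Sum>r\<in>{r. Polynomial.coeff F r \<noteq> 0}. Polynomial.monom (Polynomial.coeff F r) r) = F"
    by (rule poly_eqI) (simp add: Polynomial.coeff_sum fin)
  then show ?thesis using f by auto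
qed

text \<open>A combination k of the cocycles \<kappa> has the same \<gamma> as f, so f + k takes
  values in the radical, as twice \<gamma> is zero. Both k and f + k have multiplicative liftings,
  and f is their sum in characteristic 2.\<close>

lemma mlt_all: assumes f: "f \<in> carrier (H.Z q)" shows "mlt q f"
proof -
  obtain k where k: "mlt q k" "\<gamma> q k = \<gamma> q f" using \<gamma>_image[OF \<gamma>_good[OF f]] by blast
  have kZ: "k \<in> carrier (H.Z q)" using k(1) by (simp add: mlt_def)
  have c2: "x \<oplus> x = \<zero>" if "x \<in> carrier L" for x
    using bimod_char2(1)[OF bimod_R, of x] that by (simp add: regular_bimod_def)
  have "\<gamma> q (f \<oplus>\<^bsub>H.Z q\<^esub> k) = smult (1 + 1) (\<gamma> q f)" unfolding \<gamma>_add[OF f kZ] k(2) by (simp only: smult_add_left smult_1_left)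
  then have "\<gamma> q (f \<oplus>\<^bsub>H.Z q\<^esub> k) = 0" unfolding two_zero by simp
  then have m: "mlt q (f \<oplus>\<^bsub>H.Z q\<^esub> k)"
    using H.Z_closed(1)[OF f kZ] by (intro mlt_rad \<gamma>_zero_rad)
  have eq: "f = (f \<oplus>\<^bsub>H.Z q\<^esub> k) \<oplus>\<^bsub>H.Z q\<^esub> k"
    by (rule H.Z_eqI[OF f H.Z_closed(1)[OF H.Z_closed(1)[OF f kZ] kZ]])
       (simp add: H.Z_simps Zf(1)[OF f] Zf(1)[OF kZ] a_assoc c2)
  show ?thesis by (subst eq) (rule mlt_add[OF m k(1)])
qed

text \<open>\<gamma> on cohomology classes through an arbitrary representative; by
  \<open>\<gamma>_B\<close> the choice is immaterial.\<close>

definition \<Gamma> :: "nat \<Rightarrow> ('k res \<Rightarrow> 'k lam) set \<Rightarrow> 'k poly" where "\<Gamma> n c = \<gamma> n (SOME f. f \<in> c)"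

lemma \<Gamma>_cl: assumes f: "f \<in> carrier (H.Z n)" shows "\<Gamma> n (H.cl n f) = \<gamma> n f"
proof -
  have "(SOME f'. f' \<in> H.cl n f) \<in> H.cl n f" using H.cl_self[OF f] by (rule someI[of "\<lambda>f'. f' \<in> H.cl n f"])
  then obtain w where w: "w \<in> H.B n" "(SOME f'. f' \<in> H.cl n f) = w \<oplus>\<^bsub>H.Z n\<^esub> f" by (rule H.cl_mem)
  have "w \<in> carrier (H.Z n)" using w(1) H.B_sub by blast
  then show ?thesis unfolding \<Gamma>_def w(2) by (simp add: \<gamma>_add f \<gamma>_B[OF w(1)])
qed

lemma \<Gamma>_zero: "\<Gamma> n \<zero>\<^bsub>H.H n\<^esub> = 0" unfolding H.H_zero \<Gamma>_cl[OF H.Z_closed(2)] by (rule \<gamma>_zero)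

lemma \<Gamma>_add:
  assumes "x \<in> carrier (H.H n)" "y \<in> carrier (H.H n)" shows "\<Gamma> n (x \<oplus>\<^bsub>H.H n\<^esub> y) = \<Gamma> n x + \<Gamma> n y"
proof -
  obtain f where f: "f \<in> carrier (H.Z n)" "x = H.cl n f" using assms(1) by (rule H.H_cases)
  obtain f' where f': "f' \<in> carrier (H.Z n)" "y = H.cl n f'" using assms(2) by (rule H.H_cases)
  show ?thesis unfolding f(2) f'(2) H.cl_add[OF f(1) f'(1)] \<Gamma>_cl[OF f(1)] \<Gamma>_cl[OF f'(1)] \<Gamma>_cl[OF H.Z_closed(1)[OF f(1) f'(1)]]
    by (rule \<gamma>_add[OF f(1) f'(1)])
qed

lemma \<Gamma>_smult: assumes "x \<in> carrier (H.H n)" shows "\<Gamma> n (c \<odot>\<^bsub>H.H n\<^esub> x) = smult c (\<Gamma> n x)"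
proof -
  obtain f where f: "f \<in> carrier (H.Z n)" "x = H.cl n f" using assms(1) by (rule H.H_cases)
  show ?thesis unfolding f(2) H.cl_smult[OF f(1)] \<Gamma>_cl[OF f(1)] \<Gamma>_cl[OF H.Z_closed(3)[OF f(1)]] by (rule \<gamma>_smult[OF f(1)])
qed

lemma \<Gamma>_yo:
  assumes "x \<in> carrier (H.H p)" "y \<in> carrier (H.H q)" shows "\<Gamma> (p + q) (H.yo p q x y) = \<Gamma> p x * \<Gamma> q y"
proof -
  obtain f where f: "f \<in> carrier (H.Z p)" "x = H.cl p f" using assms(1) by (rule H.H_cases)
  obtain f' where f': "f' \<in> carrier (H.Z q)" "y = H.cl q f'" using assms(2) by (rule H.H_cases)
  obtain K where K: "is_lifting L C q f' K" "\<gamma> (p + q) (cm p q f K) = \<gamma> p f * \<gamma> q f'"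
    using mlt_all[OF f'(1)] f(1) by (elim mltE) blast
  show ?thesis unfolding f(2) f'(2) H.yo_cl[OF f(1) f'(1) K(1)] \<Gamma>_cl[OF f(1)] \<Gamma>_cl[OF f'(1)] \<Gamma>_cl[OF H.cmp_Z[OF f(1) K(1)]] by (rule K(2))
qed

lemma \<Gamma>_good: assumes "x \<in> carrier (H.H n)" "Polynomial.coeff (\<Gamma> n x) r \<noteq> 0" shows "good n r"
proof -
  obtain f where f: "f \<in> carrier (H.Z n)" "x = H.cl n f" using assms(1) by (rule H.H_cases)
  show ?thesis using assms(2) unfolding f(2) \<Gamma>_cl[OF f(1)] by (rule \<gamma>_good[OF f(1)])
qed

end

section \<open>Reduction of the cohomology ring to a polynomial ring and the nilpotent ideal\<close>

section \<open>The Hochschild cohomology modulo nilpotents inside a polynomial ring\<close>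

text \<open>Bihomogeneous elements are written \<open>t^n w^r\<close>, where \<open>t\<close> is the outer variable.\<close>

definition bip :: "'k::field poly poly set \<Rightarrow> ('k, 'k poly poly) module" where
  "bip S = \<lparr>carrier = S, monoid.mult = (*), one = 1, ring.zero = 0, ring.add = (+),
     module.smult = (\<lambda>c F. Polynomial.smult [:c:] F)\<rparr>"

abbreviation cf :: "'k::comm_semiring_1 poly poly \<Rightarrow> nat \<Rightarrow> nat \<Rightarrow> 'k" where
  "cf F n r \<equiv> Polynomial.coeff (Polynomial.coeff F n) r"

text \<open>The span of the monomials t^n w^r with r permitted by \<open>good\<close> in degree n.
  The condition is additive in (n, r), which makes the span a subalgebra.\<close>

definition chi_supp :: "nat \<Rightarrow> 'k::field poly poly set" where
  "chi_supp m = {F. \<forall>n r. cf F n r \<noteq> 0 \<longrightarrow> r \<le> n \<and> int m dvd int n - 2 * int r}"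

lemma cf_mult_nonzero:
  assumes "cf (F * G) n r \<noteq> 0"
  obtains i j where "i \<le> n" "j \<le> r" "cf F i j \<noteq> 0" "cf G (n - i) (r - j) \<noteq> 0"
proof -
  have "cf (F * G) n r = (\<Sum>i\<le>n. \<Sum>j\<le>r. cf F i j * cf G (n - i) (r - j))"
    by (simp add: coeff_mult Polynomial.coeff_sum)
  then obtain i where i: "i \<le> n" "(\<Sum>j\<le>r. cf F i j * cf G (n - i) (r - j)) \<noteq> 0"
    using assms by (metis (no_types, lifting) atMost_iff sum.neutral)
  then obtain j where j: "j \<le> r" "cf F i j * cf G (n - i) (r - j) \<noteq> 0"
    by (metis (no_types, lifting) atMost_iff sum.neutral)
  have "cf F i j \<noteq> 0" "cf G (n - i) (r - j) \<noteq> 0" using j(2) by auto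
  then show thesis by (rule that[OF i(1) j(1)])
qed

lemma chi_supp_mult: assumes "F \<in> chi_supp m" "G \<in> chi_supp m" shows "F * G \<in> chi_supp m"
  unfolding chi_supp_def
proof (intro CollectI allI impI)
  fix n r assume "cf (F * G) n r \<noteq> 0"
  then obtain i j where ij: "i \<le> n" "j \<le> r" "cf F i j \<noteq> 0" "cf G (n - i) (r - j) \<noteq> 0" by (rule cf_mult_nonzero)
  then have a: "j \<le> i" "int m dvd int i - 2 * int j" "r - j \<le> n - i" "int m dvd int (n - i) - 2 * int (r - j)"
    using assms unfolding chi_supp_def by blast+
  have "int n - 2 * int r = (int i - 2 * int j) + (int (n - i) - 2 * int (r - j))"
    using ij by (simp add: of_nat_diff)
  then have "int m dvd int n - 2 * int r" using a by (simp only: dvd_add)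
  then show "r \<le> n \<and> int m dvd int n - 2 * int r" using a(1,3) ij(1,2) by linarith
qed

lemma chi_supp_closed:
  "0 \<in> chi_supp m" "1 \<in> chi_supp m" "F \<in> chi_supp m \<Longrightarrow> G \<in> chi_supp m \<Longrightarrow> F + G \<in> chi_supp m"
  "F \<in> chi_supp m \<Longrightarrow> - F \<in> chi_supp m" "F \<in> chi_supp m \<Longrightarrow> Polynomial.smult [:c:] F \<in> chi_supp m"
proof -
  show "0 \<in> chi_supp m" by (simp add: chi_supp_def)
  show "1 \<in> chi_supp m" by (auto simp: chi_supp_def coeff_1 split: if_splits)
  show "F + G \<in> chi_supp m" if "F \<in> chi_supp m" "G \<in> chi_supp m"
    unfolding chi_supp_def
  proof (intro CollectI allI impI)
    fix n r assume "cf (F + G) n r \<noteq> 0"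
    then have "cf F n r \<noteq> 0 \<or> cf G n r \<noteq> 0" by auto
    then show "r \<le> n \<and> int m dvd int n - 2 * int r" using that unfolding chi_supp_def by blast
  qed
  show "F \<in> chi_supp m \<Longrightarrow> - F \<in> chi_supp m" "F \<in> chi_supp m \<Longrightarrow> Polynomial.smult [:c:] F \<in> chi_supp m"
    by (auto simp: chi_supp_def)
qed

lemma bip_simps [simp]:
  "carrier (bip S) = S" "x \<otimes>\<^bsub>bip S\<^esub> y = x * y" "\<one>\<^bsub>bip S\<^esub> = 1" "\<zero>\<^bsub>bip S\<^esub> = 0" "x \<oplus>\<^bsub>bip S\<^esub> y = x + y"
  "c \<odot>\<^bsub>bip S\<^esub> x = Polynomial.smult [:c:] x"
  by (simp_all add: bip_def)

lemma domain_bip: "domain (bip (chi_supp m))"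
proof -
  have "cring (bip (chi_supp m))"
  proof (rule cringI)
    show "abelian_group (bip (chi_supp m))"
    proof (rule abelian_groupI)
      fix x assume "x \<in> carrier (bip (chi_supp m))"
      then show "\<exists>y\<in>carrier (bip (chi_supp m)). y \<oplus>\<^bsub>bip (chi_supp m)\<^esub> x = \<zero>\<^bsub>bip (chi_supp m)\<^esub>"
        by (intro bexI[of _ "- x"]) (simp_all add: chi_supp_closed)
    qed (simp_all add: chi_supp_closed algebra_simps)
    show "Group.comm_monoid (bip (chi_supp m))"
      by (rule comm_monoidI) (simp_all add: chi_supp_closed chi_supp_mult algebra_simps)
  qed (simp_all add: algebra_simps)
  then show ?thesis by (rule domain.intro) (simp add: domain_axioms_def)
qed

context lam2
begin

text \<open>The generating polynomial in t of the reduced classes of all degrees. Elements of the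
  cohomology ring have finite support, so \<open>Abs_poly\<close> is applied to an admissible
  coefficient function (\<open>coeff_\<Psi>\<close>).\<close>

definition \<Psi> :: "'k hh \<Rightarrow> 'k poly poly" where "\<Psi> x = Abs_poly (\<lambda>n. \<Gamma> n (x n))"

lemma coeff_\<Psi>: assumes "x \<in> carrier H.HH" shows "Polynomial.coeff (\<Psi> x) n = \<Gamma> n (x n)"
proof -
  have "{n. \<Gamma> n (x n) \<noteq> 0} \<subseteq> {n. x n \<noteq> \<zero>\<^bsub>H.H n\<^esub>}"
    by (rule Collect_mono, rule impI, erule contrapos_nn) (simp add: \<Gamma>_zero)
  moreover have "finite {n. x n \<noteq> \<zero>\<^bsub>H.H n\<^esub>}" using assms by (simp only: H.HH_carrier)
  ultimately have "finite {n. \<Gamma> n (x n) \<noteq> 0}" by (rule finite_subset)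
  then have "\<forall>\<^sub>\<infinity>n. \<Gamma> n (x n) = 0" by (simp add: MOST_iff_cofinite)
  then show ?thesis unfolding \<Psi>_def by (simp add: Abs_poly_inverse)
qed

lemma \<Psi>_add: assumes x: "x \<in> carrier H.HH" and y: "y \<in> carrier H.HH" shows "\<Psi> (x \<oplus>\<^bsub>H.HH\<^esub> y) = \<Psi> x + \<Psi> y"
  by (rule poly_eqI) (simp add: coeff_\<Psi>[OF H.HH_add_closed[OF x y]] coeff_\<Psi>[OF x] coeff_\<Psi>[OF y] H.HH_add
    \<Gamma>_add[OF H.HH_comp[OF x] H.HH_comp[OF y]])

lemma \<Psi>_smult: assumes x: "x \<in> carrier H.HH" shows "\<Psi> (c \<odot>\<^bsub>H.HH\<^esub> x) = Polynomial.smult [:c:] (\<Psi> x)"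
  by (rule poly_eqI) (simp add: coeff_\<Psi>[OF H.HH_smult_closed[OF x]] coeff_\<Psi>[OF x] H.HH_smult \<Gamma>_smult[OF H.HH_comp[OF x]])

lemma \<Gamma>_finsum:
  assumes "finite T" "\<And>p. p \<in> T \<Longrightarrow> F p \<in> carrier (H.H n)"
  shows "\<Gamma> n (finsum (H.H n) F T) = (\<Sum>p\<in>T. \<Gamma> n (F p))"
  using assms
proof (induction T rule: finite_induct)
  case empty
  then show ?case by (simp add: \<Gamma>_zero)
next
  case (insert p T)
  have "finsum (H.H n) F (insert p T) = F p \<oplus>\<^bsub>H.H n\<^esub> finsum (H.H n) F T"
    using insert by (intro H.H.finsum_insert) auto
  moreover have "finsum (H.H n) F T \<in> carrier (H.H n)" using insert(4) by (intro H.H.finsum_closed) auto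
  ultimately show ?case using insert by (simp add: \<Gamma>_add)
qed

lemma \<Psi>_mult: assumes x: "x \<in> carrier H.HH" and y: "y \<in> carrier H.HH" shows "\<Psi> (x \<otimes>\<^bsub>H.HH\<^esub> y) = \<Psi> x * \<Psi> y"
proof (rule poly_eqI)
  fix n
  have "\<Gamma> n (H.yo p (n - p) (x p) (y (n - p))) = \<Gamma> p (x p) * \<Gamma> (n - p) (y (n - p))" if "p \<le> n" for p
    using \<Gamma>_yo[OF H.HH_comp[OF x, of p] H.HH_comp[OF y, of "n - p"]] that by simp
  moreover have "\<Gamma> n ((x \<otimes>\<^bsub>H.HH\<^esub> y) n) = (\<Sum>p\<le>n. \<Gamma> n (H.yo p (n - p) (x p) (y (n - p))))"
    unfolding H.HH_mult by (rule \<Gamma>_finsum) (simp_all add: H.HH_mult_comp[OF x y])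
  ultimately show "Polynomial.coeff (\<Psi> (x \<otimes>\<^bsub>H.HH\<^esub> y)) n = Polynomial.coeff (\<Psi> x * \<Psi> y) n"
    by (simp add: coeff_\<Psi>[OF H.HH_mult_closed[OF x y]] coeff_\<Psi>[OF x] coeff_\<Psi>[OF y] coeff_mult)
qed

lemma \<Psi>_class: assumes f: "f \<in> carrier (H.Z n)" shows "\<Psi> (HH_class L C n f) = Polynomial.monom (\<gamma> n f) n"
proof (rule poly_eqI)
  fix k
  show "Polynomial.coeff (\<Psi> (HH_class L C n f)) k = Polynomial.coeff (Polynomial.monom (\<gamma> n f) n) k"
    unfolding coeff_\<Psi>[OF H.HH_class_closed[OF f]]
    by (cases "k = n") (simp_all add: H.HH_class_eq \<Gamma>_cl[OF f] \<Gamma>_zero)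
qed

lemma \<Psi>_one: "\<Psi> \<one>\<^bsub>H.HH\<^esub> = 1"
proof -
  have "\<gamma> 0 (aug C) = 1"
    by (rule poly_eqI) (simp add: coeff_\<gamma>[OF H.aug_Z] aug_props(2) k_values k_zero coeff_1)
  then show ?thesis unfolding H.HH_one \<Psi>_class[OF H.aug_Z] by (simp add: monom_0 one_pCons)
qed

lemma \<Psi>_supp: assumes x: "x \<in> carrier H.HH" shows "\<Psi> x \<in> chi_supp m"
  using \<Gamma>_good[OF H.HH_comp[OF x]] by (simp add: chi_supp_def coeff_\<Psi>[OF x] good_def)

lemma \<Psi>_image: "\<Psi> ` carrier H.HH = chi_supp m"
proof (intro equalityI subsetI)
  fix F assume "F \<in> \<Psi> ` carrier H.HH" then show "F \<in> chi_supp m" using \<Psi>_supp by blast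
next
  fix F :: "'k poly poly" assume F: "F \<in> chi_supp m"
  have "\<exists>f. mlt n f \<and> \<gamma> n f = Polynomial.coeff F n" for n
    by (rule \<gamma>_image) (use F in \<open>simp add: chi_supp_def good_def\<close>)
  then obtain f where f: "\<And>n. mlt n (f n)" "\<And>n. \<gamma> n (f n) = Polynomial.coeff F n" by metis
  have fZ: "f n \<in> carrier (H.Z n)" for n using f(1) by (simp add: mlt_def)
  \<comment> \<open>Degrees with zero coefficient receive the zero class explicitly, to keep the
    support finite.\<close>
  define x where "x n = (if Polynomial.coeff F n = 0 then \<zero>\<^bsub>H.H n\<^esub> else H.cl n (f n))" for n
  have "finite {n. x n \<noteq> \<zero>\<^bsub>H.H n\<^esub>}"
  proof (rule finite_subset[OF _ finite_atMost[of "Polynomial.degree F"]])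
    have "n \<le> Polynomial.degree F" if "x n \<noteq> \<zero>\<^bsub>H.H n\<^esub>" for n
      using that le_degree[of F n] unfolding x_def by (cases "Polynomial.coeff F n = 0") simp_all
    then show "{n. x n \<noteq> \<zero>\<^bsub>H.H n\<^esub>} \<subseteq> {..Polynomial.degree F}" by blast
  qed
  then have x: "x \<in> carrier H.HH"
    unfolding H.HH_carrier by (simp add: x_def H.cl_closed[OF fZ])
  have "F = \<Psi> x"
    by (rule poly_eqI) (simp add: coeff_\<Psi>[OF x] x_def \<Gamma>_zero \<Gamma>_cl[OF fZ] f(2))
  then show "F \<in> \<Psi> ` carrier H.HH" using x by (rule image_eqI)
qed

sublocale HR: ring H.HH by (rule H.ring_HH)

lemma \<Psi>_hom: "ring_hom_ring H.HH (bip (chi_supp m)) \<Psi>"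
proof -
  interpret S: domain "bip (chi_supp m) :: ('k, 'k poly poly) module" by (rule domain_bip)
  show ?thesis
    by (rule ring_hom_ringI[OF H.ring_HH S.ring_axioms]) (simp_all add: \<Psi>_supp \<Psi>_add \<Psi>_mult \<Psi>_one)
qed

lemma class_mult:
  assumes f: "f \<in> carrier (H.Z p)" and f': "f' \<in> carrier (H.Z q)" and K: "is_lifting L C q f' K"
  shows "HH_class L C p f \<otimes>\<^bsub>H.HH\<^esub> HH_class L C q f' = HH_class L C (p + q) (cm p q f K)"
proof (rule ext)
  fix n
  let ?y = "\<lambda>i. H.yo i (n - i) (HH_class L C p f i) (HH_class L C q f' (n - i))"
  have cl: "?y i \<in> carrier (H.H n)" if "i \<le> n" for i
    using that by (intro H.HH_mult_comp H.HH_class_closed f f')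
  have z: "?y i = \<zero>\<^bsub>H.H n\<^esub>" if i: "i \<le> n" "\<not> (i = p \<and> n = p + q)" for i
  proof (cases "i = p")
    case True
    then have "n - i \<noteq> q" using i by auto
    then have "HH_class L C q f' (n - i) = \<zero>\<^bsub>H.H (n - i)\<^esub>" by (simp add: H.HH_class_eq)
    then have "?y i = \<zero>\<^bsub>H.H (i + (n - i))\<^esub>" using H.yo_zero(2)[OF H.HH_comp[OF H.HH_class_closed[OF f]]] by simp
    then show ?thesis using i by simp
  next
    case False
    then have "HH_class L C p f i = \<zero>\<^bsub>H.H i\<^esub>" by (simp add: H.HH_class_eq)
    then have "?y i = \<zero>\<^bsub>H.H (i + (n - i))\<^esub>" using H.yo_zero(1)[OF H.HH_comp[OF H.HH_class_closed[OF f']]] by simp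
    then show ?thesis using i by simp
  qed
  show "(HH_class L C p f \<otimes>\<^bsub>H.HH\<^esub> HH_class L C q f') n = HH_class L C (p + q) (cm p q f K) n"
  proof (cases "n = p + q")
    case True
    have yp: "?y p = H.cl n (cm p q f K)" using H.yo_cl[OF f f' K] True by (simp add: H.HH_class_eq)
    have cp: "?y p \<in> carrier (H.H n)" by (rule cl) (simp add: True)
    have "finsum (H.H n) ?y {..n} = finsum (H.H n) (\<lambda>i. if p = i then ?y p else \<zero>\<^bsub>H.H n\<^esub>) {..n}"
    proof (rule H.H.finsum_cong'[OF refl])
      show "(\<lambda>i. if p = i then ?y p else \<zero>\<^bsub>H.H n\<^esub>) \<in> {..n} \<rightarrow> carrier (H.H n)"
        using cp by (intro funcsetI) (split if_split, intro conjI impI H.H.zero_closed)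
      show "?y i = (if p = i then ?y p else \<zero>\<^bsub>H.H n\<^esub>)" if "i \<in> {..n}" for i
      proof (cases "p = i")
        case False
        then show ?thesis using z[of i] that by simp
      qed simp
    qed
    also have "\<dots> = ?y p" using cl[of p] True by (intro H.H.finsum_singleton) auto
    finally show ?thesis unfolding H.HH_mult yp H.HH_class_eq[of "p + q"] using True by simp
  next
    case False
    have "finsum (H.H n) ?y {..n} = finsum (H.H n) (\<lambda>i. \<zero>\<^bsub>H.H n\<^esub>) {..n}"
    proof (rule H.H.finsum_cong'[OF refl])
      show "?y i = \<zero>\<^bsub>H.H n\<^esub>" if "i \<in> {..n}" for i using z[of i] that False by simp
    qed simp
    then show ?thesis unfolding H.HH_mult H.HH_class_eq[of "p + q"] using False by simp
  qed
qed

text \<open>Radical-valued classes are nilpotent since the radical has cube zero.\<close>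

lemma class_cube:
  assumes f: "f \<in> carrier (H.Z p)" and \<gamma>: "\<gamma> p f = 0"
  shows "HH_class L C p f [^]\<^bsub>H.HH\<^esub> (3::nat) = \<zero>\<^bsub>H.HH\<^esub>"
proof -
  have r: "f x \<in> rad" if "x \<in> carrier (P p)" for x using \<gamma>_zero_rad[OF f \<gamma> that] .
  obtain K where K: "is_lifting L C p f K" "\<And>j x. x \<in> carrier (P (p + j)) \<Longrightarrow> K j x \<in> PR j"
    by (rule rad_lifting[OF f r]) blast+
  let ?f2 = "cm p p f K" let ?f3 = "cm (p + p) p ?f2 K"
  note f2 = H.cmp_Z[OF f K(1)]
  have r2: "?f2 x \<in> rad2" if "x \<in> carrier (P (p + p))" for x
    using Z_PR2[OF f r K(2)[OF that]] that by (simp add: compose_def)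
  have r3: "?f3 x = \<zero>" if "x \<in> carrier (P (p + p + p))" for x
  proof -
    have "K (p + p) x \<in> PR (p + p)" using K(2)[of x "p + p"] that by (simp add: add.assoc)
    then show ?thesis using Z_PR3[OF f2 r2, of "K (p + p) x"] that by (simp add: compose_def)
  qed
  have "?f3 = \<zero>\<^bsub>H.Z (p + p + p)\<^esub>"
    by (rule H.Z_eqI[OF H.cmp_Z[OF f2 K(1)] H.Z_closed(2)]) (subst r3, assumption, simp add: H.Z_simps)
  then have z: "HH_class L C (p + p + p) ?f3 = \<zero>\<^bsub>H.HH\<^esub>"
    by (intro ext) (simp add: H.HH_class_eq H.HH_zero H.H_zero)
  note c = H.HH_class_closed[OF f]
  have "HH_class L C p f [^]\<^bsub>H.HH\<^esub> (3::nat) = HH_class L C p f \<otimes>\<^bsub>H.HH\<^esub> HH_class L C p f \<otimes>\<^bsub>H.HH\<^esub> HH_class L C p f"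
    using c by (simp add: numeral_3_eq_3)
  then show ?thesis unfolding class_mult[OF f f K(1)] class_mult[OF f2 f K(1)] z .
qed

text \<open>Nilpotent elements map to zero because the target is a domain. Conversely an element of
  the kernel is a finite sum of homogeneous components, each with \<gamma> = 0, and these have cube
  zero by \<open>class_cube\<close>.\<close>

lemma nil_ideal: "HH_nil_ideal L C = {x \<in> carrier H.HH. \<Psi> x = 0}"
proof -
  interpret S: domain "bip (chi_supp m) :: ('k, 'k poly poly) module" by (rule domain_bip)
  interpret \<Psi>: ring_hom_ring H.HH "bip (chi_supp m)" \<Psi> by (rule \<Psi>_hom)
  let ?G = "{x \<in> carrier H.HH. (\<exists>n. \<forall>k. k \<noteq> n \<longrightarrow> x k = \<zero>\<^bsub>H.H k\<^esub>) \<and> (\<exists>j::nat. j > 0 \<and> x [^]\<^bsub>H.HH\<^esub> j = \<zero>\<^bsub>H.HH\<^esub>)}"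
  have G: "HH_nil_ideal L C = genideal H.HH ?G" by (simp add: HH_nil_ideal_def)
  have ker: "{x \<in> carrier H.HH. \<Psi> x = 0} = a_kernel H.HH (bip (chi_supp m)) \<Psi>"
    unfolding a_kernel_def' by simp
  have idl: "ideal {x \<in> carrier H.HH. \<Psi> x = 0} H.HH" unfolding ker by (rule \<Psi>.kernel_is_ideal)
  have pow: "\<Psi> (x [^]\<^bsub>H.HH\<^esub> (j::nat)) = \<Psi> x ^ j" if x: "x \<in> carrier H.HH" for x j
    by (induction j) (simp_all add: \<Psi>_one \<Psi>_mult x)
  have z: "\<Psi> \<zero>\<^bsub>H.HH\<^esub> = 0" using \<Psi>.hom_zero by simp
  show ?thesis
  proof (intro equalityI)
    show "HH_nil_ideal L C \<subseteq> {x \<in> carrier H.HH. \<Psi> x = 0}"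
      unfolding G
    proof (rule HR.genideal_minimal[OF idl], rule subsetI)
      fix x assume "x \<in> ?G"
      then obtain j :: nat where x: "x \<in> carrier H.HH" "j > 0" "x [^]\<^bsub>H.HH\<^esub> j = \<zero>\<^bsub>H.HH\<^esub>" by blast
      have "\<Psi> x ^ j = 0" using pow[OF x(1), of j] z unfolding x(3) by simp
      then show "x \<in> {x \<in> carrier H.HH. \<Psi> x = 0}" using x by simp
    qed
  next
    have Gc: "?G \<subseteq> carrier H.HH" by blast
    interpret N: ideal "genideal H.HH ?G" H.HH by (rule HR.genideal_ideal[OF Gc])
    \<comment> \<open>Induction on a strict bound n for the degrees that occur, splitting off the
      component of highest possible degree.\<close>
    have *: "x \<in> genideal H.HH ?G" if "x \<in> carrier H.HH" "\<Psi> x = 0" "\<And>k. k \<ge> n \<Longrightarrow> x k = \<zero>\<^bsub>H.H k\<^esub>" for x n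
      using that
    proof (induction n arbitrary: x)
      case 0
      then have "x = \<zero>\<^bsub>H.HH\<^esub>" by (intro ext) (simp add: H.HH_zero)
      then show ?case using N.zero_closed by simp
    next
      case (Suc n)
      obtain f where f: "f \<in> carrier (H.Z n)" "x n = H.cl n f" using H.HH_comp[OF Suc(2)] by (rule H.H_cases)
      define y where "y k = (if k = n then \<zero>\<^bsub>H.H k\<^esub> else x k)" for k
      have "{k. y k \<noteq> \<zero>\<^bsub>H.H k\<^esub>} \<subseteq> {k. x k \<noteq> \<zero>\<^bsub>H.H k\<^esub>}"
      proof
        fix k assume "k \<in> {k. y k \<noteq> \<zero>\<^bsub>H.H k\<^esub>}"
        then show "k \<in> {k. x k \<noteq> \<zero>\<^bsub>H.H k\<^esub>}" by (cases "k = n") (simp_all add: y_def)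
      qed
      moreover have "finite {k. x k \<noteq> \<zero>\<^bsub>H.H k\<^esub>}" using Suc(2) by (simp add: H.HH_carrier)
      ultimately have "finite {k. y k \<noteq> \<zero>\<^bsub>H.H k\<^esub>}" by (rule finite_subset)
      moreover have "y k \<in> carrier (H.H k)" for k by (simp add: y_def H.HH_comp[OF Suc(2)])
      ultimately have yc: "y \<in> carrier H.HH" unfolding H.HH_carrier by simp
      have xy: "x = HH_class L C n f \<oplus>\<^bsub>H.HH\<^esub> y"
      proof (rule ext)
        fix k show "x k = (HH_class L C n f \<oplus>\<^bsub>H.HH\<^esub> y) k"
          by (cases "k = n") (simp_all add: H.HH_add H.HH_class_eq y_def f(2) H.cl_closed[OF f(1)] H.HH_comp[OF Suc(2)])
      qed
      have g0: "\<gamma> n f = 0" using coeff_\<Psi>[OF Suc(2), of n] Suc(3) by (simp add: f(2) \<Gamma>_cl[OF f(1)])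
      then have f0: "\<Psi> (HH_class L C n f) = 0" by (simp add: \<Psi>_class[OF f(1)])
      have y0: "\<Psi> y = 0" using Suc(3) \<Psi>_add[OF H.HH_class_closed[OF f(1)] yc] by (simp add: xy f0)
      have "y k = \<zero>\<^bsub>H.H k\<^esub>" if "k \<ge> n" for k using that Suc(4)[of k] by (cases "k = n") (simp_all add: y_def)
      then have yN: "y \<in> genideal H.HH ?G" by (rule Suc(1)[OF yc y0])
      have "HH_class L C n f \<in> ?G"
      proof (intro CollectI conjI exI)
        show "HH_class L C n f \<in> carrier H.HH" by (rule H.HH_class_closed[OF f(1)])
        show "\<forall>k. k \<noteq> n \<longrightarrow> HH_class L C n f k = \<zero>\<^bsub>H.H k\<^esub>" by (simp add: H.HH_class_eq)
        show "HH_class L C n f [^]\<^bsub>H.HH\<^esub> (3::nat) = \<zero>\<^bsub>H.HH\<^esub>" by (rule class_cube[OF f(1) g0])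
      qed simp
      then have "HH_class L C n f \<in> genideal H.HH ?G" using HR.genideal_self[OF Gc] by blast
      then show ?case unfolding xy using yN by (rule N.a_closed)
    qed
    show "{x \<in> carrier H.HH. \<Psi> x = 0} \<subseteq> HH_nil_ideal L C"
      unfolding G
    proof
      fix x assume "x \<in> {x \<in> carrier H.HH. \<Psi> x = 0}"
      then have x: "x \<in> carrier H.HH" "\<Psi> x = 0" by simp_all
      then obtain n where n: "\<forall>k\<in>{k. x k \<noteq> \<zero>\<^bsub>H.H k\<^esub>}. k < n"
        using x(1) unfolding H.HH_carrier finite_nat_set_iff_bounded by (elim conjE exE)
      have "x k = \<zero>\<^bsub>H.H k\<^esub>" if "k \<ge> n" for k
      proof (rule ccontr)
        assume "x k \<noteq> \<zero>\<^bsub>H.H k\<^esub>"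
        then have "k < n" using n by simp
        with that show False by simp
      qed
      then show "x \<in> genideal H.HH ?G" by (rule *[OF x])
    qed
  qed
qed

lemma \<Psi>_chi:
  assumes s: "good n s" and d: "D = int n - 2 * int s"
  shows "chi m 1 n D \<in> carrier H.HH" "\<Psi> (chi m 1 n D) = Polynomial.monom (Polynomial.monom 1 s) n"
  unfolding chi_\<kappa>[OF s d] by (simp_all add: H.HH_class_closed \<kappa>_Z[OF s] \<Psi>_class \<gamma>_\<kappa>[OF s])

end

section \<open>Algebraic dependence and Krull dimension of the bigraded subalgebra\<close>

section \<open>Krull dimension\<close>

text \<open>Gaussian elimination on the number of equations: a linear system with more unknowns than
  equations has a non-trivial solution.\<close>

lemma homogeneous_system:
  fixes A :: "'y \<Rightarrow> 'x \<Rightarrow> 'k::field"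
  assumes "finite Y" "finite V" "card Y < card V"
  shows "\<exists>c. (\<exists>x\<in>V. c x \<noteq> 0) \<and> (\<forall>y\<in>Y. (\<Sum>x\<in>V. c x * A y x) = 0)"
  using assms
proof (induction Y arbitrary: V A rule: finite_induct)
  case empty
  then have "V \<noteq> {}" by auto
  then show ?case by (intro exI[of _ "\<lambda>_. 1"]) auto
next
  case (insert y Y)
  show ?case
  proof (cases "\<forall>x\<in>V. A y x = 0")
    case True
    obtain c where "\<exists>x\<in>V. c x \<noteq> 0" "\<forall>y\<in>Y. (\<Sum>x\<in>V. c x * A y x) = 0"
      using insert.IH[of V A] insert.prems insert.hyps by auto
    then show ?thesis using True by (intro exI[of _ c]) simp
  next
    case False
    then obtain z where z: "z \<in> V" "A y z \<noteq> 0" by blast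
    define V' where "V' = V - {z}"
    have V: "finite V'" "z \<notin> V'" "V = insert z V'" using insert.prems z by (auto simp: V'_def)
    \<comment> \<open>The unknown z is eliminated by means of the equation y, in which its
      coefficient is non-zero.\<close>
    define A' where "A' y' x = A y' x - A y' z * A y x / A y z" for y' x
    have "card Y < card V'" using insert.prems insert.hyps z by (simp add: V'_def)
    then obtain c where c: "\<exists>x\<in>V'. c x \<noteq> 0" "\<forall>y\<in>Y. (\<Sum>x\<in>V'. c x * A' y x) = 0"
      using insert.IH[of V' A'] V by blast
    define c' where "c' = c(z := - (\<Sum>x\<in>V'. c x * A y x) / A y z)"
    have s: "(\<Sum>x\<in>V. c' x * A y' x) = c' z * A y' z + (\<Sum>x\<in>V'. c x * A y' x)" for y'
    proof -
      have "(\<Sum>x\<in>V'. c' x * A y' x) = (\<Sum>x\<in>V'. c x * A y' x)" using V(2) by (intro sum.cong) (auto simp: c'_def)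
      then show ?thesis using V by simp
    qed
    have "(\<Sum>x\<in>V. c' x * A y' x) = (\<Sum>x\<in>V'. c x * A' y' x)" for y'
    proof -
      have "(\<Sum>x\<in>V'. c x * A' y' x) = (\<Sum>x\<in>V'. c x * A y' x) - (\<Sum>x\<in>V'. c x * A y x) * A y' z / A y z"
        unfolding sum_distrib_right sum_divide_distrib sum_subtractf[symmetric]
        by (rule sum.cong) (simp_all add: A'_def algebra_simps)
      then show ?thesis unfolding s by (simp add: c'_def)
    qed
    moreover have "(\<Sum>x\<in>V. c' x * A y x) = 0" unfolding s using z by (simp add: c'_def)
    moreover have "\<exists>x\<in>V. c' x \<noteq> 0" using c(1) V by (auto simp: c'_def)
    ultimately show ?thesis using c(2) by (intro exI[of _ c']) auto
  qed
qed

definition bideg_le :: "nat \<Rightarrow> 'k::field poly poly \<Rightarrow> bool" where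
  "bideg_le d F \<longleftrightarrow> (\<forall>n r. cf F n r \<noteq> 0 \<longrightarrow> n \<le> d \<and> r \<le> d)"

lemma bideg_le_mult: assumes "bideg_le d F" "bideg_le d' G" shows "bideg_le (d + d') (F * G)"
  unfolding bideg_le_def
proof (intro allI impI)
  fix n r assume "cf (F * G) n r \<noteq> 0"
  then obtain i j where ij: "i \<le> n" "j \<le> r" "cf F i j \<noteq> 0" "cf G (n - i) (r - j) \<noteq> 0" by (rule cf_mult_nonzero)
  then have "i \<le> d" "j \<le> d" "n - i \<le> d'" "r - j \<le> d'" using assms unfolding bideg_le_def by blast+
  then show "n \<le> d + d' \<and> r \<le> d + d'" by linarith
qed

lemma bideg_le_power: assumes "bideg_le d F" shows "bideg_le (i * d) (F ^ i)"
proof (induction i)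
  case 0
  show ?case by (auto simp: bideg_le_def coeff_1 split: if_splits)
next
  case (Suc i)
  then show ?case using bideg_le_mult[OF assms Suc] by simp
qed

lemma bideg_le_mono: "bideg_le d F \<Longrightarrow> d \<le> d' \<Longrightarrow> bideg_le d' F"
  unfolding bideg_le_def by (meson order_trans)

lemma bideg_le_exists: "\<exists>d. bideg_le d F"
proof -
  define d where "d = Polynomial.degree F + (\<Sum>n\<le>Polynomial.degree F. Polynomial.degree (Polynomial.coeff F n))"
  have "n \<le> d \<and> r \<le> d" if nz: "cf F n r \<noteq> 0" for n r
  proof -
    have n: "n \<le> Polynomial.degree F" using nz by (intro le_degree) auto
    have "r \<le> Polynomial.degree (Polynomial.coeff F n)" using nz by (rule le_degree)
    also have "\<dots> \<le> (\<Sum>n\<le>Polynomial.degree F. Polynomial.degree (Polynomial.coeff F n))"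
      using n by (intro member_le_sum) auto
    finally show ?thesis using n by (simp add: d_def)
  qed
  then show ?thesis unfolding bideg_le_def by blast
qed

text \<open>There are more monomials of degree at most \<open>D\<close> in three variables, \<open>(D + 1)^3\<close>, than
  coefficients of a polynomial of bidegree \<open>3 D d\<close>, as soon as \<open>D \<ge> 9 d^2\<close>.\<close>

lemma algebraic_dependence:
  fixes x1 x2 x3 :: "'k::field poly poly"
  obtains D c where "\<exists>i\<le>D. \<exists>j\<le>D. \<exists>k\<le>D. c i j k \<noteq> 0"
    "(\<Sum>i\<le>D. (\<Sum>j\<le>D. (\<Sum>k\<le>D. [:[:c i j k:]:] * x3 ^ k) * x2 ^ j) * x1 ^ i) = 0"
proof -
  obtain d1 d2 d3 where d123: "bideg_le d1 x1" "bideg_le d2 x2" "bideg_le d3 x3" using bideg_le_exists by metis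
  define d where "d = d1 + d2 + d3 + 1"
  have d: "bideg_le d x1" "bideg_le d x2" "bideg_le d x3" "d \<ge> 1"
    using d123 by (auto simp: d_def elim: bideg_le_mono)
  define D where "D = 9 * d * d"
  define N where "N = 3 * D * d"
  define V where "V = {..D} \<times> {..D} \<times> {..D}"
  define mo where "mo v = (case v of (i, j, k) \<Rightarrow> x3 ^ k * x2 ^ j * x1 ^ i)" for v :: "nat \<times> nat \<times> nat"
  have mo: "bideg_le N (mo v)" if "v \<in> V" for v
  proof -
    obtain i j k where v: "v = (i, j, k)" by (cases v)
    have b: "i \<le> D" "j \<le> D" "k \<le> D" using that by (auto simp: v V_def)
    have "bideg_le (k * d + j * d + i * d) (mo v)"
      unfolding mo_def v prod.case by (intro bideg_le_mult bideg_le_power d)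
    moreover have "k * d + j * d + i * d \<le> D * d + D * d + D * d" using b by (intro add_mono mult_right_mono) auto
    ultimately show ?thesis by (elim bideg_le_mono) (simp add: N_def)
  qed
  \<comment> \<open>From d \<ge> 1. Squaring the resulting bound gives 9 d^2 (D + 1)^2 = D (D +
    1)^2, just below the number (D + 1)^3 of monomials.\<close>
  have "N + 1 \<le> N + 3 * d" using d(4) by linarith
  also have "\<dots> = 3 * d * (D + 1)" by (simp add: N_def algebra_simps)
  finally have le: "N + 1 \<le> 3 * d * (D + 1)" .
  have "(N + 1) * (N + 1) \<le> (3 * d * (D + 1)) * (3 * d * (D + 1))" by (rule mult_mono[OF le le]) auto
  also have "\<dots> = D * ((D + 1) * (D + 1))" by (simp add: D_def algebra_simps)
  also have "\<dots> < (D + 1) * ((D + 1) * (D + 1))" by simp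
  finally have cd: "card ({..N} \<times> {..N}) < card V" by (simp add: V_def card_cartesian_product)
  obtain c where c: "\<exists>v\<in>V. c v \<noteq> 0" "\<forall>y\<in>{..N} \<times> {..N}. (\<Sum>v\<in>V. c v * (case y of (n, r) \<Rightarrow> cf (mo v) n r)) = 0"
    using homogeneous_system[OF _ _ cd, of "\<lambda>y v. case y of (n, r) \<Rightarrow> cf (mo v) n r"] by (auto simp: V_def)
  have "(\<Sum>v\<in>V. [:[:c v:]:] * mo v) = 0"
  proof (intro poly_eqI)
    fix n r
    have e: "cf (\<Sum>v\<in>V. [:[:c v:]:] * mo v) n r = (\<Sum>v\<in>V. c v * cf (mo v) n r)" by (simp add: Polynomial.coeff_sum)
    show "cf (\<Sum>v\<in>V. [:[:c v:]:] * mo v) n r = cf 0 n r"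
    proof (cases "n \<le> N \<and> r \<le> N")
      case True
      then show ?thesis using bspec[OF c(2), of "(n, r)"] unfolding e by simp
    next
      case False
      then have "cf (mo v) n r = 0" if "v \<in> V" for v using mo[OF that] unfolding bideg_le_def by blast
      then show ?thesis unfolding e by simp
    qed
  qed
  moreover have "(\<Sum>v\<in>V. [:[:c v:]:] * mo v) =
     (\<Sum>i\<le>D. (\<Sum>j\<le>D. (\<Sum>k\<le>D. [:[:c (i, j, k):]:] * x3 ^ k) * x2 ^ j) * x1 ^ i)"
    unfolding V_def sum_distrib_right sum.cartesian_product by (rule sum.cong) (auto simp: mo_def mult.assoc)
  moreover have "\<exists>i\<le>D. \<exists>j\<le>D. \<exists>k\<le>D. c (i, j, k) \<noteq> 0" using c(1) by (auto simp: V_def)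
  ultimately show thesis by (intro that[of D "\<lambda>i j k. c (i, j, k)"]) simp_all
qed

lemma bip_prime:
  assumes P: "primeideal p (bip (chi_supp m))"
  shows "F \<in> p \<Longrightarrow> F \<in> chi_supp m" "F \<in> p \<Longrightarrow> G \<in> p \<Longrightarrow> F - G \<in> p" "F \<in> p \<Longrightarrow> G \<in> chi_supp m \<Longrightarrow> G * F \<in> p"
    "F \<in> chi_supp m \<Longrightarrow> G \<in> chi_supp m \<Longrightarrow> F * G \<in> p \<Longrightarrow> F \<in> p \<or> G \<in> p" "1 \<notin> p" "0 \<in> p"
proof -
  interpret S: domain "bip (chi_supp m) :: ('a, 'a poly poly) module" by (rule domain_bip)
  interpret p: primeideal p "bip (chi_supp m)" by fact
  show c: "F \<in> p \<Longrightarrow> F \<in> chi_supp m" for F using p.Icarr by simp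
  show l: "F \<in> p \<Longrightarrow> G \<in> chi_supp m \<Longrightarrow> G * F \<in> p" for F G using p.I_l_closed[of F G] by simp
  show "F - G \<in> p" if "F \<in> p" "G \<in> p"
  proof -
    have "- 1 * G \<in> p" using that(2) by (rule l) (intro chi_supp_closed)
    then show ?thesis using p.a_closed[OF that(1), of "- G"] by simp
  qed
  show "F \<in> chi_supp m \<Longrightarrow> G \<in> chi_supp m \<Longrightarrow> F * G \<in> p \<Longrightarrow> F \<in> p \<or> G \<in> p" using p.I_prime[of F G] by simp
  show "1 \<notin> p"
  proof
    assume "1 \<in> p"
    then have "p = chi_supp m" using c l[of 1] by auto
    then show False using p.I_notcarr by simp
  qed
  show "0 \<in> p" using p.zero_closed by simp
qed

lemma chi_supp_power: "F \<in> chi_supp m \<Longrightarrow> F ^ i \<in> chi_supp m"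
  by (induction i) (simp_all add: chi_supp_closed chi_supp_mult)

lemma chi_supp_sum: "(\<And>i. i \<in> T \<Longrightarrow> F i \<in> chi_supp m) \<Longrightarrow> (\<Sum>i\<in>T. F i) \<in> chi_supp m"
  by (induction T rule: infinite_finite_induct) (simp_all add: chi_supp_closed)

lemma chi_supp_const: "[:[:c:]:] \<in> chi_supp m"
  by (auto simp: chi_supp_def coeff_pCons split: nat.splits)

text \<open>If \<open>x \<in> p' \ p\<close> satisfies an algebraic equation modulo \<open>p\<close>, then the lowest coefficient lies in \<open>p'\<close>.\<close>

lemma lowest_coeff:
  assumes p: "primeideal p (bip (chi_supp m))" and p': "primeideal p' (bip (chi_supp m))" and pp: "p \<subseteq> p'"
    and x: "x \<in> p'" "x \<notin> p" and u: "\<And>i. u i \<in> chi_supp m" and s: "(\<Sum>i\<le>D. u i * x ^ i) \<in> p"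
    and a: "a \<le> D" "\<And>i. i < a \<Longrightarrow> u i = 0"
  shows "u a \<in> p'"
proof -
  note q = bip_prime[OF p] and q' = bip_prime[OF p']
  have xS: "x \<in> chi_supp m" using q'(1)[OF x(1)] .
  \<comment> \<open>The relation reads x^a (u a + x R); as p is prime and does not contain x, the
    second factor lies in p.\<close>
  define R where "R = (\<Sum>i\<in>{Suc a..D}. u i * x ^ (i - Suc a))"
  have RS: "R \<in> chi_supp m" unfolding R_def by (intro chi_supp_sum chi_supp_mult chi_supp_power u xS)
  have "(\<Sum>i\<le>D. u i * x ^ i) = (\<Sum>i\<in>{a..D}. u i * x ^ i)"
    by (rule sum.mono_neutral_right) (auto simp: a(2) not_le)
  also have "\<dots> = u a * x ^ a + (\<Sum>i\<in>{Suc a..D}. u i * x ^ i)" using a(1) by (simp add: sum.atLeast_Suc_atMost)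
  also have "(\<Sum>i\<in>{Suc a..D}. u i * x ^ i) = x ^ a * (x * R)"
    unfolding R_def sum_distrib_left
  proof (rule sum.cong[OF refl])
    fix i assume "i \<in> {Suc a..D}"
    then have "i = a + (1 + (i - Suc a))" by simp
    then have "x ^ i = x ^ a * (x * x ^ (i - Suc a))" by (metis power_add power_one_right)
    then show "u i * x ^ i = x ^ a * (x * (u i * x ^ (i - Suc a)))" by simp
  qed
  finally have "x ^ a * (u a + x * R) \<in> p" using s by (simp add: algebra_simps)
  moreover have "x ^ i \<notin> p" for i
    by (induction i) (use q(5) q(4)[OF xS chi_supp_power[OF xS]] x(2) in auto)
  moreover have "u a + x * R \<in> chi_supp m" by (intro chi_supp_closed(3) chi_supp_mult u xS RS)
  ultimately have "u a + x * R \<in> p" using q(4)[OF chi_supp_power[OF xS]] by blast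
  then have "u a + x * R \<in> p'" using pp by blast
  moreover have "x * R \<in> p'" using q'(3)[OF x(1) RS] by (simp add: mult.commute)
  ultimately show ?thesis using q'(2) by fastforce
qed

text \<open>Given four primes, choose an element in each step of the chain. A non-trivial algebraic
  relation among these three elements, with its lexicographically least non-zero coefficient, is
  pushed through the chain by three uses of \<open>lowest_coeff\<close>, until that non-zero
  constant lies in the top prime.\<close>

lemma no_long_chain:
  assumes p: "\<And>i. i \<le> 3 \<Longrightarrow> primeideal (p i) (bip (chi_supp m))" and chain: "\<And>i. i < 3 \<Longrightarrow> p i \<subset> p (Suc i)"
  shows False
proof -
  have "\<exists>x. x \<in> p (Suc i) \<and> x \<notin> p i" if "i < 3" for i using chain[OF that] by blast
  then obtain x1 x2 x3 where x: "x1 \<in> p 1" "x1 \<notin> p 0" "x2 \<in> p 2" "x2 \<notin> p 1" "x3 \<in> p 3" "x3 \<notin> p 2"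
    by (metis One_nat_def Suc_1 eval_nat_numeral(3) less_Suc_eq numeral_3_eq_3 one_less_numeral_iff zero_less_numeral semiring_norm(77) lessI)
  have sub: "p 0 \<subseteq> p 1" "p 1 \<subseteq> p 2" "p 2 \<subseteq> p 3"
    using chain[of 0] chain[of 1] chain[of 2] by (auto simp: numeral_2_eq_2 numeral_3_eq_3)
  have pr: "primeideal (p 0) (bip (chi_supp m))" "primeideal (p 1) (bip (chi_supp m))" "primeideal (p 2) (bip (chi_supp m))" "primeideal (p 3) (bip (chi_supp m))"
    by (rule p; simp)+
  obtain D c where c: "\<exists>i\<le>D. \<exists>j\<le>D. \<exists>k\<le>D. c i j k \<noteq> 0"
    "(\<Sum>i\<le>D. (\<Sum>j\<le>D. (\<Sum>k\<le>D. [:[:c i j k:]:] * x3 ^ k) * x2 ^ j) * x1 ^ i) = 0"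
    by (rule algebraic_dependence)
  define w where "w i j = (\<Sum>k\<le>D. [:[:c i j k:]:] * x3 ^ k)" for i j
  define v where "v i = (\<Sum>j\<le>D. w i j * x2 ^ j)" for i
  \<comment> \<open>The triple (i0, j0, k0) is the lexicographically least exponent with non-zero
    coefficient; minimality supplies the vanishing lower coefficients required at each step.\<close>
  define i0 where "i0 = (LEAST i. i \<le> D \<and> (\<exists>j\<le>D. \<exists>k\<le>D. c i j k \<noteq> 0))"
  have i0: "i0 \<le> D" "\<exists>j\<le>D. \<exists>k\<le>D. c i0 j k \<noteq> 0"
    using LeastI_ex[of "\<lambda>i. i \<le> D \<and> (\<exists>j\<le>D. \<exists>k\<le>D. c i j k \<noteq> 0)"] c(1) unfolding i0_def by blast+
  have i0': "c i j k = 0" if "i < i0" "j \<le> D" "k \<le> D" for i j k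
    using not_less_Least[of i "\<lambda>i. i \<le> D \<and> (\<exists>j\<le>D. \<exists>k\<le>D. c i j k \<noteq> 0)"] that i0(1) unfolding i0_def by auto
  define j0 where "j0 = (LEAST j. j \<le> D \<and> (\<exists>k\<le>D. c i0 j k \<noteq> 0))"
  have j0: "j0 \<le> D" "\<exists>k\<le>D. c i0 j0 k \<noteq> 0"
    using LeastI_ex[of "\<lambda>j. j \<le> D \<and> (\<exists>k\<le>D. c i0 j k \<noteq> 0)"] i0(2) unfolding j0_def by blast+
  have j0': "c i0 j k = 0" if "j < j0" "k \<le> D" for j k
    using not_less_Least[of j "\<lambda>j. j \<le> D \<and> (\<exists>k\<le>D. c i0 j k \<noteq> 0)"] that j0(1) unfolding j0_def by auto
  define k0 where "k0 = (LEAST k. k \<le> D \<and> c i0 j0 k \<noteq> 0)"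
  have k0: "k0 \<le> D" "c i0 j0 k0 \<noteq> 0"
    using LeastI_ex[of "\<lambda>k. k \<le> D \<and> c i0 j0 k \<noteq> 0"] j0(2) unfolding k0_def by blast+
  have k0': "c i0 j0 k = 0" if "k < k0" for k
    using not_less_Least[of k "\<lambda>k. k \<le> D \<and> c i0 j0 k \<noteq> 0"] that k0(1) unfolding k0_def by auto
  have xS: "x1 \<in> chi_supp m" "x2 \<in> chi_supp m" "x3 \<in> chi_supp m"
    using bip_prime(1)[OF pr(2) x(1)] bip_prime(1)[OF pr(3) x(3)] bip_prime(1)[OF pr(4) x(5)] .
  have wS: "w i j \<in> chi_supp m" for i j unfolding w_def by (intro chi_supp_sum chi_supp_mult chi_supp_power chi_supp_const xS)
  have vS: "v i \<in> chi_supp m" for i unfolding v_def by (intro chi_supp_sum chi_supp_mult chi_supp_power wS xS)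
  have "v i0 \<in> p 1"
  proof (rule lowest_coeff[OF pr(1,2) sub(1) x(1,2) vS _ i0(1)])
    show "(\<Sum>i\<le>D. v i * x1 ^ i) \<in> p 0" using c(2) bip_prime(6)[OF pr(1)] by (simp add: v_def w_def)
    show "v i = 0" if "i < i0" for i using i0'[OF that] by (simp add: v_def w_def)
  qed
  then have "w i0 j0 \<in> p 2"
    unfolding v_def by (rule lowest_coeff[OF pr(2,3) sub(2) x(3,4) wS _ j0(1)]) (use j0' in \<open>simp add: w_def\<close>)
  then have "[:[:c i0 j0 k0:]:] \<in> p 3"
    unfolding w_def[of i0 j0] by (rule lowest_coeff[OF pr(3,4) sub(3) x(5,6) chi_supp_const _ k0(1)]) (use k0' in simp)
  then have "[:[:inverse (c i0 j0 k0):]:] * [:[:c i0 j0 k0:]:] \<in> p 3"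
    by (rule bip_prime(3)[OF pr(4) _ chi_supp_const])
  then show False using bip_prime(5)[OF pr(4)] k0(2) by (simp add: one_pCons)
qed

lemma primeideal_kernel:
  fixes \<phi> :: "'k::field poly poly \<Rightarrow> 'b::idom"
  assumes "\<And>F G. \<phi> (F + G) = \<phi> F + \<phi> G" "\<And>F G. \<phi> (F * G) = \<phi> F * \<phi> G" "\<phi> 1 = 1"
  shows "primeideal {F \<in> chi_supp m. \<phi> F = 0} (bip (chi_supp m))"
proof -
  interpret S: domain "bip (chi_supp m) :: ('k, 'k poly poly) module" by (rule domain_bip)
  have "\<phi> 0 + \<phi> 0 = \<phi> 0 + 0" using assms(1)[of 0 0] by simp
  then have z: "\<phi> 0 = 0" by (simp only: add_left_cancel)
  have neg: "\<phi> (- F) = - \<phi> F" for F using assms(1)[of F "- F"] z by (simp add: eq_neg_iff_add_eq_0 add.commute)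
  have inv: "\<ominus>\<^bsub>bip (chi_supp m)\<^esub> F = - F" if "F \<in> chi_supp m" for F :: "'k poly poly"
    using S.minus_equality[of "- F" F] that by (simp add: chi_supp_closed)
  show ?thesis
  proof (rule primeidealI)
    show "ideal {F \<in> chi_supp m. \<phi> F = 0} (bip (chi_supp m))"
    proof (rule idealI[OF S.ring_axioms])
      show "subgroup {F \<in> chi_supp m. \<phi> F = 0} (add_monoid (bip (chi_supp m)))"
      proof (rule subgroup.intro)
        fix F assume F: "F \<in> {F \<in> chi_supp m. \<phi> F = 0}"
        have "\<ominus>\<^bsub>bip (chi_supp m)\<^esub> F \<in> {F \<in> chi_supp m. \<phi> F = 0}"
          using F inv[of F] by (simp add: chi_supp_closed neg)
        then show "inv\<^bsub>add_monoid (bip (chi_supp m))\<^esub> F \<in> {F \<in> chi_supp m. \<phi> F = 0}" by (simp add: a_inv_def)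
      qed (auto simp: chi_supp_closed assms z)
    qed (auto simp: chi_supp_mult assms)
    show "cring (bip (chi_supp m) :: ('k, 'k poly poly) module)" by (rule S.cring_axioms)
    have "1 \<in> chi_supp m" "\<phi> 1 \<noteq> 0" using chi_supp_closed(2) assms(3) by auto
    then show "carrier (bip (chi_supp m)) \<noteq> {F \<in> chi_supp m. \<phi> F = 0}" by auto
  qed (auto simp: assms)
qed

text \<open>The chain consists of 0, the kernel of w = 0 and the kernel of w = t = 0, all prime as
  kernels of homomorphisms to domains. The inclusions are strict because of t^m w^m and t^m.\<close>

lemma krull_dim_bip: assumes m: "m \<ge> 1" shows "krull_dim (bip (chi_supp m) :: ('k::field, 'k poly poly) module) = 2"
proof -
  let ?B = "bip (chi_supp m) :: ('k, 'k poly poly) module"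
  let ?T = "{n. \<exists>p. (\<forall>i\<le>n. primeideal (p i) ?B) \<and> (\<forall>i<n. p i \<subset> p (Suc i))}"
  have le: "n \<le> 2" if n: "n \<in> ?T" for n
  proof (rule ccontr)
    assume "\<not> n \<le> 2"
    moreover obtain p where "\<forall>i\<le>n. primeideal (p i) ?B" "\<forall>i<n. p i \<subset> p (Suc i)" using n by blast
    ultimately show False by (intro no_long_chain[of p m]) auto
  qed
  define q1 where "q1 = {F \<in> chi_supp m. map_poly (\<lambda>c. Polynomial.coeff c 0) F = (0 :: 'k poly)}"
  define q2 where "q2 = {F \<in> chi_supp m. cf F 0 0 = (0 :: 'k)}"
  define p where "p i = (if i = 0 then {F \<in> chi_supp m. id F = (0 :: 'k poly poly)} else if i = 1 then q1 else q2)" for i :: nat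
  have c0: "Polynomial.coeff (map_poly (\<lambda>c. Polynomial.coeff c 0) F) n = cf F n 0" for F :: "'k poly poly" and n
    by (simp add: coeff_map_poly)
  have P1: "primeideal q1 ?B"
    unfolding q1_def
  proof (rule primeideal_kernel)
    show "map_poly (\<lambda>c. Polynomial.coeff c 0) (F + G) = map_poly (\<lambda>c. Polynomial.coeff c 0) F + map_poly (\<lambda>c. Polynomial.coeff c 0) G" for F G :: "'k poly poly"
      by (rule poly_eqI) (simp add: c0)
    show "map_poly (\<lambda>c. Polynomial.coeff c 0) (F * G) = map_poly (\<lambda>c. Polynomial.coeff c 0) F * map_poly (\<lambda>c. Polynomial.coeff c 0) G" for F G :: "'k poly poly"
      by (rule poly_eqI) (simp add: c0 coeff_mult Polynomial.coeff_sum)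
    show "map_poly (\<lambda>c. Polynomial.coeff c 0) 1 = (1 :: 'k poly)"
      by (rule poly_eqI) (simp add: c0 coeff_1)
  qed
  have P2: "primeideal q2 ?B"
    unfolding q2_def by (rule primeideal_kernel) (simp_all add: coeff_mult)
  have P0: "primeideal {F \<in> chi_supp m. id F = (0 :: 'k poly poly)} ?B" by (rule primeideal_kernel) simp_all
  have q12: "q1 \<subseteq> q2" unfolding q1_def q2_def
  proof clarsimp
    fix F :: "'k poly poly" assume "map_poly (\<lambda>c. Polynomial.coeff c 0) F = 0"
    then show "cf F 0 0 = 0" using c0[of F 0] by simp
  qed
  have y: "Polynomial.monom 1 m \<in> q2" "Polynomial.monom 1 m \<notin> q1"
  proof -
    show "Polynomial.monom 1 m \<in> q2" using m by (auto simp: q2_def chi_supp_def coeff_1 split: if_splits)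
    have "map_poly (\<lambda>c. Polynomial.coeff c 0) (Polynomial.monom 1 m) \<noteq> (0 :: 'k poly)"
    proof
      assume "map_poly (\<lambda>c. Polynomial.coeff c 0) (Polynomial.monom 1 m) = (0 :: 'k poly)"
      then show False using c0[of "Polynomial.monom 1 m" m] by simp
    qed
    then show "Polynomial.monom 1 m \<notin> q1" by (simp add: q1_def)
  qed
  have z: "Polynomial.monom (Polynomial.monom 1 m) m \<in> q1" "Polynomial.monom (Polynomial.monom 1 m) m \<noteq> (0 :: 'k poly poly)"
  proof -
    have "map_poly (\<lambda>c. Polynomial.coeff c 0) (Polynomial.monom (Polynomial.monom 1 m) m) = (0 :: 'k poly)"
      by (rule poly_eqI) (use m in \<open>simp add: c0\<close>)
    moreover have "int m dvd - int m" by simp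
    ultimately show "Polynomial.monom (Polynomial.monom 1 m) m \<in> q1" by (auto simp: q1_def chi_supp_def split: if_splits)
  qed (simp add: monom_eq_0_iff)
  have "0 \<in> q1" by (simp add: q1_def chi_supp_closed)
  then have "p 0 \<subset> p 1" using z by (auto simp: p_def)
  moreover have "p 1 \<subset> p 2" using q12 y by (auto simp: p_def)
  moreover have "i < 2 \<Longrightarrow> i = 0 \<or> i = 1" for i :: nat by linarith
  ultimately have "\<forall>i<2. p i \<subset> p (Suc i)" by (metis One_nat_def Suc_1)
  moreover have "\<forall>i\<le>2. primeideal (p i) ?B" using P0 P1 P2 by (simp add: p_def)
  ultimately have 2: "2 \<in> ?T" by blast
  have "enat 2 \<le> krull_dim ?B" unfolding krull_dim_def by (rule SUP_upper[OF 2])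
  moreover have "krull_dim ?B \<le> enat 2" unfolding krull_dim_def by (rule SUP_least) (simp add: le)
  ultimately show ?thesis by (simp add: numeral_eq_enat order_antisym)
qed

section \<open>Surjective algebra homomorphisms: quotient, generators and dimension\<close>

section \<open>Quotients of algebras and surjective homomorphisms\<close>

lemma alg_iso_inverse:
  assumes f: "f \<in> alg_iso A B" and A: "ring A" and cl: "\<And>c x. x \<in> carrier A \<Longrightarrow> c \<odot>\<^bsub>A\<^esub> x \<in> carrier A"
  shows "inv_into (carrier A) f \<in> alg_iso B A"
proof -
  have iso: "f \<in> ring_iso A B" and s: "\<And>c x. x \<in> carrier A \<Longrightarrow> f (c \<odot>\<^bsub>A\<^esub> x) = c \<odot>\<^bsub>B\<^esub> f x"
    using f by (auto simp: alg_iso_def)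
  have bij: "bij_betw f (carrier A) (carrier B)" using iso by (simp add: ring_iso_def)
  have "inv_into (carrier A) f (c \<odot>\<^bsub>B\<^esub> y) = c \<odot>\<^bsub>A\<^esub> inv_into (carrier A) f y" if y: "y \<in> carrier B" for c y
  proof -
    have x: "inv_into (carrier A) f y \<in> carrier A" "f (inv_into (carrier A) f y) = y"
      using y bij by (simp_all add: bij_betw_def inv_into_into f_inv_into_f)
    then have "c \<odot>\<^bsub>B\<^esub> y = f (c \<odot>\<^bsub>A\<^esub> inv_into (carrier A) f y)" using s[OF x(1), of c] by (simp only: x(2))
    then show ?thesis using inv_into_f_f[OF bij_betw_imp_inj_on[OF bij] cl[OF x(1)]] by simp
  qed
  then show ?thesis using ring_iso_set_sym[OF A iso] by (simp add: alg_iso_def)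
qed

lemma alg_iso_trans: "f \<in> alg_iso A B \<Longrightarrow> g \<in> alg_iso B D \<Longrightarrow> g \<circ> f \<in> alg_iso A D"
  using ring_iso_set_trans[of f A B g D] by (auto simp: alg_iso_def dest: ring_iso_memE(1))

locale surj_alg_hom = ring_hom_ring A B h
  for A :: "('k, 'a, 'm) module_scheme" and B :: "('k, 'b, 'n) module_scheme" and h +
  assumes surj: "h ` carrier A = carrier B"
    and smult_closed: "\<And>c x. x \<in> carrier A \<Longrightarrow> c \<odot>\<^bsub>A\<^esub> x \<in> carrier A"
    and smult_add: "\<And>c x y. x \<in> carrier A \<Longrightarrow> y \<in> carrier A \<Longrightarrow> c \<odot>\<^bsub>A\<^esub> (x \<oplus>\<^bsub>A\<^esub> y) = c \<odot>\<^bsub>A\<^esub> x \<oplus>\<^bsub>A\<^esub> c \<odot>\<^bsub>A\<^esub> y"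
    and smult_hom: "\<And>c x. x \<in> carrier A \<Longrightarrow> h (c \<odot>\<^bsub>A\<^esub> x) = c \<odot>\<^bsub>B\<^esub> h x"
    and smult_zero: "\<And>c. c \<odot>\<^bsub>B\<^esub> \<zero>\<^bsub>B\<^esub> = \<zero>\<^bsub>B\<^esub>"
begin

lemma quot:
  obtains \<phi> where "\<phi> \<in> alg_iso (alg_quot A (a_kernel A B h)) B" "\<And>x. x \<in> carrier A \<Longrightarrow> \<phi> (a_kernel A B h +>\<^bsub>A\<^esub> x) = h x"
    "ring (alg_quot A (a_kernel A B h))"
    "\<And>c x. x \<in> carrier (alg_quot A (a_kernel A B h)) \<Longrightarrow> c \<odot>\<^bsub>alg_quot A (a_kernel A B h)\<^esub> x \<in> carrier (alg_quot A (a_kernel A B h))"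
proof
  let ?K = "a_kernel A B h"
  interpret K: ideal ?K A by (rule kernel_is_ideal)
  have car: "carrier (alg_quot A ?K) = (\<lambda>x. ?K +>\<^bsub>A\<^esub> x) ` carrier A"
    by (auto simp: alg_quot_def A_RCOSETS_def')
  have sm: "c \<odot>\<^bsub>alg_quot A ?K\<^esub> (?K +>\<^bsub>A\<^esub> x) = ?K +>\<^bsub>A\<^esub> (c \<odot>\<^bsub>A\<^esub> x)" if "x \<in> carrier A" for c x
  proof (rule alg_quot_smult[OF K.is_abelian_subgroup _ smult_closed smult_add that])
    show "c \<odot>\<^bsub>A\<^esub> y \<in> ?K" if "y \<in> ?K" for y
      using that unfolding a_kernel_def' by (simp add: smult_closed smult_hom smult_zero)
  qed
  \<comment> \<open>The first isomorphism theorem for rings carries over, since the two quotient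
    records have the same ring fields; only compatibility with scalars remains.\<close>
  have "(\<lambda>S. the_elem (h ` S)) \<in> ring_iso (A Quot ?K) B" using FactRing_iso_set[OF surj] .
  then have "(\<lambda>S. the_elem (h ` S)) \<in> ring_iso (alg_quot A ?K) B"
    by (simp add: ring_iso_def ring_hom_def FactRing_def alg_quot_def)
  moreover have "the_elem (h ` (c \<odot>\<^bsub>alg_quot A ?K\<^esub> S)) = c \<odot>\<^bsub>B\<^esub> the_elem (h ` S)" if S: "S \<in> carrier (alg_quot A ?K)" for c S
  proof -
    obtain x where x: "x \<in> carrier A" "S = ?K +>\<^bsub>A\<^esub> x" using S unfolding car by (elim imageE)
    show ?thesis unfolding x(2) sm[OF x(1)] the_elem_simp[OF x(1)] the_elem_simp[OF smult_closed[OF x(1)]] by (rule smult_hom[OF x(1)])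
  qed
  ultimately show "(\<lambda>S. the_elem (h ` S)) \<in> alg_iso (alg_quot A ?K) B" by (simp add: alg_iso_def)
  show "the_elem (h ` (?K +>\<^bsub>A\<^esub> x)) = h x" if "x \<in> carrier A" for x using that by simp
  show "ring (alg_quot A ?K)" using K.quotient_is_ring by (simp add: ring_FactRing_alg_quot)
  show "c \<odot>\<^bsub>alg_quot A ?K\<^esub> S \<in> carrier (alg_quot A ?K)" if "S \<in> carrier (alg_quot A ?K)" for c S
    using that smult_closed unfolding car by (elim imageE) (simp add: sm)
qed

text \<open>The preimage of a subalgebra of B containing the images of the generators is a
  subalgebra of A containing the generators, hence all of A.\<close>

lemma finitely_generated_image:
  assumes "finitely_generated_algebra A"
  shows "finitely_generated_algebra B"
proof -
  obtain T where T: "finite T" "T \<subseteq> carrier A"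
    and gen: "\<forall>D. subring D A \<and> (\<forall>c. \<forall>x\<in>D. c \<odot>\<^bsub>A\<^esub> x \<in> D) \<and> T \<subseteq> D \<longrightarrow> D = carrier A"
    using assms unfolding finitely_generated_algebra_def by (elim exE conjE)
  show ?thesis
    unfolding finitely_generated_algebra_def
  proof (intro exI[of _ "h ` T"] conjI allI impI)
    show "finite (h ` T)" using T(1) by simp
    show "h ` T \<subseteq> carrier B" using T(2) surj by blast
    fix D assume "subring D B \<and> (\<forall>c. \<forall>x\<in>D. c \<odot>\<^bsub>B\<^esub> x \<in> D) \<and> h ` T \<subseteq> D"
    then have D: "subring D B" "\<And>c x. x \<in> D \<Longrightarrow> c \<odot>\<^bsub>B\<^esub> x \<in> D" "h ` T \<subseteq> D" by blast+
    note Dc = subringE[OF D(1)]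
    let ?D = "{x \<in> carrier A. h x \<in> D}"
    have eq: "?D = carrier A"
    proof (rule gen[rule_format], intro conjI allI ballI)
      show "subring ?D A" by (rule R.subringI) (auto simp: Dc)
      show "c \<odot>\<^bsub>A\<^esub> x \<in> ?D" if "x \<in> ?D" for c x using that by (simp add: smult_closed smult_hom D(2))
      show "T \<subseteq> ?D" using T(2) D(3) by blast
    qed
    have "h x \<in> D" if x: "x \<in> carrier A" for x
    proof -
      have "x \<in> ?D" using x by (subst eq)
      then show ?thesis by simp
    qed
    then have "carrier B \<subseteq> D" unfolding surj[symmetric] by (rule image_subsetI)
    with Dc(1) show "D = carrier B" by (rule subset_antisym)
  qed
qed

text \<open>Preimages of primes are prime, and surjectivity keeps inclusions strict, so chains of
  primes pull back.\<close>

lemma krull_dim_image: assumes "cring A" shows "krull_dim B \<le> krull_dim A"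
  unfolding krull_dim_def
proof (rule SUP_least)
  fix n assume "n \<in> {n. \<exists>p. (\<forall>i\<le>n. primeideal (p i) B) \<and> (\<forall>i<n. p i \<subset> p (Suc i))}"
  then obtain p where p: "\<And>i. i \<le> n \<Longrightarrow> primeideal (p i) B" "\<And>i. i < n \<Longrightarrow> p i \<subset> p (Suc i)" by blast
  let ?q = "\<lambda>i. {x \<in> carrier A. h x \<in> p i}"
  have "primeideal (?q i) A" if "i \<le> n" for i using primeideal_vimage[OF assms p(1)[OF that]] .
  moreover have "?q i \<subset> ?q (Suc i)" if i: "i < n" for i
  proof -
    obtain y where y: "y \<in> p (Suc i)" "y \<notin> p i" using p(2)[OF i] by blast
    interpret q: primeideal "p (Suc i)" B using p(1)[of "Suc i"] i by simp
    have "y \<in> h ` carrier A" using q.Icarr[OF y(1)] by (subst surj)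
    then obtain x where x: "x \<in> carrier A" "y = h x" by (elim imageE)
    show ?thesis
    proof
      show "?q i \<subseteq> ?q (Suc i)" by (rule Collect_mono) (use psubset_imp_subset[OF p(2)[OF i]] in \<open>simp add: subset_iff\<close>)
      show "?q i \<noteq> ?q (Suc i)"
      proof
        assume eq: "?q i = ?q (Suc i)"
        have "x \<in> ?q (Suc i)" using x y by simp
        then have "x \<in> ?q i" by (subst eq)
        then show False using x y by simp
      qed
    qed
  qed
  ultimately have "(\<forall>i\<le>n. primeideal (?q i) A) \<and> (\<forall>i<n. ?q i \<subset> ?q (Suc i))" by simp
  then show "enat n \<le> (SUP n\<in>{n. \<exists>p. (\<forall>i\<le>n. primeideal (p i) A) \<and> (\<forall>i<n. p i \<subset> p (Suc i))}. enat n)"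
    by (intro SUP_upper CollectI exI[of _ ?q])
qed

end

section \<open>Generators and relation of the bigraded subalgebra\<close>

section \<open>The presentation\<close>

type_synonym chi_mon = "chi_var \<Rightarrow>\<^sub>0 nat"

lemma poly_single_induct [case_names single add]:
  assumes s: "\<And>k c. Pr (Poly_Mapping.single k c)" and a: "\<And>p q. Pr p \<Longrightarrow> Pr q \<Longrightarrow> Pr (p + q)"
  shows "Pr (p :: 'a \<Rightarrow>\<^sub>0 'b::comm_monoid_add)"
proof -
  have "p = (\<Sum>k\<in>Poly_Mapping.keys p. Poly_Mapping.single k (Poly_Mapping.lookup p k))"
    by (rule poly_mapping_eqI) (simp add: lookup_sum lookup_single when_def in_keys_iff)
  moreover have "Pr (\<Sum>k\<in>T. Poly_Mapping.single k (Poly_Mapping.lookup p k))" if "finite T" for T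
    \<comment> \<open>The instance with coefficient 0 covers the empty sum.\<close>
    using that by (induction T rule: finite_induct) (use s[of undefined 0] s a in auto)
  ultimately show ?thesis by (metis finite_keys)
qed

text \<open>\<open>X20\<close>, \<open>Xm1\<close> and \<open>Xm_neg1\<close> are sent to \<open>t^2 w\<close>, \<open>t^m\<close> and \<open>t^m w^m\<close>.\<close>

definition tdeg :: "nat \<Rightarrow> chi_mon \<Rightarrow> nat" where
  "tdeg m k = 2 * Poly_Mapping.lookup k X20 + m * Poly_Mapping.lookup k Xm1 + m * Poly_Mapping.lookup k Xm_neg1"
definition wdeg :: "nat \<Rightarrow> chi_mon \<Rightarrow> nat" where
  "wdeg m k = Poly_Mapping.lookup k X20 + m * Poly_Mapping.lookup k Xm_neg1"

definition chi_eval :: "nat \<Rightarrow> (chi_mon \<Rightarrow>\<^sub>0 'k::field) \<Rightarrow> 'k poly poly" where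
  "chi_eval m p = (\<Sum>k\<in>Poly_Mapping.keys p. Polynomial.monom (Polynomial.monom (Poly_Mapping.lookup p k) (wdeg m k)) (tdeg m k))"

lemma deg_add: "tdeg m (k + l) = tdeg m k + tdeg m l" "wdeg m (k + l) = wdeg m k + wdeg m l"
  by (simp_all add: tdeg_def wdeg_def lookup_add algebra_simps)

lemma chi_eval_single: "chi_eval m (Poly_Mapping.single k c) = Polynomial.monom (Polynomial.monom c (wdeg m k)) (tdeg m k)"
  by (simp add: chi_eval_def)

lemma chi_eval_add: "chi_eval m (p + q) = chi_eval m p + chi_eval m q"
  unfolding chi_eval_def by (rule setsum_keys_plus_distrib) (simp_all add: add_monom)

lemma chi_eval_zero: "chi_eval m 0 = 0" by (simp add: chi_eval_def)

lemma chi_eval_mult: "chi_eval m (p * q) = chi_eval m p * chi_eval m q"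
proof (induction p rule: poly_single_induct)
  case (single k c)
  show ?case
    by (induction q rule: poly_single_induct)
      (simp_all add: mult_single chi_eval_single mult_monom deg_add chi_eval_add distrib_left)
qed (simp add: chi_eval_add distrib_right)

lemma chi_eval_one: "chi_eval m 1 = 1"
proof -
  have "chi_eval m 1 = chi_eval m (Poly_Mapping.single 0 1)" by simp
  also have "\<dots> = 1" unfolding chi_eval_single by (simp add: tdeg_def wdeg_def monom_0 one_pCons)
  finally show ?thesis .
qed

lemma chi_eval_diff: "chi_eval m (p - q) = chi_eval m p - chi_eval m q"
  using chi_eval_add[of m "p - q" q] by simp

lemma chi_eval_pvar:
  "chi_eval m (pvar X20) = Polynomial.monom (Polynomial.monom 1 1) 2"
  "chi_eval m (pvar Xm1) = Polynomial.monom (Polynomial.monom 1 0) m"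
  "chi_eval m (pvar Xm_neg1) = Polynomial.monom (Polynomial.monom 1 m) m"
  unfolding pvar_def chi_eval_single by (simp_all add: tdeg_def wdeg_def lookup_single when_def)

lemma chi_eval_supp: "chi_eval m p \<in> chi_supp m"
proof -
  have "wdeg m k \<le> tdeg m k" "int m dvd int (tdeg m k) - 2 * int (wdeg m k)" for k
  proof -
    show "wdeg m k \<le> tdeg m k" by (simp add: wdeg_def tdeg_def)
    have "int (tdeg m k) - 2 * int (wdeg m k) = int m * (int (Poly_Mapping.lookup k Xm1) - int (Poly_Mapping.lookup k Xm_neg1))"
      by (simp add: wdeg_def tdeg_def algebra_simps)
    then show "int m dvd int (tdeg m k) - 2 * int (wdeg m k)" by simp
  qed
  then show ?thesis unfolding chi_eval_def by (intro chi_supp_sum) (auto simp: chi_supp_def split: if_splits)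
qed

text \<open>Each permitted monomial t^n w^r is a product of powers of t^2 w and of one of the other
  two generators, according to the sign of n - 2r; sums of such monomials give everything.\<close>

lemma chi_eval_surj:
  assumes m: "m \<ge> 1" and F: "F \<in> chi_supp m"
  shows "\<exists>p. chi_eval m p = F"
proof -
  have mon: "\<exists>p. chi_eval m p = Polynomial.monom (Polynomial.monom (cf F n r) r) n" for n r
  proof (cases "cf F n r = 0")
    case True
    then show ?thesis using chi_eval_zero by (intro exI[of _ 0]) simp
  next
    case False
    then have r: "r \<le> n" and d: "int m dvd int n - 2 * int r" using F by (auto simp: chi_supp_def)
    have "\<exists>k. tdeg m k = n \<and> wdeg m k = r"
    proof (cases "2 * r \<le> n")
      case True
      then have "int n - 2 * int r = int (n - 2 * r)" by simp
      then have "m dvd n - 2 * r" using d by (simp only: int_dvd_int_iff)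
      then obtain l where "n - 2 * r = m * l" by (rule dvdE)
      \<comment> \<open>With n - 2r = m l, the monomial is the product of the powers (t^2 w)^r and
        (t^m)^l.\<close>
      then show ?thesis using True
        by (intro exI[of _ "Poly_Mapping.single X20 r + Poly_Mapping.single Xm1 l"]) (simp add: tdeg_def wdeg_def lookup_add lookup_single when_def)
    next
      case False
      then have "int n - 2 * int r = - int (2 * r - n)" by simp
      then have "m dvd 2 * r - n" using d by (simp only: dvd_minus_iff int_dvd_int_iff)
      then obtain l where "2 * r - n = m * l" by (rule dvdE)
      \<comment> \<open>With 2r - n = m l, the monomial is the product of (t^2 w)^(n - r) and (t^m
        w^m)^l, and n - r \<ge> 0 by r \<le> n.\<close>
      then show ?thesis using False r
        by (intro exI[of _ "Poly_Mapping.single X20 (n - r) + Poly_Mapping.single Xm_neg1 l"]) (simp add: tdeg_def wdeg_def lookup_add lookup_single when_def, linarith)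
    qed
    then obtain k where "tdeg m k = n" "wdeg m k = r" by blast
    then show ?thesis by (intro exI[of _ "Poly_Mapping.single k (cf F n r)"]) (simp add: chi_eval_single)
  qed
  have sum: "\<exists>p. chi_eval m p = (\<Sum>i\<in>T. G i)" if T: "finite T" and G: "\<And>i. \<exists>p. chi_eval m p = G i" for T :: "nat set" and G
    using T
  proof (induction T rule: finite_induct)
    case empty
    then show ?case using chi_eval_zero by (intro exI[of _ 0]) simp
  next
    case (insert i T)
    then obtain p where "chi_eval m p = (\<Sum>i\<in>T. G i)" by blast
    moreover obtain q where "chi_eval m q = G i" using G by blast
    ultimately show ?case using insert by (intro exI[of _ "q + p"]) (simp add: chi_eval_add)
  qed
  have "\<exists>p. chi_eval m p = Polynomial.monom (Polynomial.coeff F n) n" for n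
  proof -
    have "Polynomial.monom (\<Sum>r\<in>T. G r) n = (\<Sum>r\<in>T. Polynomial.monom (G r) n)" if "finite T" for T :: "nat set" and G :: "nat \<Rightarrow> 'a poly"
      using that by (induction T rule: finite_induct) (simp_all add: add_monom[symmetric])
    from this[of "{..Polynomial.degree (Polynomial.coeff F n)}" "\<lambda>r. Polynomial.monom (cf F n r) r"]
    have "Polynomial.monom (Polynomial.coeff F n) n = (\<Sum>r\<le>Polynomial.degree (Polynomial.coeff F n). Polynomial.monom (Polynomial.monom (cf F n r) r) n)"
      by (simp add: poly_as_sum_of_monoms)
    then show ?thesis using sum[OF _ mon[of n]] by simp
  qed
  then show ?thesis using sum[of "{..Polynomial.degree F}" "\<lambda>n. Polynomial.monom (Polynomial.coeff F n) n"] by (simp add: poly_as_sum_of_monoms)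
qed

lemma poly_alg_simps [simp]:
  "carrier poly_alg = UNIV" "x \<otimes>\<^bsub>poly_alg\<^esub> y = x * y" "\<one>\<^bsub>poly_alg\<^esub> = 1" "\<zero>\<^bsub>poly_alg\<^esub> = 0" "x \<oplus>\<^bsub>poly_alg\<^esub> y = x + y"
  "c \<odot>\<^bsub>poly_alg\<^esub> x = Poly_Mapping.single 0 c * x"
  by (simp_all add: poly_alg_def)

lemma cring_poly_alg: "cring (poly_alg :: ('k::field, ('v \<Rightarrow>\<^sub>0 nat) \<Rightarrow>\<^sub>0 'k) module)"
proof (rule cringI)
  show "abelian_group (poly_alg :: ('k::field, ('v \<Rightarrow>\<^sub>0 nat) \<Rightarrow>\<^sub>0 'k) module)"
  proof (rule abelian_groupI)
    fix x :: "('v \<Rightarrow>\<^sub>0 nat) \<Rightarrow>\<^sub>0 'k"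
    show "\<exists>y\<in>carrier poly_alg. y \<oplus>\<^bsub>poly_alg\<^esub> x = \<zero>\<^bsub>poly_alg\<^esub>" by (intro bexI[of _ "- x"]) simp_all
  qed (simp_all add: algebra_simps)
  show "Group.comm_monoid (poly_alg :: ('k::field, ('v \<Rightarrow>\<^sub>0 nat) \<Rightarrow>\<^sub>0 'k) module)"
    by (rule comm_monoidI) (simp_all add: algebra_simps)
qed (simp_all add: algebra_simps)

lemma chi_eval_hom:
  assumes "m \<ge> 1"
  shows "surj_alg_hom (poly_alg :: ('k::field, chi_mon \<Rightarrow>\<^sub>0 'k) module) (bip (chi_supp m)) (chi_eval m)"
proof -
  interpret S: domain "bip (chi_supp m) :: ('k, 'k poly poly) module" by (rule domain_bip)
  interpret A: cring "poly_alg :: ('k, chi_mon \<Rightarrow>\<^sub>0 'k) module" by (rule cring_poly_alg)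
  have "ring_hom_ring (poly_alg :: ('k, chi_mon \<Rightarrow>\<^sub>0 'k) module) (bip (chi_supp m)) (chi_eval m)"
    by (rule ring_hom_ringI[OF A.ring_axioms S.ring_axioms]) (simp_all add: chi_eval_supp chi_eval_add chi_eval_mult chi_eval_one)
  then show ?thesis
  proof (rule surj_alg_hom.intro, unfold_locales)
    show "chi_eval m ` carrier poly_alg = carrier (bip (chi_supp m))"
      using chi_eval_supp chi_eval_surj[OF assms] by (simp add: image_def) blast
    have s: "chi_eval m (Poly_Mapping.single 0 c) = [:[:c:]:]" for c :: 'k
      unfolding chi_eval_single by (simp add: tdeg_def wdeg_def monom_0)
    show "chi_eval m (c \<odot>\<^bsub>poly_alg\<^esub> x) = c \<odot>\<^bsub>bip (chi_supp m)\<^esub> chi_eval m x" for c :: 'k and x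
      by (simp add: chi_eval_mult s)
  qed (simp_all add: distrib_left)
qed

text \<open>The monomials left after rewriting the product of \<open>Xm1\<close> and
  \<open>Xm_neg1\<close> to the m-th power of \<open>X20\<close>.\<close>

definition normal :: "chi_mon \<Rightarrow> bool" where "normal k \<longleftrightarrow> Poly_Mapping.lookup k Xm1 = 0 \<or> Poly_Mapping.lookup k Xm_neg1 = 0"

text \<open>\<open>tdeg\<close> minus twice \<open>wdeg\<close> is m times the difference of the
  exponents of \<open>Xm1\<close> and \<open>Xm_neg1\<close>. For normal monomials one of these is
  zero, so the difference determines both, and \<open>wdeg\<close> then determines the exponent of
  \<open>X20\<close>.\<close>

lemma normal_inj:
  assumes "normal k" "normal l" "tdeg m k = tdeg m l" "wdeg m k = wdeg m l" "m \<ge> 1"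
  shows "k = l"
proof -
  have "m * (Poly_Mapping.lookup k Xm1 + Poly_Mapping.lookup l Xm_neg1) = m * (Poly_Mapping.lookup l Xm1 + Poly_Mapping.lookup k Xm_neg1)"
    using assms(3,4) unfolding tdeg_def wdeg_def distrib_left by linarith
  then have "Poly_Mapping.lookup k Xm1 + Poly_Mapping.lookup l Xm_neg1 = Poly_Mapping.lookup l Xm1 + Poly_Mapping.lookup k Xm_neg1" using assms(5) by simp
  then have 1: "Poly_Mapping.lookup k Xm1 = Poly_Mapping.lookup l Xm1" "Poly_Mapping.lookup k Xm_neg1 = Poly_Mapping.lookup l Xm_neg1" using assms(1,2) unfolding normal_def by linarith+
  then have "Poly_Mapping.lookup k X20 = Poly_Mapping.lookup l X20" using assms(4) by (simp add: wdeg_def)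
  then show ?thesis using 1 by (intro poly_mapping_eqI) (metis chi_var.exhaust)
qed

lemma pvar_power: "pvar v ^ n = Poly_Mapping.single (Poly_Mapping.single v n) 1"
  by (induction n) (simp_all add: pvar_def mult_single single_add[symmetric])

lemma chi_rel_ideal: "ideal (chi_rel m) (poly_alg :: ('k::field, chi_mon \<Rightarrow>\<^sub>0 'k) module)"
proof -
  interpret A: cring "poly_alg :: ('k, chi_mon \<Rightarrow>\<^sub>0 'k) module" by (rule cring_poly_alg)
  show ?thesis unfolding chi_rel_def by (rule A.genideal_ideal) simp
qed

lemma chi_rel_closed:
  fixes p q :: "chi_mon \<Rightarrow>\<^sub>0 'k::field"
  shows "0 \<in> (chi_rel m :: (chi_mon \<Rightarrow>\<^sub>0 'k) set)" "p \<in> chi_rel m \<Longrightarrow> q \<in> chi_rel m \<Longrightarrow> p + q \<in> chi_rel m" "p \<in> chi_rel m \<Longrightarrow> q * p \<in> chi_rel m"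
proof -
  interpret I: ideal "chi_rel m" "poly_alg :: ('k, chi_mon \<Rightarrow>\<^sub>0 'k) module" by (rule chi_rel_ideal)
  show "0 \<in> (chi_rel m :: (chi_mon \<Rightarrow>\<^sub>0 'k) set)" using additive_subgroup.zero_closed[OF I.is_additive_subgroup] by simp
  show "p \<in> chi_rel m \<Longrightarrow> q \<in> chi_rel m \<Longrightarrow> p + q \<in> chi_rel m" using additive_subgroup.a_closed[OF I.is_additive_subgroup, of p q] by simp
  show "p \<in> chi_rel m \<Longrightarrow> q * p \<in> chi_rel m" using I.I_l_closed[of p q] by simp
qed

text \<open>Each application of the relation to a monomial that is not normal lowers the exponent of
  \<open>Xm1\<close> by one.\<close>

lemma monomial_reduce: "\<exists>l. normal l \<and> (\<forall>c. Poly_Mapping.single k c - Poly_Mapping.single l c \<in> (chi_rel m :: (chi_mon \<Rightarrow>\<^sub>0 'k::field) set))"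
proof (induction "Poly_Mapping.lookup k Xm1" arbitrary: k)
  case 0
  then show ?case using chi_rel_closed(1) by (intro exI[of _ k]) (simp add: normal_def)
next
  case (Suc n)
  interpret A: cring "poly_alg :: ('k, chi_mon \<Rightarrow>\<^sub>0 'k) module" by (rule cring_poly_alg)
  show ?case
  proof (cases "normal k")
    case True
    then show ?thesis using chi_rel_closed(1) by (intro exI[of _ k]) simp
  next
    case False
    \<comment> \<open>The cofactor of the product of \<open>Xm1\<close> and \<open>Xm_neg1\<close>
      in k, and the monomial obtained when that product is replaced.\<close>
    define k0 where "k0 = k - Poly_Mapping.single Xm1 1 - Poly_Mapping.single Xm_neg1 1"
    define k1 where "k1 = k0 + Poly_Mapping.single X20 m"
    have k: "k = k0 + (Poly_Mapping.single Xm1 1 + Poly_Mapping.single Xm_neg1 1)"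
      using False by (intro poly_mapping_eqI) (auto simp: k0_def lookup_add lookup_minus lookup_single when_def normal_def)
    have "n = Poly_Mapping.lookup k1 Xm1" using Suc(2) by (simp add: k1_def k0_def lookup_add lookup_minus lookup_single when_def)
    then obtain l where l: "normal l" "\<And>c. Poly_Mapping.single k1 c - Poly_Mapping.single l c \<in> (chi_rel m :: (chi_mon \<Rightarrow>\<^sub>0 'k) set)"
      using Suc(1) by blast
    have g: "pvar X20 ^ m - pvar Xm1 * pvar Xm_neg1 \<in> (chi_rel m :: (chi_mon \<Rightarrow>\<^sub>0 'k) set)"
      unfolding chi_rel_def using A.genideal_self'[of "pvar X20 ^ m - pvar Xm1 * pvar Xm_neg1"] by simp
    have "Poly_Mapping.single k c - Poly_Mapping.single k1 c = Poly_Mapping.single k0 (- c) * (pvar X20 ^ m - pvar Xm1 * pvar Xm_neg1)" for c :: 'k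
      unfolding pvar_power by (simp add: pvar_def right_diff_distrib mult_single k k1_def single_uminus)
    then have "Poly_Mapping.single k c - Poly_Mapping.single k1 c \<in> chi_rel m" for c :: 'k using chi_rel_closed(3)[OF g] by simp
    then have "Poly_Mapping.single k c - Poly_Mapping.single l c \<in> chi_rel m" for c :: 'k
      using chi_rel_closed(2)[OF _ l(2)[of c], of "Poly_Mapping.single k c - Poly_Mapping.single k1 c"] by simp
    then show ?thesis using l(1) by blast
  qed
qed

lemma poly_reduce: "\<exists>q. (\<forall>k\<in>Poly_Mapping.keys q. normal k) \<and> p - q \<in> (chi_rel m :: (chi_mon \<Rightarrow>\<^sub>0 'k::field) set)"
proof (induction p rule: poly_single_induct)
  case (single k c)
  obtain l where "normal l" "Poly_Mapping.single k c - Poly_Mapping.single l c \<in> chi_rel m" using monomial_reduce by blast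
  then show ?case by (intro exI[of _ "Poly_Mapping.single l c"]) (auto split: if_splits)
next
  case (add p p')
  then obtain q q' where q: "\<forall>k\<in>Poly_Mapping.keys q. normal k" "p - q \<in> chi_rel m" "\<forall>k\<in>Poly_Mapping.keys q'. normal k" "p' - q' \<in> chi_rel m" by blast
  have "\<forall>k\<in>Poly_Mapping.keys (q + q'). normal k" using q(1,3) keys_add[of q q'] by blast
  moreover have "p + p' - (q + q') \<in> chi_rel m" using chi_rel_closed(2)[OF q(2,4)] by (simp add: algebra_simps)
  ultimately show ?case by blast
qed

text \<open>An element of the kernel is congruent modulo the relation to a combination of normal
  monomials, still in the kernel. Distinct normal monomials have distinct images among the t^n w^r,
  so all coefficients of that combination vanish.\<close>

lemma chi_eval_kernel:
  assumes m: "m \<ge> 1"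
  shows "a_kernel poly_alg (bip (chi_supp m)) (chi_eval m) = (chi_rel m :: (chi_mon \<Rightarrow>\<^sub>0 'k::field) set)"
proof -
  interpret E: surj_alg_hom "poly_alg :: ('k, chi_mon \<Rightarrow>\<^sub>0 'k) module" "bip (chi_supp m)" "chi_eval m" by (rule chi_eval_hom[OF m])
  have K: "a_kernel poly_alg (bip (chi_supp m)) (chi_eval m) = {p :: chi_mon \<Rightarrow>\<^sub>0 'k. chi_eval m p = 0}"
    unfolding a_kernel_def' poly_alg_simps bip_simps by (simp only: UNIV_I simp_thms)
  have pow: "chi_eval m (p ^ n) = chi_eval m p ^ n" for p :: "chi_mon \<Rightarrow>\<^sub>0 'k" and n
    by (induction n) (simp_all add: chi_eval_one chi_eval_mult)
  have gen: "chi_eval m (pvar X20 ^ m - pvar Xm1 * pvar Xm_neg1) = (0 :: 'k poly poly)"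
    unfolding chi_eval_diff chi_eval_mult pow chi_eval_pvar by (simp add: monom_power mult_monom mult_2)
  have sub: "chi_rel m \<subseteq> {p :: chi_mon \<Rightarrow>\<^sub>0 'k. chi_eval m p = 0}"
    unfolding chi_rel_def K[symmetric] by (rule E.R.genideal_minimal[OF E.kernel_is_ideal]) (simp add: K gen)
  have "p \<in> chi_rel m" if p: "chi_eval m p = 0" for p :: "chi_mon \<Rightarrow>\<^sub>0 'k"
  proof -
    obtain q where q: "\<forall>k\<in>Poly_Mapping.keys q. normal k" "p - q \<in> chi_rel m" using poly_reduce by blast
    have q0: "chi_eval m q = 0" using sub q(2) p by (auto simp: chi_eval_diff)
    have "Poly_Mapping.keys q = {}"
    proof (rule ccontr)
      assume "Poly_Mapping.keys q \<noteq> {}"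
      then obtain k where k: "k \<in> Poly_Mapping.keys q" by blast
      \<comment> \<open>By \<open>normal_inj\<close> only k contributes at its own bidegree.\<close>
      have "cf (chi_eval m q) (tdeg m k) (wdeg m k) = (\<Sum>l\<in>Poly_Mapping.keys q. if l = k then Poly_Mapping.lookup q l else 0)"
        unfolding chi_eval_def Polynomial.coeff_sum
      proof (intro sum.cong refl)
        fix l assume l: "l \<in> Poly_Mapping.keys q"
        show "cf (Polynomial.monom (Polynomial.monom (Poly_Mapping.lookup q l) (wdeg m l)) (tdeg m l)) (tdeg m k) (wdeg m k) = (if l = k then Poly_Mapping.lookup q l else 0)"
          using normal_inj[of l k m] q(1) l k m by auto
      qed
      then show False using q0 k by (simp add: in_keys_iff)
    qed
    then show ?thesis using q(2) by simp
  qed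
  then show ?thesis unfolding K using sub by blast
qed

text \<open>Every monomial is a product of powers of the three variables, and every polynomial is a
  combination of monomials.\<close>

lemma finitely_generated_poly_alg: "finitely_generated_algebra (poly_alg :: ('k::field, chi_mon \<Rightarrow>\<^sub>0 'k) module)"
  unfolding finitely_generated_algebra_def
proof (intro exI[of _ "{pvar X20, pvar Xm1, pvar Xm_neg1}"] conjI allI impI)
  fix D :: "(chi_mon \<Rightarrow>\<^sub>0 'k) set"
  assume "subring D poly_alg \<and> (\<forall>c. \<forall>x\<in>D. c \<odot>\<^bsub>poly_alg\<^esub> x \<in> D) \<and> {pvar X20, pvar Xm1, pvar Xm_neg1} \<subseteq> D"
  then have D: "subring D poly_alg" "\<And>c x. x \<in> D \<Longrightarrow> Poly_Mapping.single 0 c * x \<in> D" "pvar v \<in> D" for v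
    by (auto) (metis chi_var.exhaust)
  note Dc = subringE[OF D(1), simplified]
  have pow: "pvar v ^ n \<in> D" for v n by (induction n) (simp_all add: Dc D(3))
  have "p \<in> D" for p
  proof (induction p rule: poly_single_induct)
    case (single k c)
    have "k = Poly_Mapping.single X20 (Poly_Mapping.lookup k X20) + Poly_Mapping.single Xm1 (Poly_Mapping.lookup k Xm1) + Poly_Mapping.single Xm_neg1 (Poly_Mapping.lookup k Xm_neg1)"
    proof (rule poly_mapping_eqI)
      fix v show "Poly_Mapping.lookup k v = Poly_Mapping.lookup (Poly_Mapping.single X20 (Poly_Mapping.lookup k X20) + Poly_Mapping.single Xm1 (Poly_Mapping.lookup k Xm1) + Poly_Mapping.single Xm_neg1 (Poly_Mapping.lookup k Xm_neg1)) v"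
        by (cases v) (simp_all add: lookup_add lookup_single when_def)
    qed
    then have "Poly_Mapping.single k c = Poly_Mapping.single 0 c * (pvar X20 ^ Poly_Mapping.lookup k X20 * pvar Xm1 ^ Poly_Mapping.lookup k Xm1 * pvar Xm_neg1 ^ Poly_Mapping.lookup k Xm_neg1)"
      unfolding pvar_power by (simp add: mult_single)
    then show ?case using D(2) Dc pow by simp
  qed (simp add: Dc)
  then show "D = carrier poly_alg" by auto
qed simp_all

section \<open>Transfer of the presentation to the cohomology ring\<close>

context lam2
begin

lemma good_chi: "good 2 1" "good m 0" "good m m" by (simp_all add: good_def)

lemma \<Psi>_surj_hom: "surj_alg_hom H.HH (bip (chi_supp m)) \<Psi>"
proof (rule surj_alg_hom.intro[OF \<Psi>_hom], unfold_locales)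
  show "\<Psi> ` carrier H.HH = carrier (bip (chi_supp m))" using \<Psi>_image by simp
qed (simp_all add: H.HH_smult_closed H.HH_smult_add \<Psi>_smult)

text \<open>Both quotients are isomorphic to \<open>bip (chi_supp m)\<close>, one through
  \<open>chi_eval\<close> and the other through \<Psi>; \<psi> is the composite. Commutativity,
  finite generation and dimension are transported from there.\<close>

lemma presentation:
  defines "N \<equiv> HH_nil_ideal L C"
  defines "Hq \<equiv> alg_quot H.HH N"
  shows "(\<exists>\<psi> \<in> alg_iso (alg_quot (poly_alg :: ('k, (chi_var \<Rightarrow>\<^sub>0 nat) \<Rightarrow>\<^sub>0 'k) module) (chi_rel m)) Hq.
       \<psi> (chi_rel m +>\<^bsub>poly_alg\<^esub> pvar X20) = N +>\<^bsub>H.HH\<^esub> chi m 1 2 0 \<and>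
       \<psi> (chi_rel m +>\<^bsub>poly_alg\<^esub> pvar Xm1) = N +>\<^bsub>H.HH\<^esub> chi m 1 m (int m) \<and>
       \<psi> (chi_rel m +>\<^bsub>poly_alg\<^esub> pvar Xm_neg1) = N +>\<^bsub>H.HH\<^esub> chi m 1 m (- int m)) \<and>
    cring Hq \<and> finitely_generated_algebra Hq \<and> krull_dim Hq = 2"
proof -
  let ?B = "bip (chi_supp m) :: ('k, 'k poly poly) module"
  let ?A = "poly_alg :: ('k, chi_mon \<Rightarrow>\<^sub>0 'k) module"
  have m1: "m \<ge> 1" using m by simp
  interpret S: domain ?B by (rule domain_bip)
  interpret E: surj_alg_hom ?A ?B "chi_eval m" by (rule chi_eval_hom[OF m1])
  interpret Y: surj_alg_hom H.HH ?B \<Psi> by (rule \<Psi>_surj_hom)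
  have N: "a_kernel H.HH ?B \<Psi> = N" unfolding N_def nil_ideal a_kernel_def' by simp
  obtain f where f: "f \<in> alg_iso (alg_quot ?A (chi_rel m)) ?B" "\<And>x. f (chi_rel m +>\<^bsub>poly_alg\<^esub> x) = chi_eval m x"
    using E.quot unfolding chi_eval_kernel[OF m1] by (metis UNIV_I poly_alg_simps(1))
  obtain k where k: "k \<in> alg_iso Hq ?B" "\<And>x. x \<in> carrier H.HH \<Longrightarrow> k (N +>\<^bsub>H.HH\<^esub> x) = \<Psi> x" "ring Hq"
    "\<And>c x. x \<in> carrier Hq \<Longrightarrow> c \<odot>\<^bsub>Hq\<^esub> x \<in> carrier Hq"
    using Y.quot unfolding N Hq_def[symmetric] by blast
  define k' where "k' = inv_into (carrier Hq) k"
  have k': "k' \<in> alg_iso ?B Hq" unfolding k'_def by (rule alg_iso_inverse[OF k(1,3,4)])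
  have kbij: "bij_betw k (carrier Hq) (carrier ?B)" using k(1) by (simp add: alg_iso_def ring_iso_def)
  have car: "carrier Hq = (\<lambda>x. N +>\<^bsub>H.HH\<^esub> x) ` carrier H.HH"
    by (auto simp: Hq_def alg_quot_def A_RCOSETS_def')
  have k'\<Psi>: "k' (\<Psi> x) = N +>\<^bsub>H.HH\<^esub> x" if x: "x \<in> carrier H.HH" for x
  proof -
    have "N +>\<^bsub>H.HH\<^esub> x \<in> carrier Hq" unfolding car by (rule imageI[OF x])
    then show ?thesis unfolding k'_def k(2)[OF x, symmetric] by (rule inv_into_f_f[OF bij_betw_imp_inj_on[OF kbij]])
  qed
  have "\<exists>\<psi> \<in> alg_iso (alg_quot ?A (chi_rel m)) Hq.
       \<psi> (chi_rel m +>\<^bsub>poly_alg\<^esub> pvar X20) = N +>\<^bsub>H.HH\<^esub> chi m 1 2 0 \<and>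
       \<psi> (chi_rel m +>\<^bsub>poly_alg\<^esub> pvar Xm1) = N +>\<^bsub>H.HH\<^esub> chi m 1 m (int m) \<and>
       \<psi> (chi_rel m +>\<^bsub>poly_alg\<^esub> pvar Xm_neg1) = N +>\<^bsub>H.HH\<^esub> chi m 1 m (- int m)"
  proof (intro bexI conjI)
    show "k' \<circ> f \<in> alg_iso (alg_quot ?A (chi_rel m)) Hq" by (rule alg_iso_trans[OF f(1) k'])
    \<comment> \<open>The three classes are \<open>\<kappa> 2 1\<close>, \<open>\<kappa> m 0\<close>
      and \<open>\<kappa> m m\<close>, whose images are the values of \<open>chi_eval\<close> at the
      three variables.\<close>
    have c: "chi m 1 2 0 \<in> carrier H.HH" "chi m 1 m (int m) \<in> carrier H.HH" "chi m 1 m (- int m) \<in> carrier H.HH"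
      "\<Psi> (chi m 1 2 0) = chi_eval m (pvar X20)" "\<Psi> (chi m 1 m (int m)) = chi_eval m (pvar Xm1)"
      "\<Psi> (chi m 1 m (- int m)) = chi_eval m (pvar Xm_neg1)"
      unfolding chi_eval_pvar using \<Psi>_chi[OF good_chi(1), of 0] \<Psi>_chi[OF good_chi(2), of "int m"] \<Psi>_chi[OF good_chi(3), of "- int m"] by simp_all
    show "(k' \<circ> f) (chi_rel m +>\<^bsub>poly_alg\<^esub> pvar X20) = N +>\<^bsub>H.HH\<^esub> chi m 1 2 0"
      unfolding o_apply f(2) c(4)[symmetric] by (rule k'\<Psi>[OF c(1)])
    show "(k' \<circ> f) (chi_rel m +>\<^bsub>poly_alg\<^esub> pvar Xm1) = N +>\<^bsub>H.HH\<^esub> chi m 1 m (int m)"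
      unfolding o_apply f(2) c(5)[symmetric] by (rule k'\<Psi>[OF c(2)])
    show "(k' \<circ> f) (chi_rel m +>\<^bsub>poly_alg\<^esub> pvar Xm_neg1) = N +>\<^bsub>H.HH\<^esub> chi m 1 m (- int m)"
      unfolding o_apply f(2) c(6)[symmetric] by (rule k'\<Psi>[OF c(3)])
  qed
  moreover have cr: "cring Hq"
  proof -
    interpret Hq: ring Hq by (rule k(3))
    have "x \<otimes>\<^bsub>Hq\<^esub> y = y \<otimes>\<^bsub>Hq\<^esub> x" if x: "x \<in> carrier Hq" and y: "y \<in> carrier Hq" for x y
    proof (rule inj_onD[OF bij_betw_imp_inj_on[OF kbij]])
      have km: "k (x \<otimes>\<^bsub>Hq\<^esub> y) = k x * k y" if "x \<in> carrier Hq" "y \<in> carrier Hq" for x y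
        using ring_iso_memE(2)[of k Hq ?B x y] k(1) that by (simp add: alg_iso_def)
      show "k (x \<otimes>\<^bsub>Hq\<^esub> y) = k (y \<otimes>\<^bsub>Hq\<^esub> x)" using x y by (simp add: km mult.commute)
    qed (simp_all add: x y)
    then show ?thesis by unfold_locales
  qed
  moreover
  have "ring_hom_ring ?B Hq k'"
    using k' by (intro ring_hom_ringI2 S.ring_axioms k(3)) (simp add: alg_iso_def ring_iso_def)
  then have K': "surj_alg_hom ?B Hq k'"
  proof (rule surj_alg_hom.intro, unfold_locales)
    show "k' ` carrier ?B = carrier Hq" using k' by (simp add: alg_iso_def ring_iso_def bij_betw_def)
    show "k' (c \<odot>\<^bsub>?B\<^esub> x) = c \<odot>\<^bsub>Hq\<^esub> k' x" if "x \<in> carrier ?B" for c x using k' that unfolding alg_iso_def by blast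
    have z: "k' \<zero>\<^bsub>?B\<^esub> = \<zero>\<^bsub>Hq\<^esub>"
      by (rule ring_hom_zero[OF _ S.ring_axioms k(3)]) (use k' in \<open>simp add: alg_iso_def ring_iso_def\<close>)
    show "c \<odot>\<^bsub>Hq\<^esub> \<zero>\<^bsub>Hq\<^esub> = \<zero>\<^bsub>Hq\<^esub>" for c
    proof -
      have "k' (c \<odot>\<^bsub>?B\<^esub> \<zero>\<^bsub>?B\<^esub>) = c \<odot>\<^bsub>Hq\<^esub> k' \<zero>\<^bsub>?B\<^esub>" using k' S.zero_closed unfolding alg_iso_def by blast
      then show ?thesis unfolding z by (simp add: z[simplified])
    qed
  qed (simp_all add: chi_supp_closed smult_add_right)
  have "finitely_generated_algebra ?B" by (rule E.finitely_generated_image[OF finitely_generated_poly_alg])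
  then have "finitely_generated_algebra Hq" by (rule surj_alg_hom.finitely_generated_image[OF K'])
  moreover have "krull_dim Hq = 2"
  \<comment> \<open>Surjections in both directions give the two inequalities.\<close>
  proof (rule antisym)
    show "krull_dim Hq \<le> 2" using surj_alg_hom.krull_dim_image[OF K' S.cring_axioms] krull_dim_bip[OF m1, where 'k = 'k] by simp
    have "ring_hom_ring Hq ?B k" using k(1) by (intro ring_hom_ringI2 S.ring_axioms k(3)) (simp add: alg_iso_def ring_iso_def)
    then have "surj_alg_hom Hq ?B k"
    proof (rule surj_alg_hom.intro, unfold_locales)
      show "k ` carrier Hq = carrier ?B" using kbij by (simp add: bij_betw_def)
      show "c \<odot>\<^bsub>Hq\<^esub> x \<in> carrier Hq" if "x \<in> carrier Hq" for c x using that by (rule k(4))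
      show "k (c \<odot>\<^bsub>Hq\<^esub> x) = c \<odot>\<^bsub>?B\<^esub> k x" if "x \<in> carrier Hq" for c x using k(1) that unfolding alg_iso_def by blast
      show "c \<odot>\<^bsub>?B\<^esub> \<zero>\<^bsub>?B\<^esub> = \<zero>\<^bsub>?B\<^esub>" for c by simp
      show "c \<odot>\<^bsub>Hq\<^esub> (x \<oplus>\<^bsub>Hq\<^esub> y) = c \<odot>\<^bsub>Hq\<^esub> x \<oplus>\<^bsub>Hq\<^esub> c \<odot>\<^bsub>Hq\<^esub> y" if x: "x \<in> carrier Hq" and y: "y \<in> carrier Hq" for c x y
      proof -
        interpret Hq: ring Hq by (rule k(3))
        have s: "k (c \<odot>\<^bsub>Hq\<^esub> x) = Polynomial.smult [:c:] (k x)" if "x \<in> carrier Hq" for c x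
          using k(1) that unfolding alg_iso_def by simp
        have a: "k (x \<oplus>\<^bsub>Hq\<^esub> y) = k x + k y" if "x \<in> carrier Hq" "y \<in> carrier Hq" for x y
          using ring_iso_memE(3)[of k Hq ?B x y] k(1) that by (simp add: alg_iso_def)
        show ?thesis
          by (rule inj_onD[OF bij_betw_imp_inj_on[OF kbij]]) (simp_all add: s a x y k(4) smult_add_right)
      qed
    qed
    from surj_alg_hom.krull_dim_image[OF this cr] show "2 \<le> krull_dim Hq" using krull_dim_bip[OF m1, where 'k = 'k] by simp
  qed
  ultimately show ?thesis by blast
qed

end

theorem corollary5p8:
  fixes m :: nat
  assumes "m \<ge> 3" and "odd m" and "CHAR('k::field) = 2"
  defines "H \<equiv> alg_quot (HH m 1 :: ('k, 'k hh) module) (HH_nil m 1)"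
  shows "projective_bimod_resolution (Lam m 1 :: ('k, 'k lam) module) (min_res m 1) \<and>
    (\<exists>\<psi> \<in> alg_iso (alg_quot (poly_alg :: ('k, (chi_var \<Rightarrow>\<^sub>0 nat) \<Rightarrow>\<^sub>0 'k) module) (chi_rel m)) H.
       \<psi> (chi_rel m +>\<^bsub>poly_alg\<^esub> pvar X20) = HH_nil m 1 +>\<^bsub>HH m 1\<^esub> chi m 1 2 0 \<and>
       \<psi> (chi_rel m +>\<^bsub>poly_alg\<^esub> pvar Xm1) = HH_nil m 1 +>\<^bsub>HH m 1\<^esub> chi m 1 m (int m) \<and>
       \<psi> (chi_rel m +>\<^bsub>poly_alg\<^esub> pvar Xm_neg1) = HH_nil m 1 +>\<^bsub>HH m 1\<^esub> chi m 1 m (- int m)) \<and>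
    cring H \<and> finitely_generated_algebra H \<and> krull_dim H = 2"
proof -
  interpret lam2 m "Lam m 1 :: ('k, 'k lam) module"
    using assms by unfold_locales auto
  have C: "C = min_res m 1" by (rule C_def)
  show ?thesis
    unfolding H_def HH_def HH_nil_def C[symmetric] using resolution presentation by (intro conjI) blast+
qed

end
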